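(* Let $\mu$, $\hat\mu=\sum_{\gamma\in\Gamma}b_\gamma\delta_\gamma$, $A=\{a_n\}_{n\in\mathbb Z}$, its density $d$, and the entire functions $$f(z)=(1-z/a_0)\prod_{n\ge1}(1-z/a_n)(1-z/a_{-n}),\qquad g(z)=\sum_{\gamma\in\Gamma,\,0<\gamma<1}b_\gamma\frac{e^{2\pi i\gamma z}-1}{\gamma}$$ be as described in the context. (i) If $g$ is uniformly bounded on $\mathbb R$, then the function $f$, whose zero set is $A$, is almost periodic (in $\mathbb C$) and of exponential type $\pi d$. (ii) Conversely, if $A$ is the zero set (with multiplicities) of an entire almost periodic function of exponential growth, then $g$ is uniformly bounded on $\mathbb R$.
   Context: Setting. $\mu=\sum_{\lambda\in\Lambda}c_\lambda\delta_\lambda$ is a nonzero measure on $\mathbb R$ with $\Lambda\subset\mathbb R$ discrete and locally finite and $c_\lambda$ positive integers; $\mu$ is a temperate distribution; its distributional Fourier transform is a pure point measure $\hat\mu=\sum_{\gamma\in\Gamma}b_\gamma\delta_\gamma$ with $\Gamma\subset\mathbb R$ an at most countable set (not necessarily discrete), $b_\gamma\in\mathbb C$; and the measure $|\hat\mu|=\sum_{\gamma\in\Gamma}|b_\gamma|\delta_\gamma$ is also a temperate distribution (so $\sum_{0<\gamma<1}|b_\gamma|<\infty$ and $g$ is a well-defined entire function). The Fourier transform of a temperate distribution $u$ is defined by $\hat u(\varphi)=u(\hat\varphi)$ for Schwartz functions $\varphi$, with $\hat\varphi(t)=\int_{\mathbb R}\varphi(x)e^{-2\pi ixt}\,dx$.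 $A=\{a_n\}_{n\in\mathbb Z}$ is the multiset in which each $\lambda\in\Lambda$ occurs $c_\lambda$ times, enumerated so that $a_n\le a_{n+1}$ for all $n\in\mathbb Z$; it is assumed that $0\notin A$. Under these assumptions $A$ is known to be an almost periodic set (for every $\varepsilon>0$, the set of $\tau\in\mathbb R$ for which there is a bijection $\sigma:\mathbb Z\to\mathbb Z$ with $\sup_n|a_n+\tau-a_{\sigma(n)}|<\varepsilon$ is relatively dense in $\mathbb R$); it has the strictly positive density $d=\lim_{l(I)\to\infty}\#(A\cap I)/l(I)$ ($I$ half-intervals of length $l(I)$, points counted with multiplicity); and the product defining $f$ converges to an entire function of exponential type with zero set $A$ (with multiplicities). An entire function $h$ is almost periodic (in $\mathbb C$) if for all real $\alpha<\beta$ and all $\varepsilon>0$ the set $\{\tau\in\mathbb R:\ \sup_{x\in\mathbb R,\ \alpha\le y\le\beta}|h(x+\tau+iy)-h(x+iy)|<\varepsilon\}$ is relatively dense in $\mathbb R$ (i.e. intersects every interval $(x,x+L)$ for some $L$ depending on $\varepsilon,\alpha,\beta$). An entire function $h$ has exponential growth if $|h(z)|\le Ce^{C|z|}$ for some constant $C$ and all $z\in\mathbb C$; it is of exponential type $\sigma$ if $\limsup_{|z|\to\infty}|z|^{-1}\log|h(z)|=\sigma$. *)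

theory Defs
  imports "HOL-Complex_Analysis.Complex_Analysis"
begin

text \<open>Schwartz functions and temperate distributions on the real line.\<close>

definition nth_deriv :: "nat \<Rightarrow> (real \<Rightarrow> complex) \<Rightarrow> real \<Rightarrow> complex" where
  "nth_deriv n = (\<lambda>\<phi> x. vector_derivative \<phi> (at x)) ^^ n"

definition smooth_fun :: "(real \<Rightarrow> complex) \<Rightarrow> bool" where
  "smooth_fun \<phi> \<longleftrightarrow> (\<forall>n x. nth_deriv n \<phi> differentiable (at x))"

definition schwartz :: "(real \<Rightarrow> complex) \<Rightarrow> bool" where
  "schwartz \<phi> \<longleftrightarrow> smooth_fun \<phi> \<and>
     (\<forall>k n. bounded (range (\<lambda>x. \<bar>x\<bar> ^ k * norm (nth_deriv n \<phi> x))))"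

definition test_fun :: "(real \<Rightarrow> complex) \<Rightarrow> bool" where
  "test_fun \<phi> \<longleftrightarrow> smooth_fun \<phi> \<and> compact (closure {x. \<phi> x \<noteq> 0})"

definition schwartz_seminorm :: "nat \<Rightarrow> nat \<Rightarrow> (real \<Rightarrow> complex) \<Rightarrow> real" where
  "schwartz_seminorm k n \<phi> = (SUP x. \<bar>x\<bar> ^ k * norm (nth_deriv n \<phi> x))"

text \<open>Functionals are total functions, but only their values on Schwartz functions
  matter.  The last conjunct is continuity for the topology of the seminorms.\<close>

definition temperate_distribution :: "((real \<Rightarrow> complex) \<Rightarrow> complex) \<Rightarrow> bool" where
  "temperate_distribution u \<longleftrightarrow>
     (\<forall>\<phi> \<psi>. schwartz \<phi> \<longrightarrow> schwartz \<psi> \<longrightarrow> u (\<lambda>x. \<phi> x + \<psi> x) = u \<phi> + u \<psi>) \<and>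
     (\<forall>\<alpha> \<phi>. schwartz \<phi> \<longrightarrow> u (\<lambda>x. \<alpha> * \<phi> x) = \<alpha> * u \<phi>) \<and>
     (\<exists>C N. \<forall>\<phi>. schwartz \<phi> \<longrightarrow>
        norm (u \<phi>) \<le> C * (\<Sum>k\<le>N. \<Sum>n\<le>N. schwartz_seminorm k n \<phi>))"

definition fourier_fun :: "(real \<Rightarrow> complex) \<Rightarrow> real \<Rightarrow> complex" where
  "fourier_fun \<phi> t = (LBINT x. \<phi> x * exp (- 2 * pi * \<i> * x * t))"

definition fourier_dist ::
    "((real \<Rightarrow> complex) \<Rightarrow> complex) \<Rightarrow> (real \<Rightarrow> complex) \<Rightarrow> complex" where
  "fourier_dist u \<phi> = u (fourier_fun \<phi>)"

text \<open>A pure point measure is given by a set \<open>S\<close> of atoms and their masses \<open>w\<close>; its total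
  variation is finite on compact sets.  Integrals against it are a priori defined only for
  compactly supported functions, so a distribution is identified with the measure
  by its values on test functions.\<close>

definition point_measure :: "real set \<Rightarrow> (real \<Rightarrow> complex) \<Rightarrow> bool" where
  "point_measure S w \<longleftrightarrow> countable S \<and>
     (\<forall>K. compact K \<longrightarrow> (\<lambda>x. norm (w x)) summable_on (S \<inter> K))"

definition is_point_measure ::
    "((real \<Rightarrow> complex) \<Rightarrow> complex) \<Rightarrow> real set \<Rightarrow> (real \<Rightarrow> complex) \<Rightarrow> bool" where
  "is_point_measure u S w \<longleftrightarrow> point_measure S w \<and>
     (\<forall>\<phi>. test_fun \<phi> \<longrightarrow> u \<phi> = (\<Sum>\<^sub>\<infinity>x\<in>S. w x * \<phi> x))"

text \<open>A multiset of reals is represented by an enumeration \<open>a\<close>.  The filter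
  \<open>filtercomap snd at_top\<close> on pairs \<open>(s, l)\<close> expresses that the length \<open>l\<close> of the
  half-interval tends to infinity, uniformly in its left endpoint \<open>s\<close>.\<close>

definition point_density :: "(int \<Rightarrow> real) \<Rightarrow> real" where
  "point_density a = Lim (filtercomap snd at_top)
     (\<lambda>(s, l). real (card {n. a n \<in> {s..<s + l}}) / l)"

definition relatively_dense :: "real set \<Rightarrow> bool" where
  "relatively_dense E \<longleftrightarrow> (\<exists>L>0. \<forall>x. E \<inter> {x<..<x + L} \<noteq> {})"

text \<open>The supremum is taken in \<^typ>\<open>ereal\<close>, so that it is infinite for unbounded differences.\<close>

definition almost_periodic_entire :: "(complex \<Rightarrow> complex) \<Rightarrow> bool" where
  "almost_periodic_entire h \<longleftrightarrow> h holomorphic_on UNIV \<and>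
     (\<forall>\<alpha> \<beta> \<epsilon>. \<alpha> < \<beta> \<longrightarrow> \<epsilon> > 0 \<longrightarrow>
        relatively_dense {\<tau>. (SUP (x, y)\<in>UNIV \<times> {\<alpha>..\<beta>}.
          ereal (norm (h (Complex (x + \<tau>) y) - h (Complex x y)))) < ereal \<epsilon>})"

definition exponential_growth :: "(complex \<Rightarrow> complex) \<Rightarrow> bool" where
  "exponential_growth h \<longleftrightarrow> (\<exists>C. \<forall>z. norm (h z) \<le> C * exp (C * norm z))"

text \<open>The value at zeros of \<open>h\<close> is spelled out because \<open>ln 0 = 0\<close> in the library.\<close>

definition has_exponential_type :: "(complex \<Rightarrow> complex) \<Rightarrow> real \<Rightarrow> bool" where
  "has_exponential_type h \<sigma> \<longleftrightarrow> h holomorphic_on UNIV \<and>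
     Limsup at_infinity
       (\<lambda>z. if h z = 0 then - \<infinity> else ereal (ln (norm (h z)) / norm z)) = ereal \<sigma>"

text \<open>\<^const>\<open>zorder\<close> is meaningful only for functions that do not vanish identically.
  It is 0 at points where \<open>h\<close> does not vanish.\<close>

definition has_zero_multiset :: "(complex \<Rightarrow> complex) \<Rightarrow> (int \<Rightarrow> real) \<Rightarrow> bool" where
  "has_zero_multiset h a \<longleftrightarrow> (\<exists>z. h z \<noteq> 0) \<and>
     (\<forall>z. zorder h z = int (card {n. complex_of_real (a n) = z}))"

definition f_prod :: "(int \<Rightarrow> real) \<Rightarrow> complex \<Rightarrow> complex" where
  "f_prod a z = (1 - z / a 0) *
     (\<Prod>n. (1 - z / a (int (Suc n))) * (1 - z / a (- int (Suc n))))"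

definition g_sum :: "real set \<Rightarrow> (real \<Rightarrow> complex) \<Rightarrow> complex \<Rightarrow> complex" where
  "g_sum \<Gamma> b z = (\<Sum>\<^sub>\<infinity>\<gamma>\<in>\<Gamma> \<inter> {0<..<1}. b \<gamma> * ((exp (2 * pi * \<i> * \<gamma> * z) - 1) / \<gamma>))"

end

theory Submission
  imports Defs
begin

text \<open>The idea is to compare logarithmic derivatives in the upper half plane. There, the relation between
  \<open>\<mu>\<close> and its Fourier transform says that entire functions \<open>f\<close> of exponential growth
  with zeros \<open>a\<close> satisfy \<open>f' / f = \<kappa> - 2 \<pi> i E\<close> with the exponential sum \<open>E z = \<Sum> b \<gamma> e\<^bsup>2 \<pi> i \<gamma> z\<^esup>\<close>
  over \<open>\<gamma> > 0\<close> in \<open>\<Gamma>\<close>. A primitive of \<open>2 \<pi> i E\<close> is \<open>g\<close> plus the contribution of the frequencies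
  \<open>\<gamma> \<ge> 1\<close>, which is bounded on horizontal lines. So \<open>f = C exp (\<kappa> z - g + O(1))\<close> on such lines, and the
  theorem becomes a statement about the exponential of an integral of an almost periodic function.

  The relation is first proved for second derivatives (\<open>inverse_cube_pairing\<close>): the function
  \<open>t\<^sup>2 e\<^bsup>2 \<pi> i t z\<^esup>\<close> on the half line has an inverse cube as its Fourier transform and decays
  well enough to be approximated by test functions. This uses that the zeros have summable inverse
  squares (\<open>inverse_square_summable\<close>), which follows from positivity of \<open>\<mu>\<close> by testing against
  modulations of a function with nonnegative transform. Integrating twice gives the relation up to a
  linear function, which is constant by its behaviour on the imaginary axis (\<open>H_eq_E\<close>).

  For the converse direction let \<open>h\<close> be almost periodic of exponential growth with zeros \<open>a\<close>. By
  Hadamard's argument (\<open>finite_type_log_derivative\<close>) it has the logarithmic derivative above, so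
  \<open>h = C e\<^bsup>t\<^esup>\<close> on the line \<open>Im z = 1\<close>, with \<open>t\<close> equal to a linear function minus \<open>g\<close> up to bounded
  terms. As \<open>|h|\<close> is bounded below on the line, almost periods of \<open>h\<close> are translations under which
  \<open>t\<close> changes by a nearly constant amount. Hence \<open>g\<close> is additive up to a bounded error, and being
  sublinear it is bounded (\<open>g_bounded_if_almost_periodic\<close>).

  For the direct implication let \<open>g\<close> be bounded on the real axis. Then the zeros are counted by a linear
  function up to a bounded error (\<open>count_linear\<close>), as seen from a combination of Poisson kernels at
  heights 1 and 2. This gives the density \<open>D / \<pi>\<close> and the convergence of the symmetric product, with
  \<open>f = C exp (- i D z - g + O(1))\<close> on horizontal lines (\<open>f_representation\<close>); the constant \<open>\<kappa>\<close> is purely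
  imaginary because of the symmetric order of the factors. The exponent apart from \<open>- i D z\<close> is a bounded
  primitive of an almost periodic function and hence almost periodic by Bohr's theorem
  (\<open>bounded_primitive_almost_periodic\<close>). So \<open>f\<close> is almost periodic on every line of height at least 1, and
  by conjugation and the maximum principle in every strip. Finally \<open>g (x + i y) - g x = o(y)\<close> uniformly in
  \<open>x\<close>, so \<open>ln |f (x + i y)| = D y + o(y)\<close>, and the exponential type is \<open>D\<close>, which is \<open>\<pi>\<close> times the density.\<close>

section \<open>Dominated sums over arbitrary index sets\<close>

text \<open>Sums over \<open>\<Lambda>\<close> and \<open>\<Gamma>\<close> have no natural order, so limits, continuity and derivatives of such sums
  are all obtained from one principle: a summable majorant \<open>M\<close> leaves only small contributions
  outside a finite set of indices, uniformly in the parameters.\<close>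

lemma norm_infsum_le_dominated:
  fixes f :: "'i \<Rightarrow> 'a::banach"
  assumes "M summable_on I" and "\<And>i. i \<in> I \<Longrightarrow> norm (f i) \<le> M i"
  shows "f summable_on I" "norm (infsum f I) \<le> infsum M I"
proof -
  have nf: "(\<lambda>i. norm (f i)) summable_on I"
    by (rule summable_on_comparison_test[OF assms(1)]) (use assms in auto)
  then show "f summable_on I" by (rule abs_summable_summable)
  have "norm (infsum f I) \<le> infsum (\<lambda>i. norm (f i)) I"
    by (rule norm_infsum_bound[OF nf])
  also have "\<dots> \<le> infsum M I"
    by (rule infsum_mono[OF nf assms(1)]) (use assms in auto)
  finally show "norm (infsum f I) \<le> infsum M I" .
qed

lemma small_tail:
  fixes M :: "'i \<Rightarrow> real"
  assumes "M summable_on I" "e > 0"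
  shows "\<forall>\<^sub>F X in finite_subsets_at_top I. \<bar>infsum M (I - X)\<bar> < e"
proof -
  have "((\<lambda>X. sum M X) \<longlongrightarrow> infsum M I) (finite_subsets_at_top I)"
    using has_sum_infsum[OF assms(1)] by (simp add: has_sum_def)
  then have "\<forall>\<^sub>F X in finite_subsets_at_top I. dist (sum M X) (infsum M I) < e"
    using assms(2) by (rule tendstoD)
  moreover have "\<forall>\<^sub>F X in finite_subsets_at_top I. finite X \<and> X \<subseteq> I"
    by (rule eventually_finite_subsets_at_top_weakI) auto
  ultimately show ?thesis
  proof eventually_elim
    case (elim X)
    have "infsum M (I - X) = infsum M I - infsum M X"
      by (rule infsum_Diff) (use assms elim in auto)
    also have "infsum M X = sum M X" using elim by simp
    finally show ?case using elim by (simp add: dist_real_def)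
  qed
qed

lemma uniform_limit_infsum:
  fixes f :: "'i \<Rightarrow> 'b \<Rightarrow> 'a::banach"
  assumes "M summable_on I" and "\<And>i y. i \<in> I \<Longrightarrow> y \<in> Y \<Longrightarrow> norm (f i y) \<le> M i"
  shows "uniform_limit Y (\<lambda>X y. \<Sum>i\<in>X. f i y) (\<lambda>y. infsum (\<lambda>i. f i y) I) (finite_subsets_at_top I)"
proof (rule uniform_limitI)
  fix e :: real assume e: "e > 0"
  have "\<forall>\<^sub>F X in finite_subsets_at_top I. finite X \<and> X \<subseteq> I"
    by (rule eventually_finite_subsets_at_top_weakI) auto
  with small_tail[OF assms(1) e]
  show "\<forall>\<^sub>F X in finite_subsets_at_top I. \<forall>y\<in>Y. dist (\<Sum>i\<in>X. f i y) (infsum (\<lambda>i. f i y) I) < e"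
  proof eventually_elim
    case (elim X)
    show ?case
    proof
      fix y assume y: "y \<in> Y"
      have s: "(\<lambda>i. f i y) summable_on I"
        by (rule norm_infsum_le_dominated[OF assms(1)]) (use assms y in auto)
      have "infsum (\<lambda>i. f i y) (I - X) = infsum (\<lambda>i. f i y) I - infsum (\<lambda>i. f i y) X"
        by (rule infsum_Diff) (use s elim in auto)
      moreover have "norm (infsum (\<lambda>i. f i y) (I - X)) \<le> infsum M (I - X)"
      proof (rule norm_infsum_le_dominated)
        show "M summable_on I - X" using assms(1) by (rule summable_on_subset_banach) auto
      qed (use assms y in auto)
      ultimately show "dist (\<Sum>i\<in>X. f i y) (infsum (\<lambda>i. f i y) I) < e"
        using elim by (simp add: dist_norm norm_minus_commute)
    qed
  qed
qed

lemma tendsto_infsum_dominated: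
  fixes f :: "'k \<Rightarrow> 'i \<Rightarrow> 'a::banach"
  assumes M: "M summable_on I"
    and bound: "\<forall>\<^sub>F k in F. \<forall>i\<in>I. norm (f k i) \<le> M i"
    and lim: "\<And>i. i \<in> I \<Longrightarrow> ((\<lambda>k. f k i) \<longlongrightarrow> g i) F"
  shows "((\<lambda>k. infsum (f k) I) \<longlongrightarrow> infsum g I) F"
proof (cases "F = bot")
  case False
  have gM: "norm (g i) \<le> M i" if "i \<in> I" for i
  proof (rule tendsto_upperbound[OF tendsto_norm[OF lim[OF that]]])
    show "\<forall>\<^sub>F k in F. norm (f k i) \<le> M i"
      using bound by eventually_elim (use that in auto)
  qed (use False in simp)
  show ?thesis
  proof (rule tendstoI)
    fix e :: real assume e: "e > 0"
    have "\<forall>\<^sub>F X in finite_subsets_at_top I. (finite X \<and> X \<subseteq> I) \<and> \<bar>infsum M (I - X)\<bar> < e/3"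
      using e
      by (intro eventually_conj[OF eventually_finite_subsets_at_top_weakI] small_tail[OF M]) auto
    then obtain X where X: "finite X" "X \<subseteq> I" "\<bar>infsum M (I - X)\<bar> < e/3"
      using eventually_happens[of _ "finite_subsets_at_top I"] by auto
    have MX: "M summable_on I - X" using M by (rule summable_on_subset_banach) auto
    have split: "infsum h I = sum h X + infsum h (I - X) \<and> norm (infsum h (I - X)) < e/3"
      if h: "\<And>i. i \<in> I \<Longrightarrow> norm (h i) \<le> M i" for h :: "'i \<Rightarrow> 'a"
    proof -
      have s: "h summable_on I" by (rule norm_infsum_le_dominated[OF M h])
      have "infsum h (I - X) = infsum h I - infsum h X"
        by (rule infsum_Diff) (use s X in auto)
      moreover have "norm (infsum h (I - X)) \<le> infsum M (I - X)"
        by (rule norm_infsum_le_dominated[OF MX]) (use h in auto)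
      ultimately show ?thesis using X by simp
    qed
    have "((\<lambda>k. \<Sum>i\<in>X. f k i) \<longlongrightarrow> (\<Sum>i\<in>X. g i)) F"
      by (intro tendsto_sum lim) (use X in auto)
    then have "\<forall>\<^sub>F k in F. dist (\<Sum>i\<in>X. f k i) (\<Sum>i\<in>X. g i) < e/3"
      using e by (intro tendstoD) auto
    with bound show "\<forall>\<^sub>F k in F. dist (infsum (f k) I) (infsum g I) < e"
    proof eventually_elim
      case (elim k)
      note 1 = split[of "f k"] and 2 = split[OF gM]
      have "infsum (f k) I - infsum g I
          = (sum (f k) X - sum g X) + infsum (f k) (I - X) - infsum g (I - X)"
        using 1 2 elim by simp
      also have "norm \<dots> \<le> norm (sum (f k) X - sum g X) + norm (infsum (f k) (I - X)) + norm (infsum g (I - X))"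
        by (meson norm_triangle_ineq4 norm_triangle_ineq order_trans add_right_mono)
      also have "\<dots> < e/3 + e/3 + e/3"
        using 1 2 elim by (intro add_strict_mono) (auto simp: dist_norm)
      finally show ?case by (simp add: dist_norm)
    qed
  qed
qed auto

text \<open>Weierstrass' theorem for locally dominated sums; termwise differentiation comes from the uniform
  convergence of the net of finite partial sums on small closed discs.\<close>

lemma holomorphic_infsum:
  fixes f :: "'i \<Rightarrow> complex \<Rightarrow> complex"
  assumes S: "open S"
    and hol: "\<And>i. i \<in> I \<Longrightarrow> f i holomorphic_on S"
    and bound: "\<And>z. z \<in> S \<Longrightarrow> \<exists>r>0. \<exists>M. cball z r \<subseteq> S \<and> M summable_on I \<and>
                   (\<forall>i\<in>I. \<forall>w\<in>cball z r. norm (f i w) \<le> M i)"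
  shows "(\<lambda>z. infsum (\<lambda>i. f i z) I) holomorphic_on S"
    and "\<And>z. z \<in> S \<Longrightarrow> ((\<lambda>i. deriv (f i) z) has_sum deriv (\<lambda>z. infsum (\<lambda>i. f i z) I) z) I"
proof -
  let ?g = "\<lambda>z. infsum (\<lambda>i. f i z) I"
  have main: "(?g has_field_derivative deriv ?g z) (at z) \<and>
      ((\<lambda>i. deriv (f i) z) has_sum deriv ?g z) I" if z: "z \<in> S" for z
  proof -
    obtain r M where r: "r > 0" "cball z r \<subseteq> S" and M: "M summable_on I"
      and fM: "\<And>i w. i \<in> I \<Longrightarrow> w \<in> cball z r \<Longrightarrow> norm (f i w) \<le> M i"
      using bound[OF z] by metis
    have ul: "uniform_limit (cball z r) (\<lambda>X w. \<Sum>i\<in>X. f i w) ?g (finite_subsets_at_top I)"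
      by (rule uniform_limit_infsum[OF M fM])
    have "continuous_on (cball z r) (\<lambda>w. \<Sum>i\<in>X. f i w) \<and>
        (\<forall>w\<in>ball z r. ((\<lambda>w. \<Sum>i\<in>X. f i w) has_field_derivative (\<Sum>i\<in>X. deriv (f i) w)) (at w))"
      if X: "finite X" "X \<subseteq> I" for X
    proof (intro conjI ballI)
      show "continuous_on (cball z r) (\<lambda>w. \<Sum>i\<in>X. f i w)"
        using X r hol
        by (intro continuous_intros continuous_on_subset[OF holomorphic_on_imp_continuous_on]) auto
      fix w assume "w \<in> ball z r"
      then have "w \<in> S" using r by (auto simp: subset_iff)
      then show "((\<lambda>w. \<Sum>i\<in>X. f i w) has_field_derivative (\<Sum>i\<in>X. deriv (f i) w)) (at w)"
        using X hol S by (intro DERIV_sum holomorphic_derivI) auto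
    qed
    then have ev: "\<forall>\<^sub>F X in finite_subsets_at_top I. continuous_on (cball z r) (\<lambda>w. \<Sum>i\<in>X. f i w) \<and>
        (\<forall>w\<in>ball z r. ((\<lambda>w. \<Sum>i\<in>X. f i w) has_field_derivative (\<Sum>i\<in>X. deriv (f i) w)) (at w))"
      by (intro eventually_finite_subsets_at_top_weakI) blast
    obtain g' where g': "\<And>w. w \<in> ball z r \<Longrightarrow> (?g has_field_derivative g' w) (at w) \<and>
        ((\<lambda>X. \<Sum>i\<in>X. deriv (f i) w) \<longlongrightarrow> g' w) (finite_subsets_at_top I)"
      using has_complex_derivative_uniform_limit[OF ev ul] r(1) by auto
    have "(?g has_field_derivative g' z) (at z)" "((\<lambda>X. \<Sum>i\<in>X. deriv (f i) z) \<longlongrightarrow> g' z) (finite_subsets_at_top I)"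
      using g'[of z] r by auto
    moreover from this have "deriv ?g z = g' z" by (simp add: DERIV_imp_deriv)
    ultimately show ?thesis by (simp add: has_sum_def)
  qed
  show "?g holomorphic_on S"
    using main S by (auto simp: holomorphic_on_open)
  show "\<And>z. z \<in> S \<Longrightarrow> ((\<lambda>i. deriv (f i) z) has_sum deriv ?g z) I"
    using main by blast
qed

section \<open>Smooth functions through their sequences of derivatives\<close>

text \<open>A smooth function is handled together with explicit formulas for all of its derivatives. Products,
  affine substitutions and integrals with a parameter act on such sequences, and membership in the
  Schwartz space only requires bounds on the given formulas.\<close>

definition derivative_sequence :: "(nat \<Rightarrow> real \<Rightarrow> complex) \<Rightarrow> bool" where
  "derivative_sequence D \<longleftrightarrow> (\<forall>n x. (D n has_vector_derivative D (Suc n) x) (at x))"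

lemma nth_deriv_eq:
  assumes "derivative_sequence D"
  shows "nth_deriv n (D 0) = D n"
proof (induction n)
  case (Suc n)
  have "nth_deriv (Suc n) (D 0) = (\<lambda>x. vector_derivative (nth_deriv n (D 0)) (at x))"
    by (simp add: nth_deriv_def)
  also have "\<dots> = D (Suc n)"
    using assms by (auto simp: Suc.IH derivative_sequence_def intro!: ext vector_derivative_at)
  finally show ?case .
qed (simp add: nth_deriv_def)

lemma smooth_funI: "derivative_sequence D \<Longrightarrow> smooth_fun (D 0)"
  unfolding smooth_fun_def by (auto simp: nth_deriv_eq derivative_sequence_def intro: differentiableI_vector)

lemma derivative_sequence_nth_deriv:
  assumes "smooth_fun \<phi>"
  shows "derivative_sequence (\<lambda>n. nth_deriv n \<phi>)"
  unfolding derivative_sequence_def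
proof (intro allI)
  fix n x
  have "nth_deriv (Suc n) \<phi> x = vector_derivative (nth_deriv n \<phi>) (at x)"
    by (simp add: nth_deriv_def)
  then show "(nth_deriv n \<phi> has_vector_derivative nth_deriv (Suc n) \<phi> x) (at x)"
    using assms by (simp add: smooth_fun_def vector_derivative_works)
qed

lemma derivative_sequence_continuous:
  assumes "derivative_sequence D"
  shows "continuous_on S (D n)"
  by (rule continuous_on_vector_derivative[of _ _ "D (Suc n)"])
     (use assms in \<open>auto simp: derivative_sequence_def intro: has_vector_derivative_at_within\<close>)

lemma Leibniz_sum_Suc:
  fixes u v :: "nat \<Rightarrow> complex"
  shows "(\<Sum>k\<le>n. of_nat (n choose k) * (u (Suc k) * v (n - k) + u k * v (Suc (n - k))))
       = (\<Sum>k\<le>Suc n. of_nat (Suc n choose k) * (u k * v (Suc n - k)))"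
proof -
  have "(\<Sum>k\<le>Suc n. of_nat (n choose k) * (u k * v (Suc n - k)))
      = (\<Sum>k\<le>n. of_nat (n choose k) * (u k * v (Suc (n - k))))"
    by (simp add: Suc_diff_le binomial_eq_0 cong: sum.cong_simp)
  moreover have "(\<Sum>k\<le>Suc n. of_nat (n choose k) * (u k * v (Suc n - k)))
      = u 0 * v (Suc n) + (\<Sum>k\<le>n. of_nat (n choose Suc k) * (u (Suc k) * v (n - k)))"
    by (subst sum.atMost_Suc_shift) simp
  moreover have "(\<Sum>k\<le>Suc n. of_nat (Suc n choose k) * (u k * v (Suc n - k)))
      = u 0 * v (Suc n) + (\<Sum>k\<le>n. of_nat (Suc n choose Suc k) * (u (Suc k) * v (n - k)))"
    by (subst sum.atMost_Suc_shift) simp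
  ultimately show ?thesis
    by (simp add: algebra_simps sum.distrib)
qed

definition leibniz_product ::
    "(nat \<Rightarrow> real \<Rightarrow> complex) \<Rightarrow> (nat \<Rightarrow> real \<Rightarrow> complex) \<Rightarrow> nat \<Rightarrow> real \<Rightarrow> complex" where
  "leibniz_product F G n x = (\<Sum>k\<le>n. of_nat (n choose k) * (F k x * G (n - k) x))"

lemma leibniz_product_0 [simp]: "leibniz_product F G 0 x = F 0 x * G 0 x"
  by (simp add: leibniz_product_def)

lemma derivative_sequence_mult:
  assumes F: "derivative_sequence F" and G: "derivative_sequence G"
  shows "derivative_sequence (leibniz_product F G)"
  unfolding derivative_sequence_def leibniz_product_def[abs_def]
proof (intro allI)
  fix n x
  have FG: "(F k has_vector_derivative F (Suc k) x) (at x)" "(G k has_vector_derivative G (Suc k) x) (at x)" for k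
    using F G by (auto simp: derivative_sequence_def)
  have "((\<lambda>x. \<Sum>k\<le>n. of_nat (n choose k) * (F k x * G (n - k) x)) has_vector_derivative
      (\<Sum>k\<le>n. of_nat (n choose k) * (F k x * G (Suc (n - k)) x + F (Suc k) x * G (n - k) x))) (at x)"
    by (intro has_vector_derivative_sum has_vector_derivative_mult_right has_vector_derivative_mult FG)
  then show "((\<lambda>x. \<Sum>k\<le>n. of_nat (n choose k) * (F k x * G (n - k) x)) has_vector_derivative
      (\<Sum>k\<le>Suc n. of_nat (Suc n choose k) * (F k x * G (Suc n - k) x))) (at x)"
    by (simp only: Leibniz_sum_Suc[of n "\<lambda>k. F k x" "\<lambda>k. G k x", symmetric] add.commute)
qed

text \<open>Rescaling by \<open>r = 1 / R\<close> produces the cutoffs at scale \<open>R\<close>, the factor \<open>r ^ n\<close> being the gain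
  in their derivatives.\<close>

lemma derivative_sequence_affine:
  assumes F: "derivative_sequence F"
  shows "derivative_sequence (\<lambda>n x. of_real (r ^ n) * F n (r * x + s))"
  unfolding derivative_sequence_def
proof (intro allI)
  fix n x
  have "((\<lambda>x. r * x + s) has_vector_derivative r) (at x)"
    by (auto intro!: derivative_eq_intros)
  moreover have "(F n has_vector_derivative F (Suc n) (r * x + s)) (at (r * x + s))"
    using F by (simp add: derivative_sequence_def)
  ultimately have "((F n \<circ> (\<lambda>x. r * x + s)) has_vector_derivative r *\<^sub>R F (Suc n) (r * x + s)) (at x)"
    by (rule vector_diff_chain_at)
  from has_vector_derivative_mult_right[OF this, of "of_real (r ^ n)"]
  show "((\<lambda>x. of_real (r ^ n) * F n (r * x + s)) has_vector_derivative
      of_real (r ^ Suc n) * F (Suc n) (r * x + s)) (at x)"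
    by (simp add: o_def scaleR_conv_of_real mult_ac)
qed

lemma derivative_sequence_exp: "derivative_sequence (\<lambda>n t. w ^ n * exp (w * of_real t))"
  unfolding derivative_sequence_def
proof (intro allI)
  fix n x
  have "((\<lambda>z. w ^ n * exp (w * z)) has_field_derivative w ^ Suc n * exp (w * of_real x)) (at (of_real x))"
    by (auto intro!: derivative_eq_intros)
  then show "((\<lambda>t. w ^ n * exp (w * complex_of_real t)) has_vector_derivative w ^ Suc n * exp (w * of_real x)) (at x)"
    by (rule has_vector_derivative_real_field)
qed

lemma derivative_sequence_square:
  "derivative_sequence (\<lambda>n t. of_real (if n = 0 then t\<^sup>2 else if n = 1 then 2 * t else if n = 2 then 2 else 0))"
  unfolding derivative_sequence_def
proof (intro allI)
  fix n :: nat and x :: real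
  have "((\<lambda>t. if n = 0 then t\<^sup>2 else if n = 1 then 2 * t else if n = 2 then 2 else 0) has_real_derivative
    (if Suc n = 0 then x\<^sup>2 else if Suc n = 1 then 2 * x else if Suc n = 2 then 2 else 0)) (at x)"
    by (auto intro!: derivative_eq_intros)
  then show "((\<lambda>t. complex_of_real (if n = 0 then t\<^sup>2 else if n = 1 then 2 * t else if n = 2 then 2 else 0)) has_vector_derivative
    of_real (if Suc n = 0 then x\<^sup>2 else if Suc n = 1 then 2 * x else if Suc n = 2 then 2 else 0)) (at x)"
    by (intro has_vector_derivative_of_real) (simp only: has_real_derivative_iff_has_vector_derivative)
qed

lemma derivative_sequence_linear:
  "derivative_sequence (\<lambda>n t. if n = 0 then w * of_real t else if n = 1 then w else 0)"
  unfolding derivative_sequence_def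
proof (intro allI)
  fix n :: nat and x :: real
  have "((\<lambda>t. w * complex_of_real t) has_vector_derivative w) (at x)"
    by (rule has_vector_derivative_real_field) (auto intro!: derivative_eq_intros)
  then show "((\<lambda>t. if n = 0 then w * of_real t else if n = 1 then w else 0) has_vector_derivative
    (if Suc n = 0 then w * of_real x else if Suc n = 1 then w else 0)) (at x)"
    by auto
qed

lemma derivative_sequence_vanishes:
  assumes D: "derivative_sequence D" and S: "open S" and z: "\<And>x. x \<in> S \<Longrightarrow> D 0 x = 0"
  shows "x \<in> S \<Longrightarrow> D n x = 0"
proof (induction n arbitrary: x)
  case (Suc n)
  have "(D n has_vector_derivative 0) (at x)"
    by (rule has_vector_derivative_transform_within_open[of "\<lambda>_. 0"]) (use Suc S in auto)
  moreover have "(D n has_vector_derivative D (Suc n) x) (at x)"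
    using D by (simp add: derivative_sequence_def)
  ultimately show ?case by (metis vector_derivative_at)
qed (use z in auto)

lemma open_abs_greater: "open {x::real. R < \<bar>x\<bar>}"
  by (intro open_Collect_less continuous_intros)

lemma test_funI:
  assumes D: "derivative_sequence D" and z: "\<And>x. \<bar>x\<bar> > R \<Longrightarrow> D 0 x = 0"
  shows "test_fun (D 0)"
proof -
  have "{x. D 0 x \<noteq> 0} \<subseteq> {-R..R}" using z by force
  then have "closure {x. D 0 x \<noteq> 0} \<subseteq> {-R..R}" by (rule closure_minimal) simp
  then have "compact (closure {x. D 0 x \<noteq> 0})"
    using bounded_subset[OF bounded_closed_interval] by (simp add: compact_eq_bounded_closed)
  then show ?thesis using smooth_funI[OF D] by (simp add: test_fun_def)
qed

lemma test_funE:
  assumes "test_fun \<phi>"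
  obtains D R where "derivative_sequence D" "D 0 = \<phi>" "R > 0" "\<And>x n. \<bar>x\<bar> > R \<Longrightarrow> D n x = 0"
proof -
  have "bounded {x. \<phi> x \<noteq> 0}"
    using assms unfolding test_fun_def
    by (meson bounded_subset closure_subset compact_imp_bounded)
  then obtain R where R: "R > 0" "\<And>x. \<phi> x \<noteq> 0 \<Longrightarrow> \<bar>x\<bar> \<le> R"
    by (auto simp: bounded_pos)
  have d: "derivative_sequence (\<lambda>n. nth_deriv n \<phi>)"
    using assms derivative_sequence_nth_deriv by (simp add: test_fun_def)
  have "nth_deriv n \<phi> x = 0" if "\<bar>x\<bar> > R" for x n
    by (rule derivative_sequence_vanishes[OF d open_abs_greater[of R]])
       (use R that in \<open>force simp: nth_deriv_def\<close>)+
  then show ?thesis using that[OF d _ R(1)] by (simp add: nth_deriv_def)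
qed

lemma schwartzI:
  assumes D: "derivative_sequence D" and "\<And>k n. \<exists>C. \<forall>x. \<bar>x\<bar> ^ k * norm (D n x) \<le> C"
  shows "schwartz (D 0)"
  unfolding schwartz_def using smooth_funI[OF D]
proof (intro conjI allI)
  fix k n
  obtain C where "\<forall>x. \<bar>x\<bar> ^ k * norm (D n x) \<le> C" using assms(2) by blast
  then show "bounded (range (\<lambda>x. \<bar>x\<bar> ^ k * cmod (nth_deriv n (D 0) x)))"
    by (auto simp: nth_deriv_eq[OF D] bounded_iff)
qed

lemma schwartz_bounds:
  assumes "schwartz (D 0)" and D: "derivative_sequence D"
  obtains C where "C > 0" "\<And>x. \<bar>x\<bar> ^ k * norm (D n x) \<le> C"
proof -
  have "bounded (range (\<lambda>x. \<bar>x\<bar> ^ k * cmod (D n x)))"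
    using assms by (auto simp: schwartz_def nth_deriv_eq[OF D])
  then obtain C where "C > 0" "\<And>x. norm (\<bar>x\<bar> ^ k * cmod (D n x)) \<le> C"
    by (auto simp: bounded_pos)
  then show ?thesis using that by force
qed

lemma schwartz_seminorm_le:
  assumes "derivative_sequence D" "\<And>x. \<bar>x\<bar> ^ k * norm (D n x) \<le> C"
  shows "schwartz_seminorm k n (D 0) \<le> C"
  unfolding schwartz_seminorm_def nth_deriv_eq[OF assms(1)]
  by (rule cSUP_least) (use assms in auto)

lemma compact_support_bounds:
  assumes D: "derivative_sequence D" and z: "\<And>x. \<bar>x\<bar> > R \<Longrightarrow> D 0 x = 0"
  shows "\<exists>C>0. \<forall>x. \<bar>x\<bar> ^ k * norm (D n x) \<le> C"
proof -
  have "continuous_on {-R..R} (\<lambda>x. \<bar>x\<bar> ^ k * norm (D n x))"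
    using derivative_sequence_continuous[OF D] by (intro continuous_intros)
  then have "bounded ((\<lambda>x. \<bar>x\<bar> ^ k * norm (D n x)) ` {-R..R})"
    by (intro compact_imp_bounded compact_continuous_image) auto
  then obtain C where C: "C > 0" "\<And>x. x \<in> {-R..R} \<Longrightarrow> norm (\<bar>x\<bar> ^ k * norm (D n x)) \<le> C"
    by (auto simp: bounded_pos)
  have "\<bar>x\<bar> ^ k * norm (D n x) \<le> C" for x
  proof (cases "\<bar>x\<bar> > R")
    case True
    then have "D n x = 0"
      using derivative_sequence_vanishes[OF D open_abs_greater, of R] z by simp
    then show ?thesis using C by simp
  next
    case False
    then have "x \<in> {-R..R}" by auto
    then show ?thesis using C(2)[of x] by simp
  qed
  then show ?thesis using C(1) by blast
qed

lemma schwartz_compact_support: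
  assumes D: "derivative_sequence D" and z: "\<And>x. \<bar>x\<bar> > R \<Longrightarrow> D 0 x = 0"
  shows "schwartz (D 0)"
  by (rule schwartzI[OF D]) (use compact_support_bounds[OF assms] in blast)

text \<open>The derivatives of \<open>exp (- 1 / x)\<close> on the positive axis are \<open>p (1 / x) * exp (- 1 / x)\<close> with
  polynomials \<open>p\<close>; the recursion is the chain rule for \<open>u = 1 / x\<close>, where \<open>du/dx = - u\<^sup>2\<close>.\<close>

fun flat_poly :: "nat \<Rightarrow> real poly" where
  "flat_poly 0 = 1"
| "flat_poly (Suc n) = [:0, 0, 1:] * (flat_poly n - pderiv (flat_poly n))"

definition flat_deriv :: "nat \<Rightarrow> real \<Rightarrow> real" where
  "flat_deriv n x = (if x > 0 then poly (flat_poly n) (1 / x) * exp (- 1 / x) else 0)"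

lemma poly_exp_tendsto_0: "((\<lambda>y. poly p (1 / y) * exp (- 1 / y)) \<longlongrightarrow> 0) (at_right (0::real))"
proof -
  have "((\<lambda>u. \<Sum>i\<le>degree p. coeff p i * (u ^ i / exp u)) \<longlongrightarrow> (\<Sum>i\<le>degree p. coeff p i * 0)) (at_top::real filter)"
    by (intro tendsto_intros tendsto_power_div_exp_0)
  moreover have "(\<Sum>i\<le>degree p. coeff p i * (u ^ i / exp u)) = poly p u * exp (- u)" for u :: real
    by (simp add: poly_altdef exp_minus field_simps sum_divide_distrib)
  ultimately have "((\<lambda>u. poly p u * exp (- u)) \<longlongrightarrow> 0) at_top" by simp
  from filterlim_compose[OF this filterlim_inverse_at_top_right]
  show ?thesis by (simp add: inverse_eq_divide)
qed

lemma flat_deriv_has_derivative: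
  "(flat_deriv n has_real_derivative flat_deriv (Suc n) x) (at x)"
proof -
  consider "x > 0" | "x < 0" | "x = 0" by linarith
  then show ?thesis
  proof cases
    case 1
    have "((\<lambda>x. poly (flat_poly n) (1 / x) * exp (- 1 / x)) has_real_derivative flat_deriv (Suc n) x) (at x)"
      using 1 by (auto intro!: derivative_eq_intros poly_DERIV DERIV_chain2[OF poly_DERIV]
          simp: flat_deriv_def field_simps power2_eq_square)
    then show ?thesis
      by (rule DERIV_cong_ev[THEN iffD1, rotated -1])
         (use 1 in \<open>auto simp: flat_deriv_def intro!: eventually_mono[OF eventually_nhds_in_open[of "{0<..}"]]\<close>)
  next
    case 2
    have "((\<lambda>x. 0) has_real_derivative flat_deriv (Suc n) x) (at x)"
      using 2 by (auto simp: flat_deriv_def)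
    then show ?thesis
      by (rule DERIV_cong_ev[THEN iffD1, rotated -1])
         (use 2 in \<open>auto simp: flat_deriv_def intro!: eventually_mono[OF eventually_nhds_in_open[of "{..<0}"]]\<close>)
  next
    case 3
    let ?q = "\<lambda>y. (flat_deriv n y - flat_deriv n 0) / (y - 0)"
    have "(?q \<longlongrightarrow> 0) (at_right 0)"
    proof (rule Lim_transform_eventually[OF poly_exp_tendsto_0[of "[:0, 1:] * flat_poly n"]])
      show "\<forall>\<^sub>F x in at_right 0. poly ([:0, 1:] * flat_poly n) (1 / x) * exp (- 1 / x) = ?q x"
        by (auto simp: eventually_at_filter flat_deriv_def)
    qed
    moreover have "(?q \<longlongrightarrow> 0) (at_left 0)"
    proof (rule Lim_transform_eventually[OF tendsto_const])
      show "\<forall>\<^sub>F x in at_left 0. 0 = ?q x"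
        by (auto simp: eventually_at_filter flat_deriv_def)
    qed
    ultimately have "(?q \<longlongrightarrow> 0) (at 0)"
      by (simp add: filterlim_split_at)
    then show ?thesis using 3 by (simp add: has_field_derivative_iff flat_deriv_def)
  qed
qed

lemma derivative_sequence_flat: "derivative_sequence (\<lambda>n x. of_real (flat_deriv n x))"
  unfolding derivative_sequence_def
  using flat_deriv_has_derivative
  by (auto intro!: has_vector_derivative_of_real simp flip: has_real_derivative_iff_has_vector_derivative)

text \<open>This is \<open>e\<close> times the product of \<open>exp (- 1 / (2 + x))\<close> and \<open>exp (- 1 / (2 - x))\<close>, normalized to be
  1 at the origin. The product form gives the derivatives, the closed form the elementary bounds.\<close>

definition bump :: "real \<Rightarrow> real" where
  "bump x = (if \<bar>x\<bar> < 2 then exp (1 - 4 / (4 - x\<^sup>2)) else 0)"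

lemma bump_0 [simp]: "bump 0 = 1" by (simp add: bump_def)
lemma bump_nonneg: "bump x \<ge> 0" by (simp add: bump_def)
lemma bump_outside: "\<bar>x\<bar> \<ge> 2 \<Longrightarrow> bump x = 0" by (simp add: bump_def)

lemma bump_le_1: "bump x \<le> 1"
proof (cases "\<bar>x\<bar> < 2")
  case True
  then have "x\<^sup>2 < 2\<^sup>2" using power_strict_mono[of "\<bar>x\<bar>" 2 2] by simp
  then have "4 / (4 - x\<^sup>2) \<ge> 1" by (simp add: field_simps)
  then show ?thesis by (simp add: bump_def)
qed (simp add: bump_def)

lemma bump_lower:
  assumes "\<bar>x\<bar> \<le> 1"
  shows "bump x \<ge> exp (- 1)"
proof -
  have "x\<^sup>2 \<le> 1" using assms by (simp add: abs_square_le_1)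
  then have "4 / (4 - x\<^sup>2) \<le> 2" by (simp add: field_simps)
  then show ?thesis using assms by (simp add: bump_def)
qed

lemma bump_derivatives:
  obtains X where "derivative_sequence X" "X 0 = (\<lambda>x. of_real (bump x))"
proof -
  let ?A = "\<lambda>n x. of_real (1 ^ n) * complex_of_real (flat_deriv n (1 * x + 2))"
  let ?B = "\<lambda>n x. of_real ((-1) ^ n) * complex_of_real (flat_deriv n ((-1) * x + 2))"
  let ?AB = "leibniz_product ?A ?B"
  have AB: "derivative_sequence ?AB"
    by (intro derivative_sequence_mult derivative_sequence_affine derivative_sequence_flat)
  have "derivative_sequence (\<lambda>n x. of_real (exp 1) * ?AB n x)"
    unfolding derivative_sequence_def
    using AB[unfolded derivative_sequence_def] by (intro allI has_vector_derivative_mult_right) auto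
  moreover have "of_real (exp 1) * ?AB 0 x = of_real (bump x)" for x
  proof (cases "\<bar>x\<bar> < 2")
    case True
    then have "x + 2 > 0" "2 - x > 0" "4 - x\<^sup>2 = (2 - x) * (x + 2)"
      by (auto simp: abs_less_iff algebra_simps power2_eq_square)
    then have "1 - 4 / (4 - x\<^sup>2) = 1 + (- 1 / (x + 2) + - 1 / (2 - x))"
      by (simp add: divide_simps)
    then have "exp 1 * (flat_deriv 0 (x + 2) * flat_deriv 0 (2 - x)) = bump x"
      using True \<open>x + 2 > 0\<close> \<open>2 - x > 0\<close> by (simp only: bump_def flat_deriv_def exp_add) simp
    then show ?thesis by (simp flip: of_real_mult)
  next
    case False
    then show ?thesis by (auto simp: bump_def flat_deriv_def)
  qed
  ultimately show ?thesis using that[of "\<lambda>n x. of_real (exp 1) * ?AB n x"] by auto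
qed

section \<open>Temperate point measures with nonnegative masses\<close>

text \<open>How estimates for the mass of windows turn into summability: the weight \<open>v\<close> is dominated, point by
  point, by one term of the series of kernels \<open>p j * K j\<close>, while the total mass seen by \<open>K j\<close> is at
  most \<open>C j\<close>. It is used with the bumps of width \<open>j\<close>, and with Fourier kernels centred at multiples
  of a fixed step.\<close>

lemma weighted_summable_on:
  fixes w v :: "'x \<Rightarrow> real" and K :: "nat \<Rightarrow> 'x \<Rightarrow> real"
  assumes w: "\<And>x. x \<in> S \<Longrightarrow> w x \<ge> 0" and v: "\<And>x. v x \<ge> 0" and K: "\<And>j x. K j x \<ge> 0"
    and c: "c > 0" and p: "\<And>j. p j \<ge> 0"
    and lower: "\<And>x. x \<in> S \<Longrightarrow> \<exists>j. p j * K j x \<ge> c * v x"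
    and upper: "\<And>j F. finite F \<Longrightarrow> F \<subseteq> S \<Longrightarrow> (\<Sum>x\<in>F. w x * K j x) \<le> C j"
    and summ: "summable (\<lambda>j. p j * C j)"
  shows "(\<lambda>x. w x * v x) summable_on S"
proof -
  have C: "C j \<ge> 0" for j using upper[of "{}"] by simp
  obtain j where j: "\<And>x. x \<in> S \<Longrightarrow> p (j x) * K (j x) x \<ge> c * v x"
    using lower by metis
  have "(\<Sum>x\<in>F. w x * v x) \<le> (\<Sum>j. p j * C j) / c" if F: "finite F" "F \<subseteq> S" for F
  proof -
    define J where "J = Suc (Max (insert 0 (j ` F)))"
    have jJ: "j x < J" if "x \<in> F" for x
      using F that by (auto simp: J_def less_Suc_eq_le intro!: Max_ge)
    have "c * (\<Sum>x\<in>F. w x * v x) = (\<Sum>x\<in>F. w x * (c * v x))"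
      by (simp add: sum_distrib_left mult_ac)
    also have "\<dots> \<le> (\<Sum>x\<in>F. w x * (\<Sum>i<J. p i * K i x))"
    proof (intro sum_mono mult_left_mono)
      fix x assume x: "x \<in> F"
      have "c * v x \<le> p (j x) * K (j x) x" using j x F by auto
      also have "\<dots> \<le> (\<Sum>i<J. p i * K i x)"
        by (rule member_le_sum) (use jJ x p K in auto)
      finally show "c * v x \<le> (\<Sum>i<J. p i * K i x)" .
      show "0 \<le> w x" using w x F by auto
    qed
    also have "\<dots> = (\<Sum>x\<in>F. \<Sum>i<J. p i * (w x * K i x))"
      by (simp add: sum_distrib_left mult_ac)
    also have "\<dots> = (\<Sum>i<J. \<Sum>x\<in>F. p i * (w x * K i x))"
      by (rule sum.swap)
    also have "\<dots> = (\<Sum>i<J. p i * (\<Sum>x\<in>F. w x * K i x))"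
      by (simp add: sum_distrib_left)
    also have "\<dots> \<le> (\<Sum>i<J. p i * C i)"
      by (intro sum_mono mult_left_mono upper F p)
    also have "\<dots> \<le> (\<Sum>j. p j * C j)"
      by (rule sum_le_suminf[OF summ]) (use p C in auto)
    finally show ?thesis using c by (simp add: field_simps)
  qed
  then show ?thesis
    by (intro nonneg_bdd_above_summable_on bdd_aboveI2) (use w v in auto)
qed

definition cutoff_seq :: "(nat \<Rightarrow> real \<Rightarrow> complex) \<Rightarrow> real \<Rightarrow> nat \<Rightarrow> real \<Rightarrow> complex" where
  "cutoff_seq X R n x = of_real ((1 / R) ^ n) * X n (1 / R * x + 0)"

lemma derivative_sequence_cutoff:
  "derivative_sequence X \<Longrightarrow> derivative_sequence (cutoff_seq X R)"
  unfolding cutoff_seq_def[abs_def] by (rule derivative_sequence_affine)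

lemma cutoff_seq_0: "X 0 = (\<lambda>x. of_real (bump x)) \<Longrightarrow> cutoff_seq X R 0 x = of_real (bump (x / R))"
  by (simp add: cutoff_seq_def)

lemma cutoff_outside:
  assumes "X 0 = (\<lambda>x. of_real (bump x))" "R > 0" "\<bar>x\<bar> > 2 * R"
  shows "cutoff_seq X R 0 x = 0"
proof -
  have "\<bar>x / R\<bar> \<ge> 2" using assms by (simp add: field_simps)
  then show ?thesis by (simp add: cutoff_seq_0 assms bump_outside)
qed

lemma point_measure_summable_bump:
  fixes \<theta> :: "real \<Rightarrow> 'a::banach"
  assumes "point_measure S (\<lambda>x. of_real (w x))" 
    and out: "\<And>x. \<bar>x\<bar> > R \<Longrightarrow> \<theta> x = 0" and B: "\<And>x. norm (\<theta> x) \<le> B"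
  shows "(\<lambda>x. \<bar>w x\<bar> * norm (\<theta> x)) summable_on S"
proof -
  have "(\<lambda>x. \<bar>w x\<bar>) summable_on S \<inter> {-R..R}"
    using assms(1) by (auto simp: point_measure_def norm_of_real)
  then have "(\<lambda>x. \<bar>w x\<bar> * B) summable_on S \<inter> {-R..R}"
    by (rule summable_on_cmult_left)
  then have "(\<lambda>x. \<bar>w x\<bar> * norm (\<theta> x)) summable_on S \<inter> {-R..R}"
    by (rule summable_on_comparison_test) (auto intro!: mult_left_mono B)
  moreover have "(\<lambda>x. \<bar>w x\<bar> * norm (\<theta> x)) summable_on S \<inter> {-R..R} \<longleftrightarrow> (\<lambda>x. \<bar>w x\<bar> * norm (\<theta> x)) summable_on S"
  proof (rule summable_on_cong_neutral)
    fix x assume "x \<in> S - S \<inter> {-R..R}"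
    then have "\<bar>x\<bar> > R" by auto
    then show "\<bar>w x\<bar> * norm (\<theta> x) = 0" using out by simp
  qed auto
  ultimately show ?thesis by simp
qed

text \<open>For a nonnegative measure, the continuity estimate for the bump at scale \<open>R\<close> bounds the mass of
  \<open>[-R, R]\<close> by a power of \<open>R\<close>. This is where positivity of the masses enters: mass cannot cancel.\<close>

lemma temperate_weight_summable:
  assumes u: "temperate_distribution u" and pm: "is_point_measure u S (\<lambda>x. of_real (w x))"
    and w: "\<And>x. x \<in> S \<Longrightarrow> w x \<ge> 0"
  shows "\<exists>N. (\<lambda>x. w x * (1 / (1 + \<bar>x\<bar>) ^ N)) summable_on S"
proof -
  obtain X where X: "derivative_sequence X" "X 0 = (\<lambda>x. of_real (bump x))"
    by (rule bump_derivatives)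
  have X0: "X 0 x = 0" if "\<bar>x\<bar> > 2" for x using that by (simp add: X bump_outside)
  obtain C N where CN: "\<And>\<phi>. schwartz \<phi> \<Longrightarrow> norm (u \<phi>) \<le> C * (\<Sum>k\<le>N. \<Sum>n\<le>N. schwartz_seminorm k n \<phi>)"
    using u unfolding temperate_distribution_def by metis
  have "\<forall>k n. \<exists>M>0. \<forall>x. \<bar>x\<bar> ^ k * norm (X n x) \<le> M"
    using compact_support_bounds[OF X(1) X0] by blast
  then obtain M where M: "\<And>k n x. \<bar>x\<bar> ^ k * norm (X n x) \<le> M k n" "\<And>k n. M k n > 0"
    by metis
  define Cb where "Cb = \<bar>C\<bar> * (\<Sum>k\<le>N. \<Sum>n\<le>N. M k n)"
  have ub: "(\<Sum>x\<in>F. w x * bump (x / R)) \<le> Cb * R ^ N" if R: "R \<ge> 1" and F: "finite F" "F \<subseteq> S" for R F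
  proof -
    let ?\<Phi> = "cutoff_seq X R"
    have d: "derivative_sequence ?\<Phi>" using X by (intro derivative_sequence_cutoff)
    have out: "?\<Phi> 0 x = 0" if "\<bar>x\<bar> > 2 * R" for x by (rule cutoff_outside) (use X R that in auto)
    have sch: "schwartz (?\<Phi> 0)" using schwartz_compact_support[OF d out] .
    have sn: "schwartz_seminorm k n (?\<Phi> 0) \<le> M k n * R ^ N" if "k \<le> N" for k n
    proof (rule schwartz_seminorm_le[OF d])
      fix x
      have "\<bar>x\<bar> ^ k * norm (?\<Phi> n x) = (R ^ k * (1 / R) ^ n) * (\<bar>x / R\<bar> ^ k * norm (X n (x / R)))"
        using R by (simp add: cutoff_seq_def norm_mult norm_divide norm_power power_divide field_simps)
      also have "\<dots> \<le> (R ^ N * 1) * M k n"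
        using R that M(2)[of k n] by (intro mult_mono M power_increasing) (auto simp: power_le_one)
      finally show "\<bar>x\<bar> ^ k * norm (?\<Phi> n x) \<le> M k n * R ^ N" by (simp add: mult_ac)
    qed
    have "norm (u (?\<Phi> 0)) \<le> C * (\<Sum>k\<le>N. \<Sum>n\<le>N. schwartz_seminorm k n (?\<Phi> 0))"
      using CN sch by blast
    also have "\<dots> \<le> \<bar>C\<bar> * (\<Sum>k\<le>N. \<Sum>n\<le>N. M k n * R ^ N)"
    proof (rule mult_mono)
      show "(\<Sum>k\<le>N. \<Sum>n\<le>N. schwartz_seminorm k n (?\<Phi> 0)) \<le> (\<Sum>k\<le>N. \<Sum>n\<le>N. M k n * R ^ N)"
        by (intro sum_mono sn) auto
      have "0 \<le> schwartz_seminorm k n (?\<Phi> 0)" for k n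
      proof -
        have "bdd_above (range (\<lambda>x. \<bar>x\<bar> ^ k * norm (nth_deriv n (?\<Phi> 0) x)))"
          using sch unfolding schwartz_def by (auto intro!: bounded_imp_bdd_above)
        then show ?thesis unfolding schwartz_seminorm_def
          by (rule cSUP_upper2[of _ _ 0]) auto
      qed
      then show "0 \<le> (\<Sum>k\<le>N. \<Sum>n\<le>N. schwartz_seminorm k n (?\<Phi> 0))" by (intro sum_nonneg) auto
    qed auto
    also have "\<dots> = Cb * R ^ N" by (simp add: Cb_def sum_distrib_right)
    finally have le: "norm (u (?\<Phi> 0)) \<le> Cb * R ^ N" .
    have "(\<lambda>x. \<bar>w x\<bar> * norm (bump (x / R))) summable_on S"
    proof (rule point_measure_summable_bump)
      show "point_measure S (\<lambda>x. complex_of_real (w x))" using pm by (simp add: is_point_measure_def)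
      show "bump (x / R) = 0" if "\<bar>x\<bar> > 2 * R" for x
        using out[OF that] X by (simp add: cutoff_seq_0)
      show "norm (bump (x / R)) \<le> 1" for x
        using bump_nonneg bump_le_1 by simp
    qed
    then have s: "(\<lambda>x. w x * bump (x / R)) summable_on S"
      by (rule summable_on_cong[THEN iffD1, rotated]) (use w in \<open>auto simp: bump_nonneg\<close>)
    have "test_fun (?\<Phi> 0)" by (rule test_funI[OF d out])
    then have "u (?\<Phi> 0) = (\<Sum>\<^sub>\<infinity>x\<in>S. of_real (w x) * ?\<Phi> 0 x)"
      using pm by (simp add: is_point_measure_def)
    also have "\<dots> = (\<Sum>\<^sub>\<infinity>x\<in>S. of_real (w x * bump (x / R)))"
      by (simp add: cutoff_seq_0 X)
    also have "\<dots> = of_real (\<Sum>\<^sub>\<infinity>x\<in>S. w x * bump (x / R))"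
      by (rule infsumI) (use has_sum_infsum[OF s] in \<open>simp only: has_sum_of_real_iff\<close>)
    finally have eq: "u (?\<Phi> 0) = of_real (\<Sum>\<^sub>\<infinity>x\<in>S. w x * bump (x / R))" .
    have "(\<Sum>x\<in>F. w x * bump (x / R)) \<le> (\<Sum>\<^sub>\<infinity>x\<in>S. w x * bump (x / R))"
      by (rule finite_sum_le_infsum[OF s]) (use F w bump_nonneg in auto)
    also have "\<dots> \<le> Cb * R ^ N" using le unfolding eq norm_of_real by simp
    finally show ?thesis .
  qed
  have "(\<lambda>x. w x * (1 / (1 + \<bar>x\<bar>) ^ (N + 2))) summable_on S"
  proof (rule weighted_summable_on[where p = "\<lambda>j. 1 / real (Suc j) ^ (N + 2)" and K = "\<lambda>j x. bump (x / real (Suc j))"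
        and C = "\<lambda>j. Cb * real (Suc j) ^ N" and c = "exp (-1) / 2 ^ (N + 2)"])
    show "\<exists>j. exp (-1) / 2 ^ (N + 2) * (1 / (1 + \<bar>x\<bar>) ^ (N + 2)) \<le> 1 / real (Suc j) ^ (N + 2) * bump (x / real (Suc j))" for x
    proof
      let ?j = "nat \<lceil>\<bar>x\<bar>\<rceil>"
      have j: "\<bar>x\<bar> \<le> real (Suc ?j)" "real (Suc ?j) \<le> 2 * (1 + \<bar>x\<bar>)"
        using of_nat_nat[of "\<lceil>\<bar>x\<bar>\<rceil>", where 'a = real] by (simp_all, linarith+)
      then have "\<bar>x / real (Suc ?j)\<bar> \<le> 1" by (simp add: abs_divide divide_le_eq_1 del: of_nat_Suc)
      then have "exp (-1) \<le> bump (x / real (Suc ?j))" by (rule bump_lower)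
      moreover have "1 / (2 * (1 + \<bar>x\<bar>)) ^ (N + 2) \<le> 1 / real (Suc ?j) ^ (N + 2)"
        using j by (intro frac_le power_mono zero_less_power) (simp_all del: of_nat_Suc)
      ultimately have "1 / (2 * (1 + \<bar>x\<bar>)) ^ (N + 2) * exp (-1) \<le> 1 / real (Suc ?j) ^ (N + 2) * bump (x / real (Suc ?j))"
        by (intro mult_mono) auto
      then show "exp (-1) / 2 ^ (N + 2) * (1 / (1 + \<bar>x\<bar>) ^ (N + 2)) \<le> 1 / real (Suc ?j) ^ (N + 2) * bump (x / real (Suc ?j))"
        by (simp only: power_mult_distrib) (simp add: field_simps)
    qed
    show "(\<Sum>x\<in>F. w x * bump (x / real (Suc j))) \<le> Cb * real (Suc j) ^ N" if "finite F" "F \<subseteq> S" for j F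
      by (rule ub) (use that in auto)
    have "summable (\<lambda>j. inverse (real (Suc j) ^ 2))"
      using inverse_power_summable[of 2, where 'a = real] summable_Suc_iff[of "\<lambda>n. inverse (real n ^ 2)"] by simp
    then have "summable (\<lambda>j. Cb * (1 / real (Suc j) ^ 2))"
      unfolding inverse_eq_divide by (rule summable_mult)
    then show "summable (\<lambda>j. 1 / real (Suc j) ^ (N + 2) * (Cb * real (Suc j) ^ N))"
      by (rule back_subst[of summable]) (auto simp: power_add power2_eq_square field_simps simp del: of_nat_Suc)
  qed (use w bump_nonneg in auto)
  then show ?thesis by blast
qed


text \<open>Every derivative of \<open>1 - bump (x / R)\<close> is \<open>O((1 + |x|) / R)\<close>; one power of \<open>|x|\<close> is what a Schwartz
  function can absorb, and then the cutoffs of it converge to it in every seminorm.\<close>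

lemma bump_deviation:
  assumes X: "derivative_sequence X" "X 0 = (\<lambda>x. of_real (bump x))"
  shows "\<exists>B>0. \<forall>R\<ge>1. \<forall>x. norm ((if n = 0 then 1 else 0) - cutoff_seq X R n x) \<le> B * (1 + \<bar>x\<bar>) / R"
proof -
  have X0: "X 0 x = 0" if "\<bar>x\<bar> > 2" for x using that by (simp add: X bump_outside)
  have "\<exists>M>0. \<forall>x. \<bar>x\<bar> ^ 0 * norm (X n x) \<le> M" for n
    by (rule compact_support_bounds[OF X(1) X0])
  then obtain M where M: "\<And>n x. norm (X n x) \<le> M n" "\<And>n. M n > 0"
    by simp metis
  show ?thesis
  proof (cases "n = 0")
    case True
    have lip: "norm (X 0 x - X 0 y) \<le> M 1 * norm (x - y)" for x y
    proof (rule differentiable_bound)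
      fix x :: real
      show "(X 0 has_derivative (\<lambda>h. h *\<^sub>R X 1 x)) (at x within UNIV)"
        using X(1) unfolding derivative_sequence_def has_vector_derivative_def by simp
      show "onorm (\<lambda>h. h *\<^sub>R X 1 x) \<le> M 1"
        by (rule onorm_le) (use M(1)[of 1 x] in \<open>simp add: mult.commute mult_left_mono\<close>)
    qed auto
    have "norm (1 - cutoff_seq X R 0 x) \<le> M 1 * (1 + \<bar>x\<bar>) / R" if "R \<ge> 1" for R x
    proof -
      have "norm (1 - cutoff_seq X R 0 x) = norm (X 0 0 - X 0 (x / R))"
        using X by (simp add: cutoff_seq_def)
      also have "\<dots> \<le> M 1 * norm (0 - x / R)" by (rule lip)
      also have "\<dots> \<le> M 1 * ((1 + \<bar>x\<bar>) / R)"
        using that M(2)[of 1] by (intro mult_left_mono) (auto simp: field_simps)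
      finally show ?thesis by simp
    qed
    then show ?thesis using True M(2)[of 1] by (intro exI[of _ "M 1"]) auto
  next
    case False
    have "norm (cutoff_seq X R n x) \<le> M n * (1 + \<bar>x\<bar>) / R" if R: "R \<ge> 1" for R x
    proof -
      have "(1 / R) ^ n \<le> (1 / R) ^ 1" using False R by (intro power_decreasing) auto
      then have "(1 / R) ^ n * norm (X n (x / R)) \<le> 1 / R * M n"
        using R by (intro mult_mono M) auto
      also have "\<dots> \<le> M n * (1 + \<bar>x\<bar>) / R"
        using R M(2)[of n] by (simp add: field_simps)
      finally show ?thesis using R by (simp add: cutoff_seq_def norm_mult norm_power norm_divide)
    qed
    then show ?thesis using False M(2)[of n] by (intro exI[of _ "M n"]) auto
  qed
qed

text \<open>A distribution is compared with a measure on test functions only; this extends the identity to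
  Schwartz functions, by cutting off at scale \<open>R\<close>, using continuity on the side of the distribution
  and dominated convergence on the side of the measure.\<close>

lemma temperate_pairing:
  assumes u: "temperate_distribution u" and pm: "is_point_measure u S (\<lambda>x. of_real (w x))"
    and w: "\<And>x. x \<in> S \<Longrightarrow> w x \<ge> 0"
    and D: "derivative_sequence D" and sD: "schwartz (D 0)"
  shows "(\<lambda>x. w x * norm (D 0 x)) summable_on S"
    and "u (D 0) = (\<Sum>\<^sub>\<infinity>x\<in>S. of_real (w x) * D 0 x)"
proof -
  obtain X where X: "derivative_sequence X" "X 0 = (\<lambda>x. of_real (bump x))"
    by (rule bump_derivatives)
  have "\<forall>k n. \<exists>M>0. \<forall>x. \<bar>x\<bar> ^ k * norm (D n x) \<le> M"
    using schwartz_bounds[OF sD D] by metis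
  then obtain M where M: "\<And>k n x. \<bar>x\<bar> ^ k * norm (D n x) \<le> M k n" "\<And>k n. M k n > 0"
    by metis
  show summ: "(\<lambda>x. w x * norm (D 0 x)) summable_on S"
  proof -
    obtain N where N: "(\<lambda>x. w x * (1 / (1 + \<bar>x\<bar>) ^ N)) summable_on S"
      using temperate_weight_summable[OF u pm w] by blast
    let ?B = "2 ^ N * (M 0 0 + M N 0)"
    have le: "norm (D 0 x) \<le> ?B * (1 / (1 + \<bar>x\<bar>) ^ N)" for x
    proof -
      have "(1 + \<bar>x\<bar>) ^ N \<le> (2 * max 1 \<bar>x\<bar>) ^ N" by (intro power_mono) auto
      also have "\<dots> \<le> 2 ^ N * (1 + \<bar>x\<bar> ^ N)" by (simp add: power_mult_distrib max_def)
      finally have "(1 + \<bar>x\<bar>) ^ N * norm (D 0 x) \<le> 2 ^ N * (1 + \<bar>x\<bar> ^ N) * norm (D 0 x)"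
        by (intro mult_right_mono) auto
      also have "\<dots> = 2 ^ N * (\<bar>x\<bar> ^ 0 * norm (D 0 x) + \<bar>x\<bar> ^ N * norm (D 0 x))"
        by (simp add: algebra_simps)
      also have "\<dots> \<le> ?B" by (intro mult_left_mono add_mono M) auto
      finally show ?thesis by (simp add: field_simps)
    qed
    from N have "(\<lambda>x. w x * (1 / (1 + \<bar>x\<bar>) ^ N) * ?B) summable_on S"
      by (rule summable_on_cmult_left)
    then show ?thesis
    proof (rule summable_on_comparison_test)
      fix x assume "x \<in> S"
      then have "w x * norm (D 0 x) \<le> w x * (?B * (1 / (1 + \<bar>x\<bar>) ^ N))"
        by (intro mult_left_mono le w)
      then show "w x * norm (D 0 x) \<le> w x * (1 / (1 + \<bar>x\<bar>) ^ N) * ?B" by (simp add: mult_ac)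
    qed (use w in auto)
  qed
  obtain C N where CN: "\<And>\<phi>. schwartz \<phi> \<Longrightarrow> norm (u \<phi>) \<le> C * (\<Sum>k\<le>N. \<Sum>n\<le>N. schwartz_seminorm k n \<phi>)"
    using u unfolding temperate_distribution_def by metis
  have "\<forall>n. \<exists>B>0. \<forall>R\<ge>1. \<forall>x. norm ((if n = 0 then 1 else 0) - cutoff_seq X R n x) \<le> B * (1 + \<bar>x\<bar>) / R"
    using bump_deviation[OF X] by blast
  then obtain B where B: "\<And>R n x. R \<ge> 1 \<Longrightarrow> norm ((if n = 0 then 1 else 0) - cutoff_seq X R n x) \<le> B n * (1 + \<bar>x\<bar>) / R"
    "\<And>n. B n > 0" by metis
  define G where "G R = leibniz_product D (cutoff_seq X R)" for R
  define Y where "Y R n x = (if n = 0 then 1 else 0) - cutoff_seq X R n x" for R n x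
  have dG: "derivative_sequence (G R)" for R
    unfolding G_def by (intro derivative_sequence_mult D derivative_sequence_cutoff X)
  have outG: "G R 0 x = 0" if "R > 0" "\<bar>x\<bar> > 2 * R" for R x
    using cutoff_outside[of X R x] X that by (simp add: G_def)
  have dY: "derivative_sequence (Y R)" for R
    unfolding derivative_sequence_def
  proof (intro allI)
    fix n x
    have "((\<lambda>x. (if n = 0 then 1 else 0) - cutoff_seq X R n x) has_vector_derivative (0 - cutoff_seq X R (Suc n) x)) (at x)"
      using derivative_sequence_cutoff[OF X(1)]
      by (intro has_vector_derivative_diff has_vector_derivative_const) (auto simp: derivative_sequence_def)
    then show "(Y R n has_vector_derivative Y R (Suc n) x) (at x)"
      by (simp add: Y_def[abs_def])
  qed
  define Z where "Z R = leibniz_product D (Y R)" for R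
  have dZ: "derivative_sequence (Z R)" for R
    unfolding Z_def by (intro derivative_sequence_mult D dY)
  define K where "K k n = (\<Sum>i\<le>n. real (n choose i) * (B (n - i) * (M k i + M (Suc k) i)))" for k n
  have Zb: "\<bar>x\<bar> ^ k * norm (Z R n x) \<le> K k n / R" if R: "R \<ge> 1" for R k n x
  proof -
    have "\<bar>x\<bar> ^ k * norm (Z R n x) \<le> \<bar>x\<bar> ^ k * (\<Sum>i\<le>n. real (n choose i) * (norm (D i x) * norm (Y R (n - i) x)))"
      unfolding Z_def leibniz_product_def
      by (intro mult_left_mono order_trans[OF norm_sum]) (auto simp: norm_mult)
    also have "\<dots> = (\<Sum>i\<le>n. real (n choose i) * (norm (Y R (n - i) x) * (\<bar>x\<bar> ^ k * norm (D i x))))"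
      by (simp add: sum_distrib_left mult_ac)
    also have "\<dots> \<le> (\<Sum>i\<le>n. real (n choose i) * (B (n - i) * (1 + \<bar>x\<bar>) / R * (\<bar>x\<bar> ^ k * norm (D i x))))"
      unfolding Y_def by (intro sum_mono mult_left_mono mult_right_mono B R) auto
    also have "\<dots> = (\<Sum>i\<le>n. real (n choose i) * (B (n - i) * (\<bar>x\<bar> ^ k * norm (D i x) + \<bar>x\<bar> ^ Suc k * norm (D i x)))) / R"
      by (simp add: sum_divide_distrib algebra_simps add_divide_distrib)
    also have "\<dots> \<le> K k n / R"
      unfolding K_def using R B(2)
      by (intro divide_right_mono sum_mono mult_left_mono add_mono M) (auto intro: less_imp_le)
    finally show ?thesis .
  qed
  have sZ: "schwartz (Z R 0)" if "R \<ge> 1" for R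
    by (rule schwartzI[OF dZ]) (use Zb[OF that] in auto)
  define KK where "KK = \<bar>C\<bar> * (\<Sum>k\<le>N. \<Sum>n\<le>N. K k n)"
  have uZ: "norm (u (Z R 0)) \<le> KK / R" if R: "R \<ge> 1" for R
  proof -
    have nn: "0 \<le> schwartz_seminorm k n (Z R 0)" for k n
    proof -
      have "bdd_above (range (\<lambda>x. \<bar>x\<bar> ^ k * norm (nth_deriv n (Z R 0) x)))"
        using sZ[OF R] unfolding schwartz_def by (auto intro!: bounded_imp_bdd_above)
      then show ?thesis unfolding schwartz_seminorm_def
        by (rule cSUP_upper2[of _ _ 0]) auto
    qed
    have "norm (u (Z R 0)) \<le> C * (\<Sum>k\<le>N. \<Sum>n\<le>N. schwartz_seminorm k n (Z R 0))"
      by (rule CN[OF sZ[OF R]])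
    also have "\<dots> \<le> \<bar>C\<bar> * (\<Sum>k\<le>N. \<Sum>n\<le>N. K k n / R)"
      by (intro mult_mono sum_mono schwartz_seminorm_le[OF dZ] Zb R sum_nonneg nn) auto
    also have "\<dots> = KK / R"
      unfolding KK_def by (simp only: sum_divide_distrib times_divide_eq_right[symmetric])
    finally show ?thesis .
  qed
  define RR where "RR j = real (Suc j)" for j
  have RR: "RR j \<ge> 1" for j by (simp add: RR_def)
  have uG: "u (G R 0) = u (D 0) - u (Z R 0)" if R: "R \<ge> 1" for R
  proof -
    have sG: "schwartz (G R 0)"
      by (rule schwartz_compact_support[OF dG outG]) (use R in auto)
    have "u (\<lambda>x. G R 0 x + Z R 0 x) = u (G R 0) + u (Z R 0)"
      using u sG sZ[OF R] unfolding temperate_distribution_def by blast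
    moreover have "(\<lambda>x. G R 0 x + Z R 0 x) = D 0"
      by (auto simp: G_def Z_def Y_def algebra_simps)
    ultimately show ?thesis by simp
  qed
  have "(\<lambda>j. KK / RR j) \<longlonglongrightarrow> 0"
    unfolding RR_def using LIMSEQ_inverse_real_of_nat[THEN tendsto_mult_right, of KK]
    by (simp add: field_simps)
  then have "(\<lambda>j. u (Z (RR j) 0)) \<longlonglongrightarrow> 0"
    by (rule Lim_null_comparison[rotated]) (use uZ RR in auto)
  then have "(\<lambda>j. u (D 0) - u (Z (RR j) 0)) \<longlonglongrightarrow> u (D 0) - 0"
    by (intro tendsto_intros)
  then have lim1: "(\<lambda>j. u (G (RR j) 0)) \<longlonglongrightarrow> u (D 0)"
    using uG RR by simp
  have "u (G R 0) = (\<Sum>\<^sub>\<infinity>x\<in>S. of_real (w x) * G R 0 x)" if "R > 0" for R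
  proof -
    have "test_fun (G R 0)" by (rule test_funI[OF dG outG[OF that]])
    then show ?thesis using pm by (simp add: is_point_measure_def)
  qed
  then have "u (G (RR j) 0) = (\<Sum>\<^sub>\<infinity>x\<in>S. of_real (w x) * G (RR j) 0 x)" for j
    using RR[of j] by auto
  moreover have "(\<lambda>j. \<Sum>\<^sub>\<infinity>x\<in>S. of_real (w x) * G (RR j) 0 x) \<longlonglongrightarrow> (\<Sum>\<^sub>\<infinity>x\<in>S. of_real (w x) * D 0 x)"
  proof (rule tendsto_infsum_dominated[OF summ])
    show "\<forall>\<^sub>F j in sequentially. \<forall>x\<in>S. norm (of_real (w x) * G (RR j) 0 x) \<le> w x * norm (D 0 x)"
    proof (intro always_eventually allI ballI)
      fix j x assume x: "x \<in> S"
      have "norm (G (RR j) 0 x) = norm (D 0 x) * bump (x / RR j)"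
        by (simp add: G_def cutoff_seq_0[of X, OF X(2)] norm_mult bump_nonneg)
      also have "\<dots> \<le> norm (D 0 x) * 1" by (intro mult_left_mono bump_le_1) auto
      finally show "norm (of_real (w x) * G (RR j) 0 x) \<le> w x * norm (D 0 x)"
        using w[OF x] by (simp add: norm_mult mult_left_mono)
    qed
    fix x
    have "(\<lambda>j. x / RR j) \<longlonglongrightarrow> 0"
      unfolding RR_def using LIMSEQ_inverse_real_of_nat[THEN tendsto_mult_right, of x]
      by (simp add: field_simps)
    moreover have "isCont (X 0) 0"
      using derivative_sequence_continuous[OF X(1), of UNIV 0] by (simp add: continuous_on_eq_continuous_at)
    ultimately have "(\<lambda>j. X 0 (x / RR j)) \<longlonglongrightarrow> X 0 0"
      by (rule isCont_tendsto_compose[rotated])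
    then have "(\<lambda>j. of_real (w x) * (D 0 x * X 0 (x / RR j))) \<longlonglongrightarrow> of_real (w x) * (D 0 x * X 0 0)"
      by (intro tendsto_intros)
    then show "(\<lambda>j. of_real (w x) * G (RR j) 0 x) \<longlonglongrightarrow> of_real (w x) * D 0 x"
      by (simp add: G_def cutoff_seq_def X)
  qed
  ultimately have "(\<lambda>j. u (G (RR j) 0)) \<longlonglongrightarrow> (\<Sum>\<^sub>\<infinity>x\<in>S. of_real (w x) * D 0 x)" by simp
  with lim1 show "u (D 0) = (\<Sum>\<^sub>\<infinity>x\<in>S. of_real (w x) * D 0 x)"
    by (rule LIMSEQ_unique)
qed

section \<open>The summation formula\<close>

text \<open>The Fourier transform of a function supported in \<open>[-R, R]\<close>, as an entire function of a complex
  exponent. Complex exponents allow factors \<open>e\<^bsup>2 \<pi> i t z\<^esup>\<close> with \<open>z\<close> in the upper half plane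
  to be absorbed by a shift of the argument.\<close>

definition laplace :: "real \<Rightarrow> (real \<Rightarrow> complex) \<Rightarrow> complex \<Rightarrow> complex" where
  "laplace R \<phi> c = integral {-R..R} (\<lambda>x. \<phi> x * exp (c * of_real x))"

lemma laplace_integrable:
  assumes "continuous_on UNIV \<phi>"
  shows "(\<lambda>x. \<phi> x * exp (c * complex_of_real x)) integrable_on {l..r}"
  by (intro integrable_continuous_interval continuous_intros continuous_on_subset[OF assms]) simp

lemma closure_abs_greater: 
  fixes x :: real assumes x: "R \<le> \<bar>x\<bar>" shows "x \<in> closure {x. R < \<bar>x\<bar>}"
proof -
  have "\<exists>y. R < \<bar>y\<bar> \<and> dist y x < e" if e: "e > 0" for e
  proof (intro exI[of _ "x + (if x \<ge> 0 then e/2 else -e/2)"] conjI)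
    show "R < \<bar>x + (if x \<ge> 0 then e/2 else -e/2)\<bar>" using e x by (cases "x \<ge> 0") simp_all
    show "dist (x + (if x \<ge> 0 then e/2 else -e/2)) x < e" using e by (simp add: dist_real_def)
  qed
  then show ?thesis by (simp add: closure_approachable)
qed
lemma vanishes_outside:
  assumes D: "derivative_sequence D" and z: "\<And>x. \<bar>x\<bar> \<ge> R \<Longrightarrow> D 0 x = 0" and x: "\<bar>x\<bar> \<ge> R"
  shows "D n x = 0"
proof -
  have out: "D n y = 0" if y: "y \<in> {x. R < \<bar>x\<bar>}" for y
    using D open_abs_greater[of R] _ y
  proof (rule derivative_sequence_vanishes)
    show "D 0 u = 0" if "u \<in> {x. R < \<bar>x\<bar>}" for u using that z[of u] by simp
  qed
  show "D n x = 0"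
    by (rule continuous_constant_on_closure[OF derivative_sequence_continuous[OF D] out closure_abs_greater[OF x]])
qed

lemma laplace_by_parts:
  assumes D: "derivative_sequence D" and R: "R \<ge> 0" and z: "\<And>x. \<bar>x\<bar> \<ge> R \<Longrightarrow> D 0 x = 0"
  shows "c * laplace R (D n) c = - laplace R (D (Suc n)) c"
proof -
  have v: "D n x = 0" if "\<bar>x\<bar> \<ge> R" for n x using vanishes_outside[OF D z that] .
  have "((\<lambda>x. D (Suc n) x * exp (c * of_real x) + c * (D n x * exp (c * of_real x))) has_integral
      (D n R * exp (c * of_real R) - D n (-R) * exp (c * of_real (-R)))) {-R..R}"
  proof (rule fundamental_theorem_of_calculus)
    fix x assume "x \<in> {-R..R}"
    have "((\<lambda>t. exp (c * of_real t)) has_vector_derivative c * exp (c * of_real x)) (at x)"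
      using derivative_sequence_exp[of c, unfolded derivative_sequence_def, rule_format, of 0 x] by simp
    moreover have "(D n has_vector_derivative D (Suc n) x) (at x)" using D by (simp add: derivative_sequence_def)
    ultimately have "((\<lambda>x. D n x * exp (c * of_real x)) has_vector_derivative
        (D n x * (c * exp (c * of_real x)) + D (Suc n) x * exp (c * of_real x))) (at x)"
      by (rule has_vector_derivative_mult[rotated])
    moreover have "D n x * (c * exp (c * of_real x)) + D (Suc n) x * exp (c * of_real x)
        = D (Suc n) x * exp (c * of_real x) + c * (D n x * exp (c * of_real x))"
      by (simp only: mult.left_commute add.commute)
    ultimately show "((\<lambda>x. D n x * exp (c * of_real x)) has_vector_derivative
        D (Suc n) x * exp (c * of_real x) + c * (D n x * exp (c * of_real x))) (at x within {-R..R})"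
      by (simp only: has_vector_derivative_at_within)
  qed (use R in auto)
  then have 1: "((\<lambda>x. D (Suc n) x * exp (c * of_real x) + c * (D n x * exp (c * of_real x))) has_integral 0) {-R..R}"
    using v[of R n] v[of "-R" n] R by simp
  have i: "(\<lambda>x. D n x * exp (c * of_real x)) integrable_on {-R..R}" for n
    by (rule laplace_integrable[OF derivative_sequence_continuous[OF D]])
  have "((\<lambda>x. D (Suc n) x * exp (c * of_real x) + c * (D n x * exp (c * of_real x))) has_integral
      laplace R (D (Suc n)) c + c * laplace R (D n) c) {-R..R}"
    unfolding laplace_def by (intro has_integral_add has_integral_mult_right integrable_integral i)
  from has_integral_unique[OF this 1] show ?thesis
    by (simp only: add_eq_0_iff)
qed

lemma laplace_by_parts_iter:
  assumes D: "derivative_sequence D" and R: "R \<ge> 0" and z: "\<And>x. \<bar>x\<bar> \<ge> R \<Longrightarrow> D 0 x = 0"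
  shows "laplace R (D n) c = (- c) ^ n * laplace R (D 0) c"
proof (induction n)
  case (Suc n)
  have "laplace R (D (Suc n)) c = - (c * laplace R (D n) c)"
    using laplace_by_parts[OF D R z, of c n] by simp
  then show ?case by (simp add: Suc)
qed simp

lemma fourier_fun_eq_laplace:
  assumes c: "continuous_on UNIV \<phi>" and z: "\<And>x. \<bar>x\<bar> > R \<Longrightarrow> \<phi> x = 0"
  shows "fourier_fun \<phi> t = laplace R \<phi> (- 2 * pi * \<i> * of_real t)"
proof -
  let ?f = "\<lambda>x. \<phi> x * exp ((- 2 * pi * \<i> * of_real t) * of_real x)"
  have "continuous_on {-R..R} ?f"
    by (intro continuous_intros continuous_on_subset[OF c]) auto
  then have i: "set_integrable lborel {-R..R} ?f"
    by (rule borel_integrable_atLeastAtMost')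
  have "fourier_fun \<phi> t = set_lebesgue_integral lborel {-R..R} ?f"
    unfolding fourier_fun_def set_lebesgue_integral_def
  proof (intro Bochner_Integration.integral_cong refl)
    fix x :: real
    show "\<phi> x * exp (complex_of_real (- 2 * pi) * \<i> * of_real x * of_real t) = indicat_real {-R..R} x *\<^sub>R ?f x"
      using z[of x] by (cases "\<bar>x\<bar> > R") (auto simp: indicator_def mult_ac)
  qed
  also have "\<dots> = laplace R \<phi> (- 2 * pi * \<i> * of_real t)"
    unfolding laplace_def by (rule set_borel_integral_eq_integral(2)[OF i])
  finally show ?thesis .
qed

lemma laplace_imaginary_bound:
  assumes c: "continuous_on UNIV \<phi>"
  shows "\<exists>B. \<forall>t. norm (laplace R \<phi> (\<i> * of_real t)) \<le> B"
proof (cases "R \<ge> 0")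
  case True
  have "bounded (\<phi> ` {-R..R})"
    by (intro compact_imp_bounded compact_continuous_image continuous_on_subset[OF c]) auto
  then obtain B where B: "B > 0" "\<And>x. x \<in> {-R..R} \<Longrightarrow> norm (\<phi> x) \<le> B"
    unfolding bounded_pos by auto
  have "norm (laplace R \<phi> (\<i> * of_real t)) \<le> B * (R - - R)" for t
    unfolding laplace_def
  proof (rule integral_bound)
    show "continuous_on {-R..R} (\<lambda>x. \<phi> x * exp (\<i> * complex_of_real t * complex_of_real x))"
      by (intro continuous_intros continuous_on_subset[OF c]) auto
    show "\<And>x. x \<in> {- R..R} \<Longrightarrow> norm (\<phi> x * exp (\<i> * complex_of_real t * complex_of_real x)) \<le> B"
      using B by (simp add: norm_mult)
  qed (use True in auto)
  then show ?thesis by blast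
next
  case False
  then show ?thesis by (auto simp: laplace_def)
qed

fun moment_seq :: "(nat \<Rightarrow> real \<Rightarrow> complex) \<Rightarrow> nat \<Rightarrow> nat \<Rightarrow> real \<Rightarrow> complex" where
  "moment_seq D 0 = D"
| "moment_seq D (Suc m) = leibniz_product
     (\<lambda>n t. if n = 0 then (- 2 * pi * \<i>) * of_real t else if n = 1 then (- 2 * pi * \<i>) else 0) (moment_seq D m)"

lemma derivative_sequence_moment: "derivative_sequence D \<Longrightarrow> derivative_sequence (moment_seq D m)"
  by (induction m) (simp_all add: derivative_sequence_mult derivative_sequence_linear del: of_real_mult)

lemma moment_seq_0: "moment_seq D (Suc m) 0 x = (- 2 * pi * \<i>) * of_real x * moment_seq D m 0 x"
  by simp

lemma derivative_sequence_laplace_moments: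
  assumes D: "derivative_sequence D"
  shows "derivative_sequence (\<lambda>m t. laplace R (moment_seq D m 0) (- 2 * pi * \<i> * of_real t))"
  unfolding derivative_sequence_def
proof (intro allI)
  fix m t
  let ?e = "\<lambda>(t::real) (x::real). exp ((- 2 * pi * \<i> * of_real t) * of_real x)"
  have cont: "continuous_on UNIV (moment_seq D m 0)" for m
    by (rule derivative_sequence_continuous[OF derivative_sequence_moment[OF D]])
  have "((\<lambda>t. integral (cbox (-R) R) (\<lambda>x. moment_seq D m 0 x * ?e t x)) has_vector_derivative
     integral (cbox (-R) R) (\<lambda>x. moment_seq D (Suc m) 0 x * ?e t x)) (at t within UNIV)"
  proof (rule leibniz_rule_vector_derivative)
    fix t x :: real
    have "((\<lambda>z. exp ((- 2 * pi * \<i> * z) * of_real x)) has_field_derivative ((- 2 * pi * \<i> * of_real x) * ?e t x)) (at (of_real t))"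
      by (auto intro!: derivative_eq_intros)
    then have "((\<lambda>t. ?e t x) has_vector_derivative ((- 2 * pi * \<i> * of_real x) * ?e t x)) (at t)"
      by (rule has_vector_derivative_real_field)
    from has_vector_derivative_mult_right[OF this, of "moment_seq D m 0 x"]
    show "((\<lambda>t. moment_seq D m 0 x * ?e t x) has_vector_derivative moment_seq D (Suc m) 0 x * ?e t x) (at t within UNIV)"
      unfolding moment_seq_0 by (simp add: mult_ac)
  next
    fix t show "(\<lambda>x. moment_seq D m 0 x * ?e t x) integrable_on cbox (- R) R"
      unfolding box_real by (rule laplace_integrable[OF cont])
  next
    have "continuous_on (UNIV \<times> cbox (-R) R) (\<lambda>p. moment_seq D (Suc m) 0 (snd p) * ?e (fst p) (snd p))"
      by (intro continuous_intros continuous_on_compose2[OF cont[of "Suc m"] continuous_on_snd]) auto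
    then show "continuous_on (UNIV \<times> cbox (- R) R) (\<lambda>(t, x). moment_seq D (Suc m) 0 x * ?e t x)"
      by (simp add: case_prod_beta)
  qed auto
  then show "((\<lambda>t. laplace R (moment_seq D m 0) (- 2 * pi * \<i> * of_real t)) has_vector_derivative
      laplace R (moment_seq D (Suc m) 0) (- 2 * pi * \<i> * of_real t)) (at t)"
    by (simp add: laplace_def box_real)
qed

text \<open>Derivatives of the transform come from moments, and decay from integration by parts. The transform
  need not have compact support, so that it is paired with a measure through \<open>temperate_pairing\<close>.\<close>

lemma fourier_test_fun:
  assumes "test_fun \<phi>"
  obtains F where "derivative_sequence F" "F 0 = fourier_fun \<phi>" "schwartz (F 0)"
proof -
  obtain D R0 where D: "derivative_sequence D" "D 0 = \<phi>" and R0: "R0 > 0" "\<And>x n. \<bar>x\<bar> > R0 \<Longrightarrow> D n x = 0"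
    using test_funE[OF assms] by metis
  define R where "R = R0 + 1"
  have R: "R \<ge> 0" and z: "\<And>x. \<bar>x\<bar> \<ge> R \<Longrightarrow> D 0 x = 0" using R0 by (auto simp: R_def)
  have zm: "moment_seq D m 0 x = 0" if "\<bar>x\<bar> \<ge> R" for m x
    using z[OF that] by (induction m) simp_all
  let ?F = "\<lambda>m t. laplace R (moment_seq D m 0) (- 2 * pi * \<i> * of_real t)"
  have F: "derivative_sequence ?F" by (rule derivative_sequence_laplace_moments[OF D(1)])
  have F0: "?F 0 = fourier_fun \<phi>"
  proof
    fix t
    have "fourier_fun (D 0) t = laplace R (D 0) (- 2 * pi * \<i> * of_real t)"
      by (rule fourier_fun_eq_laplace[OF derivative_sequence_continuous[OF D(1)]]) (use z in auto)
    then show "?F 0 t = fourier_fun \<phi> t" using D(2) by simp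
  qed
  have "schwartz (?F 0)"
  proof (rule schwartzI[OF F])
    fix k m
    have dm: "derivative_sequence (moment_seq D m)" by (rule derivative_sequence_moment[OF D(1)])
    obtain B where B: "\<And>t. norm (laplace R (moment_seq D m k) (\<i> * of_real t)) \<le> B"
      using laplace_imaginary_bound[OF derivative_sequence_continuous[OF dm]] by metis
    have "\<bar>t\<bar> ^ k * norm (?F m t) \<le> B" for t
    proof -
      have "laplace R (moment_seq D m k) (- 2 * pi * \<i> * of_real t) = (- (- 2 * pi * \<i> * of_real t)) ^ k * ?F m t"
        by (rule laplace_by_parts_iter[OF dm R zm])
      then have "(2 * pi * \<bar>t\<bar>) ^ k * norm (?F m t) = norm (laplace R (moment_seq D m k) (\<i> * of_real (- 2 * pi * t)))"
        by (simp add: norm_mult norm_power mult_ac)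
      also have "\<dots> \<le> B" by (rule B)
      finally have *: "(2 * pi * \<bar>t\<bar>) ^ k * norm (?F m t) \<le> B" .
      have "\<bar>t\<bar> \<le> 2 * pi * \<bar>t\<bar>" using pi_ge_two by (simp add: mult_le_cancel_right1)
      then have "\<bar>t\<bar> ^ k * norm (?F m t) \<le> (2 * pi * \<bar>t\<bar>) ^ k * norm (?F m t)"
        by (intro mult_right_mono power_mono) auto
      with * show ?thesis by linarith
    qed
    then show "\<exists>C. \<forall>t. \<bar>t\<bar> ^ k * norm (?F m t) \<le> C" by blast
  qed
  then show ?thesis using that[of ?F] F F0 by simp
qed

text \<open>The hypothesis on \<open>\<mu>\<close> and its Fourier transform in the form in which it is used from here on.\<close>

lemma summation_formula:
  assumes u: "temperate_distribution u" and pm: "is_point_measure u S (\<lambda>x. of_real (w x))"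
    and w: "\<And>x. x \<in> S \<Longrightarrow> w x \<ge> 0"
    and pm': "is_point_measure (fourier_dist u) \<Gamma> b" and \<phi>: "test_fun \<phi>"
  shows "(\<lambda>x. w x * norm (fourier_fun \<phi> x)) summable_on S"
    and "(\<Sum>\<^sub>\<infinity>x\<in>S. of_real (w x) * fourier_fun \<phi> x) = (\<Sum>\<^sub>\<infinity>\<gamma>\<in>\<Gamma>. b \<gamma> * \<phi> \<gamma>)"
proof -
  obtain F where F: "derivative_sequence F" "F 0 = fourier_fun \<phi>" "schwartz (F 0)"
    by (rule fourier_test_fun[OF \<phi>])
  note tp = temperate_pairing[OF u pm w F(1,3), unfolded F(2)]
  show "(\<lambda>x. w x * norm (fourier_fun \<phi> x)) summable_on S" by (rule tp(1))
  have "u (fourier_fun \<phi>) = (\<Sum>\<^sub>\<infinity>\<gamma>\<in>\<Gamma>. b \<gamma> * \<phi> \<gamma>)"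
    using pm' \<phi> by (simp add: is_point_measure_def fourier_dist_def)
  with tp(2) show "(\<Sum>\<^sub>\<infinity>x\<in>S. of_real (w x) * fourier_fun \<phi> x) = (\<Sum>\<^sub>\<infinity>\<gamma>\<in>\<Gamma>. b \<gamma> * \<phi> \<gamma>)"
    by simp
qed

lemma laplace_window:
  assumes c: "continuous_on UNIV \<phi>" and z: "\<And>x. \<bar>x\<bar> \<ge> R \<Longrightarrow> \<phi> x = 0" and "l \<le> -R" "R \<le> r"
  shows "integral {l..r} (\<lambda>x. \<phi> x * exp (c * of_real x)) = laplace R \<phi> c"
proof (rule integral_unique, rule has_integral_on_superset)
  show "((\<lambda>x. \<phi> x * exp (c * of_real x)) has_integral laplace R \<phi> c) {-R..R}"
    unfolding laplace_def by (intro integrable_integral laplace_integrable assms)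
  show "\<phi> x * exp (c * of_real x) = 0" if "x \<notin> {-R..R}" for x
    using that z[of x] by auto
qed (use assms in auto)

section \<open>The zeros have square summable inverses\<close>

text \<open>With \<open>X\<close> a derivative sequence of the bump, this is the convolution of the bump with its reflection,
  so that its Fourier transform is a squared modulus.\<close>

definition autocorrelation :: "(nat \<Rightarrow> real \<Rightarrow> complex) \<Rightarrow> nat \<Rightarrow> real \<Rightarrow> complex" where
  "autocorrelation X n t = integral {-2..2} (\<lambda>s. X n (s + t) * X 0 s)"

lemma derivative_sequence_autocorrelation:
  assumes X: "derivative_sequence X"
  shows "derivative_sequence (autocorrelation X)"
  unfolding derivative_sequence_def
proof (intro allI)
  fix n t
  have cont: "continuous_on A (X m)" for A m by (rule derivative_sequence_continuous[OF X])
  have "((\<lambda>t. integral (cbox (-2) 2) (\<lambda>s. X n (s + t) * X 0 s)) has_vector_derivative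
     integral (cbox (-2) 2) (\<lambda>s. X (Suc n) (s + t) * X 0 s)) (at t within UNIV)"
  proof (rule leibniz_rule_vector_derivative)
    fix t s :: real
    have "((\<lambda>t. X n (s + t)) has_vector_derivative X (Suc n) (s + t)) (at t)"
      using derivative_sequence_affine[OF X, of 1 s, unfolded derivative_sequence_def, rule_format, of n t]
      by (simp add: add.commute)
    then show "((\<lambda>t. X n (s + t) * X 0 s) has_vector_derivative X (Suc n) (s + t) * X 0 s) (at t within UNIV)"
      by (intro has_vector_derivative_mult_left) simp
  next
    fix t show "(\<lambda>s. X n (s + t) * X 0 s) integrable_on cbox (- 2) 2"
      unfolding box_real
      by (intro integrable_continuous_interval continuous_intros cont continuous_on_compose2[OF cont[of UNIV n]]) auto
  next
    have "continuous_on (UNIV \<times> cbox (-2) 2) (\<lambda>p. X (Suc n) (snd p + fst p) * X 0 (snd p))"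
      by (intro continuous_intros continuous_on_compose2[OF cont[of UNIV "Suc n"]] continuous_on_compose2[OF cont[of UNIV 0]]) auto
    then show "continuous_on (UNIV \<times> cbox (- 2) 2) (\<lambda>(t, s). X (Suc n) (s + t) * X 0 s)"
      by (simp add: case_prod_beta)
  qed auto
  then show "(autocorrelation X n has_vector_derivative autocorrelation X (Suc n) t) (at t)"
    by (simp add: autocorrelation_def[abs_def] box_real)
qed

lemma laplace_autocorrelation:
  assumes X: "derivative_sequence X" and z: "\<And>x. \<bar>x\<bar> \<ge> 2 \<Longrightarrow> X 0 x = 0"
  shows "laplace 4 (autocorrelation X 0) c = laplace 2 (X 0) c * laplace 2 (X 0) (- c)"
proof -
  have cont: "continuous_on A (X m)" for A m by (rule derivative_sequence_continuous[OF X])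
  have "laplace 4 (autocorrelation X 0) c
      = integral {-4..4} (\<lambda>t. integral {-2..2} (\<lambda>s. X 0 (s + t) * X 0 s * exp (c * of_real t)))"
    by (simp add: laplace_def autocorrelation_def)
  also have "\<dots> = integral {-2..2} (\<lambda>s. integral {-4..4} (\<lambda>t. X 0 (s + t) * X 0 s * exp (c * of_real t)))"
  proof (rule integral_swap_continuous[of "-4::real" "-2::real" 4 2, unfolded box_real])
    have "continuous_on (cbox (-4::real, -2::real) (4, 2)) (\<lambda>p. X 0 (snd p + fst p) * X 0 (snd p) * exp (c * of_real (fst p)))"
      by (intro continuous_intros continuous_on_compose2[OF cont[of UNIV 0]]) auto
    then show "continuous_on (cbox (-4::real, -2::real) (4, 2)) (\<lambda>(t, s). X 0 (s + t) * X 0 s * exp (c * of_real t))"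
      by (simp add: case_prod_beta)
  qed
  also have "\<dots> = integral {-2..2} (\<lambda>s. laplace 2 (X 0) c * (X 0 s * exp (- c * of_real s)))"
  proof (rule integral_cong)
    fix s :: real assume s: "s \<in> {-2..2}"
    have "integral {-4..4} (\<lambda>t. X 0 (s + t) * X 0 s * exp (c * of_real t))
        = integral {-4..4} (\<lambda>t. (X 0 s * exp (- c * of_real s)) * ((\<lambda>u. X 0 u * exp (c * of_real u)) \<circ> (\<lambda>x. x + s)) t)"
      by (intro integral_cong) (simp add: o_def exp_add[symmetric] algebra_simps exp_minus_inverse flip: exp_add)
    also have "\<dots> = (X 0 s * exp (- c * of_real s)) * integral {-4..4} ((\<lambda>u. X 0 u * exp (c * of_real u)) \<circ> (\<lambda>x. x + s))"
      by (rule integral_mult_right)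
    also have "integral {-4..4} ((\<lambda>u. X 0 u * exp (c * of_real u)) \<circ> (\<lambda>x. x + s)) = integral {-4+s..4+s} (\<lambda>u. X 0 u * exp (c * of_real u))"
      by (rule integral_shift) (intro continuous_intros cont)
    also have "\<dots> = laplace 2 (X 0) c"
      by (rule laplace_window[OF cont z]) (use s in auto)
    finally show "integral {-4..4} (\<lambda>t. X 0 (s + t) * X 0 s * exp (c * of_real t)) = laplace 2 (X 0) c * (X 0 s * exp (- c * of_real s))"
      by (simp only: mult.commute)
  qed
  also have "\<dots> = laplace 2 (X 0) c * laplace 2 (X 0) (- c)"
    by (simp add: laplace_def)
  finally show ?thesis .
qed

lemma positive_definite_test_function:
  obtains \<eta> k r \<kappa> where "derivative_sequence \<eta>" "\<And>t. \<bar>t\<bar> \<ge> 4 \<Longrightarrow> \<eta> 0 t = 0"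
    "\<And>s x. fourier_fun (\<lambda>t. \<eta> 0 t * exp (2 * pi * \<i> * of_real s * of_real t)) x = of_real (k (x - s))"
    "\<And>t. k t \<ge> 0" "r > 0" "\<kappa> > 0" "\<And>t. \<bar>t\<bar> \<le> r \<Longrightarrow> k t \<ge> \<kappa>"
proof -
  obtain X where X: "derivative_sequence X" "X 0 = (\<lambda>x. of_real (bump x))"
    by (rule bump_derivatives)
  have cont: "continuous_on A (X m)" for A m by (rule derivative_sequence_continuous[OF X(1)])
  have X0: "X 0 x = 0" if "\<bar>x\<bar> \<ge> 2" for x using that by (simp add: X bump_outside)
  let ?\<eta> = "autocorrelation X"
  define L where "L t = laplace 2 (X 0) (- 2 * pi * \<i> * of_real t)" for t :: real
  define k where "k t = (norm (L t))\<^sup>2" for t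
  have d: "derivative_sequence ?\<eta>" by (rule derivative_sequence_autocorrelation[OF X(1)])
  have out: "?\<eta> 0 t = 0" if "\<bar>t\<bar> \<ge> 4" for t
  proof -
    have "?\<eta> 0 t = integral {-2..2} (\<lambda>s::real. 0)"
      unfolding autocorrelation_def by (intro integral_cong) (use that X0 in auto)
    then show ?thesis by simp
  qed
  have four: "fourier_fun (\<lambda>t. ?\<eta> 0 t * exp (2 * pi * \<i> * of_real s * of_real t)) x = of_real (k (x - s))" for s x
  proof -
    have "fourier_fun (\<lambda>t. ?\<eta> 0 t * exp (2 * pi * \<i> * of_real s * of_real t)) x
        = laplace 4 (\<lambda>t. ?\<eta> 0 t * exp (2 * pi * \<i> * of_real s * of_real t)) (- 2 * pi * \<i> * of_real x)"
      by (rule fourier_fun_eq_laplace)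
         (auto intro!: continuous_intros derivative_sequence_continuous[OF d] simp: out)
    also have "\<dots> = laplace 4 (?\<eta> 0) (- 2 * pi * \<i> * of_real (x - s))"
      unfolding laplace_def by (intro integral_cong) (simp add: mult.assoc exp_add[symmetric] algebra_simps)
    also have "\<dots> = L (x - s) * laplace 2 (X 0) (2 * pi * \<i> * of_real (x - s))"
      unfolding L_def by (subst laplace_autocorrelation[OF X(1) X0]) auto
    also have "laplace 2 (X 0) (2 * pi * \<i> * of_real (x - s)) = cnj (L (x - s))"
      unfolding L_def laplace_def integral_cnj by (intro integral_cong) (simp add: X exp_cnj)
    also have "L (x - s) * cnj (L (x - s)) = of_real (k (x - s))"
      unfolding k_def by (rule complex_norm_square[symmetric])
    finally show ?thesis .
  qed
  have "continuous_on UNIV L"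
    unfolding L_def using derivative_sequence_continuous[OF derivative_sequence_laplace_moments[OF X(1), of 2], of UNIV 0] by simp
  then have Lc: "isCont L 0" by (simp add: continuous_on_eq_continuous_at)
  have "L 0 \<noteq> 0"
  proof -
    have bc: "continuous_on A bump" for A
    proof -
      have "continuous_on A (\<lambda>x. Re (X 0 x))" by (intro continuous_intros cont)
      then show ?thesis by (simp add: X)
    qed
    have ib: "bump integrable_on {l..u}" for l u by (intro integrable_continuous_interval bc)
    have "integral {-1..1} (\<lambda>x::real. exp (-1)) \<le> integral {-1..1} bump"
      by (intro integral_le ib bump_lower) auto
    also have "\<dots> \<le> integral {-2..2} bump"
      by (intro integral_subset_le ib) (auto simp: bump_nonneg)
    finally have "integral {-2..2} bump > 0" by (simp add: less_le_trans[rotated])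
    moreover have "L 0 = of_real (integral {-2..2} bump)"
      unfolding L_def laplace_def using integral_linear[OF ib bounded_linear_of_real, of "-2" 2, where ?'a1 = complex]
      by (simp add: X o_def)
    ultimately show ?thesis by simp
  qed
  moreover have "\<forall>\<^sub>F t in nhds 0. dist (L t) (L 0) < norm (L 0) / 2"
    using Lc \<open>L 0 \<noteq> 0\<close> unfolding isCont_def tendsto_at_iff_tendsto_nhds by (intro tendstoD) auto
  then obtain r where r: "r > 0" "\<And>t. dist t 0 < r \<Longrightarrow> dist (L t) (L 0) < norm (L 0) / 2"
    unfolding eventually_nhds_metric by blast
  have kge: "k t \<ge> (norm (L 0) / 2)\<^sup>2" if "\<bar>t\<bar> \<le> r / 2" for t
  proof -
    have "dist (L t) (L 0) < norm (L 0) / 2" by (rule r(2)) (use that r(1) in auto)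
    moreover have "norm (L 0) \<le> norm (L t) + dist (L t) (L 0)"
      using norm_triangle_sub[of "L 0" "L t"] by (simp add: dist_norm norm_minus_commute)
    ultimately show ?thesis unfolding k_def by (intro power_mono) auto
  qed
  show ?thesis
    by (rule that[of ?\<eta> k "r / 2" "(norm (L 0) / 2)\<^sup>2", OF d out four _ _ _ kge]) (use r \<open>L 0 \<noteq> 0\<close> in \<open>auto simp: k_def\<close>)
qed

lemma point_measure_summable_test:
  assumes pm: "point_measure S b" and c: "continuous_on UNIV \<theta>" and z: "\<And>x. \<bar>x\<bar> \<ge> R \<Longrightarrow> \<theta> x = 0"
  shows "(\<lambda>x. norm (b x * \<theta> x :: complex)) summable_on S"
proof -
  have "bounded (\<theta> ` {-R..R})"
    by (intro compact_imp_bounded compact_continuous_image continuous_on_subset[OF c]) auto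
  then obtain B where B: "B > 0" "\<And>x. x \<in> {-R..R} \<Longrightarrow> norm (\<theta> x) \<le> B"
    unfolding bounded_pos by auto
  have Bx: "norm (\<theta> x) \<le> B" for x
  proof (cases "x \<in> {-R..R}")
    case False
    then have "\<theta> x = 0" by (intro z) auto
    then show ?thesis using B by simp
  qed (use B in auto)
  have "(\<lambda>x. \<bar>norm (b x)\<bar> * norm (\<theta> x)) summable_on S"
  proof (rule point_measure_summable_bump)
    show "point_measure S (\<lambda>x. complex_of_real (norm (b x)))" using pm by (simp add: point_measure_def)
    show "\<And>x. R < \<bar>x\<bar> \<Longrightarrow> \<theta> x = 0" using z by simp
  qed (rule Bx)
  then show ?thesis by (simp add: norm_mult)
qed

text \<open>Testing against a function whose transform \<open>k\<close> is nonnegative and bounded below near the origin,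
  modulated by frequency \<open>s\<close>, bounds the mass of every window of fixed length by the constant \<open>C\<close>,
  which does not depend on \<open>s\<close> because modulation does not change absolute values on the side of
  \<open>\<Gamma>\<close>. Bounded mass in windows of fixed length makes \<open>1 / (1 + x\<^sup>2)\<close> integrable.\<close>

theorem inverse_square_summable:
  assumes u: "temperate_distribution u" and pm: "is_point_measure u S (\<lambda>x. of_real (w x))"
    and w: "\<And>x. x \<in> S \<Longrightarrow> w x \<ge> 0"
    and pm': "is_point_measure (fourier_dist u) \<Gamma> b"
  shows "(\<lambda>x. w x * (1 / (1 + x\<^sup>2))) summable_on S"
proof -
  obtain \<eta> k r \<kappa> where \<eta>: "derivative_sequence \<eta>" "\<And>t. \<bar>t\<bar> \<ge> 4 \<Longrightarrow> \<eta> 0 t = 0"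
    and four: "\<And>s x. fourier_fun (\<lambda>t. \<eta> 0 t * exp (2 * pi * \<i> * of_real s * of_real t)) x = of_real (k (x - s))"
    and k: "\<And>t. k t \<ge> 0" "r > 0" "\<kappa> > 0" "\<And>t. \<bar>t\<bar> \<le> r \<Longrightarrow> k t \<ge> \<kappa>"
    using positive_definite_test_function by blast
  have c\<eta>: "continuous_on UNIV (\<eta> 0)" by (rule derivative_sequence_continuous[OF \<eta>(1)])
  have pb: "point_measure \<Gamma> b" using pm' by (simp add: is_point_measure_def)
  define C where "C = (\<Sum>\<^sub>\<infinity>\<gamma>\<in>\<Gamma>. norm (b \<gamma> * \<eta> 0 \<gamma>))"
  have ub: "(\<Sum>x\<in>F. w x * k (x - s)) \<le> C" if F: "finite F" "F \<subseteq> S" for F s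
  proof -
    let ?D = "leibniz_product \<eta> (\<lambda>n t. (2 * pi * \<i> * of_real s) ^ n * exp (2 * pi * \<i> * of_real s * of_real t))"
    have "test_fun (?D 0)"
      by (rule test_funI[of _ 4]) (intro derivative_sequence_mult \<eta> derivative_sequence_exp, simp add: \<eta>)
    moreover have "?D 0 = (\<lambda>t. \<eta> 0 t * exp (2 * pi * \<i> * of_real s * of_real t))" by auto
    ultimately have tf: "test_fun (\<lambda>t. \<eta> 0 t * exp (2 * pi * \<i> * of_real s * of_real t))" by simp
    note sf = summation_formula[OF u pm w pm' tf, unfolded four norm_of_real]
    have s: "(\<lambda>x. w x * k (x - s)) summable_on S"
      by (rule summable_on_cong[THEN iffD1, OF _ sf(1)]) (simp_all add: k)
    have "(\<Sum>\<^sub>\<infinity>x\<in>S. of_real (w x) * complex_of_real (k (x - s))) = of_real (\<Sum>\<^sub>\<infinity>x\<in>S. w x * k (x - s))"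
      by (rule infsumI) (use has_sum_infsum[OF s] in \<open>simp only: has_sum_of_real_iff flip: of_real_mult\<close>)
    with sf(2) have eq: "of_real (\<Sum>\<^sub>\<infinity>x\<in>S. w x * k (x - s)) =
        (\<Sum>\<^sub>\<infinity>\<gamma>\<in>\<Gamma>. b \<gamma> * (\<eta> 0 \<gamma> * exp (2 * pi * \<i> * of_real s * of_real \<gamma>)))" by simp
    have "norm (\<Sum>\<^sub>\<infinity>\<gamma>\<in>\<Gamma>. b \<gamma> * (\<eta> 0 \<gamma> * exp (2 * pi * \<i> * of_real s * of_real \<gamma>))) \<le> C"
      unfolding C_def
    proof (rule norm_infsum_le_dominated)
      show "(\<lambda>\<gamma>. norm (b \<gamma> * \<eta> 0 \<gamma>)) summable_on \<Gamma>"
        by (rule point_measure_summable_test[OF pb c\<eta> \<eta>(2)])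
    qed (simp add: norm_mult)
    then have "(\<Sum>\<^sub>\<infinity>x\<in>S. w x * k (x - s)) \<le> C" unfolding eq[symmetric] norm_of_real by simp
    moreover have "(\<Sum>x\<in>F. w x * k (x - s)) \<le> (\<Sum>\<^sub>\<infinity>x\<in>S. w x * k (x - s))"
      by (rule finite_sum_le_infsum[OF s]) (use F w k in auto)
    ultimately show ?thesis by simp
  qed
  show ?thesis
  \<comment> \<open>windows of length \<open>r\<close> around \<open>\<plusminus> j r\<close>\<close>
  proof (rule weighted_summable_on[where p = "\<lambda>j. 1 / (1 + (real j * r)\<^sup>2)"
        and K = "\<lambda>j x. k (x - real j * r) + k (x - (- (real j * r)))" and C = "\<lambda>j. 2 * C" and c = \<kappa>])
    fix x
    define j where "j = nat \<lfloor>\<bar>x\<bar> / r\<rfloor>"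
    have "real j \<le> \<bar>x\<bar> / r" "\<bar>x\<bar> / r \<le> real j + 1"
      using k(2) unfolding j_def by (auto simp: of_nat_nat) 
    then have j: "real j * r \<le> \<bar>x\<bar>" "\<bar>x\<bar> \<le> real j * r + r" using k(2) by (auto simp: field_simps)
    have kk: "k (x - real j * r) + k (x - (- (real j * r))) \<ge> \<kappa>"
    proof (cases "x \<ge> 0")
      case True
      then have "k (x - real j * r) \<ge> \<kappa>" using j by (intro k) auto
      then show ?thesis using k(1)[of "x - (- (real j * r))"] by linarith
    next
      case False
      then have "k (x - (- (real j * r))) \<ge> \<kappa>" using j by (intro k) auto
      then show ?thesis using k(1)[of "x - real j * r"] by linarith
    qed
    have "(real j * r)\<^sup>2 \<le> \<bar>x\<bar>\<^sup>2" using j k(2) by (intro power_mono) auto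
    then have "1 / (1 + x\<^sup>2) \<le> 1 / (1 + (real j * r)\<^sup>2)"
      by (intro frac_le) (auto intro: add_pos_nonneg)
    then have "1 / (1 + x\<^sup>2) * \<kappa> \<le> 1 / (1 + (real j * r)\<^sup>2) * (k (x - real j * r) + k (x - (- (real j * r))))"
      using kk k(3) by (intro mult_mono) auto
    then show "\<exists>j. \<kappa> * (1 / (1 + x\<^sup>2)) \<le> 1 / (1 + (real j * r)\<^sup>2) * (k (x - real j * r) + k (x - (- (real j * r))))"
      by (intro exI[of _ j]) (simp only: mult.commute)
  next
    fix j F assume "finite F" "F \<subseteq> S"
    from ub[OF this, of "real j * r"] ub[OF this, of "- (real j * r)"]
    show "(\<Sum>x\<in>F. w x * (k (x - real j * r) + k (x - (- (real j * r))))) \<le> 2 * C"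
      by (simp add: distrib_left sum.distrib)
  next
    have "summable (\<lambda>j. inverse (real j ^ 2))" by (rule inverse_power_summable) simp
    then have s: "summable (\<lambda>j. inverse (real j ^ 2) * (1 / r\<^sup>2 * (2 * \<bar>C\<bar>)))" by (rule summable_mult2)
    show "summable (\<lambda>j. 1 / (1 + (real j * r)\<^sup>2) * (2 * C))"
    proof (rule summable_comparison_test_ev[OF _ s])
      show "\<forall>\<^sub>F j in sequentially. norm (1 / (1 + (real j * r)\<^sup>2) * (2 * C)) \<le> inverse (real j ^ 2) * (1 / r\<^sup>2 * (2 * \<bar>C\<bar>))"
        using eventually_gt_at_top[of 0]
      proof eventually_elim
        case (elim j)
        have "1 / (1 + (real j * r)\<^sup>2) \<le> 1 / (real j * r)\<^sup>2"
          using elim k(2) by (intro frac_le) auto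
        then have "1 / (1 + (real j * r)\<^sup>2) * (2 * \<bar>C\<bar>) \<le> 1 / (real j * r)\<^sup>2 * (2 * \<bar>C\<bar>)"
          by (intro mult_right_mono) auto
        moreover have "norm (1 / (1 + (real j * r)\<^sup>2) * (2 * C)) = 1 / (1 + (real j * r)\<^sup>2) * (2 * \<bar>C\<bar>)"
          by (simp add: abs_mult)
        moreover have "1 / (real j * r)\<^sup>2 * (2 * \<bar>C\<bar>) = inverse (real j ^ 2) * (1 / r\<^sup>2 * (2 * \<bar>C\<bar>))"
          by (simp add: power_mult_distrib field_simps)
        ultimately show ?case by linarith
      qed
    qed
  qed (use w k in auto)
qed


section \<open>The pairing with inverse cubes\<close>

text \<open>This is \<open>t\<^sup>2 exp (- 1 / (R t))\<close> for \<open>t > 0\<close>, a smooth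
  substitute for \<open>t\<^sup>2\<close> on the half line. The quadratic factor makes the first two derivatives bounded
  by \<open>2 t\<close> and 2 uniformly in \<open>R\<close>; two integrations by parts, which is exactly what is needed for
  absolute convergence against \<open>1 / (1 + x\<^sup>2)\<close>, are therefore harmless as \<open>R\<close> tends to infinity.\<close>

definition flat_square :: "real \<Rightarrow> nat \<Rightarrow> real \<Rightarrow> complex" where
  "flat_square R = leibniz_product
     (\<lambda>n t. of_real (if n = 0 then t\<^sup>2 else if n = 1 then 2 * t else if n = 2 then 2 else 0))
     (\<lambda>n t. of_real (R ^ n) * of_real (flat_deriv n (R * t + 0)))"

lemma derivative_sequence_flat_square: "derivative_sequence (flat_square R)"
  unfolding flat_square_def
  by (intro derivative_sequence_mult derivative_sequence_square derivative_sequence_affine derivative_sequence_flat)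

lemma flat_square_nonpos:
  assumes "R > 0" "x \<le> 0"
  shows "flat_square R n x = 0"
proof -
  have "R * x \<le> 0" using assms by (simp add: mult_nonneg_nonpos)
  then show ?thesis by (simp add: flat_square_def leibniz_product_def flat_deriv_def)
qed

text \<open>The extra exponential factor depends on \<open>t\<close> and \<open>R\<close> only through \<open>u = 1 / (R t)\<close>, which tends to 0.\<close>

lemma flat_square_pos:
  assumes R: "R > 0" "x > 0" and u: "u = 1 / (R * x)"
  shows "flat_square R 0 x = of_real (x\<^sup>2 * exp (- u))"
    and "flat_square R (Suc 0) x = of_real (x * ((2 + u) * exp (- u)))"
    and "flat_square R (Suc (Suc 0)) x = of_real ((2 + 2 * u + u\<^sup>2) * exp (- u))"
proof -
  have Rx: "R * x > 0" using R by simp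
  have [simp]: "flat_deriv 0 (R * x) = exp (- u)"
    "flat_deriv (Suc 0) (R * x) = u\<^sup>2 * exp (- u)"
    "flat_deriv (Suc (Suc 0)) (R * x) = (u ^ 4 - 2 * u ^ 3) * exp (- u)"
    using Rx by (simp_all add: flat_deriv_def u pderiv_pCons power2_eq_square power3_eq_cube power4_eq_xxxx algebra_simps)
  have ux: "R * x * u = 1" using R by (simp add: u)
  show "flat_square R 0 x = of_real (x\<^sup>2 * exp (- u))"
    by (simp add: flat_square_def)
  have "flat_square R (Suc 0) x = of_real (x\<^sup>2 * (R * (u\<^sup>2 * exp (- u))) + 2 * x * exp (- u))"
    by (simp add: flat_square_def leibniz_product_def)
  also have "x\<^sup>2 * (R * (u\<^sup>2 * exp (- u))) + 2 * x * exp (- u) = x * (R * x * u) * u * exp (- u) + 2 * x * exp (- u)"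
    by (simp add: power2_eq_square)
  also have "\<dots> = x * ((2 + u) * exp (- u))" unfolding ux by (simp add: algebra_simps)
  finally show "flat_square R (Suc 0) x = of_real (x * ((2 + u) * exp (- u)))" .
  have "flat_square R (Suc (Suc 0)) x = of_real (x\<^sup>2 * (R\<^sup>2 * ((u ^ 4 - 2 * u ^ 3) * exp (- u)))
      + 2 * (2 * x * (R * (u\<^sup>2 * exp (- u)))) + 2 * exp (- u))"
    by (simp add: flat_square_def leibniz_product_def power2_eq_square)
  also have "x\<^sup>2 * (R\<^sup>2 * ((u ^ 4 - 2 * u ^ 3) * exp (- u))) + 2 * (2 * x * (R * (u\<^sup>2 * exp (- u)))) + 2 * exp (- u)
     = ((R * x * u)\<^sup>2 * (u\<^sup>2 - 2 * u) + 4 * (R * x * u) * u + 2) * exp (- u)"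
    by (simp add: algebra_simps power2_eq_square power3_eq_cube power4_eq_xxxx)
  also have "\<dots> = (2 + 2 * u + u\<^sup>2) * exp (- u)" unfolding ux by simp
  finally show "flat_square R (Suc (Suc 0)) x = of_real ((2 + 2 * u + u\<^sup>2) * exp (- u))" .
qed

lemma flat_square_bounds:
  assumes R: "R > 0" "x > 0"
  shows "norm (flat_square R 0 x) \<le> x\<^sup>2" "norm (flat_square R (Suc 0) x) \<le> 2 * x"
    "norm (flat_square R (Suc (Suc 0)) x) \<le> 2"
proof -
  define u where "u = 1 / (R * x)"
  have u: "u > 0" using R by (simp add: u_def)
  have q: "1 + u + u\<^sup>2 / 2 \<le> exp u" using exp_lower_Taylor_quadratic u by simp
  have e: "y * exp (- u) \<le> c" if "y \<le> c * exp u" for y c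
    using mult_right_mono[OF that, of "exp (- u)"] by (simp add: exp_minus_inverse mult.assoc)
  note fs = flat_square_pos[OF R u_def]
  show "norm (flat_square R 0 x) \<le> x\<^sup>2"
    using mult_left_mono[of "exp (- u)" 1 "x\<^sup>2"] u unfolding fs norm_of_real by simp
  have "(2 + u) * exp (- u) \<le> 2" by (rule e) (use q u zero_le_power2[of u] in linarith)
  then have "x * ((2 + u) * exp (- u)) \<le> x * 2" using R by (intro mult_left_mono) auto
  then show "norm (flat_square R (Suc 0) x) \<le> 2 * x"
    using R u unfolding fs norm_of_real by simp
  have "(2 + 2 * u + u\<^sup>2) * exp (- u) \<le> 2" by (rule e) (use q in simp)
  then show "norm (flat_square R (Suc (Suc 0)) x) \<le> 2"
    using u unfolding fs norm_of_real by simp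
qed

lemma poly_times_exp_bounded:
  assumes s: "s > (0::real)"
  shows "\<exists>C>0. \<forall>x\<ge>0. (1 + x) ^ N * exp (- s * x) \<le> C"
proof (cases "N = 0")
  case True
  then show ?thesis using s by (intro exI[of _ 1]) (auto simp: mult_le_0_iff)
next
  case False
  define t where "t = s / real N"
  have t: "t > 0" using s False by (simp add: t_def)
  define m where "m = min 1 t"
  have m: "m > 0" using t by (simp add: m_def)
  have "(1 + x) ^ N * exp (- s * x) \<le> (1 / m) ^ N" if x: "x \<ge> 0" for x
  proof -
    have "m * (1 + x) \<le> 1 + t * x"
      using x t by (simp add: m_def distrib_left add_mono mult_right_mono)
    also have "\<dots> \<le> exp (t * x)" by (rule exp_ge_add_one_self)
    finally have "1 + x \<le> 1 / m * exp (t * x)" using m by (simp add: field_simps)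
    then have "(1 + x) ^ N \<le> (1 / m * exp (t * x)) ^ N" using x by (intro power_mono) auto
    also have "\<dots> = (1 / m) ^ N * exp (s * x)"
      using False by (simp only: power_mult_distrib exp_of_nat_mult[symmetric]) (simp add: t_def)
    finally have "(1 + x) ^ N * exp (- s * x) \<le> (1 / m) ^ N * exp (s * x) * exp (- s * x)"
      by (intro mult_right_mono) auto
    also have "\<dots> = (1 / m) ^ N" by (simp add: mult.assoc flip: exp_add)
    finally show ?thesis .
  qed
  then show ?thesis using m by (intro exI[of _ "(1 / m) ^ N"]) auto
qed

text \<open>Temperedness of the measure of absolute values enters only here: a polynomial weight makes it
  summable, and every exponential weight beats the polynomial.\<close>

lemma exponentially_weighted_summable:
  assumes \<nu>: "temperate_distribution \<nu>" "is_point_measure \<nu> \<Gamma> (\<lambda>\<gamma>. of_real (norm (b \<gamma>)))" and s: "s > 0"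
  shows "(\<lambda>\<gamma>. norm (b \<gamma>) * ((1 + \<gamma>) ^ k * exp (- s * \<gamma>))) summable_on (\<Gamma> \<inter> {0<..})"
proof -
  obtain N where "(\<lambda>x. norm (b x) * (1 / (1 + \<bar>x\<bar>) ^ N)) summable_on \<Gamma>"
    using temperate_weight_summable[OF \<nu>] by auto
  then have N: "(\<lambda>x. norm (b x) * (1 / (1 + \<bar>x\<bar>) ^ N)) summable_on (\<Gamma> \<inter> {0<..})"
    by (rule summable_on_subset_banach) auto
  obtain C where C: "\<And>x. x \<ge> 0 \<Longrightarrow> (1 + x) ^ (N + k) * exp (- s * x) \<le> C"
    using poly_times_exp_bounded[OF s, of "N + k"] by auto
  from N have "(\<lambda>x. norm (b x) * (1 / (1 + \<bar>x\<bar>) ^ N) * C) summable_on (\<Gamma> \<inter> {0<..})"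
    by (rule summable_on_cmult_left)
  then show ?thesis
  proof (rule summable_on_comparison_test)
    fix x assume "x \<in> \<Gamma> \<inter> {0<..}"
    then have x: "x > 0" by simp
    have "(1 + x) ^ k * exp (- s * x) = 1 / (1 + \<bar>x\<bar>) ^ N * ((1 + x) ^ (N + k) * exp (- s * x))"
      using x by (simp add: power_add)
    also have "\<dots> \<le> 1 / (1 + \<bar>x\<bar>) ^ N * C" using x by (intro mult_left_mono C) auto
    finally have "norm (b x) * ((1 + x) ^ k * exp (- s * x)) \<le> norm (b x) * (1 / (1 + \<bar>x\<bar>) ^ N * C)"
      by (intro mult_left_mono) auto
    then show "norm (b x) * ((1 + x) ^ k * exp (- s * x)) \<le> norm (b x) * (1 / (1 + \<bar>x\<bar>) ^ N) * C"
      by (simp only: mult.assoc)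
  qed auto
qed

lemma integral_exp_halfline:
  assumes c: "Re c < 0"
  shows "integral {0..} (\<lambda>t. exp (c * of_real t)) = - 1 / c"
proof -
  let ?f = "\<lambda>(k::nat) t. if t \<in> {0..real k} then exp (c * complex_of_real t) else 0"
  have c0: "c \<noteq> 0" using c by auto
  have fk: "(?f k has_integral (exp (c * of_real (real k)) - 1) / c) {0..}" for k
  proof -
    have "((\<lambda>t. exp (c * of_real t)) has_integral (exp (c * of_real (real k)) / c - exp (c * of_real 0) / c)) {0..real k}"
    proof (rule fundamental_theorem_of_calculus)
      fix x assume "x \<in> {0..real k}"
      have "((\<lambda>z. exp (c * z) / c) has_field_derivative exp (c * of_real x)) (at (of_real x))"
        using c0 by (auto intro!: derivative_eq_intros)
      then show "((\<lambda>t. exp (c * of_real t) / c) has_vector_derivative exp (c * of_real x)) (at x within {0..real k})"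
        by (rule has_vector_derivative_at_within[OF has_vector_derivative_real_field])
    qed auto
    then have "((\<lambda>t. exp (c * of_real t)) has_integral (exp (c * of_real (real k)) - 1) / c) {0..real k}"
      by (simp add: diff_divide_distrib)
    then show ?thesis by (subst has_integral_restrict) auto
  qed
  have "(\<lambda>k. integral {0..} (?f k)) \<longlonglongrightarrow> integral {0..} (\<lambda>t. exp (c * of_real t))"
  proof (rule dominated_convergence(2))
    show "\<And>k. ?f k integrable_on {0..}" using fk by (auto simp: integrable_on_def)
    show "(\<lambda>x. exp (- (- Re c) * x)) integrable_on {0..}"
      by (rule integrable_on_exp_minus_to_infinity) (use c in auto)
    fix x :: real assume x: "x \<in> {0..}"
    show "norm (?f k x) \<le> exp (- (- Re c) * x)" for k by (auto simp: norm_exp)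
    have "\<forall>\<^sub>F k in sequentially. exp (c * of_real x) = ?f k x"
      using eventually_ge_at_top[of "nat \<lceil>x\<rceil>"] by eventually_elim (use x in \<open>auto simp: nat_ceiling_le_eq\<close>)
    then show "(\<lambda>k. ?f k x) \<longlonglongrightarrow> exp (c * of_real x)"
      by (rule Lim_transform_eventually[OF tendsto_const])
  qed
  moreover have "(\<lambda>k. integral {0..} (?f k)) \<longlonglongrightarrow> (0 - 1) / c"
  proof -
    have "(\<lambda>k. exp (Re c) ^ k) \<longlonglongrightarrow> 0" using c by (intro LIMSEQ_realpow_zero) auto
    then have "(\<lambda>k. norm (exp (c * of_real (real k)))) \<longlonglongrightarrow> 0"
      by (simp add: norm_exp exp_of_nat_mult[symmetric] mult.commute)
    then have "(\<lambda>k. exp (c * of_real (real k))) \<longlonglongrightarrow> 0" by (rule tendsto_norm_zero_cancel)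
    then have "(\<lambda>k. (exp (c * of_real (real k)) - 1) / c) \<longlonglongrightarrow> (0 - 1) / c" by (intro tendsto_intros c0)
    moreover have "(\<lambda>k. integral {0..} (?f k)) = (\<lambda>k. (exp (c * of_real (real k)) - 1) / c)"
      by (intro ext integral_unique fk)
    ultimately show ?thesis by (simp only:)
  qed
  ultimately have "integral {0..} (\<lambda>t. exp (c * of_real t)) = (0 - 1) / c" by (rule LIMSEQ_unique)
  then show ?thesis by simp
qed


lemma one_plus_square_le_distance:
  fixes z :: complex
  assumes "norm z \<le> B" "\<bar>Im z\<bar> \<ge> y" "y > 0"
  shows "1 + x\<^sup>2 \<le> (2 + (1 + 2 * B\<^sup>2) / y\<^sup>2) * (norm (z - of_real x))\<^sup>2"
proof -
  define d where "d = norm (z - of_real x)"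
  have "y \<le> \<bar>Im (z - of_real x)\<bar>" using assms by simp
  also have "\<dots> \<le> d" unfolding d_def by (rule abs_Im_le_cmod)
  finally have "y\<^sup>2 \<le> d\<^sup>2" using assms by (intro power_mono) auto
  define K where "K = (1 + 2 * B\<^sup>2) * (d\<^sup>2 / y\<^sup>2)"
  have "1 \<le> d\<^sup>2 / y\<^sup>2" using assms \<open>y\<^sup>2 \<le> d\<^sup>2\<close> by simp
  then have "1 + 2 * B\<^sup>2 \<le> K"
    unfolding K_def using mult_left_mono[of 1 "d\<^sup>2 / y\<^sup>2" "1 + 2 * B\<^sup>2"] by simp
  moreover have "\<bar>x\<bar> \<le> d + B"
    using norm_triangle_ineq4[of z "z - of_real x"] assms(1) by (simp add: d_def)
  then have "x\<^sup>2 \<le> (d + B)\<^sup>2" by (metis abs_ge_zero power2_abs power_mono)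
  moreover have "(d + B)\<^sup>2 \<le> 2 * d\<^sup>2 + 2 * B\<^sup>2"
    using zero_le_power2[of "d - B"] by (simp add: power2_sum power2_diff)
  ultimately have "1 + x\<^sup>2 \<le> 2 * d\<^sup>2 + K" by linarith
  also have "\<dots> = (2 + (1 + 2 * B\<^sup>2) / y\<^sup>2) * d\<^sup>2"
    by (simp add: K_def distrib_right)
  finally show ?thesis by (simp add: d_def)
qed

text \<open>The summation formula for \<open>t\<^sup>2 e\<^bsup>2 \<pi> i t z\<^esup>\<close> on the half line \<open>t > 0\<close>, whose Fourier transform
  is an inverse cube; only positive frequencies remain. Being neither smooth at 0 nor compactly supported,
  this function is approximated by \<open>flat_square R\<close> times a cutoff at scale \<open>R\<close>, and both sides
  converge by domination: the left one by the inverse squares of the zeros, the right one by exponential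
  decay. With a lower power of \<open>t\<close> the second derivatives of the
  approximations would not stay bounded near 0.\<close>

theorem inverse_cube_pairing:
  assumes u: "temperate_distribution u" and pm: "is_point_measure u S (\<lambda>x. of_real (w x))"
    and w: "\<And>x. x \<in> S \<Longrightarrow> w x \<ge> 0"
    and pm': "is_point_measure (fourier_dist u) \<Gamma> b"
    and \<nu>: "temperate_distribution \<nu>" "is_point_measure \<nu> \<Gamma> (\<lambda>\<gamma>. of_real (norm (b \<gamma>)))"
    and z: "Im z > 0"
  shows "(\<Sum>\<^sub>\<infinity>x\<in>S. of_real (w x) * (- 2 / (2 * pi * \<i> * (z - of_real x)) ^ 3))
       = (\<Sum>\<^sub>\<infinity>\<gamma>\<in>\<Gamma> \<inter> {0<..}. b \<gamma> * (of_real (\<gamma>\<^sup>2) * exp (2 * pi * \<i> * z * of_real \<gamma>)))"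
proof -
  obtain X where X: "derivative_sequence X" "X 0 = (\<lambda>x. of_real (bump x))"
    by (rule bump_derivatives)
  have X0: "X 0 x = 0" if "\<bar>x\<bar> \<ge> 2" for x using that by (simp add: X bump_outside)
  have X0': "X 0 x = 0" if "\<bar>x\<bar> > 2" for x using that by (simp add: X0)
  have "\<exists>M>0. \<forall>x. \<bar>x\<bar> ^ 0 * norm (X n x) \<le> M" for n
    by (rule compact_support_bounds[OF X(1) X0'])
  then obtain M where M: "\<And>n x. norm (X n x) \<le> M n" "\<And>n. M n > 0"
    by simp metis
  define RR where "RR j = real (Suc j)" for j
  have RR: "RR j > 0" "RR j \<ge> 1" for j by (simp_all add: RR_def)
  have RRlim: "filterlim RR at_top sequentially"
    unfolding RR_def by (rule filterlim_compose[OF filterlim_real_sequentially filterlim_Suc])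
  have inv: "(\<lambda>j. q / RR j) \<longlonglongrightarrow> 0" for q :: real
    using tendsto_divide_0[OF tendsto_const filterlim_at_top_imp_at_infinity[OF RRlim]] .
  define P where "P j = leibniz_product (flat_square (RR j)) (cutoff_seq X (RR j))" for j
  define s where "s = 2 * pi * Im z"
  have s: "s > 0" using z by (simp add: s_def)
  define c where "c x = 2 * pi * \<i> * (z - of_real x)" for x
  have Rec: "Re (c x) = - s" for x by (simp add: c_def s_def)
  have c0: "c x \<noteq> 0" for x using Rec[of x] s by auto
  have dP: "derivative_sequence (P j)" for j
    unfolding P_def by (intro derivative_sequence_mult derivative_sequence_flat_square derivative_sequence_cutoff X)
  have outP: "P j 0 x = 0" if "\<bar>x\<bar> \<ge> 2 * RR j" for j x
  proof -
    have "\<bar>x / RR j\<bar> \<ge> 2" using that RR(1)[of j] by (simp add: abs_divide le_divide_eq)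
    then show ?thesis by (simp add: P_def cutoff_seq_def X0)
  qed
  have negP: "P j n x = 0" if "x \<le> 0" for j n x
    unfolding P_def leibniz_product_def using flat_square_nonpos[OF RR(1) that] by simp
  have cut: "norm (cutoff_seq X (RR j) n x) \<le> M n" for j n x
  proof -
    have "(1 / RR j) ^ n * norm (X n (x / RR j)) \<le> 1 * M n"
      using RR[of j] by (intro mult_mono M power_le_one) auto
    then show ?thesis using RR[of j] by (simp add: cutoff_seq_def norm_mult norm_power norm_divide)
  qed
  \<comment> \<open>the second derivative stays below a quadratic polynomial, uniformly in \<open>j\<close>\<close>
  have P2: "P j (Suc (Suc 0)) x = flat_square (RR j) 0 x * cutoff_seq X (RR j) (Suc (Suc 0)) x
     + 2 * (flat_square (RR j) (Suc 0) x * cutoff_seq X (RR j) (Suc 0) x)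
     + flat_square (RR j) (Suc (Suc 0)) x * cutoff_seq X (RR j) 0 x" for j x
    by (simp add: P_def leibniz_product_def)
  define MM where "MM = M 0 + M 1 + M 2"
  have MM: "M 0 \<le> MM" "M (Suc 0) \<le> MM" "M (Suc (Suc 0)) \<le> MM" "MM > 0"
    using M(2)[of 0] M(2)[of 1] M(2)[of 2] by (auto simp: MM_def numeral_2_eq_2)
  have P2b: "norm (P j (Suc (Suc 0)) x) \<le> 2 * MM * (1 + x)\<^sup>2" if x: "x \<ge> 0" for j x
  proof (cases "x = 0")
    case True then show ?thesis using negP MM by simp
  next
    case False
    then have x: "x > 0" using x by simp
    note fb = flat_square_bounds[OF RR(1)[of j] x]
    have le: "norm (p * cutoff_seq X (RR j) n x) \<le> q * MM" if "norm p \<le> q" "M n \<le> MM" for p q n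
      unfolding norm_mult
      by (intro mult_mono order_trans[OF cut] that order_trans[OF norm_ge_zero that(1)]) auto
    have "norm (P j (Suc (Suc 0)) x) \<le> x\<^sup>2 * MM + 2 * (2 * x * MM) + 2 * MM"
      unfolding P2
      using le[OF fb(1) MM(3)] le[OF fb(2) MM(2)] le[OF fb(3) MM(1)]
      by (intro order_trans[OF norm_triangle_ineq] add_mono) (simp_all add: norm_mult mult_ac)
    also have "\<dots> \<le> 2 * MM * (1 + x)\<^sup>2"
      using MM x by (simp add: power2_eq_square algebra_simps)
    finally show ?thesis .
  qed
  obtain C where C: "\<And>x. x \<ge> 0 \<Longrightarrow> (1 + x)\<^sup>2 * exp (- (s / 2) * x) \<le> C" "C > 0"
    using poly_times_exp_bounded[of "s / 2" 2] s by auto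
  define h where "h x = 2 * MM * C * exp (- (s / 2) * x)" for x
  have hint: "h integrable_on {0..}"
    unfolding h_def using integrable_on_exp_minus_to_infinity[of "s / 2" 0] s
    by (intro integrable_on_mult_right) auto
  have hb: "norm (P j (Suc (Suc 0)) t * exp (c x * of_real t)) \<le> h t" if t: "t \<ge> 0" for j x t
  proof -
    have "norm (P j (Suc (Suc 0)) t * exp (c x * of_real t)) = norm (P j (Suc (Suc 0)) t) * exp (- s * t)"
      by (simp add: norm_mult norm_exp Rec)
    also have "\<dots> \<le> 2 * MM * (1 + t)\<^sup>2 * exp (- s * t)" by (intro mult_right_mono P2b t) auto
    also have "\<dots> = 2 * MM * ((1 + t)\<^sup>2 * exp (- (s / 2) * t)) * exp (- (s / 2) * t)"
      by (simp add: mult.assoc flip: exp_add)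
    also have "\<dots> \<le> 2 * MM * C * exp (- (s / 2) * t)"
      using MM by (intro mult_right_mono mult_left_mono C t) auto
    finally show ?thesis by (simp add: h_def)
  qed
  have window: "((\<lambda>t. P j (Suc (Suc 0)) t * exp (c x * of_real t)) has_integral
      laplace (2 * RR j) (P j (Suc (Suc 0))) (c x)) {0..}" for j x
  proof -
    let ?f = "\<lambda>t. P j (Suc (Suc 0)) t * exp (c x * of_real t)"
    have v: "P j (Suc (Suc 0)) t = 0" if "\<bar>t\<bar> \<ge> 2 * RR j" for t
      by (rule vanishes_outside[OF dP outP that])
    have "(?f has_integral laplace (2 * RR j) (P j (Suc (Suc 0))) (c x)) {- (2 * RR j)..2 * RR j}"
      unfolding laplace_def by (intro integrable_integral laplace_integrable derivative_sequence_continuous[OF dP])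
    then have "(?f has_integral laplace (2 * RR j) (P j (Suc (Suc 0))) (c x)) UNIV"
      by (rule has_integral_on_superset) (use v in auto)
    moreover have "(if t \<in> {0..} then ?f t else 0) = ?f t" for t using negP by auto
    ultimately have "((\<lambda>t. if t \<in> {0..} then ?f t else 0) has_integral
        laplace (2 * RR j) (P j (Suc (Suc 0))) (c x)) UNIV" by (simp only:)
    then show ?thesis by (rule has_integral_restrict_UNIV[THEN iffD1])
  qed
  have lap_bound: "norm (laplace (2 * RR j) (P j (Suc (Suc 0))) (c x)) \<le> integral {0..} h" for j x
  proof -
    have "norm (integral {0..} (\<lambda>t. P j (Suc (Suc 0)) t * exp (c x * of_real t))) \<le> integral {0..} h"
      by (rule integral_norm_bound_integral) (use window hint hb in \<open>auto simp: integrable_on_def\<close>)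
    then show ?thesis by (simp add: integral_unique[OF window])
  qed
  \<comment> \<open>in the limit only the second derivative of \<open>t\<^sup>2\<close>, the constant 2, survives\<close>
  have lap_lim: "(\<lambda>j. laplace (2 * RR j) (P j (Suc (Suc 0))) (c x)) \<longlonglongrightarrow> - 2 / c x" for x
  proof -
    let ?g = "\<lambda>t. if t = 0 then 0 else 2 * exp (c x * of_real t)"
    have "(\<lambda>j. integral {0..} (\<lambda>t. P j (Suc (Suc 0)) t * exp (c x * of_real t))) \<longlonglongrightarrow> integral {0..} ?g"
    proof (rule dominated_convergence(2)[OF _ hint])
      show "(\<lambda>t. P j (Suc (Suc 0)) t * exp (c x * of_real t)) integrable_on {0..}" for j
        using window by (auto simp: integrable_on_def)
      show "norm (P j (Suc (Suc 0)) t * exp (c x * of_real t)) \<le> h t" if "t \<in> {0..}" for j t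
        using that by (intro hb) auto
      fix t :: real assume "t \<in> {0..}"
      show "(\<lambda>j. P j (Suc (Suc 0)) t * exp (c x * of_real t)) \<longlonglongrightarrow> ?g t"
      proof (cases "t = 0")
        case True then show ?thesis using negP by simp
      next
        case False
        then have t: "t > 0" using \<open>t \<in> {0..}\<close> by auto
        define u where "u j = 1 / (RR j * t)" for j
        have u: "u \<longlonglongrightarrow> 0" using inv[of "1 / t"] by (simp add: u_def[abs_def] mult.commute)
        note fs = flat_square_pos[OF RR(1) t u_def]
        have cut0: "(\<lambda>j. cutoff_seq X (RR j) n t) \<longlonglongrightarrow> 0" if n: "n > 0" for n
        proof (rule Lim_null_comparison[OF always_eventually inv[of "M n"]], rule allI)
          fix j
          have "(1 / RR j) ^ n \<le> (1 / RR j) ^ 1" using n RR[of j] by (intro power_decreasing) auto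
          then have "(1 / RR j) ^ n * norm (X n (t / RR j)) \<le> 1 / RR j * M n"
            using RR[of j] by (intro mult_mono M) auto
          then show "norm (cutoff_seq X (RR j) n t) \<le> M n / RR j"
            using RR[of j] by (simp add: cutoff_seq_def norm_mult norm_power norm_divide)
        qed
        have "isCont (X 0) 0"
          using derivative_sequence_continuous[OF X(1), of UNIV 0] by (simp add: continuous_on_eq_continuous_at)
        then have "(\<lambda>j. X 0 (t / RR j)) \<longlonglongrightarrow> X 0 0" by (rule isCont_tendsto_compose[OF _ inv])
        then have cut1: "(\<lambda>j. cutoff_seq X (RR j) 0 t) \<longlonglongrightarrow> 1" by (simp add: cutoff_seq_def X)
        have "(\<lambda>j. P j (Suc (Suc 0)) t * exp (c x * of_real t)) \<longlonglongrightarrow>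
          (of_real (t\<^sup>2 * exp (- 0)) * 0 + 2 * (of_real (t * ((2 + 0) * exp (- 0))) * 0)
            + of_real ((2 + 2 * 0 + 0\<^sup>2) * exp (- 0)) * 1) * exp (c x * of_real t)"
          unfolding P2 fs by (intro tendsto_intros u cut0 cut1) auto
        then show ?thesis using t by simp
      qed
    qed
    moreover have "integral {0..} ?g = integral {0..} (\<lambda>t. 2 * exp (c x * of_real t))"
      by (rule integral_spike[of "{0}"]) auto
    moreover have "\<dots> = 2 * (- 1 / c x)"
      by (subst integral_mult_right) (use integral_exp_halfline[of "c x"] Rec s in auto)
    ultimately show ?thesis by (simp add: integral_unique[OF window])
  qed
  let ?\<phi> = "\<lambda>j t. P j 0 t * exp (2 * pi * \<i> * z * of_real t)"
  have tf: "test_fun (?\<phi> j)" for j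
  proof -
    let ?D = "leibniz_product (P j) (\<lambda>n t. (2 * pi * \<i> * z) ^ n * exp (2 * pi * \<i> * z * of_real t))"
    have "test_fun (?D 0)"
      by (rule test_funI[of _ "2 * RR j"]) (intro derivative_sequence_mult dP derivative_sequence_exp, simp add: outP)
    moreover have "?D 0 = ?\<phi> j" by auto
    ultimately show ?thesis by simp
  qed
  \<comment> \<open>two integrations by parts provide the decay in \<open>x\<close>\<close>
  have four: "fourier_fun (?\<phi> j) x = laplace (2 * RR j) (P j (Suc (Suc 0))) (c x) / (c x)\<^sup>2" for j x
  proof -
    have "fourier_fun (?\<phi> j) x = laplace (2 * RR j) (?\<phi> j) (- 2 * pi * \<i> * of_real x)"
      by (rule fourier_fun_eq_laplace)
         (auto intro!: continuous_intros derivative_sequence_continuous[OF dP] simp: outP)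
    also have "\<dots> = laplace (2 * RR j) (P j 0) (c x)"
      unfolding laplace_def c_def by (intro integral_cong) (simp add: mult.assoc exp_add[symmetric] algebra_simps)
    also have "laplace (2 * RR j) (P j (Suc (Suc 0))) (c x) = (- c x) ^ Suc (Suc 0) * laplace (2 * RR j) (P j 0) (c x)"
      by (rule laplace_by_parts_iter[OF dP _ outP]) (use RR[of j] in auto)
    then have "laplace (2 * RR j) (P j 0) (c x) = laplace (2 * RR j) (P j (Suc (Suc 0))) (c x) / (c x)\<^sup>2"
      using c0[of x] by (simp add: power2_eq_square)
    finally show ?thesis .
  qed
  define B where "B = (2 + (1 + 2 * (norm z)\<^sup>2) / (Im z)\<^sup>2)"
  have cB: "1 / (norm (c x))\<^sup>2 \<le> B * (1 / (1 + x\<^sup>2))" for x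
  proof -
    have "1 + x\<^sup>2 \<le> B * (norm (z - of_real x))\<^sup>2"
      unfolding B_def by (rule one_plus_square_le_distance) (use z in auto)
    also have "\<dots> \<le> B * (norm (c x))\<^sup>2"
    proof (intro mult_left_mono power_mono)
      have "1 * norm (z - of_real x) \<le> (2 * pi) * norm (z - of_real x)"
        using pi_ge_two by (intro mult_right_mono) auto
      then show "norm (z - of_real x) \<le> norm (c x)" by (simp add: c_def norm_mult)
    qed (auto simp: B_def intro!: add_nonneg_nonneg)
    finally show ?thesis using c0[of x] by (simp add: field_simps add_pos_nonneg)
  qed
  have "(\<lambda>j. \<Sum>\<^sub>\<infinity>x\<in>S. of_real (w x) * fourier_fun (?\<phi> j) x) \<longlonglongrightarrow> (\<Sum>\<^sub>\<infinity>x\<in>S. of_real (w x) * (- 2 / c x / (c x)\<^sup>2))"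
  proof (rule tendsto_infsum_dominated)
    show "(\<lambda>x. w x * (1 / (1 + x\<^sup>2)) * (integral {0..} h * B)) summable_on S"
      by (rule summable_on_cmult_left) (rule inverse_square_summable[OF u pm w pm'])
    have "norm (of_real (w x) * fourier_fun (?\<phi> j) x) \<le> w x * (1 / (1 + x\<^sup>2)) * (integral {0..} h * B)" if x: "x \<in> S" for x j
    proof -
      have "norm (of_real (w x) * fourier_fun (?\<phi> j) x) = w x * (norm (laplace (2 * RR j) (P j (Suc (Suc 0))) (c x)) * (1 / (norm (c x))\<^sup>2))"
        unfolding four using w[OF x] by (simp add: norm_mult norm_divide norm_power)
      also have "\<dots> \<le> w x * (integral {0..} h * (B * (1 / (1 + x\<^sup>2))))"
        using order_trans[OF norm_ge_zero lap_bound] by (intro mult_left_mono mult_mono lap_bound cB w x) auto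
      finally show ?thesis by (simp add: mult_ac)
    qed
    then show "\<forall>\<^sub>F j in sequentially. \<forall>x\<in>S. norm (of_real (w x) * fourier_fun (?\<phi> j) x) \<le> w x * (1 / (1 + x\<^sup>2)) * (integral {0..} h * B)"
      by (intro always_eventually) auto
    show "(\<lambda>j. of_real (w x) * fourier_fun (?\<phi> j) x) \<longlonglongrightarrow> of_real (w x) * (- 2 / c x / (c x)\<^sup>2)" for x
      unfolding four by (intro tendsto_intros lap_lim) (use c0 in auto)
  qed
  moreover have "(\<Sum>\<^sub>\<infinity>x\<in>S. of_real (w x) * fourier_fun (?\<phi> j) x) = (\<Sum>\<^sub>\<infinity>\<gamma>\<in>\<Gamma> \<inter> {0<..}. b \<gamma> * ?\<phi> j \<gamma>)" for j
  proof -
    have "(\<Sum>\<^sub>\<infinity>x\<in>S. of_real (w x) * fourier_fun (?\<phi> j) x) = (\<Sum>\<^sub>\<infinity>\<gamma>\<in>\<Gamma>. b \<gamma> * ?\<phi> j \<gamma>)"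
      by (rule summation_formula(2)[OF u pm w pm' tf])
    also have "\<dots> = (\<Sum>\<^sub>\<infinity>\<gamma>\<in>\<Gamma> \<inter> {0<..}. b \<gamma> * ?\<phi> j \<gamma>)"
      by (rule infsum_cong_neutral) (auto simp: negP)
    finally show ?thesis .
  qed
  moreover have "(\<lambda>j. \<Sum>\<^sub>\<infinity>\<gamma>\<in>\<Gamma> \<inter> {0<..}. b \<gamma> * ?\<phi> j \<gamma>) \<longlonglongrightarrow>
      (\<Sum>\<^sub>\<infinity>\<gamma>\<in>\<Gamma> \<inter> {0<..}. b \<gamma> * (of_real (\<gamma>\<^sup>2) * exp (2 * pi * \<i> * z * of_real \<gamma>)))"
  proof (rule tendsto_infsum_dominated)
    show "(\<lambda>\<gamma>. norm (b \<gamma>) * ((1 + \<gamma>) ^ 2 * exp (- s * \<gamma>)) * M 0) summable_on \<Gamma> \<inter> {0<..}"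
      by (rule summable_on_cmult_left) (rule exponentially_weighted_summable[OF \<nu> s])
    have "norm (b \<gamma> * ?\<phi> j \<gamma>) \<le> norm (b \<gamma>) * ((1 + \<gamma>) ^ 2 * exp (- s * \<gamma>)) * M 0" if "\<gamma> \<in> \<Gamma> \<inter> {0<..}" for j \<gamma>
    proof -
      have g: "\<gamma> > 0" using that by auto
      have "norm (P j 0 \<gamma>) \<le> \<gamma>\<^sup>2 * M 0"
        unfolding P_def leibniz_product_0 norm_mult by (intro mult_mono flat_square_bounds RR g cut) auto
      also have "\<dots> \<le> (1 + \<gamma>)\<^sup>2 * M 0" using g M(2)[of 0] by (intro mult_right_mono power_mono) auto
      finally have "norm (b \<gamma>) * (norm (P j 0 \<gamma>) * exp (- s * \<gamma>)) \<le> norm (b \<gamma>) * ((1 + \<gamma>)\<^sup>2 * M 0 * exp (- s * \<gamma>))"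
        by (intro mult_left_mono mult_right_mono) auto
      then show ?thesis by (simp add: norm_mult norm_exp s_def mult_ac)
    qed
    then show "\<forall>\<^sub>F j in sequentially. \<forall>\<gamma>\<in>\<Gamma> \<inter> {0<..}. norm (b \<gamma> * ?\<phi> j \<gamma>) \<le> norm (b \<gamma>) * ((1 + \<gamma>) ^ 2 * exp (- s * \<gamma>)) * M 0"
      by (intro always_eventually) auto
    fix \<gamma> assume "\<gamma> \<in> \<Gamma> \<inter> {0<..}"
    then have g: "\<gamma> > 0" by auto
    define u where "u j = 1 / (RR j * \<gamma>)" for j
    have u: "u \<longlonglongrightarrow> 0" using inv[of "1 / \<gamma>"] by (simp add: u_def[abs_def] mult.commute)
    have "isCont (X 0) 0"
      using derivative_sequence_continuous[OF X(1), of UNIV 0] by (simp add: continuous_on_eq_continuous_at)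
    then have "(\<lambda>j. X 0 (\<gamma> / RR j)) \<longlonglongrightarrow> X 0 0" by (rule isCont_tendsto_compose[OF _ inv])
    then have cut1: "(\<lambda>j. cutoff_seq X (RR j) 0 \<gamma>) \<longlonglongrightarrow> 1" by (simp add: cutoff_seq_def X)
    have "(\<lambda>j. b \<gamma> * ?\<phi> j \<gamma>) \<longlonglongrightarrow> b \<gamma> * ((of_real (\<gamma>\<^sup>2 * exp (- 0)) * 1) * exp (2 * pi * \<i> * z * of_real \<gamma>))"
      unfolding P_def leibniz_product_0 flat_square_pos(1)[OF RR(1) g u_def] by (intro tendsto_intros u cut1)
    then show "(\<lambda>j. b \<gamma> * ?\<phi> j \<gamma>) \<longlonglongrightarrow> b \<gamma> * (of_real (\<gamma>\<^sup>2) * exp (2 * pi * \<i> * z * of_real \<gamma>))" by simp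
  qed
  ultimately have "(\<Sum>\<^sub>\<infinity>x\<in>S. of_real (w x) * (- 2 / c x / (c x)\<^sup>2)) =
      (\<Sum>\<^sub>\<infinity>\<gamma>\<in>\<Gamma> \<inter> {0<..}. b \<gamma> * (of_real (\<gamma>\<^sup>2) * exp (2 * pi * \<i> * z * of_real \<gamma>)))"
    using LIMSEQ_unique by simp
  then show ?thesis by (simp add: c_def power2_eq_square power3_eq_cube mult_ac)
qed

lemma norm_exp_minus_one_le: "norm (exp w - 1) \<le> norm (w::complex) * exp (max 0 (Re w))"
proof -
  let ?M = "max 0 (Re w)"
  have "norm (exp w - exp 0) \<le> exp ?M * norm (w - 0)"
  proof (rule field_differentiable_bound[of "{u. Re u \<le> ?M}"])
    show "convex {u. Re u \<le> ?M}" by (rule convex_halfspace_Re_le)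
    show "(exp has_field_derivative exp u) (at u within {u. Re u \<le> ?M})" for u
      by (rule DERIV_subset[OF DERIV_exp]) simp
  qed (auto simp: norm_exp)
  then show ?thesis by (simp add: mult.commute)
qed

section \<open>The logarithmic derivative in the upper half plane\<close>

abbreviation "UHP \<equiv> {z::complex. Im z > 0}"

lemma open_UHP: "open UHP" and convex_UHP: "convex UHP" and connected_UHP: "connected UHP"
  using open_halfspace_Im_gt[of 0] convex_halfspace_Im_gt[of 0] convex_connected by auto

lemma UHP_cball:
  assumes "Im z > 0" "w \<in> cball z (Im z / 2)"
  shows "Im w \<ge> Im z / 2" "norm w \<le> 2 * norm z" "Im w > 0"
proof -
  have d: "norm (z - w) \<le> Im z / 2" using assms(2) by (simp add: dist_norm)
  have "Im z - Im w \<le> norm (z - w)" using abs_Im_le_cmod[of "z - w"] by simp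
  then show 1: "Im w \<ge> Im z / 2" using d by linarith
  then show "Im w > 0" using assms(1) by linarith
  have "norm w \<le> norm z + norm (z - w)" using norm_triangle_sub[of w z] by (simp add: norm_minus_commute)
  also have "\<dots> \<le> 2 * norm z" using d abs_Im_le_cmod[of z] by linarith
  finally show "norm w \<le> 2 * norm z" .
qed

lemma UHP_linear_of_second_deriv_zero:
  assumes F: "F holomorphic_on UHP" and 0: "\<And>z. Im z > 0 \<Longrightarrow> deriv (deriv F) z = 0"
  shows "\<exists>k0 k1. \<forall>z. Im z > 0 \<longrightarrow> F z = k0 + k1 * z"
proof -
  have F': "deriv F holomorphic_on UHP" by (rule holomorphic_deriv[OF F open_UHP])
  have "\<exists>c. \<forall>x\<in>UHP. deriv F x = c"
  proof (rule has_field_derivative_zero_constant[OF convex_UHP])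
    fix x assume x: "x \<in> UHP"
    then show "(deriv F has_field_derivative 0) (at x within UHP)"
      using holomorphic_derivI[OF F' open_UHP x] 0[of x] by (simp add: has_field_derivative_at_within)
  qed
  then obtain k1 where k1: "\<And>z. Im z > 0 \<Longrightarrow> deriv F z = k1" by auto
  have "\<exists>c. \<forall>x\<in>UHP. F x - k1 * x = c"
  proof (rule has_field_derivative_zero_constant[OF convex_UHP])
    fix x assume x: "x \<in> UHP"
    have "((\<lambda>x. F x - k1 * x) has_field_derivative (deriv F x - k1)) (at x within UHP)"
      by (auto intro!: derivative_eq_intros holomorphic_derivI[OF F open_UHP x])
    then show "((\<lambda>x. F x - k1 * x) has_field_derivative 0) (at x within UHP)"
      using k1 x by simp
  qed
  then obtain k0 where "\<And>z. Im z > 0 \<Longrightarrow> F z - k1 * z = k0" by auto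
  then have "F z = k0 + k1 * z" if "Im z > 0" for z using that by (simp add: diff_eq_eq)
  then show ?thesis by blast
qed

text \<open>All that remains of the distributions: zeros \<open>a\<close> with summable inverse squares, positive
  frequencies \<open>P\<close> with amplitudes \<open>b\<close>, and the pairing with inverse cubes.\<close>

locale one_sided_spectrum =
  fixes a :: "int \<Rightarrow> real" and P :: "real set" and b :: "real \<Rightarrow> complex"
  assumes a_nonzero: "\<And>n. a n \<noteq> 0"
    and a_summable: "(\<lambda>n. 1 / (1 + (a n)\<^sup>2)) summable_on UNIV"
    and P_pos: "\<And>\<gamma>. \<gamma> \<in> P \<Longrightarrow> \<gamma> > 0"
    and b_summable: "\<And>s. s > 0 \<Longrightarrow> (\<lambda>\<gamma>. norm (b \<gamma>) * ((1 + \<gamma>)\<^sup>2 * exp (- s * \<gamma>))) summable_on P"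
    and inverse_cubes: "\<And>z. Im z > 0 \<Longrightarrow> (\<Sum>\<^sub>\<infinity>n. - 2 / (2 * pi * \<i> * (z - of_real (a n))) ^ 3)
          = (\<Sum>\<^sub>\<infinity>\<gamma>\<in>P. b \<gamma> * (of_real (\<gamma>\<^sup>2) * exp (2 * pi * \<i> * z * of_real \<gamma>)))"
begin

lemma b_exp_summable:
  assumes "s > 0"
  shows "(\<lambda>\<gamma>. norm (b \<gamma>) * exp (- s * \<gamma>)) summable_on P"
proof (rule summable_on_comparison_test[OF b_summable[OF assms]])
  fix \<gamma> assume "\<gamma> \<in> P"
  then have "1 \<le> (1 + \<gamma>)\<^sup>2" using P_pos[of \<gamma>] by (intro one_le_power) auto
  then have "1 * exp (- s * \<gamma>) \<le> (1 + \<gamma>)\<^sup>2 * exp (- s * \<gamma>)" by (intro mult_right_mono) auto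
  then show "norm (b \<gamma>) * exp (- s * \<gamma>) \<le> norm (b \<gamma>) * ((1 + \<gamma>)\<^sup>2 * exp (- s * \<gamma>))"
    by (intro mult_left_mono) auto
qed auto

text \<open>The exponential sum \<open>E\<close> and the function \<open>H\<close>, which is the logarithmic derivative of the canonical
  product of genus one with zeros \<open>a\<close>. Frequencies below 1 are left to \<open>g\<close>: the primitive of
  \<open>2 \<pi> i E\<close> is \<open>g + high\<close>, where the terms of \<open>g\<close> are normalized at 0 because the sum of
  \<open>b \<gamma> / \<gamma>\<close> over small \<open>\<gamma>\<close> may diverge.\<close>

definition E :: "complex \<Rightarrow> complex" where
  "E z = (\<Sum>\<^sub>\<infinity>\<gamma>\<in>P. b \<gamma> * exp (2 * pi * \<i> * z * of_real \<gamma>))"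

definition high :: "complex \<Rightarrow> complex" where
  "high z = (\<Sum>\<^sub>\<infinity>\<gamma>\<in>P \<inter> {1..}. b \<gamma> * exp (2 * pi * \<i> * z * of_real \<gamma>) / of_real \<gamma>)"

definition H :: "complex \<Rightarrow> complex" where
  "H z = (\<Sum>\<^sub>\<infinity>n. 1 / (z - of_real (a n)) + 1 / of_real (a n))"

abbreviation "g \<equiv> g_sum P b"

lemma E_term_bound:
  assumes "Im z \<ge> y" "\<gamma> \<in> P"
  shows "norm (b \<gamma> * exp (2 * pi * \<i> * z * of_real \<gamma>)) \<le> norm (b \<gamma>) * exp (- (2 * pi * y) * \<gamma>)"
proof -
  have "y * \<gamma> \<le> Im z * \<gamma>" using assms P_pos[of \<gamma>] by (intro mult_right_mono) auto
  then show ?thesis using assms P_pos[of \<gamma>] by (auto simp: norm_mult norm_exp intro!: mult_left_mono)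
qed

lemma E_has_sum:
  assumes "Im z > 0"
  shows "((\<lambda>\<gamma>. b \<gamma> * exp (2 * pi * \<i> * z * of_real \<gamma>)) has_sum E z) P"
  unfolding E_def
proof (rule has_sum_infsum, rule norm_infsum_le_dominated(1))
  show "(\<lambda>\<gamma>. norm (b \<gamma>) * exp (- (2 * pi * Im z) * \<gamma>)) summable_on P"
    using assms by (intro b_exp_summable) auto
qed (use E_term_bound[of "Im z" z] in auto)

lemma E_bound:
  assumes "y > 0" "Im z \<ge> y"
  shows "norm (E z) \<le> (\<Sum>\<^sub>\<infinity>\<gamma>\<in>P. norm (b \<gamma>) * exp (- (2 * pi * y) * \<gamma>))"
  unfolding E_def
  by (rule norm_infsum_le_dominated(2)[OF b_exp_summable]) (use assms E_term_bound[of y z] in auto)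

lemma E_holomorphic: "E holomorphic_on UHP"
  and E_second_deriv: "Im z > 0 \<Longrightarrow> deriv (deriv E) z =
     (\<Sum>\<^sub>\<infinity>\<gamma>\<in>P. (2 * pi * \<i> * of_real \<gamma>)\<^sup>2 * (b \<gamma> * exp (2 * pi * \<i> * z * of_real \<gamma>)))"
proof -
  let ?e = "\<lambda>k \<gamma> z. (2 * pi * \<i> * of_real \<gamma>) ^ k * (b \<gamma> * exp (2 * pi * \<i> * z * of_real \<gamma>))"
  have hol: "?e k \<gamma> holomorphic_on UHP" for k \<gamma> by (intro holomorphic_intros)
  have der: "deriv (?e k \<gamma>) z = ?e (Suc k) \<gamma> z" for k \<gamma> z
    by (rule DERIV_imp_deriv) (auto intro!: derivative_eq_intros)
  have bd: "\<exists>r>0. \<exists>M. cball z r \<subseteq> UHP \<and> M summable_on P \<and> (\<forall>\<gamma>\<in>P. \<forall>w\<in>cball z r. norm (?e k \<gamma> w) \<le> M \<gamma>)"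
    if z: "z \<in> UHP" and k: "k \<le> 2" for z k
  proof (intro exI conjI ballI)
    show "Im z / 2 > 0" using z by simp
    show "cball z (Im z / 2) \<subseteq> UHP" using UHP_cball(3)[of z] z by auto
    show "(\<lambda>\<gamma>. norm (b \<gamma>) * ((1 + \<gamma>)\<^sup>2 * exp (- (pi * Im z) * \<gamma>)) * (2 * pi) ^ k) summable_on P"
      by (rule summable_on_cmult_left, rule b_summable) (use z in auto)
    fix \<gamma> w assume g: "\<gamma> \<in> P" and w: "w \<in> cball z (Im z / 2)"
    have pos: "\<gamma> > 0" using P_pos g by auto
    have "\<gamma> ^ k \<le> (1 + \<gamma>) ^ k" using pos by (intro power_mono) auto
    also have "\<dots> \<le> (1 + \<gamma>)\<^sup>2" using pos k by (intro power_increasing) auto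
    finally have gk: "\<gamma> ^ k \<le> (1 + \<gamma>)\<^sup>2" .
    have z': "Im z > 0" using z by simp
    have t: "norm (b \<gamma> * exp (2 * pi * \<i> * w * of_real \<gamma>)) \<le> norm (b \<gamma>) * exp (- (2 * pi * (Im z / 2)) * \<gamma>)"
      by (rule E_term_bound[OF UHP_cball(1)[OF z' w] g])
    have "norm (?e k \<gamma> w) = (2 * pi) ^ k * \<gamma> ^ k * norm (b \<gamma> * exp (2 * pi * \<i> * w * of_real \<gamma>))"
      using pos by (simp add: norm_mult norm_power power_mult_distrib)
    also have "\<dots> \<le> (2 * pi) ^ k * (1 + \<gamma>)\<^sup>2 * (norm (b \<gamma>) * exp (- (2 * pi * (Im z / 2)) * \<gamma>))"
      by (rule mult_mono[OF mult_left_mono[OF gk] t]) auto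
    finally show "norm (?e k \<gamma> w) \<le> norm (b \<gamma>) * ((1 + \<gamma>)\<^sup>2 * exp (- (pi * Im z) * \<gamma>)) * (2 * pi) ^ k"
      by (simp add: mult_ac)
  qed
  have H: "(\<lambda>z. \<Sum>\<^sub>\<infinity>\<gamma>\<in>P. ?e k \<gamma> z) holomorphic_on UHP"
    and S: "\<And>z. z \<in> UHP \<Longrightarrow> ((\<lambda>\<gamma>. deriv (?e k \<gamma>) z) has_sum deriv (\<lambda>z. \<Sum>\<^sub>\<infinity>\<gamma>\<in>P. ?e k \<gamma> z) z) P"
    if "k \<le> 2" for k
    using holomorphic_infsum[OF open_UHP hol bd[OF _ that]] by auto
  have E0: "E = (\<lambda>z. \<Sum>\<^sub>\<infinity>\<gamma>\<in>P. ?e 0 \<gamma> z)" by (simp add: E_def[abs_def])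
  show "E holomorphic_on UHP" unfolding E0 by (rule H) simp
  have d: "deriv (\<lambda>z. \<Sum>\<^sub>\<infinity>\<gamma>\<in>P. ?e k \<gamma> z) z = (\<Sum>\<^sub>\<infinity>\<gamma>\<in>P. ?e (Suc k) \<gamma> z)" if "k \<le> 2" "z \<in> UHP" for k z
    using infsumI[OF S[OF that]] unfolding der by simp
  show "deriv (deriv E) z = (\<Sum>\<^sub>\<infinity>\<gamma>\<in>P. (2 * pi * \<i> * of_real \<gamma>)\<^sup>2 * (b \<gamma> * exp (2 * pi * \<i> * z * of_real \<gamma>)))"
    if z: "Im z > 0"
  proof -
    have "deriv (deriv E) z = deriv (\<lambda>z. \<Sum>\<^sub>\<infinity>\<gamma>\<in>P. ?e (Suc 0) \<gamma> z) z"
      unfolding E0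
    proof (rule complex_derivative_transform_within_open[OF _ _ open_UHP])
      show "deriv (\<lambda>z. \<Sum>\<^sub>\<infinity>\<gamma>\<in>P. ?e 0 \<gamma> z) holomorphic_on UHP"
        by (intro holomorphic_deriv H open_UHP) simp
      show "(\<lambda>z. \<Sum>\<^sub>\<infinity>\<gamma>\<in>P. ?e (Suc 0) \<gamma> z) holomorphic_on UHP" by (rule H) simp
    qed (use z d[of 0] in auto)
    also have "\<dots> = (\<Sum>\<^sub>\<infinity>\<gamma>\<in>P. ?e (Suc (Suc 0)) \<gamma> z)" by (rule d) (use z in auto)
    finally show ?thesis by (simp only: numeral_2_eq_2)
  qed
qed

text \<open>Discreteness of the zeros, as a consequence of the summability.\<close>

lemma finite_small: "finite {n. \<bar>a n\<bar> \<le> R}"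
proof (rule ccontr)
  assume inf: "infinite {n. \<bar>a n\<bar> \<le> R}"
  define S where "S = {n. \<bar>a n\<bar> \<le> R}"
  define I where "I = (\<Sum>\<^sub>\<infinity>n\<in>S. 1 / (1 + (a n)\<^sup>2))"
  have sS: "(\<lambda>n. 1 / (1 + (a n)\<^sup>2)) summable_on S"
    using a_summable by (rule summable_on_subset_banach) auto
  have p: "1 + R\<^sup>2 > 0" by (simp add: add_pos_nonneg)
  obtain N where N: "real N > I * (1 + R\<^sup>2)" using reals_Archimedean2 by blast
  obtain F where F: "finite F" "card F = N" "F \<subseteq> S"
    using infinite_arbitrarily_large[OF inf[folded S_def]] by blast
  have "real N * (1 / (1 + R\<^sup>2)) = (\<Sum>n\<in>F. 1 / (1 + R\<^sup>2))" using F by simp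
  also have "\<dots> \<le> (\<Sum>n\<in>F. 1 / (1 + (a n)\<^sup>2))"
  proof (rule sum_mono)
    fix n assume "n \<in> F"
    then have "\<bar>a n\<bar>\<^sup>2 \<le> R\<^sup>2" using F by (intro power_mono) (auto simp: S_def)
    then show "1 / (1 + R\<^sup>2) \<le> 1 / (1 + (a n)\<^sup>2)"
      by (intro frac_le) (auto intro: add_pos_nonneg)
  qed
  also have "\<dots> \<le> I" unfolding I_def
    by (rule finite_sum_le_infsum[OF sS]) (use F in auto)
  finally show False using N p by (simp add: field_simps)
qed

lemma inverse_square_bound:
  obtains C where "C > 0" "\<And>n. 1 / (a n)\<^sup>2 \<le> C * (1 / (1 + (a n)\<^sup>2))"
proof -
  define \<delta> where "\<delta> = Min (insert 1 ((\<lambda>n. \<bar>a n\<bar>) ` {n. \<bar>a n\<bar> \<le> 1}))"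
  have fin: "finite (insert 1 ((\<lambda>n. \<bar>a n\<bar>) ` {n. \<bar>a n\<bar> \<le> 1}))" using finite_small by auto
  have \<delta>: "\<delta> > 0" unfolding \<delta>_def by (subst Min_gr_iff[OF fin]) (use a_nonzero in auto)
  have le: "\<delta> \<le> \<bar>a n\<bar>" for n
  proof (cases "\<bar>a n\<bar> \<le> 1")
    case True
    then show ?thesis unfolding \<delta>_def by (intro Min_le[OF fin]) auto
  next
    case False
    have "\<delta> \<le> 1" unfolding \<delta>_def by (intro Min_le[OF fin]) auto
    then show ?thesis using False by linarith
  qed
  have "1 / (a n)\<^sup>2 \<le> (1 + 1 / \<delta>\<^sup>2) * (1 / (1 + (a n)\<^sup>2))" for n
  proof -
    have "\<delta>\<^sup>2 \<le> (a n)\<^sup>2" using le[of n] \<delta> by (metis less_imp_le power2_abs power_mono)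
    then have "1 \<le> (a n)\<^sup>2 / \<delta>\<^sup>2" using \<delta> by simp
    then have "1 + (a n)\<^sup>2 \<le> (1 + 1 / \<delta>\<^sup>2) * (a n)\<^sup>2" by (simp add: distrib_right)
    moreover have "(a n)\<^sup>2 > 0" "1 + (a n)\<^sup>2 > 0" using a_nonzero[of n] by (auto intro: add_pos_nonneg)
    ultimately show ?thesis by (simp add: divide_le_eq le_divide_eq mult.commute)
  qed
  then show ?thesis by (intro that[of "1 + 1 / \<delta>\<^sup>2"]) (auto intro: add_pos_nonneg)
qed

lemma inverse_square_summable_a: "(\<lambda>n. 1 / (a n)\<^sup>2) summable_on UNIV"
proof -
  obtain C where C: "C > 0" "\<And>n. 1 / (a n)\<^sup>2 \<le> C * (1 / (1 + (a n)\<^sup>2))"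
    using inverse_square_bound by blast
  have "(\<lambda>n. C * (1 / (1 + (a n)\<^sup>2))) summable_on UNIV" by (rule summable_on_cmult_right[OF a_summable])
  then show ?thesis by (rule summable_on_comparison_test) (use C in auto)
qed

lemma a_distance_bound:
  assumes "Im z > 0"
  obtains B where "B > 0" "\<And>w n. w \<in> cball z (Im z / 2) \<Longrightarrow> 1 / (norm (w - of_real (a n)))\<^sup>2 \<le> B * (1 / (1 + (a n)\<^sup>2))"
    "\<And>w n. w \<in> cball z (Im z / 2) \<Longrightarrow> 1 / norm (w - of_real (a n)) \<le> B"
proof -
  define B where "B = 2 + (1 + 2 * (2 * norm z)\<^sup>2) / (Im z / 2)\<^sup>2"
  define B' where "B' = B + 2 / Im z"
  have B: "B > 0" unfolding B_def by (intro add_pos_nonneg divide_nonneg_nonneg) auto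
  have BB: "B' \<ge> B" "B' > 0" using assms B by (auto simp: B'_def add_pos_pos)
  have 1: "1 / (norm (w - of_real (a n)))\<^sup>2 \<le> B' * (1 / (1 + (a n)\<^sup>2))" if w: "w \<in> cball z (Im z / 2)" for w n
  proof -
    note c = UHP_cball[OF assms w]
    have le: "1 + (a n)\<^sup>2 \<le> B * (norm (w - of_real (a n)))\<^sup>2"
      unfolding B_def by (rule one_plus_square_le_distance) (use c assms in auto)
    have p: "1 + (a n)\<^sup>2 > 0" by (simp add: add_pos_nonneg)
    have "w - of_real (a n) \<noteq> 0" using c by (auto simp: complex_eq_iff)
    then have "1 / (norm (w - of_real (a n)))\<^sup>2 \<le> B * (1 / (1 + (a n)\<^sup>2))"
      using le p by (simp add: divide_le_eq le_divide_eq mult.commute)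
    also have "\<dots> \<le> B' * (1 / (1 + (a n)\<^sup>2))" using BB p by (intro mult_right_mono) auto
    finally show ?thesis .
  qed
  have 2: "1 / norm (w - of_real (a n)) \<le> B'" if w: "w \<in> cball z (Im z / 2)" for w n
  proof -
    have "Im z / 2 \<le> \<bar>Im (w - of_real (a n))\<bar>" using UHP_cball[OF assms w] by simp
    also have "\<dots> \<le> norm (w - of_real (a n))" by (rule abs_Im_le_cmod)
    finally have "1 / norm (w - of_real (a n)) \<le> 1 / (Im z / 2)" using assms by (intro frac_le) auto
    then show ?thesis using B by (simp add: B'_def)
  qed
  show ?thesis using that[OF BB(2) 1 2] .
qed

lemma H_term_bound:
  fixes w :: complex
  assumes "w \<noteq> of_real (a n)"
  shows "norm (1 / (w - of_real (a n)) + 1 / of_real (a n)) = norm w / (\<bar>a n\<bar> * norm (w - of_real (a n)))"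
proof -
  have "1 / (w - of_real (a n)) + 1 / of_real (a n) = w / (of_real (a n) * (w - of_real (a n)))"
    using assms a_nonzero[of n] by (simp add: field_simps)
  then show ?thesis by (simp add: norm_divide norm_mult)
qed

lemma H_term_bound':
  fixes w :: complex
  assumes "w \<noteq> of_real (a n)"
  shows "norm (1 / (w - of_real (a n)) + 1 / of_real (a n)) \<le> norm w * (1 / (a n)\<^sup>2 + 1 / (norm (w - of_real (a n)))\<^sup>2)"
proof -
  let ?u = "1 / \<bar>a n\<bar>" and ?v = "1 / norm (w - of_real (a n))"
  have "?u * ?v \<le> ?u\<^sup>2 + ?v\<^sup>2"
  proof -
    have "0 \<le> ?u * ?v" by (intro mult_nonneg_nonneg) auto
    moreover have "2 * (?u * ?v) \<le> ?u\<^sup>2 + ?v\<^sup>2" using sum_squares_bound[of ?u ?v] by (simp only: mult.assoc)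
    ultimately show ?thesis by linarith
  qed
  then have "norm w * (?u * ?v) \<le> norm w * (?u\<^sup>2 + ?v\<^sup>2)" by (intro mult_left_mono) auto
  then show ?thesis unfolding H_term_bound[OF assms] by (simp add: power_divide)
qed

lemma H_holomorphic: "H holomorphic_on UHP"
  and H_has_sum: "Im z > 0 \<Longrightarrow> ((\<lambda>n. 1 / (z - of_real (a n)) + 1 / of_real (a n)) has_sum H z) UNIV"
  and H_deriv: "Im z > 0 \<Longrightarrow> ((\<lambda>n. - 1 / (z - of_real (a n))\<^sup>2) has_sum deriv H z) UNIV"
  and H_second_deriv: "Im z > 0 \<Longrightarrow> ((\<lambda>n. 2 / (z - of_real (a n)) ^ 3) has_sum deriv (deriv H) z) UNIV"
proof -
  let ?f = "\<lambda>n z. 1 / (z - of_real (a n)) + 1 / of_real (a n)"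
  let ?f1 = "\<lambda>n z. - 1 / (z - complex_of_real (a n))\<^sup>2"
  have ne: "z \<noteq> of_real (a n)" if "z \<in> UHP" for z n using that by auto
  have hol: "?f n holomorphic_on UHP" "?f1 n holomorphic_on UHP" for n
    using ne by (auto intro!: holomorphic_intros)
  have der: "deriv (?f n) z = ?f1 n z" "deriv (?f1 n) z = 2 / (z - of_real (a n)) ^ 3" if "z \<in> UHP" for n z
  proof -
    have z: "z - of_real (a n) \<noteq> 0" using ne[OF that] by auto
    show "deriv (?f n) z = ?f1 n z"
      by (rule DERIV_imp_deriv) (use z in \<open>auto intro!: derivative_eq_intros simp: power2_eq_square\<close>)
    show "deriv (?f1 n) z = 2 / (z - of_real (a n)) ^ 3"
      by (rule DERIV_imp_deriv)
         (use z in \<open>auto intro!: derivative_eq_intros simp: power2_eq_square power3_eq_cube divide_simps\<close>)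
  qed
  have bd: "\<exists>r>0. \<exists>M. cball z r \<subseteq> UHP \<and> M summable_on UNIV \<and> (\<forall>n\<in>UNIV. \<forall>w\<in>cball z r. norm (?f n w) \<le> M n)"
    and bd1: "\<exists>r>0. \<exists>M. cball z r \<subseteq> UHP \<and> M summable_on UNIV \<and> (\<forall>n\<in>UNIV. \<forall>w\<in>cball z r. norm (?f1 n w) \<le> M n)"
    if z: "z \<in> UHP" for z
  proof -
    have z': "Im z > 0" using z by simp
    obtain B where B: "B > 0" "\<And>w n. w \<in> cball z (Im z / 2) \<Longrightarrow> 1 / (norm (w - of_real (a n)))\<^sup>2 \<le> B * (1 / (1 + (a n)\<^sup>2))"
      by (rule a_distance_bound[OF z']) blast
    have sub: "cball z (Im z / 2) \<subseteq> UHP" using UHP_cball(3)[OF z'] by auto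
    have Bs: "(\<lambda>n. B * (1 / (1 + (a n)\<^sup>2))) summable_on UNIV" by (rule summable_on_cmult_right[OF a_summable])
    show "\<exists>r>0. \<exists>M. cball z r \<subseteq> UHP \<and> M summable_on UNIV \<and> (\<forall>n\<in>UNIV. \<forall>w\<in>cball z r. norm (?f1 n w) \<le> M n)"
      using z' sub Bs B(2) by (intro exI[of _ "Im z / 2"] exI[of _ "\<lambda>n. B * (1 / (1 + (a n)\<^sup>2))"] conjI ballI)
        (auto simp: norm_divide norm_power)
    have "(\<lambda>n. 2 * norm z * (1 / (a n)\<^sup>2 + B * (1 / (1 + (a n)\<^sup>2)))) summable_on UNIV"
      by (intro summable_on_cmult_right summable_on_add inverse_square_summable_a Bs)
    moreover have "norm (?f n w) \<le> 2 * norm z * (1 / (a n)\<^sup>2 + B * (1 / (1 + (a n)\<^sup>2)))" if w: "w \<in> cball z (Im z / 2)" for n w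
    proof -
      have "norm (?f n w) \<le> norm w * (1 / (a n)\<^sup>2 + 1 / (norm (w - of_real (a n)))\<^sup>2)"
        by (rule H_term_bound') (use sub w in auto)
      also have "\<dots> \<le> 2 * norm z * (1 / (a n)\<^sup>2 + B * (1 / (1 + (a n)\<^sup>2)))"
        by (intro mult_mono add_left_mono B w UHP_cball[OF z']) auto
      finally show ?thesis .
    qed
    ultimately show "\<exists>r>0. \<exists>M. cball z r \<subseteq> UHP \<and> M summable_on UNIV \<and> (\<forall>n\<in>UNIV. \<forall>w\<in>cball z r. norm (?f n w) \<le> M n)"
      using z' sub by (intro exI[of _ "Im z / 2"] exI conjI ballI) (assumption | simp)+
  qed
  have H0: "H = (\<lambda>z. \<Sum>\<^sub>\<infinity>n. ?f n z)" by (simp add: H_def[abs_def])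
  note h0 = holomorphic_infsum[OF open_UHP hol(1) bd, folded H0]
  show "H holomorphic_on UHP" by (rule h0(1))
  show H1: "((\<lambda>n. - 1 / (z - of_real (a n))\<^sup>2) has_sum deriv H z) UNIV" if "Im z > 0" for z
    using h0(2)[of z] that der(1)[of z] by simp
  show "((\<lambda>n. 1 / (z - of_real (a n)) + 1 / of_real (a n)) has_sum H z) UNIV" if "Im z > 0" for z
  proof -
    have "z \<in> UHP" using that by simp
    from bd[OF this] have "(\<lambda>n. ?f n z) summable_on UNIV"
    proof (elim exE conjE)
      fix r M assume "0 < r" and M: "M summable_on (UNIV :: int set)"
        and le: "\<forall>n\<in>UNIV. \<forall>w\<in>cball z r. norm (?f n w) \<le> M n"
      show ?thesis
        by (rule norm_infsum_le_dominated(1)[OF M]) (use le \<open>0 < r\<close> in simp)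
    qed
    then show ?thesis unfolding H_def by (rule has_sum_infsum)
  qed
  note h1 = holomorphic_infsum[OF open_UHP hol(2) bd1]
  show "((\<lambda>n. 2 / (z - of_real (a n)) ^ 3) has_sum deriv (deriv H) z) UNIV" if z: "Im z > 0" for z
  proof -
    have "deriv (deriv H) z = deriv (\<lambda>z. \<Sum>\<^sub>\<infinity>n. ?f1 n z) z"
    proof (rule complex_derivative_transform_within_open[OF _ h1(1) open_UHP])
      show "deriv H holomorphic_on UHP" by (rule holomorphic_deriv[OF h0(1) open_UHP])
    qed (use z infsumI[OF H1] in auto)
    then show ?thesis using h1(2)[of z] der(2)[of z] z by simp
  qed
qed

definition K :: complex where
  "K = H \<i> + 2 * pi * \<i> * E \<i>"

text \<open>The pairing with inverse cubes says that \<open>H\<close> and \<open>- 2 \<pi> i E\<close> have the same second derivative, so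
  that they differ by a linear function. Dividing by \<open>z\<close> along the imaginary axis, where \<open>H z / z\<close>
  tends to 0 and \<open>E\<close> stays bounded, shows that the linear term vanishes.\<close>

lemma H_eq_E:
  assumes z0: "Im z0 > 0"
  shows "H z0 = K - 2 * pi * \<i> * E z0"
proof -
  let ?c = "2 * pi * \<i>"
  let ?F = "\<lambda>z. H z + ?c * E z"
  have F: "?F holomorphic_on UHP" by (intro holomorphic_intros H_holomorphic E_holomorphic)
  have dd: "deriv (deriv ?F) z = 0" if z: "Im z > 0" for z
  proof -
    have dH: "deriv H holomorphic_on UHP" and dE: "deriv E holomorphic_on UHP"
      by (auto intro: holomorphic_deriv H_holomorphic E_holomorphic open_UHP)
    have d1: "deriv ?F w = deriv H w + ?c * deriv E w" if "w \<in> UHP" for w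
      by (rule DERIV_imp_deriv)
         (auto intro!: derivative_eq_intros holomorphic_derivI[OF H_holomorphic open_UHP that] holomorphic_derivI[OF E_holomorphic open_UHP that])
    have "deriv (deriv ?F) z = deriv (\<lambda>w. deriv H w + ?c * deriv E w) z"
    proof (rule complex_derivative_transform_within_open[OF _ _ open_UHP])
      show "deriv ?F holomorphic_on UHP" by (rule holomorphic_deriv[OF F open_UHP])
      show "(\<lambda>w. deriv H w + ?c * deriv E w) holomorphic_on UHP" by (intro holomorphic_intros dH dE)
    qed (use z d1 in auto)
    also have "\<dots> = deriv (deriv H) z + ?c * deriv (deriv E) z"
      by (rule DERIV_imp_deriv)
         (use z in \<open>auto intro!: derivative_eq_intros holomorphic_derivI[OF dH open_UHP] holomorphic_derivI[OF dE open_UHP]\<close>)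
    also have "deriv (deriv E) z = ?c\<^sup>2 * (\<Sum>\<^sub>\<infinity>\<gamma>\<in>P. b \<gamma> * (of_real (\<gamma>\<^sup>2) * exp (2 * pi * \<i> * z * of_real \<gamma>)))"
      unfolding E_second_deriv[OF z]
      by (subst infsum_cmult_right'[symmetric]) (simp add: power_mult_distrib mult_ac)
    also have "(\<Sum>\<^sub>\<infinity>\<gamma>\<in>P. b \<gamma> * (of_real (\<gamma>\<^sup>2) * exp (2 * pi * \<i> * z * of_real \<gamma>)))
        = (\<Sum>\<^sub>\<infinity>n. - 2 / (2 * pi * \<i> * (z - of_real (a n))) ^ 3)"
      by (rule inverse_cubes[OF z, symmetric])
    also have "\<dots> = (- 1 / ?c ^ 3) * (\<Sum>\<^sub>\<infinity>n. 2 / (z - of_real (a n)) ^ 3)"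
    proof -
      have "- 2 / (c * w) ^ 3 = (- 1 / c ^ 3) * (2 / w ^ 3)" for c w :: complex
        by (simp add: power_mult_distrib)
      then show ?thesis by (simp only: infsum_cmult_right')
    qed
    also have "(\<Sum>\<^sub>\<infinity>n. 2 / (z - of_real (a n)) ^ 3) = deriv (deriv H) z"
      by (rule infsumI[OF H_second_deriv[OF z]])
    finally show ?thesis by (simp add: power2_eq_square power3_eq_cube)
  qed
  have "\<exists>k0 k1. \<forall>z. Im z > 0 \<longrightarrow> ?F z = k0 + k1 * z"
    by (rule UHP_linear_of_second_deriv_zero[OF F]) (rule dd)
  then obtain k0 k1 where k: "\<And>z. Im z > 0 \<Longrightarrow> ?F z = k0 + k1 * z" by auto
  define z where "z j = of_real (real (Suc j)) * \<i>" for j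
  have z: "Im (z j) > 0" "Im (z j) \<ge> 1" "z j \<noteq> 0" "norm (z j) = real (Suc j)" for j
    by (auto simp: z_def norm_mult simp del: of_nat_Suc)
  have inv: "(\<lambda>j. q / real (Suc j)) \<longlonglongrightarrow> 0" for q
    using LIMSEQ_inverse_real_of_nat[THEN tendsto_mult_right, of q] by (simp add: field_simps)
  have "(\<lambda>j. \<Sum>\<^sub>\<infinity>n. (1 / (z j - of_real (a n)) + 1 / of_real (a n)) / z j) \<longlonglongrightarrow> (\<Sum>\<^sub>\<infinity>n::int. 0)"
  proof (rule tendsto_infsum_dominated[OF inverse_square_summable_a])
    have n: "norm ((1 / (z j - of_real (a n)) + 1 / of_real (a n)) / z j) = 1 / (\<bar>a n\<bar> * norm (z j - of_real (a n)))" for j n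
    proof -
      have "z j \<noteq> of_real (a n)" using z(1)[of j] by auto
      from H_term_bound[OF this] show ?thesis using z(3)[of j] by (simp only: norm_divide[of _ "z j"]) simp
    qed
    have "norm ((1 / (z j - of_real (a n)) + 1 / of_real (a n)) / z j) \<le> 1 / (a n)\<^sup>2" for j n
    proof -
      have "\<bar>a n\<bar> \<le> norm (z j - of_real (a n))"
        using abs_Re_le_cmod[of "z j - of_real (a n)"] by (simp add: z_def)
      then have "1 / (\<bar>a n\<bar> * norm (z j - of_real (a n))) \<le> 1 / (\<bar>a n\<bar> * \<bar>a n\<bar>)"
        using a_nonzero[of n] by (intro frac_le mult_left_mono mult_pos_pos) auto
      then show ?thesis unfolding n by (simp add: power2_eq_square)
    qed
    then show "\<forall>\<^sub>F j in sequentially. \<forall>n\<in>UNIV. norm ((1 / (z j - of_real (a n)) + 1 / of_real (a n)) / z j) \<le> 1 / (a n)\<^sup>2"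
      by simp
    show "(\<lambda>j. (1 / (z j - of_real (a n)) + 1 / of_real (a n)) / z j) \<longlonglongrightarrow> 0" for n
    proof (rule Lim_null_comparison[OF always_eventually inv[of "1 / \<bar>a n\<bar>"]], rule allI)
      fix j
      have "real (Suc j) \<le> norm (z j - of_real (a n))"
        using abs_Im_le_cmod[of "z j - of_real (a n)"] by (simp add: z_def)
      then have "1 / (\<bar>a n\<bar> * norm (z j - of_real (a n))) \<le> 1 / (\<bar>a n\<bar> * real (Suc j))"
        using a_nonzero[of n] by (intro frac_le mult_left_mono mult_pos_pos) auto
      then show "norm ((1 / (z j - of_real (a n)) + 1 / of_real (a n)) / z j) \<le> 1 / \<bar>a n\<bar> / real (Suc j)"
        unfolding n by simp
    qed
  qed
  then have "(\<lambda>j. H (z j) / z j) \<longlonglongrightarrow> 0"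
    by (simp add: H_def divide_inverse infsum_cmult_left')
  moreover have "(\<lambda>j. (?c * E (z j) - k0) / z j) \<longlonglongrightarrow> 0"
  proof (rule Lim_null_comparison[OF always_eventually inv], rule allI)
    fix j
    have "norm (?c * E (z j) - k0) \<le> 2 * pi * norm (E (z j)) + norm k0"
      by (rule order_trans[OF norm_triangle_ineq4]) (simp add: norm_mult)
    also have "\<dots> \<le> 2 * pi * (\<Sum>\<^sub>\<infinity>\<gamma>\<in>P. norm (b \<gamma>) * exp (- (2 * pi * 1) * \<gamma>)) + norm k0"
      using z(2)[of j] by (intro add_right_mono mult_left_mono E_bound) auto
    finally show "norm ((?c * E (z j) - k0) / z j) \<le>
        (2 * pi * (\<Sum>\<^sub>\<infinity>\<gamma>\<in>P. norm (b \<gamma>) * exp (- (2 * pi * 1) * \<gamma>)) + norm k0) / real (Suc j)"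
      unfolding norm_divide z(4) by (intro divide_right_mono) auto
  qed
  ultimately have "(\<lambda>j. H (z j) / z j + (?c * E (z j) - k0) / z j) \<longlonglongrightarrow> 0 + 0" by (rule tendsto_add)
  moreover have "H (z j) / z j + (?c * E (z j) - k0) / z j = k1" for j
  proof -
    have "H (z j) + (?c * E (z j) - k0) = k1 * z j" using k[OF z(1)[of j]] by (simp add: algebra_simps)
    then show ?thesis using z(3)[of j] by (simp add: nonzero_eq_divide_eq flip: add_divide_distrib)
  qed
  ultimately have "k1 = 0" by (simp add: LIMSEQ_const_iff)
  then have "?F z = k0" if "Im z > 0" for z using k[OF that] by simp
  then have "?F z0 = ?F \<i>" using z0 by simp
  then show ?thesis by (simp add: K_def eq_diff_eq)
qed

end

lemma has_sum_diff:
  fixes f h :: "'i \<Rightarrow> 'a::real_normed_vector"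
  assumes "(f has_sum x) A" "(h has_sum y) A"
  shows "((\<lambda>i. f i - h i) has_sum (x - y)) A"
proof -
  have "(sum f \<longlongrightarrow> x) (finite_subsets_at_top A)" "(sum h \<longlongrightarrow> y) (finite_subsets_at_top A)"
    using assms by (simp_all add: has_sum_def)
  from tendsto_diff[OF this] have "((\<lambda>X. sum f X - sum h X) \<longlongrightarrow> x - y) (finite_subsets_at_top A)" .
  moreover have "sum (\<lambda>i. f i - h i) = (\<lambda>X. sum f X - sum h X)" by (auto simp: sum_subtractf)
  ultimately show ?thesis unfolding has_sum_def by (simp only:)
qed

context one_sided_spectrum
begin

abbreviation "low \<equiv> P \<inter> {0<..<1}"

lemma b_low_summable: "(\<lambda>\<gamma>. norm (b \<gamma>)) summable_on low"
proof -
  have "(\<lambda>\<gamma>. norm (b \<gamma>) * exp (- 1 * \<gamma>)) summable_on low"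
    by (rule summable_on_subset_banach[OF b_exp_summable]) auto
  then have "(\<lambda>\<gamma>. norm (b \<gamma>) * exp (- 1 * \<gamma>) * exp 1) summable_on low"
    by (rule summable_on_cmult_left)
  then show ?thesis
  proof (rule summable_on_comparison_test)
    fix \<gamma> assume "\<gamma> \<in> low"
    then have "1 \<le> exp (- 1 * \<gamma>) * exp 1" by (simp add: flip: exp_add)
    from mult_left_mono[OF this, of "norm (b \<gamma>)"]
    show "norm (b \<gamma>) \<le> norm (b \<gamma>) * exp (- 1 * \<gamma>) * exp 1" by (simp add: mult_ac)
  qed auto
qed

text \<open>In the closed upper half plane the exponential has modulus at most 1 and the bound is linear in \<open>z\<close>;
  this is what makes \<open>g\<close> sublinear on the real axis.\<close>

lemma g_term_bound:
  assumes "\<gamma> \<in> low"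
  shows "norm (b \<gamma> * ((exp (2 * pi * \<i> * \<gamma> * z) - 1) / \<gamma>)) \<le> norm (b \<gamma>) * (2 * pi * norm z * exp (2 * pi * norm z))"
    and "Im z \<ge> 0 \<Longrightarrow> norm (b \<gamma> * ((exp (2 * pi * \<i> * \<gamma> * z) - 1) / \<gamma>)) \<le> norm (b \<gamma>) * (2 * pi * norm z)"
proof -
  have g: "0 < \<gamma>" "\<gamma> < 1" using assms by auto
  let ?w = "2 * pi * \<i> * \<gamma> * z"
  have nw: "norm ?w = \<gamma> * (2 * pi * norm z)" using g by (simp add: norm_mult)
  have q: "norm ((exp ?w - 1) / \<gamma>) \<le> 2 * pi * norm z * exp (max 0 (Re ?w))"
  proof -
    have "norm (exp ?w - 1) \<le> \<gamma> * (2 * pi * norm z * exp (max 0 (Re ?w)))"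
      using norm_exp_minus_one_le[of ?w] unfolding nw by (simp only: mult.assoc)
    then show ?thesis using g by (simp add: norm_divide divide_le_eq mult.commute)
  qed
  have "max 0 (Re ?w) \<le> norm ?w" using complex_Re_le_cmod[of ?w] by simp
  also have "\<dots> \<le> 2 * pi * norm z" unfolding nw using g mult_right_mono[of \<gamma> 1 "2 * pi * norm z"] by simp
  finally have "2 * pi * norm z * exp (max 0 (Re ?w)) \<le> 2 * pi * norm z * exp (2 * pi * norm z)"
    by (intro mult_left_mono) auto
  with q have "norm ((exp ?w - 1) / \<gamma>) \<le> 2 * pi * norm z * exp (2 * pi * norm z)" by (rule order_trans)
  then show "norm (b \<gamma> * ((exp ?w - 1) / \<gamma>)) \<le> norm (b \<gamma>) * (2 * pi * norm z * exp (2 * pi * norm z))"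
    unfolding norm_mult[of "b \<gamma>"] by (intro mult_left_mono) auto
  show "norm (b \<gamma> * ((exp ?w - 1) / \<gamma>)) \<le> norm (b \<gamma>) * (2 * pi * norm z)" if "Im z \<ge> 0"
  proof -
    have "Re ?w \<le> 0" using that g by simp
    then have "max 0 (Re ?w) = 0" by simp
    with q have "norm ((exp ?w - 1) / \<gamma>) \<le> 2 * pi * norm z" by simp
    then show ?thesis unfolding norm_mult[of "b \<gamma>"] by (intro mult_left_mono) auto
  qed
qed

lemma g_has_sum: "((\<lambda>\<gamma>. b \<gamma> * ((exp (2 * pi * \<i> * \<gamma> * z) - 1) / \<gamma>)) has_sum g z) low"
  unfolding g_sum_def
  by (rule has_sum_infsum, rule norm_infsum_le_dominated(1)[OF summable_on_cmult_left[OF b_low_summable] g_term_bound(1)])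

lemma g_holomorphic: "g holomorphic_on UNIV"
  and g_deriv: "((\<lambda>\<gamma>. 2 * pi * \<i> * (b \<gamma> * exp (2 * pi * \<i> * z * of_real \<gamma>))) has_sum deriv g z) low"
proof -
  let ?f = "\<lambda>\<gamma> z. b \<gamma> * ((exp (2 * pi * \<i> * \<gamma> * z) - 1) / \<gamma>)"
  have hol: "?f \<gamma> holomorphic_on UNIV" if "\<gamma> \<in> low" for \<gamma>
    using that by (auto intro!: holomorphic_intros)
  have bd: "\<exists>r>0. \<exists>M. cball z r \<subseteq> UNIV \<and> M summable_on low \<and> (\<forall>\<gamma>\<in>low. \<forall>w\<in>cball z r. norm (?f \<gamma> w) \<le> M \<gamma>)" for z
  proof (intro exI conjI ballI)
    show "(0::real) < 1" by simp
    let ?R = "norm z + 1"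
    show "(\<lambda>\<gamma>. norm (b \<gamma>) * (2 * pi * ?R * exp (2 * pi * ?R))) summable_on low"
      by (rule summable_on_cmult_left[OF b_low_summable])
    fix \<gamma> w assume g: "\<gamma> \<in> low" and w: "w \<in> cball z 1"
    have "norm w \<le> ?R" using w norm_triangle_ineq2[of w z] by (simp add: dist_norm norm_minus_commute)
    then have "2 * pi * norm w * exp (2 * pi * norm w) \<le> 2 * pi * ?R * exp (2 * pi * ?R)"
      by (intro mult_mono) auto
    then have "norm (b \<gamma>) * (2 * pi * norm w * exp (2 * pi * norm w)) \<le> norm (b \<gamma>) * (2 * pi * ?R * exp (2 * pi * ?R))"
      by (intro mult_left_mono) auto
    with g_term_bound(1)[OF g, of w] show "norm (?f \<gamma> w) \<le> norm (b \<gamma>) * (2 * pi * ?R * exp (2 * pi * ?R))"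
      by linarith
  qed auto
  have g0: "g = (\<lambda>z. \<Sum>\<^sub>\<infinity>\<gamma>\<in>low. ?f \<gamma> z)" by (simp add: g_sum_def[abs_def])
  note h = holomorphic_infsum[OF open_UNIV hol bd, folded g0]
  show "g holomorphic_on UNIV" by (rule h(1))
  have "deriv (?f \<gamma>) z = 2 * pi * \<i> * (b \<gamma> * exp (2 * pi * \<i> * z * of_real \<gamma>))" if "\<gamma> \<in> low" for \<gamma>
    by (rule DERIV_imp_deriv) (use that in \<open>auto intro!: derivative_eq_intros simp: mult_ac\<close>)
  then show "((\<lambda>\<gamma>. 2 * pi * \<i> * (b \<gamma> * exp (2 * pi * \<i> * z * of_real \<gamma>))) has_sum deriv g z) low"
    using h(2)[of z] by (subst has_sum_cong[where g = "\<lambda>\<gamma>. deriv (?f \<gamma>) z"]) auto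
qed

lemma high_term_bound:
  assumes "y > 0" "Im z \<ge> y" "\<gamma> \<in> P \<inter> {1..}"
  shows "norm (b \<gamma> * exp (2 * pi * \<i> * z * of_real \<gamma>) / of_real \<gamma>) \<le> norm (b \<gamma>) * exp (- (2 * pi * y) * \<gamma>)"
proof -
  have "norm (b \<gamma> * exp (2 * pi * \<i> * z * of_real \<gamma>) / of_real \<gamma>) \<le> norm (b \<gamma> * exp (2 * pi * \<i> * z * of_real \<gamma>)) / 1"
    unfolding norm_divide by (intro divide_left_mono) (use assms in auto)
  also have "\<dots> \<le> norm (b \<gamma>) * exp (- (2 * pi * y) * \<gamma>)"
    using E_term_bound[OF assms(2), of \<gamma>] assms by simp
  finally show ?thesis .
qed

lemma high_bound:
  assumes "y > 0" "Im z \<ge> y"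
  shows "norm (high z) \<le> (\<Sum>\<^sub>\<infinity>\<gamma>\<in>P \<inter> {1..}. norm (b \<gamma>) * exp (- (2 * pi * y) * \<gamma>))"
  unfolding high_def
proof (rule norm_infsum_le_dominated(2))
  show "(\<lambda>\<gamma>. norm (b \<gamma>) * exp (- (2 * pi * y) * \<gamma>)) summable_on P \<inter> {1..}"
    by (rule summable_on_subset_banach[OF b_exp_summable]) (use assms in auto)
qed (rule high_term_bound[OF assms])

lemma high_holomorphic: "high holomorphic_on UHP"
  and high_deriv: "Im z > 0 \<Longrightarrow> ((\<lambda>\<gamma>. 2 * pi * \<i> * (b \<gamma> * exp (2 * pi * \<i> * z * of_real \<gamma>))) has_sum deriv high z) (P \<inter> {1..})"
proof -
  let ?f = "\<lambda>\<gamma> z. b \<gamma> * exp (2 * pi * \<i> * z * of_real \<gamma>) / of_real \<gamma>"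
  have hol: "?f \<gamma> holomorphic_on UHP" if "\<gamma> \<in> P \<inter> {1..}" for \<gamma>
    using that by (auto intro!: holomorphic_intros)
  have bd: "\<exists>r>0. \<exists>M. cball z r \<subseteq> UHP \<and> M summable_on (P \<inter> {1..}) \<and> (\<forall>\<gamma>\<in>P \<inter> {1..}. \<forall>w\<in>cball z r. norm (?f \<gamma> w) \<le> M \<gamma>)"
    if z: "z \<in> UHP" for z
  proof (intro exI conjI ballI)
    have z': "Im z > 0" using z by simp
    show "Im z / 2 > 0" using z by simp
    show "cball z (Im z / 2) \<subseteq> UHP" using UHP_cball(3)[of z] z by auto
    show "(\<lambda>\<gamma>. norm (b \<gamma>) * exp (- (2 * pi * (Im z / 2)) * \<gamma>)) summable_on P \<inter> {1..}"
      by (rule summable_on_subset_banach[OF b_exp_summable]) (use z in auto)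
    fix \<gamma> w assume "\<gamma> \<in> P \<inter> {1..}" "w \<in> cball z (Im z / 2)"
    then show "norm (?f \<gamma> w) \<le> norm (b \<gamma>) * exp (- (2 * pi * (Im z / 2)) * \<gamma>)"
      using z' by (intro high_term_bound UHP_cball(1)) auto
  qed
  have g0: "high = (\<lambda>z. \<Sum>\<^sub>\<infinity>\<gamma>\<in>P \<inter> {1..}. ?f \<gamma> z)" by (simp add: high_def[abs_def])
  note h = holomorphic_infsum[OF open_UHP hol bd, folded g0]
  show "high holomorphic_on UHP" by (rule h(1))
  have "deriv (?f \<gamma>) z = 2 * pi * \<i> * (b \<gamma> * exp (2 * pi * \<i> * z * of_real \<gamma>))" if "\<gamma> \<in> P \<inter> {1..}" for \<gamma> z
    by (rule DERIV_imp_deriv) (use that in \<open>auto intro!: derivative_eq_intros simp: mult_ac\<close>)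
  then show "((\<lambda>\<gamma>. 2 * pi * \<i> * (b \<gamma> * exp (2 * pi * \<i> * z * of_real \<gamma>))) has_sum deriv high z) (P \<inter> {1..})" if "Im z > 0"
    using h(2)[of z] that by (subst has_sum_cong[where g = "\<lambda>\<gamma>. deriv (?f \<gamma>) z"]) auto
qed

lemma g_high_deriv:
  assumes z: "Im z > 0"
  shows "deriv g z + deriv high z = 2 * pi * \<i> * E z"
proof -
  have "low \<union> P \<inter> {1..} = P" using P_pos by force
  moreover have "((\<lambda>\<gamma>. 2 * pi * \<i> * (b \<gamma> * exp (2 * pi * \<i> * z * of_real \<gamma>))) has_sum (deriv g z + deriv high z)) (low \<union> P \<inter> {1..})"
    by (rule has_sum_Un_disjoint[OF g_deriv high_deriv[OF z]]) auto
  ultimately have "((\<lambda>\<gamma>. 2 * pi * \<i> * (b \<gamma> * exp (2 * pi * \<i> * z * of_real \<gamma>))) has_sum (deriv g z + deriv high z)) P"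
    by (simp only:)
  from has_sum_unique[OF this has_sum_cmult_right[OF E_has_sum[OF z], of "2 * pi * \<i>"]]
  show ?thesis by simp
qed

text \<open>A primitive of \<open>\<kappa> - 2 \<pi> i E\<close>. Functions with logarithmic derivative of this form are multiples of
  \<open>exp (T \<kappa>)\<close>, and on horizontal lines \<open>T \<kappa>\<close> differs from \<open>\<kappa> z - g\<close> by the bounded function
  \<open>high\<close>: this ties \<open>g\<close> to entire functions with zeros \<open>a\<close>.\<close>

definition T :: "complex \<Rightarrow> complex \<Rightarrow> complex" where
  "T \<kappa> z = \<kappa> * z - g z - high z"

lemma T_has_derivative:
  assumes z: "Im z > 0"
  shows "(T \<kappa> has_field_derivative (\<kappa> - 2 * pi * \<i> * E z)) (at z)"
proof -
  have "((\<lambda>z. \<kappa> * z - g z - high z) has_field_derivative (\<kappa> - deriv g z - deriv high z)) (at z)"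
    by (auto intro!: derivative_eq_intros holomorphic_derivI[OF g_holomorphic open_UNIV]
          holomorphic_derivI[OF high_holomorphic open_UHP] simp: z)
  moreover have "\<kappa> - deriv g z - deriv high z = \<kappa> - 2 * pi * \<i> * E z"
    using g_high_deriv[OF z] by (simp add: diff_diff_eq)
  ultimately show ?thesis by (simp add: T_def[abs_def])
qed

lemma exponential_representation:
  assumes F: "F holomorphic_on UHP" and nz: "\<And>z. Im z > 0 \<Longrightarrow> F z \<noteq> 0"
    and log: "\<And>z. Im z > 0 \<Longrightarrow> deriv F z = F z * (\<kappa> - 2 * pi * \<i> * E z)"
  shows "\<exists>C. C \<noteq> 0 \<and> (\<forall>z. Im z > 0 \<longrightarrow> F z = C * exp (T \<kappa> z))"
proof -
  have "\<exists>c. \<forall>z\<in>UHP. F z * exp (- T \<kappa> z) = c"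
  proof (rule has_field_derivative_zero_constant[OF convex_UHP])
    fix z assume z: "z \<in> UHP"
    then have z': "Im z > 0" by simp
    note dF = holomorphic_derivI[OF F open_UHP z] and dT = T_has_derivative[OF z', of \<kappa>]
    have "((\<lambda>z. F z * exp (- T \<kappa> z)) has_field_derivative
        (deriv F z * exp (- T \<kappa> z) + (exp (- T \<kappa> z) * (- (\<kappa> - 2 * pi * \<i> * E z))) * F z)) (at z)"
      by (rule DERIV_mult[OF dF DERIV_chain2[OF DERIV_exp DERIV_minus[OF dT]]])
    moreover have "deriv F z * exp (- T \<kappa> z) + (exp (- T \<kappa> z) * (- (\<kappa> - 2 * pi * \<i> * E z))) * F z = 0"
      unfolding log[OF z'] by (simp only: mult_minus_right mult_minus_left mult_ac) simp
    ultimately have "((\<lambda>z. F z * exp (- T \<kappa> z)) has_field_derivative 0) (at z)" by (simp only:)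
    then show "((\<lambda>z. F z * exp (- T \<kappa> z)) has_field_derivative 0) (at z within UHP)"
      by (rule has_field_derivative_at_within)
  qed
  then obtain c where c: "\<And>z. Im z > 0 \<Longrightarrow> F z * exp (- T \<kappa> z) = c" by auto
  have "F z = c * exp (T \<kappa> z)" if "Im z > 0" for z
    using c[OF that] by (simp add: exp_minus field_simps)
  moreover have "c \<noteq> 0" using c[of \<i>] nz[of \<i>] by auto
  ultimately show ?thesis by auto
qed

text \<open>Moving up from the real axis changes \<open>g\<close> by an amount that depends on the height only, whether or
  not \<open>g\<close> is bounded.\<close>

lemma g_vertical:
  assumes "y \<ge> 0"
  shows "norm (g (of_real x + \<i> * of_real y) - g (of_real x)) \<le> (\<Sum>\<^sub>\<infinity>\<gamma>\<in>low. norm (b \<gamma>) * ((1 - exp (- 2 * pi * y * \<gamma>)) / \<gamma>))"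
    and "(\<lambda>\<gamma>. norm (b \<gamma>) * ((1 - exp (- 2 * pi * y * \<gamma>)) / \<gamma>)) summable_on low"
proof -
  have le: "0 \<le> (1 - exp (- 2 * pi * y * \<gamma>)) / \<gamma>" "(1 - exp (- 2 * pi * y * \<gamma>)) / \<gamma> \<le> 2 * pi * y" if "\<gamma> \<in> low" for \<gamma>
  proof -
    have g: "\<gamma> > 0" using that by auto
    show "0 \<le> (1 - exp (- 2 * pi * y * \<gamma>)) / \<gamma>" using g assms by simp
    have "1 - exp (- 2 * pi * y * \<gamma>) \<le> 2 * pi * y * \<gamma>"
      using exp_ge_add_one_self[of "- 2 * pi * y * \<gamma>"] by simp
    then show "(1 - exp (- 2 * pi * y * \<gamma>)) / \<gamma> \<le> 2 * pi * y" using g by (simp add: divide_le_eq)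
  qed
  show s: "(\<lambda>\<gamma>. norm (b \<gamma>) * ((1 - exp (- 2 * pi * y * \<gamma>)) / \<gamma>)) summable_on low"
  proof (rule summable_on_comparison_test[OF summable_on_cmult_left[OF b_low_summable, of "2 * pi * y"]])
    fix \<gamma> assume \<gamma>: "\<gamma> \<in> low"
    show "norm (b \<gamma>) * ((1 - exp (- 2 * pi * y * \<gamma>)) / \<gamma>) \<le> norm (b \<gamma>) * (2 * pi * y)"
      by (rule mult_left_mono[OF le(2)[OF \<gamma>] norm_ge_zero])
    show "0 \<le> norm (b \<gamma>) * ((1 - exp (- 2 * pi * y * \<gamma>)) / \<gamma>)"
      by (rule mult_nonneg_nonneg[OF norm_ge_zero le(1)[OF \<gamma>]])
  qed
  have "((\<lambda>\<gamma>. b \<gamma> * ((exp (2 * pi * \<i> * \<gamma> * (of_real x + \<i> * of_real y)) - 1) / \<gamma>)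
      - b \<gamma> * ((exp (2 * pi * \<i> * \<gamma> * of_real x) - 1) / \<gamma>)) has_sum
      (g (of_real x + \<i> * of_real y) - g (of_real x))) low"
    by (intro has_sum_diff g_has_sum)
  from infsumI[OF this, symmetric] show "norm (g (of_real x + \<i> * of_real y) - g (of_real x))
      \<le> (\<Sum>\<^sub>\<infinity>\<gamma>\<in>low. norm (b \<gamma>) * ((1 - exp (- 2 * pi * y * \<gamma>)) / \<gamma>))"
  proof (rule ssubst, intro norm_infsum_le_dominated(2)[OF s])
    fix \<gamma> assume g: "\<gamma> \<in> low"
    let ?u = "exp (2 * pi * \<i> * \<gamma> * of_real x)"
    have "exp (2 * pi * \<i> * \<gamma> * (of_real x + \<i> * of_real y)) = ?u * of_real (exp (- 2 * pi * y * \<gamma>))"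
    proof -
      have "2 * pi * \<i> * \<gamma> * (of_real x + \<i> * of_real y) = 2 * pi * \<i> * \<gamma> * of_real x + complex_of_real (- 2 * pi * y * \<gamma>)"
        by (simp add: algebra_simps)
      then show ?thesis by (simp only: exp_add exp_of_real)
    qed
    then have "b \<gamma> * ((exp (2 * pi * \<i> * \<gamma> * (of_real x + \<i> * of_real y)) - 1) / \<gamma>) - b \<gamma> * ((?u - 1) / \<gamma>)
        = - (b \<gamma> * (?u * of_real ((1 - exp (- 2 * pi * y * \<gamma>)) / \<gamma>)))"
      using g by (simp add: field_simps)
    also have "norm \<dots> = norm (b \<gamma>) * ((1 - exp (- 2 * pi * y * \<gamma>)) / \<gamma>)"
    proof -
      have "norm ?u = 1" by (simp add: norm_exp)
      then show ?thesis
        by (simp only: norm_minus_cancel norm_mult norm_of_real abs_of_nonneg[OF le(1)[OF g]] mult_1_left)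
    qed
    finally show "norm (b \<gamma> * ((exp (2 * pi * \<i> * \<gamma> * (of_real x + \<i> * of_real y)) - 1) / \<gamma>) - b \<gamma> * ((?u - 1) / \<gamma>))
        \<le> norm (b \<gamma>) * ((1 - exp (- 2 * pi * y * \<gamma>)) / \<gamma>)" by simp
  qed
qed

lemma g_sublinear: "((\<lambda>t::real. g (of_real (t * x)) / of_real t) \<longlongrightarrow> 0) at_top"
proof -
  let ?f = "\<lambda>(t::real) \<gamma>. b \<gamma> * ((exp (2 * pi * \<i> * \<gamma> * of_real (t * x)) - 1) / \<gamma>) / of_real t"
  have "((\<lambda>t. \<Sum>\<^sub>\<infinity>\<gamma>\<in>low. ?f t \<gamma>) \<longlongrightarrow> (\<Sum>\<^sub>\<infinity>\<gamma>\<in>low. 0)) at_top"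
  proof (rule tendsto_infsum_dominated)
    show "(\<lambda>\<gamma>. norm (b \<gamma>) * (2 * pi * \<bar>x\<bar>)) summable_on low"
      by (rule summable_on_cmult_left[OF b_low_summable])
    show "\<forall>\<^sub>F t in at_top. \<forall>\<gamma>\<in>low. norm (?f t \<gamma>) \<le> norm (b \<gamma>) * (2 * pi * \<bar>x\<bar>)"
      using eventually_gt_at_top[of 0]
    proof eventually_elim
      case (elim t)
      show ?case
      proof
        fix \<gamma> assume "\<gamma> \<in> low"
        from g_term_bound(2)[OF this, of "of_real (t * x)"]
        have "norm (b \<gamma> * ((exp (2 * pi * \<i> * \<gamma> * of_real (t * x)) - 1) / \<gamma>)) \<le> norm (b \<gamma>) * (2 * pi * \<bar>x\<bar>) * t"
          using elim by (simp add: norm_mult abs_mult mult_ac)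
        from pos_divide_le_eq[OF elim, THEN iffD2, OF this]
        show "norm (?f t \<gamma>) \<le> norm (b \<gamma>) * (2 * pi * \<bar>x\<bar>)"
          using elim by (simp only: norm_divide[of _ "of_real t"] norm_of_real abs_of_pos)
      qed
    qed
    fix \<gamma> assume "\<gamma> \<in> low"
    then have g: "\<gamma> > 0" by auto
    have "((\<lambda>t::real. norm (b \<gamma>) * (2 / \<gamma>) / t) \<longlongrightarrow> 0) at_top"
      by (rule tendsto_divide_0[OF tendsto_const filterlim_at_top_imp_at_infinity[OF filterlim_ident]])
    then show "((\<lambda>t. ?f t \<gamma>) \<longlongrightarrow> 0) at_top"
    proof (rule Lim_null_comparison[rotated])
      show "\<forall>\<^sub>F t in at_top. norm (?f t \<gamma>) \<le> norm (b \<gamma>) * (2 / \<gamma>) / t"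
        using eventually_gt_at_top[of 0]
      proof eventually_elim
        case (elim t)
        have "norm (exp (2 * pi * \<i> * \<gamma> * of_real (t * x)) - 1) \<le> 2"
          by (rule order_trans[OF norm_triangle_ineq4]) (simp add: norm_exp)
        then have "norm (b \<gamma>) * (norm (exp (2 * pi * \<i> * \<gamma> * of_real (t * x)) - 1) / \<gamma>) / t \<le> norm (b \<gamma>) * (2 / \<gamma>) / t"
          using g elim by (intro divide_right_mono mult_left_mono) auto
        then show ?case using g elim by (simp add: norm_mult norm_divide)
      qed
    qed
  qed
  moreover have "(\<Sum>\<^sub>\<infinity>\<gamma>\<in>low. ?f t \<gamma>) = g (of_real (t * x)) / of_real t" for t
    unfolding g_sum_def divide_inverse[of _ "of_real t"] by (rule infsum_cmult_left')
  ultimately show ?thesis by simp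
qed

end

section \<open>Entire functions of exponential growth with the given zeros\<close>

text \<open>The Borel-Caratheodory inequality for the half radius: \<open>w / (2 A - w)\<close> maps the half plane
  \<open>Re w < A\<close> into the unit disc, and the lemma of Schwarz applies.\<close>

lemma Borel_Caratheodory_half:
  assumes L: "L holomorphic_on ball 0 R" and R: "R > 0" and L0: "L 0 = 0"
    and Re: "\<And>z. norm z < R \<Longrightarrow> Re (L z) < A" and z: "norm z \<le> R / 2"
  shows "norm (L z) \<le> 2 * A"
proof -
  have A: "A > 0" using Re[of 0] R L0 by simp
  have ne: "2 * of_real A - L w \<noteq> 0" if "norm w < R" for w
    using Re[OF that] A by (auto simp: complex_eq_iff)
  define \<phi> where "\<phi> w = L (of_real R * w) / (2 * of_real A - L (of_real R * w))" for w
  have nR: "norm (of_real R * w) < R" if "norm w < 1" for w :: complex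
    using that R by (simp add: norm_mult)
  have "norm (\<phi> (z / of_real R)) \<le> norm (z / of_real R)"
  proof (rule Schwarz_Lemma(1))
    have "L \<circ> (\<lambda>w. of_real R * w) holomorphic_on ball 0 1"
      by (rule holomorphic_on_compose_gen[OF _ L]) (use nR in \<open>auto intro!: holomorphic_intros\<close>)
    then show "\<phi> holomorphic_on ball 0 1"
      unfolding \<phi>_def o_def using ne nR by (intro holomorphic_intros) auto
    show "\<phi> 0 = 0" by (simp add: \<phi>_def L0)
    fix w :: complex assume w: "norm w < 1"
    let ?D = "L (of_real R * w)"
    have "A * Re ?D < A * A" using Re[OF nR[OF w]] A by simp
    then have "(norm ?D)\<^sup>2 < (norm (2 * of_real A - ?D))\<^sup>2"
      unfolding cmod_power2 by (simp add: power2_eq_square algebra_simps)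
    then have "norm ?D < norm (2 * of_real A - ?D)" by (rule power_less_imp_less_base) simp
    then show "norm (\<phi> w) < 1" using ne[OF nR[OF w]] by (simp add: \<phi>_def norm_divide)
  next
    show "norm (z / of_real R) < 1" using z R by (simp add: norm_divide)
  qed
  then have "norm (L z) / norm (2 * of_real A - L z) \<le> norm z / R"
    using R by (simp add: \<phi>_def norm_divide)
  also have "\<dots> \<le> 1 / 2" using z R by (simp add: field_simps)
  finally have "norm (L z) / norm (2 * of_real A - L z) \<le> 1 / 2" .
  moreover have "norm (2 * of_real A - L z) > 0" using ne[of z] z R by simp
  ultimately have "norm (L z) \<le> norm (2 * of_real A - L z) / 2" by (simp add: divide_le_eq)
  also have "norm (2 * of_real A - L z) \<le> 2 * A + norm (L z)"
    by (rule order_trans[OF norm_triangle_ineq4]) (use A in \<open>simp add: norm_mult\<close>)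
  finally show ?thesis by simp
qed

lemma entire_nonzero_frequently:
  assumes k: "k holomorphic_on UNIV" and "k w \<noteq> 0"
  shows "\<exists>\<^sub>F z in at c. k z \<noteq> 0"
proof (rule ccontr)
  assume "\<not> (\<exists>\<^sub>F z in at c. k z \<noteq> 0)"
  then have "\<forall>\<^sub>F z in at c. k z = 0" by (simp add: not_frequently)
  then obtain d where d: "d > 0" "\<And>z. z \<noteq> c \<Longrightarrow> dist z c < d \<Longrightarrow> k z = 0"
    by (auto simp: eventually_at)
  have "c + of_real (d / 2) \<in> ball c d - {c}" using d(1) by (simp add: dist_norm)
  then have "ball c d - {c} \<noteq> {}" by blast
  then have "k w = 0"
    by (rule analytic_continuation_open[of "ball c d - {c}" UNIV k "\<lambda>_. 0" w, rotated 2])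
       (use k d in \<open>auto simp: dist_commute\<close>)
  with assms(2) show False by contradiction
qed

lemma zorder_linear_factor:
  assumes "c \<noteq> 0"
  shows "zorder (\<lambda>z. 1 - z / c) z = (if z = c then 1 else 0)"
proof (cases "z = c")
  case True
  have "zorder (\<lambda>z. 1 - z / c) c = 1"
    by (rule zorder_eqI[of UNIV c "\<lambda>_. - 1 / c"]) (use assms in \<open>auto simp: field_simps\<close>)
  then show ?thesis using True by simp
next
  case False
  have "zorder (\<lambda>z. 1 - z / c) z = 0"
    by (rule zorder_eq_0I) (use False assms in \<open>auto intro!: analytic_intros\<close>)
  then show ?thesis using False by simp
qed

lemma entire_divide_zero:
  assumes k: "k holomorphic_on UNIV" and "k c = 0" "c \<noteq> 0"
  shows "\<exists>q. q holomorphic_on UNIV \<and> (\<forall>z. k z = q z * (1 - z / c))"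
proof (intro exI conjI allI)
  let ?q = "\<lambda>z. - c * (if z = c then deriv k c else (k z - k c) / (z - c))"
  show "?q holomorphic_on UNIV"
    by (intro holomorphic_intros pole_lemma[OF k]) auto
  show "k z = ?q z * (1 - z / c)" for z
    using assms by (auto simp: field_simps)
qed

text \<open>The orders of the zeros are given as cardinalities of fibres of an enumeration; dividing by the
  factor of one index removes that index from its fibre.\<close>

lemma divide_finitely_many_zeros:
  fixes a :: "int \<Rightarrow> real"
  assumes h: "h holomorphic_on UNIV" "h w \<noteq> 0" and zo: "\<And>z. zorder h z = int (card {n. complex_of_real (a n) = z})"
    and a: "\<And>n. a n \<noteq> 0" and fib: "\<And>z. finite {n. complex_of_real (a n) = z}" and F: "finite F"
  shows "\<exists>k. k holomorphic_on UNIV \<and> (\<forall>z. h z = k z * (\<Prod>n\<in>F. 1 - z / of_real (a n))) \<and>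
     (\<forall>z. zorder k z = int (card {n. n \<notin> F \<and> complex_of_real (a n) = z}))"
  using F
proof (induction F rule: finite_induct)
  case empty
  then show ?case using h zo by (intro exI[of _ h]) auto
next
  case (insert m F)
  then obtain k where k: "k holomorphic_on UNIV" "\<And>z. h z = k z * (\<Prod>n\<in>F. 1 - z / of_real (a n))"
    and zk: "\<And>z. zorder k z = int (card {n. n \<notin> F \<and> complex_of_real (a n) = z})" by blast
  let ?c = "complex_of_real (a m)"
  have kw: "k w \<noteq> 0" using h(2) k(2)[of w] by auto
  have fin: "finite {n. n \<notin> F \<and> complex_of_real (a n) = z}" for z
    by (rule finite_subset[OF _ fib[of z]]) auto
  have "card {n. n \<notin> F \<and> complex_of_real (a n) = ?c} > 0"
    using fin[of ?c] insert.hyps by (subst card_gt_0_iff) auto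
  then have "zorder k ?c > 0" using zk by simp
  then have "k ?c = 0"
    using zorder_pos_iff[OF k(1) open_UNIV UNIV_I entire_nonzero_frequently[OF k(1) kw]] by simp
  then obtain q where q: "q holomorphic_on UNIV" "\<And>z. k z = q z * (1 - z / ?c)"
    using entire_divide_zero[OF k(1), of ?c] a by auto
  have qw: "q w \<noteq> 0" using kw q(2)[of w] by auto
  have zq: "zorder q z = int (card {n. n \<notin> insert m F \<and> complex_of_real (a n) = z})" for z
  proof -
    have lin: "(\<lambda>z. 1 - z / ?c) holomorphic_on UNIV" using a by (auto intro!: holomorphic_intros)
    have "zorder (\<lambda>z. q z * (1 - z / ?c)) z = zorder q z + zorder (\<lambda>z. 1 - z / ?c) z"
    proof (rule zorder_mult)
      show "q meromorphic_on {z}" "(\<lambda>z. 1 - z / ?c) meromorphic_on {z}"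
        using q(1) lin by (auto intro!: analytic_on_imp_meromorphic_on holomorphic_on_imp_analytic_at[OF _ open_UNIV])
      show "\<exists>\<^sub>F z in at z. q z \<noteq> 0" by (rule entire_nonzero_frequently[OF q(1) qw])
      show "\<exists>\<^sub>F z in at z. 1 - z / ?c \<noteq> 0" by (rule entire_nonzero_frequently[OF lin, of 0]) simp
    qed
    moreover have "k = (\<lambda>z. q z * (1 - z / ?c))" using q(2) by auto
    ultimately have "zorder q z = zorder k z - (if z = ?c then 1 else 0)"
      using a by (simp add: zorder_linear_factor)
    also have "\<dots> = int (card {n. n \<notin> insert m F \<and> complex_of_real (a n) = z})"
    proof (cases "z = ?c")
      case True
      have "{n. n \<notin> insert m F \<and> complex_of_real (a n) = z} = {n. n \<notin> F \<and> complex_of_real (a n) = z} - {m}" by auto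
      moreover have "m \<in> {n. n \<notin> F \<and> complex_of_real (a n) = z}" using True insert.hyps by auto
      ultimately have "card {n. n \<notin> insert m F \<and> complex_of_real (a n) = z} = card {n. n \<notin> F \<and> complex_of_real (a n) = z} - 1"
        and "card {n. n \<notin> F \<and> complex_of_real (a n) = z} > 0"
        using fin[of z] by (auto simp: card_Diff_singleton card_gt_0_iff)
      then show ?thesis using True zk[of z] by (simp add: of_nat_diff)
    next
      case False
      then have "{n. n \<notin> insert m F \<and> complex_of_real (a n) = z} = {n. n \<notin> F \<and> complex_of_real (a n) = z}" by auto
      then show ?thesis using False zk by simp
    qed
    finally show ?thesis .
  qed
  show ?case
    by (rule exI[of _ q]) (use q zq k insert.hyps in \<open>simp add: mult.assoc\<close>)
qed

lemma prod_linear_factors_derivative: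
  fixes a :: "int \<Rightarrow> real"
  assumes "finite F" and a: "\<And>n. a n \<noteq> 0" and z: "\<And>n. z \<noteq> complex_of_real (a n)"
  shows "((\<lambda>z. \<Prod>n\<in>F. 1 - z / complex_of_real (a n)) has_field_derivative
      (\<Prod>n\<in>F. 1 - z / of_real (a n)) * (\<Sum>n\<in>F. 1 / (z - of_real (a n)))) (at z)"
  using assms(1)
proof (induction F rule: finite_induct)
  case (insert m F)
  have "((\<lambda>z. (1 - z / complex_of_real (a m)) * (\<Prod>n\<in>F. 1 - z / complex_of_real (a n))) has_field_derivative
     (- 1 / of_real (a m)) * (\<Prod>n\<in>F. 1 - z / of_real (a n)) + ((\<Prod>n\<in>F. 1 - z / of_real (a n)) * (\<Sum>n\<in>F. 1 / (z - of_real (a n)))) * (1 - z / of_real (a m))) (at z)"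
    by (rule DERIV_mult[OF _ insert.IH]) (use a in \<open>auto intro!: derivative_eq_intros\<close>)
  moreover have "(- 1 / of_real (a m)) * (\<Prod>n\<in>F. 1 - z / of_real (a n)) + ((\<Prod>n\<in>F. 1 - z / of_real (a n)) * (\<Sum>n\<in>F. 1 / (z - of_real (a n)))) * (1 - z / of_real (a m))
     = ((1 - z / of_real (a m)) * (\<Prod>n\<in>F. 1 - z / of_real (a n))) * (1 / (z - of_real (a m)) + (\<Sum>n\<in>F. 1 / (z - of_real (a n))))"
  proof -
    have "- 1 / complex_of_real (a m) = (1 - z / of_real (a m)) * (1 / (z - of_real (a m)))"
      using a[of m] z[of m] by (simp add: field_simps)
    then show ?thesis by (simp only: distrib_left mult_ac)
  qed
  ultimately show ?case
    by (simp only: prod.insert[OF insert.hyps] sum.insert[OF insert.hyps])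
qed simp

text \<open>Dividing by these factors does not increase the modulus on large circles, so the maximum principle
  carries the growth bound over to the quotient.\<close>

lemma norm_prod_linear_factors_ge_1:
  fixes a :: "int \<Rightarrow> real"
  assumes "\<And>n. n \<in> F \<Longrightarrow> \<bar>a n\<bar> \<le> R" "\<And>n. a n \<noteq> 0" "norm z \<ge> 2 * R"
  shows "norm (\<Prod>n\<in>F. 1 - z / complex_of_real (a n)) \<ge> 1"
  unfolding prod_norm[symmetric]
proof (rule prod_ge_1)
  fix n assume n: "n \<in> F"
  have "2 * \<bar>a n\<bar> \<le> norm z" using assms(1)[OF n] assms(3) by linarith
  then have "2 \<le> norm (z / complex_of_real (a n))" using assms(2)[of n] by (simp add: norm_divide le_divide_eq)
  then show "1 \<le> norm (1 - z / complex_of_real (a n))"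
    using norm_triangle_ineq2[of "z / complex_of_real (a n)" 1] by (simp add: norm_minus_commute)
qed

context one_sided_spectrum
begin

lemma finite_fibre: "finite {n. complex_of_real (a n) = z}"
proof (rule finite_subset[OF _ finite_small[of "norm z"]])
  show "{n. complex_of_real (a n) = z} \<subseteq> {n. \<bar>a n\<bar> \<le> norm z}" by auto
qed

text \<open>The quotient of \<open>h\<close> by the factors of the zeros in the disc of radius \<open>2 R\<close> has a logarithm \<open>L\<close>
  in that disc whose real part is \<open>O(R)\<close>. By Borel-Caratheodory \<open>L\<close> itself is \<open>O(R)\<close> in the disc of
  radius \<open>R\<close>, and Cauchy's inequality makes the second derivative of \<open>L\<close> of order \<open>1 / R\<close>.\<close>

lemma log_derivative_approximation:
  assumes h: "h holomorphic_on UNIV" and h0: "h w \<noteq> 0" and zo: "\<And>z. zorder h z = int (card {n. complex_of_real (a n) = z})"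
    and C: "C > 0" and growth: "\<And>z. norm (h z) \<le> C * exp (C * norm z)"
    and R: "R > 0" "norm z0 \<le> R / 2" and z0: "Im z0 > 0"
  shows "norm (deriv (\<lambda>z. deriv h z / h z) z0 + (\<Sum>n\<in>{n. \<bar>a n\<bar> \<le> 2 * R}. 1 / (z0 - of_real (a n))\<^sup>2))
      \<le> 16 * (\<bar>ln (C / norm (h 0))\<bar> + 4 * C * R + 1) / R\<^sup>2"
proof -
  define F where "F = {n. \<bar>a n\<bar> \<le> 2 * R}"
  have finF: "finite F" unfolding F_def by (rule finite_small)
  obtain k where k: "k holomorphic_on UNIV" "\<And>z. h z = k z * (\<Prod>n\<in>F. 1 - z / of_real (a n))"
    and zk: "\<And>z. zorder k z = int (card {n. n \<notin> F \<and> complex_of_real (a n) = z})"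
    using divide_finitely_many_zeros[OF h h0 zo a_nonzero finite_fibre finF] by blast
  have kw: "k w \<noteq> 0" using h0 k(2)[of w] by auto
  have knz: "k z \<noteq> 0" if z: "norm z < 2 * R" for z
  proof
    assume "k z = 0"
    then have "zorder k z > 0"
      using zorder_pos_iff[OF k(1) open_UNIV UNIV_I entire_nonzero_frequently[OF k(1) kw]] by simp
    moreover have "{n. n \<notin> F \<and> complex_of_real (a n) = z} = {}" using z by (auto simp: F_def)
    ultimately show False using zk[of z] by simp
  qed
  have h00: "h 0 = k 0" using k(2)[of 0] by simp
  have k0: "k 0 \<noteq> 0" using knz[of 0] R by simp
  obtain L0 where L0: "L0 holomorphic_on ball 0 (2 * R)" "\<And>z. z \<in> ball 0 (2 * R) \<Longrightarrow> exp (L0 z) = k z"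
  proof (rule holomorphic_logarithm_exists[of "ball 0 (2 * R)" k 0])
    show "k holomorphic_on ball 0 (2 * R)" using k(1) by (rule holomorphic_on_subset) simp
    show "k x \<noteq> 0" if "x \<in> ball 0 (2 * R)" for x using knz that by simp
  qed (use R that in auto)
  define L where "L z = L0 z - L0 0" for z
  have L: "L holomorphic_on ball 0 (2 * R)" unfolding L_def by (intro holomorphic_intros L0)
  have kL: "k z = k 0 * exp (L z)" if "norm z < 2 * R" for z
  proof -
    have "exp (L0 z) = k z" "exp (L0 0) = k 0" using L0(2)[of z] L0(2)[of 0] that R by auto
    then show ?thesis using k0 by (simp add: L_def exp_diff)
  qed
  have kb: "norm (k z) \<le> C * exp (C * (4 * R))" if z: "norm z < 4 * R" for z
  proof (rule maximum_modulus_frontier[of k "ball 0 (4 * R)"])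
    show "k holomorphic_on interior (ball 0 (4 * R))" using k(1) by (rule holomorphic_on_subset) simp
    show "continuous_on (closure (ball 0 (4 * R))) k"
      using holomorphic_on_imp_continuous_on[OF k(1)] by (rule continuous_on_subset) simp
    show "z \<in> ball 0 (4 * R)" using z by simp
    fix u assume "u \<in> frontier (ball 0 (4 * R) :: complex set)"
    then have u: "norm u = 4 * R" using R by (simp add: frontier_ball)
    have "1 \<le> norm (\<Prod>n\<in>F. 1 - u / complex_of_real (a n))"
      by (rule norm_prod_linear_factors_ge_1[of _ _ "2 * R"]) (use a_nonzero u in \<open>auto simp: F_def\<close>)
    then have "norm (k u) * 1 \<le> norm (k u) * norm (\<Prod>n\<in>F. 1 - u / complex_of_real (a n))"
      by (intro mult_left_mono) auto
    also have "\<dots> = norm (h u)" using k(2)[of u] by (simp add: norm_mult)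
    also have "\<dots> \<le> C * exp (C * (4 * R))" using growth[of u] u by simp
    finally show "norm (k u) \<le> C * exp (C * (4 * R))" by simp
  qed auto
  define A where "A = \<bar>ln (C / norm (h 0))\<bar> + 4 * C * R + 1"
  have ReL: "Re (L z) < A" if z: "norm z < 2 * R" for z
  proof -
    have "norm (k 0) * exp (Re (L z)) = norm (k z)" using kL[OF z] by (simp add: norm_mult norm_exp)
    also have "\<dots> \<le> C * exp (C * (4 * R))" by (rule kb) (use z R in auto)
    finally have "exp (Re (L z)) \<le> C / norm (h 0) * exp (4 * C * R)"
      using k0 h00 by (simp add: le_divide_eq mult_ac)
    also have "C / norm (h 0) = exp (ln (C / norm (h 0)))" using C k0 h00 by simp
    also have "\<dots> * exp (4 * C * R) < exp A"
      unfolding exp_add[symmetric] exp_less_cancel_iff A_def by linarith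
    finally show ?thesis by simp
  qed
  have Lb: "norm (L z) \<le> 2 * A" if "norm z \<le> R" for z
    by (rule Borel_Caratheodory_half[OF L]) (use R that ReL in \<open>auto simp: L_def\<close>)
  have zin: "ball z0 (R / 2) \<subseteq> ball 0 (2 * R)" "cball z0 (R / 2) \<subseteq> cball 0 R"
  proof -
    show "ball z0 (R / 2) \<subseteq> ball 0 (2 * R)"
    proof
      fix x assume "x \<in> ball z0 (R / 2)"
      then have "dist x 0 \<le> dist x z0 + dist z0 0" "dist x z0 < R / 2" using dist_triangle[of x 0 z0] by (auto simp: dist_commute)
      then show "x \<in> ball 0 (2 * R)" using R by (simp add: dist_norm)
    qed
    show "cball z0 (R / 2) \<subseteq> cball 0 R"
    proof
      fix x assume "x \<in> cball z0 (R / 2)"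
      then have "dist x 0 \<le> dist x z0 + dist z0 0" "dist x z0 \<le> R / 2" using dist_triangle[of x 0 z0] by (auto simp: dist_commute)
      then show "x \<in> cball 0 R" using R by (simp add: dist_norm)
    qed
  qed
  have "norm ((deriv ^^ 2) L z0) \<le> fact 2 * (2 * A) / (R / 2) ^ 2"
  proof (rule Cauchy_inequality)
    show "L holomorphic_on ball z0 (R / 2)" by (rule holomorphic_on_subset[OF L zin(1)])
    have "cball z0 (R / 2) \<subseteq> ball 0 (2 * R)" using zin(2) R by (auto simp: subset_iff)
    then show "continuous_on (cball z0 (R / 2)) L"
      by (rule continuous_on_subset[OF holomorphic_on_imp_continuous_on[OF L]])
    show "norm (L x) \<le> 2 * A" if "norm (z0 - x) = R / 2" for x
    proof -
      have "x \<in> cball z0 (R / 2)" using that by (simp add: dist_norm)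
      then show ?thesis using Lb[of x] zin(2) by auto
    qed
  qed (use R in auto)
  then have LL: "norm (deriv (deriv L) z0) \<le> 16 * A / R\<^sup>2"
    by (simp add: numeral_2_eq_2 power2_eq_square fact_numeral)
  define U where "U = UHP \<inter> ball 0 (2 * R)"
  have U: "open U" "z0 \<in> U" unfolding U_def using open_UHP z0 R by auto
  have ne: "z \<noteq> of_real (a n)" if "z \<in> U" for z n using that by (auto simp: U_def)
  have LU: "L holomorphic_on U" using L by (rule holomorphic_on_subset) (auto simp: U_def)
  have hd: "deriv h z / h z = deriv L z + (\<Sum>n\<in>F. 1 / (z - of_real (a n)))" if z: "z \<in> U" for z
  proof -
    let ?Q = "\<lambda>z. \<Prod>n\<in>F. 1 - z / complex_of_real (a n)" and ?S = "\<Sum>n\<in>F. 1 / (z - of_real (a n))"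
    have dL: "(L has_field_derivative deriv L z) (at z)" by (rule holomorphic_derivI[OF LU U(1) z])
    have dQ: "(?Q has_field_derivative ?Q z * ?S) (at z)"
      by (rule prod_linear_factors_derivative[OF finF a_nonzero ne[OF z]])
    have "((\<lambda>z. (k 0 * exp (L z)) * ?Q z) has_field_derivative
        (k 0 * (exp (L z) * deriv L z)) * ?Q z + (?Q z * ?S) * (k 0 * exp (L z))) (at z)"
      by (rule DERIV_mult[OF DERIV_cmult[OF DERIV_chain2[OF DERIV_exp dL]] dQ])
    then have "(h has_field_derivative
        (k 0 * (exp (L z) * deriv L z)) * ?Q z + (?Q z * ?S) * (k 0 * exp (L z))) (at z)"
    proof (rule has_field_derivative_transform_within_open[OF _ U(1) z])
      show "k 0 * exp (L x) * ?Q x = h x" if "x \<in> U" for x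
        using k(2)[of x] kL[of x] that by (simp add: U_def)
    qed
    then have "deriv h z = (k 0 * exp (L z) * ?Q z) * (deriv L z + ?S)"
      by (subst DERIV_imp_deriv, assumption) (simp add: algebra_simps)
    moreover have hz: "h z = k 0 * exp (L z) * ?Q z" using k(2)[of z] kL[of z] z by (simp add: U_def)
    moreover have "?Q z \<noteq> 0" using ne[OF z] a_nonzero finF by (auto simp: divide_eq_1_iff)
    ultimately show ?thesis using k0 by simp
  qed
  have dS: "((\<lambda>z. \<Sum>n\<in>F. 1 / (z - of_real (a n))) has_field_derivative (\<Sum>n\<in>F. - 1 / (z0 - of_real (a n))\<^sup>2)) (at z0)"
    using ne[OF U(2)] by (auto intro!: derivative_eq_intros sum.cong simp: power2_eq_square)
  have "((\<lambda>z. deriv L z + (\<Sum>n\<in>F. 1 / (z - of_real (a n)))) has_field_derivative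
      (deriv (deriv L) z0 + (\<Sum>n\<in>F. - 1 / (z0 - of_real (a n))\<^sup>2))) (at z0)"
    by (rule DERIV_add[OF holomorphic_derivI[OF holomorphic_deriv[OF LU U(1)] U] dS])
  then have "((\<lambda>z. deriv h z / h z) has_field_derivative
      (deriv (deriv L) z0 + (\<Sum>n\<in>F. - 1 / (z0 - of_real (a n))\<^sup>2))) (at z0)"
    by (rule has_field_derivative_transform_within_open[OF _ U]) (simp add: hd)
  then have "deriv (\<lambda>z. deriv h z / h z) z0 + (\<Sum>n\<in>F. 1 / (z0 - of_real (a n))\<^sup>2) = deriv (deriv L) z0"
    by (subst DERIV_imp_deriv, assumption) (simp add: sum_negf)
  with LL show ?thesis unfolding A_def F_def by simp
qed

text \<open>Hadamard's factorization in logarithmic form: letting \<open>R\<close> tend to infinity, \<open>(h' / h)'\<close> and \<open>H'\<close>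
  coincide, so \<open>h' / h\<close> is \<open>H\<close> plus a constant.\<close>

lemma finite_type_log_derivative:
  assumes h: "h holomorphic_on UNIV" and h0: "h w \<noteq> 0" and zo: "\<And>z. zorder h z = int (card {n. complex_of_real (a n) = z})"
    and growth: "exponential_growth h"
  shows "\<exists>\<kappa>. \<forall>z. Im z > 0 \<longrightarrow> h z \<noteq> 0 \<and> deriv h z = h z * (\<kappa> - 2 * pi * \<i> * E z)"
proof -
  obtain C0 where C0: "\<And>z. norm (h z) \<le> C0 * exp (C0 * norm z)"
    using growth by (auto simp: exponential_growth_def)
  define C where "C = max C0 1"
  have C: "C > 0" "C0 \<le> C" by (auto simp: C_def)
  have gr: "norm (h z) \<le> C * exp (C * norm z)" for z
  proof (rule order_trans[OF C0])
    have "C0 * exp (C0 * norm z) \<le> C * exp (C0 * norm z)" using C by (intro mult_right_mono) auto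
    also have "\<dots> \<le> C * exp (C * norm z)" using C by (intro mult_left_mono) (auto intro!: mult_right_mono)
    finally show "C0 * exp (C0 * norm z) \<le> C * exp (C * norm z)" .
  qed
  have nz: "h z \<noteq> 0" if "Im z > 0" for z
  proof
    assume "h z = 0"
    then have "zorder h z > 0"
      using zorder_pos_iff[OF h open_UNIV UNIV_I entire_nonzero_frequently[OF h h0]] by simp
    moreover have "{n. complex_of_real (a n) = z} = {}" using that by auto
    ultimately show False using zo[of z] by simp
  qed
  have dd: "deriv (\<lambda>z. deriv h z / h z) z = deriv H z" if z: "Im z > 0" for z
  proof -
    let ?F = "\<lambda>j. {n. \<bar>a n\<bar> \<le> 2 * real (Suc j)}"
    have "filterlim ?F (finite_subsets_at_top UNIV) sequentially"
      unfolding filterlim_finite_subsets_at_top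
    proof (intro allI impI)
      fix X :: "int set" assume X: "finite X \<and> X \<subseteq> UNIV"
      define N where "N = nat \<lceil>Max (insert 0 ((\<lambda>n. \<bar>a n\<bar>) ` X))\<rceil>"
      have N: "\<bar>a n\<bar> \<le> real N" if "n \<in> X" for n
      proof -
        have "\<bar>a n\<bar> \<le> Max (insert 0 ((\<lambda>n. \<bar>a n\<bar>) ` X))" using X that by (intro Max_ge) auto
        then show ?thesis unfolding N_def by linarith
      qed
      show "\<forall>\<^sub>F j in sequentially. finite (?F j) \<and> X \<subseteq> ?F j \<and> ?F j \<subseteq> UNIV"
        using eventually_ge_at_top[of N]
      proof eventually_elim
        case (elim j)
        have "\<bar>a n\<bar> \<le> 2 * real (Suc j)" if "n \<in> X" for n using N[OF that] elim by simp
        then show ?case using finite_small[of "2 * real (Suc j)"] by blast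
      qed
    qed
    moreover have "(sum (\<lambda>n. - 1 / (z - of_real (a n))\<^sup>2) \<longlongrightarrow> deriv H z) (finite_subsets_at_top UNIV)"
      using H_deriv[OF z] by (simp add: has_sum_def)
    ultimately have l1: "(\<lambda>j. \<Sum>n\<in>?F j. - 1 / (z - of_real (a n))\<^sup>2) \<longlonglongrightarrow> deriv H z"
      by (rule filterlim_compose[rotated])
    let ?G = "deriv (\<lambda>z. deriv h z / h z) z"
    define q where "q = \<bar>ln (C / norm (h 0))\<bar> + 1"
    have inv: "(\<lambda>j. 1 / real (Suc j)) \<longlonglongrightarrow> 0"
      using LIMSEQ_inverse_real_of_nat by (simp add: field_simps)
    have "(\<lambda>j. 16 * (q * (1 / real (Suc j))\<^sup>2 + 4 * C * (1 / real (Suc j)))) \<longlonglongrightarrow> 16 * (q * 0\<^sup>2 + 4 * C * 0)"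
      by (intro tendsto_intros inv)
    then have e0: "(\<lambda>j. 16 * (q * (1 / real (Suc j))\<^sup>2 + 4 * C * (1 / real (Suc j)))) \<longlonglongrightarrow> 0" by simp
    have "(\<lambda>j. ?G + (\<Sum>n\<in>?F j. 1 / (z - of_real (a n))\<^sup>2)) \<longlonglongrightarrow> 0"
    proof (rule Lim_null_comparison[OF _ e0])
      show "\<forall>\<^sub>F j in sequentially. norm (?G + (\<Sum>n\<in>?F j. 1 / (z - of_real (a n))\<^sup>2))
          \<le> 16 * (q * (1 / real (Suc j))\<^sup>2 + 4 * C * (1 / real (Suc j)))"
        using eventually_ge_at_top[of "nat \<lceil>2 * norm z\<rceil>"]
      proof eventually_elim
        case (elim j)
        have "2 * norm z \<le> real (nat \<lceil>2 * norm z\<rceil>)" by linarith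
        also have "\<dots> \<le> real j" using elim by (rule of_nat_mono)
        also have "\<dots> \<le> real (Suc j)" by simp
        finally have jz: "norm z \<le> real (Suc j) / 2" by simp
        have "norm (?G + (\<Sum>n\<in>?F j. 1 / (z - of_real (a n))\<^sup>2)) \<le> 16 * (\<bar>ln (C / norm (h 0))\<bar> + 4 * C * real (Suc j) + 1) / (real (Suc j))\<^sup>2"
          by (rule log_derivative_approximation[OF h h0 zo C(1) gr _ jz z]) simp
        also have "\<dots> = 16 * (q * (1 / real (Suc j))\<^sup>2 + 4 * C * (1 / real (Suc j)))"
          by (simp add: q_def power2_eq_square add_divide_distrib distrib_left del: of_nat_Suc)
        finally show ?case .
      qed
    qed
    then have "(\<lambda>j. ?G - (?G + (\<Sum>n\<in>?F j. 1 / (z - of_real (a n))\<^sup>2))) \<longlonglongrightarrow> ?G - 0"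
      by (intro tendsto_intros)
    then have "(\<lambda>j. \<Sum>n\<in>?F j. - 1 / (z - of_real (a n))\<^sup>2) \<longlonglongrightarrow> ?G" by (simp add: sum_negf)
    from LIMSEQ_unique[OF this l1] show ?thesis .
  qed
  let ?l = "\<lambda>z. deriv h z / h z"
  have hU: "h holomorphic_on UHP" using h by (rule holomorphic_on_subset) simp
  have lU: "?l holomorphic_on UHP"
    by (intro holomorphic_intros holomorphic_deriv[OF hU open_UHP] hU) (use nz in auto)
  have "\<exists>c. \<forall>z\<in>UHP. ?l z - H z = c"
  proof (rule has_field_derivative_zero_constant[OF convex_UHP])
    fix z assume z: "z \<in> UHP"
    have "((\<lambda>z. ?l z - H z) has_field_derivative (deriv ?l z - deriv H z)) (at z)"
      by (rule DERIV_diff[OF holomorphic_derivI[OF lU open_UHP z] holomorphic_derivI[OF H_holomorphic open_UHP z]])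
    moreover have "deriv ?l z - deriv H z = 0" using dd[of z] z by simp
    ultimately have "((\<lambda>z. ?l z - H z) has_field_derivative 0) (at z)" by (simp only:)
    then show "((\<lambda>z. ?l z - H z) has_field_derivative 0) (at z within UHP)"
      by (rule has_field_derivative_at_within)
  qed
  then obtain c where c: "\<And>z. Im z > 0 \<Longrightarrow> ?l z - H z = c" by auto
  have "deriv h z = h z * ((c + K) - 2 * pi * \<i> * E z)" if z: "Im z > 0" for z
  proof -
    have "?l z = (c + K) - 2 * pi * \<i> * E z" using c[OF z] H_eq_E[OF z] by (simp add: algebra_simps)
    then show ?thesis using nz[OF z] by (simp add: divide_eq_eq mult.commute)
  qed
  then show ?thesis using nz by blast
qed

end

section \<open>Almost periodicity makes g bounded\<close>

text \<open>Where \<open>exp (s x)\<close> stays near 1, the value \<open>s x\<close> stays near the multiples of \<open>2 \<pi> i\<close>, and by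
  continuity near one and the same multiple.\<close>

lemma continuous_logarithm_oscillation:
  fixes s :: "real \<Rightarrow> complex"
  assumes c: "continuous_on UNIV s" and near: "\<And>x. norm (exp (s x) - 1) \<le> 1 / 2"
  shows "norm (s x - s y) \<le> 10"
proof -
  let ?q = "\<lambda>x. s x - Ln (exp (s x))"
  have Re: "Re (exp (s x)) > 0" for x
    using abs_Re_le_cmod[of "exp (s x) - 1"] near[of x] by simp
  have nn: "exp (s x) \<notin> \<real>\<^sub>\<le>\<^sub>0" for x
    using Re[of x] by (auto simp: complex_nonpos_Reals_iff)
  have "?q constant_on UNIV"
  proof (rule continuous_discrete_range_constant)
    show "continuous_on UNIV ?q" using nn by (intro continuous_intros c) auto
    fix x :: real
    have "2 \<le> norm (?q y - ?q x)" if "?q y \<noteq> ?q x" for y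
    proof -
      have e1: "exp (?q x) = 1" for x by (simp add: exp_diff)
      have "exp (?q y) = exp (?q x)" unfolding e1 ..
      then obtain n :: int where n: "?q y = ?q x + (of_int (2 * n) * pi) * \<i>"
        unfolding exp_eq by blast
      then have "n \<noteq> 0" using that by auto
      then have "1 \<le> \<bar>real_of_int n\<bar>" by linarith
      moreover have "norm (?q y - ?q x) = 2 * \<bar>real_of_int n\<bar> * pi" using n by (simp add: norm_mult)
      moreover have "2 * 1 * 1 \<le> 2 * \<bar>real_of_int n\<bar> * pi"
        using \<open>1 \<le> \<bar>real_of_int n\<bar>\<close> pi_ge_two by (intro mult_mono) auto
      ultimately show ?thesis by simp
    qed
    then show "\<exists>e>0. \<forall>y. y \<in> UNIV \<and> ?q y \<noteq> ?q x \<longrightarrow> e \<le> norm (?q y - ?q x)"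
      by (intro exI[of _ 2]) auto
  qed auto
  then have q: "?q x = ?q y" by (auto simp: constant_on_def)
  have Lb: "norm (Ln (exp (s x))) \<le> 5" for x
  proof -
    let ?w = "exp (s x)"
    have w: "1 / 2 \<le> norm ?w" "norm ?w \<le> 2"
      using near[of x] norm_triangle_ineq2[of 1 "1 - ?w"] norm_triangle_ineq2[of ?w 1]
      by (simp_all add: norm_minus_commute)
    have "ln (norm ?w) \<le> 1" using w ln_le_minus_one[of "norm ?w"] by simp
    moreover have "ln (norm ?w) \<ge> - 1"
    proof -
      have "norm (1 / ?w) \<le> 2" using w by (simp add: norm_divide divide_le_eq)
      then have "ln (norm (1 / ?w)) \<le> 1" using ln_le_minus_one[of "norm (1 / ?w)"] by (simp add: norm_divide)
      then show ?thesis by (simp add: norm_divide ln_div)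
    qed
    ultimately have "\<bar>Re (Ln ?w)\<bar> \<le> 1" by (simp add: Re_Ln)
    moreover have "\<bar>Im (Ln ?w)\<bar> \<le> 4"
      using Im_Ln_le_pi[of ?w] mpi_less_Im_Ln[of ?w] pi_less_4 by simp
    ultimately show ?thesis using cmod_le[of "Ln ?w"] by linarith
  qed
  have "s x - s y = Ln (exp (s x)) - Ln (exp (s y))" using q by (simp add: algebra_simps)
  then show ?thesis using norm_triangle_ineq4[of "Ln (exp (s x))" "Ln (exp (s y))"] Lb[of x] Lb[of y] by simp
qed

lemma almost_periodic_entire_translates:
  assumes h: "almost_periodic_entire h" and e: "\<epsilon> > 0"
  obtains L where "L > 0" "\<And>x. \<exists>\<tau>. x < \<tau> \<and> \<tau> < x + L \<and> (\<forall>u. norm (h (of_real (u + \<tau>) + \<i>) - h (of_real u + \<i>)) < \<epsilon>)"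
proof -
  let ?E = "{\<tau>. (SUP (x, y)\<in>UNIV \<times> {0..2}. ereal (norm (h (Complex (x + \<tau>) y) - h (Complex x y)))) < ereal \<epsilon>}"
  have "relatively_dense ?E" using h e by (simp add: almost_periodic_entire_def)
  then obtain L where L: "L > 0" "\<And>x. ?E \<inter> {x<..<x + L} \<noteq> {}" by (auto simp: relatively_dense_def)
  have "\<exists>\<tau>. x < \<tau> \<and> \<tau> < x + L \<and> (\<forall>u. norm (h (of_real (u + \<tau>) + \<i>) - h (of_real u + \<i>)) < \<epsilon>)" for x
  proof -
    obtain \<tau> where \<tau>: "\<tau> \<in> ?E" "x < \<tau>" "\<tau> < x + L" using L(2)[of x] by auto
    have "norm (h (of_real (u + \<tau>) + \<i>) - h (of_real u + \<i>)) < \<epsilon>" for u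
    proof -
      have "ereal (norm (h (Complex (u + \<tau>) 1) - h (Complex u 1)))
         \<le> (SUP (x, y)\<in>UNIV \<times> {0..2}. ereal (norm (h (Complex (x + \<tau>) y) - h (Complex x y))))"
        by (rule SUP_upper2[of "(u, 1)"]) auto
      also have "\<dots> < ereal \<epsilon>" using \<tau>(1) by simp
      finally show ?thesis by (simp add: complex_eq_iff Complex_eq)
    qed
    with \<tau> show ?thesis by blast
  qed
  with L(1) show ?thesis by (rule that)
qed

context one_sided_spectrum
begin

text \<open>On the line \<open>Im z = 1\<close> one has \<open>h = C exp t\<close> with \<open>t x = \<kappa> (x + i) - g x\<close> up to bounded terms. Almost
  periodicity bounds \<open>|h|\<close> from below there, so that for an almost period \<open>\<tau>\<close> the quotient
  \<open>exp (t (x + \<tau>) - t x)\<close> is close to 1 and \<open>t (x + \<tau>) - t x\<close> is constant up to a bounded error. As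
  every \<open>s\<close> is close to an almost period, \<open>t\<close> and hence \<open>g\<close> is additive up to a bounded error; in
  particular \<open>g (2 x) - 2 g x\<close> is bounded. By Hyers' argument \<open>g\<close> stays at bounded distance from the
  limit of \<open>g (2 ^ n x) / 2 ^ n\<close>, and that limit is 0 because \<open>g\<close> is sublinear.\<close>

theorem g_bounded_if_almost_periodic:
  assumes ap: "almost_periodic_entire h" and growth: "exponential_growth h"
    and h0: "h w \<noteq> 0" and zo: "\<And>z. zorder h z = int (card {n. complex_of_real (a n) = z})"
  shows "\<exists>B. \<forall>x::real. norm (g (of_real x)) \<le> B"
proof -
  have hol: "h holomorphic_on UNIV" using ap by (simp add: almost_periodic_entire_def)
  obtain \<kappa> where \<kappa>: "\<And>z. Im z > 0 \<Longrightarrow> h z \<noteq> 0 \<and> deriv h z = h z * (\<kappa> - 2 * pi * \<i> * E z)"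
    using finite_type_log_derivative[OF hol h0 zo growth] by auto
  have "\<exists>C. C \<noteq> 0 \<and> (\<forall>z. Im z > 0 \<longrightarrow> h z = C * exp (T \<kappa> z))"
    by (rule exponential_representation) (use \<kappa> hol in \<open>auto intro: holomorphic_on_subset\<close>)
  then obtain C where C: "C \<noteq> 0" "\<And>z. Im z > 0 \<Longrightarrow> h z = C * exp (T \<kappa> z)" by auto
  define t where "t x = T \<kappa> (of_real x + \<i>)" for x :: real
  have ht: "h (of_real x + \<i>) = C * exp (t x)" for x unfolding t_def by (rule C(2)) simp
  define B1 where "B1 = norm \<kappa> + 2 * pi * (\<Sum>\<^sub>\<infinity>\<gamma>\<in>P. norm (b \<gamma>) * exp (- (2 * pi * 1) * \<gamma>))"
  have tder: "(t has_vector_derivative (\<kappa> - 2 * pi * \<i> * E (of_real x + \<i>))) (at x)" for x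
  proof -
    have "(T \<kappa> has_field_derivative (\<kappa> - 2 * pi * \<i> * E (of_real x + \<i>))) (at (of_real x + \<i>))"
      by (rule T_has_derivative) simp
    then have "((\<lambda>z. T \<kappa> (z + \<i>)) has_field_derivative (\<kappa> - 2 * pi * \<i> * E (of_real x + \<i>))) (at (of_real x))"
      by (simp add: DERIV_shift)
    then show ?thesis unfolding t_def by (rule has_vector_derivative_real_field)
  qed
  have tb: "norm (\<kappa> - 2 * pi * \<i> * E (of_real x + \<i>)) \<le> B1" for x :: real
  proof -
    have "norm (\<kappa> - 2 * pi * \<i> * E (of_real x + \<i>)) \<le> norm \<kappa> + 2 * pi * norm (E (of_real x + \<i>))"
      by (rule order_trans[OF norm_triangle_ineq4]) (simp add: norm_mult)
    also have "\<dots> \<le> B1" unfolding B1_def by (intro add_left_mono mult_left_mono E_bound) auto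
    finally show ?thesis .
  qed
  have lip: "norm (t x - t y) \<le> B1 * \<bar>x - y\<bar>" for x y
  proof -
    have "norm (t x - t y) \<le> B1 * norm (x - y)"
    proof (rule differentiable_bound[of UNIV])
      show "(t has_derivative (\<lambda>h. h *\<^sub>R (\<kappa> - 2 * pi * \<i> * E (of_real x + \<i>)))) (at x within UNIV)" for x
        using tder[of x] unfolding has_vector_derivative_def by simp
      show "onorm (\<lambda>h. h *\<^sub>R (\<kappa> - 2 * pi * \<i> * E (of_real x + \<i>))) \<le> B1" for x :: real
        by (rule onorm_le, simp only: norm_scaleR real_norm_def mult.commute[of B1])
           (rule mult_left_mono[OF tb abs_ge_zero])
    qed auto
    then show ?thesis by simp
  qed
  have B1: "B1 \<ge> 0" using tb[of 0] norm_ge_zero order_trans by blast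
  have tcont: "continuous_on UNIV t"
    by (rule continuous_on_vector_derivative) (use tder in \<open>auto intro: has_vector_derivative_at_within\<close>)
  \<comment> \<open>Every interval of length \<open>L\<close> contains a point \<open>\<tau>\<close> with \<open>h (\<tau> + i)\<close> close to \<open>h i\<close>, and \<open>t\<close> is
    Lipschitz continuous; hence \<open>|h|\<close> has a positive lower bound on the line.\<close>
  define v where "v = norm (h \<i>)"
  have v: "v > 0" using \<kappa>[of \<i>] by (simp add: v_def)
  obtain L where L: "L > 0" "\<And>x. \<exists>\<tau>. x < \<tau> \<and> \<tau> < x + L \<and> (\<forall>u. norm (h (of_real (u + \<tau>) + \<i>) - h (of_real u + \<i>)) < v / 2)"
    by (rule almost_periodic_entire_translates[OF ap, of "v / 2"]) (use v in auto)
  define m where "m = v / 2 * exp (- (B1 * L))"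
  have m: "m > 0" using v by (simp add: m_def)
  have lower: "m \<le> norm (h (of_real x + \<i>))" for x
  proof -
    obtain \<tau> where \<tau>: "x < \<tau>" "\<tau> < x + L" "\<And>u. norm (h (of_real (u + \<tau>) + \<i>) - h (of_real u + \<i>)) < v / 2"
      using L(2)[of x] by blast
    have "v \<le> norm (h (of_real \<tau> + \<i>)) + norm (h (of_real \<tau> + \<i>) - h \<i>)"
      unfolding v_def using norm_triangle_sub[of "h \<i>" "h (of_real \<tau> + \<i>)"] by (simp add: norm_minus_commute)
    then have 1: "v / 2 \<le> norm (h (of_real \<tau> + \<i>))" using \<tau>(3)[of 0] by simp
    have "B1 * \<bar>x - \<tau>\<bar> \<le> B1 * L" using \<tau> B1 by (intro mult_left_mono) auto
    then have "\<bar>Re (t x - t \<tau>)\<bar> \<le> B1 * L"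
      using lip[of x \<tau>] abs_Re_le_cmod[of "t x - t \<tau>"] by linarith
    then have 2: "exp (- (B1 * L)) \<le> norm (exp (t x - t \<tau>))" by (simp add: norm_exp)
    have "m \<le> norm (h (of_real \<tau> + \<i>)) * norm (exp (t x - t \<tau>))"
      unfolding m_def using 1 2 v by (intro mult_mono) auto
    also have "\<dots> = norm (h (of_real x + \<i>))" by (simp add: ht norm_mult exp_diff norm_divide)
    finally show ?thesis .
  qed
  obtain L' where L': "L' > 0" "\<And>x. \<exists>\<tau>. x < \<tau> \<and> \<tau> < x + L' \<and> (\<forall>u. norm (h (of_real (u + \<tau>) + \<i>) - h (of_real u + \<i>)) < m / 2)"
    by (rule almost_periodic_entire_translates[OF ap, of "m / 2"]) (use m in auto)
  \<comment> \<open>Replacing \<open>s\<close> by a nearby almost period costs at most \<open>B1 * L'\<close> twice.\<close>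
  have quasi: "norm (t (x + s) - t x - (t s - t 0)) \<le> 10 + 2 * (B1 * L')" for x s
  proof -
    obtain \<tau> where \<tau>: "s < \<tau>" "\<tau> < s + L'" "\<And>u. norm (h (of_real (u + \<tau>) + \<i>) - h (of_real u + \<i>)) < m / 2"
      using L'(2)[of s] by blast
    have near: "norm (exp (t (u + \<tau>) - t u) - 1) \<le> 1 / 2" for u
    proof -
      have "norm (h (of_real u + \<i>)) * norm (exp (t (u + \<tau>) - t u) - 1) = norm (h (of_real (u + \<tau>) + \<i>) - h (of_real u + \<i>))"
      proof -
        have "exp (t u) * exp (t (u + \<tau>) - t u) = exp (t (u + \<tau>))" by (simp flip: exp_add)
        then have "C * exp (t u) * (exp (t (u + \<tau>) - t u) - 1) = C * exp (t (u + \<tau>)) - C * exp (t u)"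
          by (simp add: right_diff_distrib mult.assoc)
        then show ?thesis unfolding norm_mult[symmetric] ht by simp
      qed
      also have "\<dots> \<le> m / 2" using \<tau>(3)[of u] by simp
      also have "\<dots> \<le> norm (h (of_real u + \<i>)) * (1 / 2)" using lower[of u] by simp
      finally have "norm (exp (t (u + \<tau>) - t u) - 1) * norm (h (of_real u + \<i>)) \<le> 1 / 2 * norm (h (of_real u + \<i>))"
        by (simp only: mult.commute)
      moreover have "norm (h (of_real u + \<i>)) > 0" using lower[of u] m by linarith
      ultimately show ?thesis by (rule mult_right_le_imp_le)
    qed
    have c: "continuous_on UNIV (\<lambda>u. t (u + \<tau>) - t u)"
      by (intro continuous_intros tcont continuous_on_compose2[OF tcont]) auto
    have o: "norm ((t (x + \<tau>) - t x) - (t (0 + \<tau>) - t 0)) \<le> 10"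
      by (rule continuous_logarithm_oscillation[OF c near])
    have b: "norm (t (u + s) - t (u + \<tau>)) \<le> B1 * L'" for u
      using lip[of "u + s" "u + \<tau>"] \<tau> B1 mult_left_mono[of "\<bar>s - \<tau>\<bar>" L' B1] by simp
    have "t (x + s) - t x - (t s - t 0) = ((t (x + \<tau>) - t x) - (t (0 + \<tau>) - t 0)) + ((t (x + s) - t (x + \<tau>)) - (t (0 + s) - t (0 + \<tau>)))"
      by simp
    also have "norm \<dots> \<le> 10 + (B1 * L' + B1 * L')"
      by (intro order_trans[OF norm_triangle_ineq] add_mono o order_trans[OF norm_triangle_ineq4] b)
    finally show ?thesis by simp
  qed
  define B2 where "B2 = (\<Sum>\<^sub>\<infinity>\<gamma>\<in>low. norm (b \<gamma>) * ((1 - exp (- 2 * pi * 1 * \<gamma>)) / \<gamma>))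
     + (\<Sum>\<^sub>\<infinity>\<gamma>\<in>P \<inter> {1..}. norm (b \<gamma>) * exp (- (2 * pi * 1) * \<gamma>))"
  define r where "r x = t x - \<kappa> * (of_real x + \<i>) + g (of_real x)" for x :: real
  have r: "norm (r x) \<le> B2" for x
  proof -
    have "r x = - ((g (of_real x + \<i>) - g (of_real x)) + high (of_real x + \<i>))" by (simp add: r_def t_def T_def)
    then have "norm (r x) \<le> norm (g (of_real x + \<i> * of_real 1) - g (of_real x)) + norm (high (of_real x + \<i>))"
      by (simp only: norm_minus_cancel) (simp add: norm_triangle_ineq)
    also have "\<dots> \<le> B2" unfolding B2_def by (intro add_mono g_vertical high_bound) auto
    finally show ?thesis .
  qed
  have g0: "g 0 = 0" by (simp add: g_sum_def)
  define B where "B = 10 + 2 * (B1 * L') + 4 * B2"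
  have gq: "norm (g (of_real (x + x)) - 2 * g (of_real x)) \<le> B" for x :: real
  proof -
    have gt: "g (of_real x) = r x - t x + \<kappa> * (of_real x + \<i>)" for x by (simp add: r_def)
    have t0: "t 0 = r 0 + \<kappa> * \<i>" using gt[of 0] g0 by (simp add: algebra_simps)
    have "g (of_real (x + x)) - 2 * g (of_real x) = - (t (x + x) - t x - (t x - t 0)) + ((r (x + x) - r x) - (r x - r 0))"
      unfolding gt t0 by (simp add: algebra_simps)
    also have "norm \<dots> \<le> (10 + 2 * (B1 * L')) + ((B2 + B2) + (B2 + B2))"
      by (intro order_trans[OF norm_triangle_ineq] add_mono order_trans[OF norm_triangle_ineq4] r)
         (use quasi[of x x] in \<open>simp only: norm_minus_cancel\<close>)
    finally show ?thesis by (simp add: B_def)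
  qed
  have "norm (g (of_real x)) \<le> B" for x :: real
  proof -
    have it: "norm (g (of_real (2 ^ n * x)) / 2 ^ n - g (of_real x)) \<le> B * (1 - 1 / 2 ^ n)" for n
    proof (induction n)
      case (Suc n)
      have "g (of_real (2 ^ Suc n * x)) / 2 ^ Suc n - g (of_real x)
        = (g (of_real (2 ^ n * x + 2 ^ n * x)) - 2 * g (of_real (2 ^ n * x))) / 2 ^ Suc n + (g (of_real (2 ^ n * x)) / 2 ^ n - g (of_real x))"
        by (simp add: field_simps)
      also have "norm \<dots> \<le> B / 2 ^ Suc n + B * (1 - 1 / 2 ^ n)"
        by (intro order_trans[OF norm_triangle_ineq] add_mono Suc)
           (use gq[of "2 ^ n * x"] in \<open>simp only: norm_divide norm_power norm_numeral divide_right_mono zero_le_power zero_le_numeral\<close>)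
      also have "\<dots> = B * (1 - 1 / 2 ^ Suc n)" by (simp add: field_simps)
      finally show ?case .
    qed simp
    have Bnn: "B \<ge> 0" using gq[of 0] norm_ge_zero order_trans by blast
    have it': "norm (g (of_real (2 ^ n * x)) / 2 ^ n - g (of_real x)) \<le> B" for n
    proof (rule order_trans[OF it])
      have "B * (1 - 1 / 2 ^ n) \<le> B * 1" using Bnn by (intro mult_left_mono) auto
      then show "B * (1 - 1 / 2 ^ n) \<le> B" by simp
    qed
    have "filterlim (\<lambda>n. (2::real) ^ n) at_top sequentially"
      by (rule filterlim_at_infinity_imp_filterlim_at_top[OF filterlim_realpow_sequentially_gt1]) auto
    from filterlim_compose[OF g_sublinear[of x] this]
    have "(\<lambda>n. g (of_real (2 ^ n * x)) / 2 ^ n) \<longlonglongrightarrow> 0" by simp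
    then have "(\<lambda>n. norm (g (of_real (2 ^ n * x)) / 2 ^ n - g (of_real x))) \<longlonglongrightarrow> norm (0 - g (of_real x))"
      by (intro tendsto_intros)
    then have "norm (0 - g (of_real x)) \<le> B" by (rule LIMSEQ_le_const2) (use it' in auto)
    then show ?thesis by simp
  qed
  then show ?thesis by blast
qed

end

section \<open>Counting the zeros\<close>

text \<open>With \<open>u\<^sub>y x = y / (x\<^sup>2 + y\<^sup>2)\<close>, the Poisson kernel up to the factor \<open>\<pi>\<close>, the step kernel is
  \<open>2 u\<^sub>1 - u\<^sub>2\<close>. A single Poisson kernel gives a step \<open>arctan x\<close> whose distance from a sharp step
  decays like \<open>1 / x\<close> only, which is not summable over the zeros; in this combination the terms of order
  \<open>1 / x\<close> cancel. The total increment of the smooth step is \<open>\<pi>\<close>.\<close>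

definition step_kernel :: "real \<Rightarrow> real" where
  "step_kernel x = 2 * (1 / (x\<^sup>2 + 1)) - 2 / (x\<^sup>2 + 4)"

definition smooth_step :: "real \<Rightarrow> real" where
  "smooth_step x = 2 * arctan x - arctan (x / 2)"

definition sharp_step :: "real \<Rightarrow> real" where
  "sharp_step x = (if x > 0 then pi / 2 else - pi / 2)"

lemma smooth_step_derivative: "(smooth_step has_real_derivative step_kernel x) (at x)"
proof -
  have "x\<^sup>2 + 1 > 0" "x\<^sup>2 + 4 > 0" by (auto intro: add_nonneg_pos)
  then have "2 * inverse (1 + x\<^sup>2) - inverse (1 + (x / 2)\<^sup>2) * (1 / 2) = step_kernel x"
    by (simp add: step_kernel_def power_divide divide_simps) (simp add: algebra_simps)
  moreover have "((\<lambda>x. 2 * arctan x - arctan (x / 2)) has_real_derivative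
      2 * inverse (1 + x\<^sup>2) - inverse (1 + (x / 2)\<^sup>2) * (1 / 2)) (at x)"
    by (auto intro!: derivative_eq_intros)
  ultimately show ?thesis unfolding smooth_step_def[abs_def] by simp
qed

lemma step_kernel_bound: "\<bar>step_kernel x\<bar> \<le> 4 * (1 / (1 + x\<^sup>2))"
proof -
  define p q where "p = 2 / (x\<^sup>2 + 1)" and "q = 2 / (x\<^sup>2 + 4)"
  have "q \<le> p" unfolding p_def q_def by (intro frac_le) (auto intro: add_nonneg_pos)
  moreover have "0 \<le> q" by (simp add: q_def)
  moreover have "step_kernel x = p - q" "4 * (1 / (1 + x\<^sup>2)) = 2 * p"
    by (simp_all add: step_kernel_def p_def q_def add.commute)
  ultimately show ?thesis by simp
qed

lemma smooth_step_close_pos: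
  assumes x: "x > 0"
  shows "\<bar>smooth_step x - pi / 2\<bar> \<le> 14 * (1 / (1 + x\<^sup>2))"
proof (cases "x \<ge> 1")
  case True
  define v where "v = 1 / x"
  have v: "v > 0" "v \<le> 1" using True by (auto simp: v_def)
  let ?q = "\<lambda>v. 2 * arctan v - arctan (2 * v)"
  have "smooth_step x - pi / 2 = - ?q v"
  proof -
    have "arctan v = pi / 2 - arctan x" "arctan (2 * v) = pi / 2 - arctan (x / 2)"
      using arctan_inverse[of x] arctan_inverse[of "x / 2"] x unfolding v_def by (simp_all add: inverse_eq_divide)
    then show ?thesis by (simp add: smooth_step_def)
  qed
  have "\<exists>z>0. z < v \<and> ?q v - ?q 0 = (v - 0) * (2 * inverse (1 + z\<^sup>2) - inverse (1 + (2 * z)\<^sup>2) * 2)"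
    by (rule MVT2) (use v in \<open>auto intro!: derivative_eq_intros\<close>)
  then obtain z where z: "0 < z" "z < v" "?q v = v * (2 * inverse (1 + z\<^sup>2) - inverse (1 + (2 * z)\<^sup>2) * 2)"
    by auto
  define r where "r = 2 * inverse (1 + z\<^sup>2) - inverse (1 + (2 * z)\<^sup>2) * 2"
  have r: "r = 6 * z\<^sup>2 / ((1 + z\<^sup>2) * (1 + 4 * z\<^sup>2))"
  proof -
    have "1 + z\<^sup>2 > 0" "1 + 4 * z\<^sup>2 > 0" by (auto intro: add_pos_nonneg)
    then show ?thesis by (simp add: r_def divide_simps power_mult_distrib)
  qed
  have r0: "0 \<le> r" unfolding r by simp
  have "r \<le> 6 * z\<^sup>2"
  proof -
    have "1 * 1 \<le> (1 + z\<^sup>2) * (1 + 4 * z\<^sup>2)" by (intro mult_mono) auto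
    then have "6 * z\<^sup>2 / ((1 + z\<^sup>2) * (1 + 4 * z\<^sup>2)) \<le> 6 * z\<^sup>2 / 1" by (intro divide_left_mono) auto
    then show ?thesis unfolding r by simp
  qed
  also have "\<dots> \<le> 6 * v\<^sup>2" using z by (intro mult_left_mono power_mono) auto
  finally have r1: "r \<le> 6 * v\<^sup>2" .
  have "\<bar>?q v\<bar> = v * r" using z(3) v r0 unfolding r_def[symmetric] by (simp add: abs_mult)
  moreover have "smooth_step x - pi / 2 = - ?q v" by fact
  ultimately have "\<bar>smooth_step x - pi / 2\<bar> = v * r" by (simp only: abs_minus_cancel)
  also have "\<dots> \<le> v * (6 * v\<^sup>2)" using r1 v by (intro mult_left_mono) auto
  also have "\<dots> \<le> 1 * (6 * v\<^sup>2)" using v by (intro mult_right_mono) auto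
  also have "\<dots> \<le> 14 * (1 / (1 + x\<^sup>2))"
  proof -
    have "1 \<le> x\<^sup>2" using True by (simp add: one_le_power)
    then have "6 * (1 + x\<^sup>2) \<le> 14 * x\<^sup>2" by simp
    moreover have "1 + x\<^sup>2 > 0" "x\<^sup>2 > 0" using x by (auto intro: add_pos_nonneg)
    ultimately show ?thesis by (simp add: v_def power_divide divide_le_eq le_divide_eq mult.commute)
  qed
  finally show ?thesis .
next
  case False
  have "x\<^sup>2 \<le> 1" using x False by (simp add: power_le_one)
  then have "1 / 2 \<le> 1 / (1 + x\<^sup>2)" by (intro frac_le) (auto intro: add_pos_nonneg)
  moreover have "0 \<le> arctan x" "arctan x < pi / 2" "0 \<le> arctan (x / 2)" "arctan (x / 2) < pi / 2"
    using x arctan_ubound by auto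
  then have "\<bar>smooth_step x - pi / 2\<bar> \<le> 7" using pi_less_4 unfolding smooth_step_def by linarith
  ultimately show ?thesis by linarith
qed

lemma smooth_step_close: "\<bar>smooth_step x - sharp_step x\<bar> \<le> 14 * (1 / (1 + x\<^sup>2))"
proof -
  consider "x > 0" | "x < 0" | "x = 0" by linarith
  then show ?thesis
  proof cases
    case 1
    then show ?thesis using smooth_step_close_pos by (simp add: sharp_step_def)
  next
    case 2
    have "smooth_step (- x) = - smooth_step x" by (simp add: smooth_step_def arctan_minus)
    then have "\<bar>smooth_step x - sharp_step x\<bar> = \<bar>smooth_step (- x) - pi / 2\<bar>"
      using 2 by (simp add: sharp_step_def)
    then show ?thesis using smooth_step_close_pos[of "- x"] 2 by simp
  next
    case 3
    then show ?thesis using pi_less_4 by (simp add: smooth_step_def sharp_step_def)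
  qed
qed

context one_sided_spectrum
begin

text \<open>\<open>D\<close> will turn out to be \<open>\<pi>\<close> times the density of the zeros, and the exponential type of \<open>f\<close>.\<close>

definition D :: real where "D = - Im K"

lemma Im_H: 
  assumes "y > 0"
  shows "((\<lambda>n. y / ((x - a n)\<^sup>2 + y\<^sup>2)) has_sum (- Im (H (Complex x y)))) UNIV"
proof -
  have "((\<lambda>n. 1 / (Complex x y - of_real (a n)) + 1 / of_real (a n)) has_sum H (Complex x y)) UNIV"
    by (rule H_has_sum) (use assms in simp)
  from has_sum_uminusI[OF has_sum_Im[OF this]]
  have "((\<lambda>n. - Im (1 / (Complex x y - of_real (a n)) + 1 / of_real (a n))) has_sum (- Im (H (Complex x y)))) UNIV" .
  moreover have "- Im (1 / (Complex x y - of_real (a n)) + 1 / of_real (a n)) = y / ((x - a n)\<^sup>2 + y\<^sup>2)" for n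
    by (simp add: Im_divide)
  ultimately show ?thesis by simp
qed

lemma Im_H_bound:
  assumes "y \<ge> 1"
  shows "- Im (H (Complex x y)) \<le> norm K + 2 * pi * (\<Sum>\<^sub>\<infinity>\<gamma>\<in>P. norm (b \<gamma>) * exp (- (2 * pi * 1) * \<gamma>))"
proof -
  have "norm (H (Complex x y)) \<le> norm K + norm (2 * pi * \<i> * E (Complex x y))"
    unfolding H_eq_E[of "Complex x y", simplified] using assms
    by (subst H_eq_E) (auto intro: norm_triangle_ineq4)
  also have "\<dots> \<le> norm K + 2 * pi * (\<Sum>\<^sub>\<infinity>\<gamma>\<in>P. norm (b \<gamma>) * exp (- (2 * pi * 1) * \<gamma>))"
    using E_bound[of 1 "Complex x y"] assms by (simp add: norm_mult)
  finally show ?thesis using abs_Im_le_cmod[of "H (Complex x y)"] by linarith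
qed

text \<open>As \<open>- Im H\<close> at height \<open>y\<close> is the sum of the Poisson kernels \<open>u\<^sub>y\<close> over the zeros, this is a primitive
  of the sum of the step kernels; its increments count zeros up to a bounded error.\<close>

definition W :: "real \<Rightarrow> real" where
  "W x = Im (T K (Complex x 2)) - 2 * Im (T K (Complex x 1))"

lemma W_derivative: "(W has_real_derivative (\<Sum>\<^sub>\<infinity>n. step_kernel (x - a n))) (at x)"
proof -
  have ks: "((\<lambda>n. step_kernel (x - a n)) has_sum (2 * (- Im (H (Complex x 1))) - (- Im (H (Complex x 2))))) UNIV"
  proof -
    have "((\<lambda>n. 2 * (1 / ((x - a n)\<^sup>2 + 1\<^sup>2)) - 2 / ((x - a n)\<^sup>2 + 2\<^sup>2)) has_sum (2 * (- Im (H (Complex x 1))) - (- Im (H (Complex x 2))))) UNIV"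
      by (intro has_sum_diff has_sum_cmult_right Im_H) auto
    then show ?thesis by (simp add: step_kernel_def)
  qed
  have T: "((\<lambda>x. Im (T K (Complex x y))) has_real_derivative Im (H (Complex x y))) (at x)" if y: "y > 0" for y
  proof -
    have "(T K has_field_derivative H (Complex x y)) (at (Complex x y))"
      using T_has_derivative[of "Complex x y" K] H_eq_E[of "Complex x y"] y by simp
    then have "((\<lambda>z. T K (z + Complex 0 y)) has_field_derivative H (Complex x y)) (at (of_real x))"
      using DERIV_shift[of "T K" "H (Complex x y)" "of_real x" "Complex 0 y"] by (simp add: complex_eq_iff Complex_eq)
    then have "((\<lambda>x. T K (of_real x + Complex 0 y)) has_vector_derivative H (Complex x y)) (at x)"
      by (rule has_vector_derivative_real_field)
    then have "((\<lambda>x. Im (T K (of_real x + Complex 0 y))) has_vector_derivative Im (H (Complex x y))) (at x)"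
      by (rule bounded_linear.has_vector_derivative[OF bounded_linear_Im])
    moreover have "of_real x + Complex 0 y = Complex x y" for x by (simp add: complex_eq_iff)
    ultimately show ?thesis by (simp add: has_real_derivative_iff_has_vector_derivative)
  qed
  have "((\<lambda>x. Im (T K (Complex x 2)) - 2 * Im (T K (Complex x 1))) has_real_derivative
     (Im (H (Complex x 2)) - 2 * Im (H (Complex x 1)))) (at x)"
    by (intro DERIV_diff DERIV_cmult T) auto
  then show ?thesis
    unfolding infsumI[OF ks] W_def[abs_def] by (simp add: algebra_simps)
qed

lemma smooth_step_has_sum:
  assumes st: "s \<le> t"
  shows "((\<lambda>n. smooth_step (t - a n) - smooth_step (s - a n)) has_sum (W t - W s)) UNIV"
proof -
  define X where "X = \<bar>s\<bar> + \<bar>t\<bar>"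
  define B where "B = 2 + (1 + 2 * (X + 1)\<^sup>2) / 1\<^sup>2"
  have b: "\<bar>step_kernel (x - a n)\<bar> \<le> 4 * B * (1 / (1 + (a n)\<^sup>2))" if x: "x \<in> {s..t}" for x n
  proof -
    have nx: "norm (Complex x 1) \<le> X + 1"
    proof -
      have "norm (Complex x 1) \<le> \<bar>x\<bar> + 1" using cmod_le[of "Complex x 1"] by simp
      then show ?thesis using x unfolding X_def by auto
    qed
    have "1 + (a n)\<^sup>2 \<le> B * (norm (Complex x 1 - of_real (a n)))\<^sup>2"
      unfolding B_def by (rule one_plus_square_le_distance[OF nx]) auto
    also have "(norm (Complex x 1 - of_real (a n)))\<^sup>2 = 1 + (x - a n)\<^sup>2" by (simp add: cmod_power2)
    finally have le: "1 + (a n)\<^sup>2 \<le> B * (1 + (x - a n)\<^sup>2)" .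
    have "1 + (a n)\<^sup>2 > 0" "1 + (x - a n)\<^sup>2 > 0" by (auto intro: add_pos_nonneg)
    then have "1 / (1 + (x - a n)\<^sup>2) \<le> B * (1 / (1 + (a n)\<^sup>2))"
      using le by (simp add: divide_le_eq le_divide_eq mult.commute)
    then show ?thesis using step_kernel_bound[of "x - a n"] by linarith
  qed
  have ul: "uniform_limit {s..t} (\<lambda>F x. \<Sum>n\<in>F. step_kernel (x - a n)) (\<lambda>x. \<Sum>\<^sub>\<infinity>n. step_kernel (x - a n)) (finite_subsets_at_top UNIV)"
    by (rule uniform_limit_infsum[OF summable_on_cmult_right[OF a_summable, of "4 * B"]]) (use b in auto)
  have kc: "continuous_on A (\<lambda>x. step_kernel (x - a n))" for A n
    unfolding step_kernel_def by (intro continuous_intros) (auto simp: add_nonneg_eq_0_iff)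
  have c: "continuous_on {s..t} (\<lambda>x. \<Sum>n\<in>F. step_kernel (x - a n))" for F
    by (intro continuous_intros kc)
  obtain I J where I: "\<And>F. ((\<lambda>x. \<Sum>n\<in>F. step_kernel (x - a n)) has_integral I F) {s..t}"
    and J: "((\<lambda>x. \<Sum>\<^sub>\<infinity>n. step_kernel (x - a n)) has_integral J) {s..t}"
    and lim: "(I \<longlongrightarrow> J) (finite_subsets_at_top UNIV)"
    using uniform_limit_integral[OF ul c] by (metis finite_subsets_at_top_neq_bot)
  have IF: "I F = (\<Sum>n\<in>F. smooth_step (t - a n) - smooth_step (s - a n))" for F
  proof -
    have "((\<lambda>x. \<Sum>n\<in>F. step_kernel (x - a n)) has_integral ((\<Sum>n\<in>F. smooth_step (t - a n)) - (\<Sum>n\<in>F. smooth_step (s - a n)))) {s..t}"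
    proof (rule fundamental_theorem_of_calculus[OF st])
      fix x assume "x \<in> {s..t}"
      have "((\<lambda>x. smooth_step (x - a n)) has_real_derivative step_kernel (x - a n)) (at x)" for n
        using smooth_step_derivative[of "x - a n"] DERIV_shift[of smooth_step "step_kernel (x - a n)" x "- a n"] by simp
      then have "((\<lambda>x. \<Sum>n\<in>F. smooth_step (x - a n)) has_real_derivative (\<Sum>n\<in>F. step_kernel (x - a n))) (at x)"
        by (intro DERIV_sum)
      then show "((\<lambda>x. \<Sum>n\<in>F. smooth_step (x - a n)) has_vector_derivative (\<Sum>n\<in>F. step_kernel (x - a n))) (at x within {s..t})"
        by (simp add: has_real_derivative_iff_has_vector_derivative has_vector_derivative_at_within)
    qed
    from has_integral_unique[OF I this] show ?thesis by (simp add: sum_subtractf)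
  qed
  have "((\<lambda>x. \<Sum>\<^sub>\<infinity>n. step_kernel (x - a n)) has_integral (W t - W s)) {s..t}"
    by (rule fundamental_theorem_of_calculus[OF st])
       (rule has_vector_derivative_at_within[OF W_derivative[unfolded has_real_derivative_iff_has_vector_derivative]])
  with J have "J = W t - W s" by (rule has_integral_unique)
  moreover have "I = sum (\<lambda>n. smooth_step (t - a n) - smooth_step (s - a n))" using IF by auto
  ultimately show ?thesis using lim by (simp add: has_sum_def)
qed

lemma finite_window: "finite {n. a n \<in> {s..<t}}"
  by (rule finite_subset[OF _ finite_small[of "max \<bar>s\<bar> \<bar>t\<bar>"]]) auto

lemma count_eq_W:
  obtains C where "\<And>s t. s \<le> t \<Longrightarrow> \<bar>pi * real (card {n. a n \<in> {s..<t}}) - (W t - W s)\<bar> \<le> C"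
proof -
  define U where "U = norm K + 2 * pi * (\<Sum>\<^sub>\<infinity>\<gamma>\<in>P. norm (b \<gamma>) * exp (- (2 * pi * 1) * \<gamma>))"
  have err: "(\<lambda>n. smooth_step (t - a n) - sharp_step (t - a n)) summable_on UNIV"
     "\<bar>\<Sum>\<^sub>\<infinity>n. smooth_step (t - a n) - sharp_step (t - a n)\<bar> \<le> 14 * U" for t
  proof -
    have h: "((\<lambda>n. 14 * (1 / (1 + (t - a n)\<^sup>2))) has_sum (14 * (- Im (H (Complex t 1))))) UNIV"
      using has_sum_cmult_right[OF Im_H[of 1 t], of 14] by (simp add: add.commute)
    note d = norm_infsum_le_dominated[OF has_sum_imp_summable[OF h], of "\<lambda>n. smooth_step (t - a n) - sharp_step (t - a n)"]
    show "(\<lambda>n. smooth_step (t - a n) - sharp_step (t - a n)) summable_on UNIV"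
      by (rule d(1)) (use smooth_step_close in \<open>simp only: real_norm_def\<close>)
    have "norm (\<Sum>\<^sub>\<infinity>n. smooth_step (t - a n) - sharp_step (t - a n)) \<le> (\<Sum>\<^sub>\<infinity>n. 14 * (1 / (1 + (t - a n)\<^sup>2)))"
      by (rule d(2)) (use smooth_step_close in \<open>simp only: real_norm_def\<close>)
    also have "\<dots> = 14 * (- Im (H (Complex t 1)))" by (rule infsumI[OF h])
    also have "\<dots> \<le> 14 * U" using Im_H_bound[of 1 t] unfolding U_def by simp
    finally show "\<bar>\<Sum>\<^sub>\<infinity>n. smooth_step (t - a n) - sharp_step (t - a n)\<bar> \<le> 14 * U" by simp
  qed
  have "\<bar>pi * real (card {n. a n \<in> {s..<t}}) - (W t - W s)\<bar> \<le> 28 * U" if st: "s \<le> t" for s t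
  proof -
    let ?e = "\<lambda>t n. smooth_step (t - a n) - sharp_step (t - a n)"
    have "((\<lambda>n. (smooth_step (t - a n) - smooth_step (s - a n)) - (?e t n - ?e s n)) has_sum
        ((W t - W s) - ((\<Sum>\<^sub>\<infinity>n. ?e t n) - (\<Sum>\<^sub>\<infinity>n. ?e s n)))) UNIV"
      by (intro has_sum_diff smooth_step_has_sum st has_sum_infsum err(1))
    moreover have "((\<lambda>n. (smooth_step (t - a n) - smooth_step (s - a n)) - (?e t n - ?e s n)) has_sum (\<Sum>n\<in>{n. a n \<in> {s..<t}}. pi)) UNIV"
    proof -
      have "((\<lambda>n. pi) has_sum (\<Sum>n\<in>{n. a n \<in> {s..<t}}. pi)) {n. a n \<in> {s..<t}}"
        by (rule has_sum_finite[OF finite_window])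
      then show ?thesis
        by (rule has_sum_cong_neutral[THEN iffD1, rotated -1]) (use st in \<open>auto simp: sharp_step_def\<close>)
    qed
    ultimately have "(W t - W s) - ((\<Sum>\<^sub>\<infinity>n. ?e t n) - (\<Sum>\<^sub>\<infinity>n. ?e s n)) = (\<Sum>n\<in>{n. a n \<in> {s..<t}}. pi)"
      by (rule has_sum_unique)
    then have "pi * real (card {n. a n \<in> {s..<t}}) = (W t - W s) - ((\<Sum>\<^sub>\<infinity>n. ?e t n) - (\<Sum>\<^sub>\<infinity>n. ?e s n))" by simp
    then show ?thesis using err(2)[of t] err(2)[of s] by linarith
  qed
  then show ?thesis by (rule that)
qed

end

text \<open>The situation of the direct implication. Monotonicity links the position of a zero to its index.\<close>

locale bounded_low_part = one_sided_spectrum +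
  fixes Bg :: real
  assumes g_bounded: "\<And>x::real. norm (g (of_real x)) \<le> Bg"
    and a_mono: "\<And>n. a n \<le> a (n + 1)"
begin

lemma a_le: "i \<le> j \<Longrightarrow> a i \<le> a j"
  by (induction rule: int_ge_induct) (use a_mono order_trans in blast)+

text \<open>On the lines of height 1 and 2 the function \<open>T K\<close> is \<open>K z\<close> up to a bounded error, since \<open>g\<close> is
  bounded on the real axis and thus on every horizontal line of the upper half plane.\<close>

lemma W_linear:
  obtains C where "\<And>s t. \<bar>(W t - W s) - D * (t - s)\<bar> \<le> C"
proof -
  define B where "B = Bg + (\<Sum>\<^sub>\<infinity>\<gamma>\<in>low. norm (b \<gamma>) * ((1 - exp (- 2 * pi * 2 * \<gamma>)) / \<gamma>))
     + (\<Sum>\<^sub>\<infinity>\<gamma>\<in>low. norm (b \<gamma>) * ((1 - exp (- 2 * pi * 1 * \<gamma>)) / \<gamma>))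
     + (\<Sum>\<^sub>\<infinity>\<gamma>\<in>P \<inter> {1..}. norm (b \<gamma>) * exp (- (2 * pi * 1) * \<gamma>))"
  have nn: "0 \<le> (\<Sum>\<^sub>\<infinity>\<gamma>\<in>low. norm (b \<gamma>) * ((1 - exp (- 2 * pi * y * \<gamma>)) / \<gamma>))" if "y \<ge> 0" for y
    using norm_ge_zero g_vertical(1)[OF that] order_trans by blast
  have gh: "norm (g (Complex x y) + high (Complex x y)) \<le> B" if y: "y = 1 \<or> y = 2" for x y
  proof -
    have z: "Complex x y = of_real x + \<i> * of_real y" by (simp add: complex_eq_iff)
    have "norm (g (Complex x y)) \<le> norm (g (of_real x)) + norm (g (Complex x y) - g (of_real x))"
      by (rule norm_triangle_sub)
    also have "\<dots> \<le> Bg + (\<Sum>\<^sub>\<infinity>\<gamma>\<in>low. norm (b \<gamma>) * ((1 - exp (- 2 * pi * y * \<gamma>)) / \<gamma>))"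
      unfolding z by (intro add_mono g_bounded g_vertical) (use y in auto)
    also have "\<dots> \<le> Bg + ((\<Sum>\<^sub>\<infinity>\<gamma>\<in>low. norm (b \<gamma>) * ((1 - exp (- 2 * pi * 2 * \<gamma>)) / \<gamma>))
     + (\<Sum>\<^sub>\<infinity>\<gamma>\<in>low. norm (b \<gamma>) * ((1 - exp (- 2 * pi * 1 * \<gamma>)) / \<gamma>)))"
      using y nn[of 1] nn[of 2] by (elim disjE) simp_all
    finally have "norm (g (Complex x y)) \<le> \<dots>" .
    moreover have "norm (high (Complex x y)) \<le> (\<Sum>\<^sub>\<infinity>\<gamma>\<in>P \<inter> {1..}. norm (b \<gamma>) * exp (- (2 * pi * 1) * \<gamma>))"
      by (rule high_bound) (use y in auto)
    ultimately show ?thesis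
      using norm_triangle_ineq[of "g (Complex x y)" "high (Complex x y)"] unfolding B_def by linarith
  qed
  define r where "r x = W x - D * x" for x
  have r: "\<bar>r x\<bar> \<le> 3 * B" for x
  proof -
    let ?h = "\<lambda>y. g (Complex x y) + high (Complex x y)"
    have T: "Im (T K (Complex x y)) = Im (K * Complex x y) - Im (?h y)" for y by (simp add: T_def)
    have "r x = 2 * Im (?h 1) - Im (?h 2)" unfolding r_def W_def D_def T[of 1] T[of 2] by (simp add: algebra_simps)
    moreover have "\<bar>Im (?h y)\<bar> \<le> B" if "y = 1 \<or> y = 2" for y
      using abs_Im_le_cmod[of "?h y"] gh[OF that, of x] by linarith
    from this[of 1] this[of 2] have "\<bar>Im (?h 1)\<bar> \<le> B" "\<bar>Im (?h 2)\<bar> \<le> B" by auto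
    ultimately show ?thesis by linarith
  qed
  have "\<bar>(W t - W s) - D * (t - s)\<bar> \<le> 6 * B" for s t
  proof -
    have "(W t - W s) - D * (t - s) = r t - r s" by (simp add: r_def algebra_simps)
    then show ?thesis using r[of t] r[of s] by linarith
  qed
  then show ?thesis by (rule that)
qed

lemma count_linear:
  obtains C where "C > 0" "\<And>s t. s \<le> t \<Longrightarrow> \<bar>pi * real (card {n. a n \<in> {s..<t}}) - D * (t - s)\<bar> \<le> C"
proof -
  obtain C1 where C1: "\<And>s t. s \<le> t \<Longrightarrow> \<bar>pi * real (card {n. a n \<in> {s..<t}}) - (W t - W s)\<bar> \<le> C1"
    using count_eq_W by blast
  obtain C2 where C2: "\<And>s t. \<bar>(W t - W s) - D * (t - s)\<bar> \<le> C2"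
    using W_linear by blast
  have "\<bar>pi * real (card {n. a n \<in> {s..<t}}) - D * (t - s)\<bar> \<le> \<bar>C1\<bar> + \<bar>C2\<bar> + 1" if "s \<le> t" for s t
    using C1[OF that] C2[of t s] by linarith
  moreover have "\<bar>C1\<bar> + \<bar>C2\<bar> + 1 > 0" by simp
  ultimately show ?thesis using that by blast
qed

text \<open>The enumeration by all integers provides arbitrarily many zeros in long intervals.\<close>

lemma D_pos: "D > 0"
proof (rule ccontr)
  assume D: "\<not> D > 0"
  obtain C where C: "C > 0" "\<And>s t. s \<le> t \<Longrightarrow> \<bar>pi * real (card {n. a n \<in> {s..<t}}) - D * (t - s)\<bar> \<le> C"
    using count_linear by blast
  obtain N :: nat where N: "real N > C" using reals_Archimedean2 by blast
  let ?s = "a 0" and ?t = "a (int N) + 1"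
  have st: "?s \<le> ?t" using a_le[of 0 "int N"] by simp
  have "{0..int N} \<subseteq> {n. a n \<in> {?s..<?t}}"
  proof
    fix n assume "n \<in> {0..int N}"
    then have "a 0 \<le> a n" "a n \<le> a (int N)" using a_le[of 0 n] a_le[of n "int N"] by auto
    then show "n \<in> {n. a n \<in> {?s..<?t}}" by simp
  qed
  from card_mono[OF finite_window this] have "real (Suc N) \<le> real (card {n. a n \<in> {?s..<?t}})" by simp
  moreover have "1 * real (card {n. a n \<in> {?s..<?t}}) \<le> pi * real (card {n. a n \<in> {?s..<?t}})"
    using pi_ge_two by (intro mult_right_mono) auto
  moreover have "D * (?t - ?s) \<le> 0" using D st by (intro mult_nonpos_nonneg) auto
  ultimately show False using C(2)[OF st] N by linarith
qed

lemma density: "point_density a = D / pi"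
  unfolding point_density_def
proof (rule tendsto_Lim)
  have "surj (snd :: real \<times> real \<Rightarrow> real)" by (rule surjI[of snd "\<lambda>l. (0, l)"]) simp
  then show "filtercomap snd (at_top :: real filter) \<noteq> (bot :: (real \<times> real) filter)"
    by (intro filtercomap_neq_bot_surj) auto
  obtain C where C: "C > 0" "\<And>s t. s \<le> t \<Longrightarrow> \<bar>pi * real (card {n. a n \<in> {s..<t}}) - D * (t - s)\<bar> \<le> C"
    using count_linear by blast
  have lim: "((\<lambda>p::real \<times> real. C / pi / snd p) \<longlongrightarrow> 0) (filtercomap snd at_top)"
  proof -
    have "filterlim snd at_top (filtercomap (snd :: real \<times> real \<Rightarrow> real) at_top)"
      by (rule filterlim_filtercomap)
    from tendsto_divide_0[OF tendsto_const filterlim_at_top_imp_at_infinity[OF this]] show ?thesis .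
  qed
  have "((\<lambda>p. (case p of (s, l) \<Rightarrow> real (card {n. a n \<in> {s..<s + l}}) / l) - D / pi) \<longlongrightarrow> 0) (filtercomap snd at_top)"
  proof (rule Lim_null_comparison[OF _ lim])
    have "\<forall>\<^sub>F p in filtercomap snd at_top. (snd (p :: real \<times> real) > 0)"
      using eventually_filtercomapI[OF eventually_gt_at_top[of "0::real"], of snd] .
    then show "\<forall>\<^sub>F p in filtercomap snd at_top.
        norm ((case p of (s, l) \<Rightarrow> real (card {n. a n \<in> {s..<s + l}}) / l) - D / pi) \<le> C / pi / snd p"
    proof eventually_elim
      case (elim p)
      obtain s l where p: "p = (s, l)" by (cases p)
      have l: "l > 0" using elim p by simp
      let ?c = "real (card {n. a n \<in> {s..<s + l}})"
      have "\<bar>pi * ?c - D * l\<bar> \<le> C" using C(2)[of s "s + l"] l by simp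
      then have "\<bar>pi * ?c - D * l\<bar> / (pi * l) \<le> C / (pi * l)" using l by (intro divide_right_mono) auto
      moreover have "\<bar>pi * ?c - D * l\<bar> / (pi * l) = \<bar>?c / l - D / pi\<bar>"
      proof -
        have "\<bar>pi * ?c - D * l\<bar> / (pi * l) = \<bar>(pi * ?c - D * l) / (pi * l)\<bar>" using l by (simp add: abs_divide abs_mult)
        also have "(pi * ?c - D * l) / (pi * l) = ?c / l - D / pi" using l by (simp add: diff_divide_distrib)
        finally show ?thesis .
      qed
      ultimately show ?case by (simp add: p)
    qed
  qed
  then show "((\<lambda>(s, l). real (card {n. a n \<in> {s..<s + l}}) / l) \<longlongrightarrow> D / pi) (filtercomap snd at_top)"
    by (simp add: LIM_zero_cancel)
qed

text \<open>Repeated zeros are harmless: an interval of length 1 contains a bounded number of indices.\<close>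

lemma index_linear:
  obtains C where "\<And>i j. i \<le> j \<Longrightarrow> \<bar>D * (a j - a i) - pi * real_of_int (j - i)\<bar> \<le> C"
proof -
  obtain C where C: "C > 0" "\<And>s t. s \<le> t \<Longrightarrow> \<bar>pi * real (card {n. a n \<in> {s..<t}}) - D * (t - s)\<bar> \<le> C"
    using count_linear by blast
  have "\<bar>D * (a j - a i) - pi * real_of_int (j - i)\<bar> \<le> 2 * C + D" if ij: "i \<le> j" for i j
  proof -
    have le: "a i \<le> a j" using a_le ij by simp
    have "{i..j} \<subseteq> {n. a n \<in> {a i..<a j + 1}}" using a_le by (force intro: add_strict_increasing2)
    from of_nat_mono[OF card_mono[OF finite_window this], where 'a = real]
    have "real (card {i..j}) \<le> real (card {n. a n \<in> {a i..<a j + 1}})" .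
    moreover have "real (card {i..j}) = real_of_int (j - i) + 1" using ij by simp
    ultimately have "real_of_int (j - i) + 1 \<le> real (card {n. a n \<in> {a i..<a j + 1}})" by linarith
    then have "pi * (real_of_int (j - i) + 1) \<le> pi * real (card {n. a n \<in> {a i..<a j + 1}})" by (intro mult_left_mono) auto
    moreover have "pi * (real_of_int (j - i) + 1) = pi * real_of_int (j - i) + pi" by (simp only: distrib_left mult_1_right)
    moreover have "D * (a j + 1 - a i) = D * (a j - a i) + D" by (simp add: algebra_simps)
    moreover have "\<bar>pi * real (card {n. a n \<in> {a i..<a j + 1}}) - D * (a j + 1 - a i)\<bar> \<le> C"
      by (rule C(2)) (use le in simp)
    ultimately have 1: "pi * real_of_int (j - i) \<le> D * (a j - a i) + D + C"
      using pi_gt_zero by linarith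
    have sub: "{n. a n \<in> {a i..<a j}} \<subseteq> {i..<j} \<union> {n. a n \<in> {a i..<a i + 1}}"
    proof
      fix n assume n: "n \<in> {n. a n \<in> {a i..<a j}}"
      then have "n < j" using a_le[of j n] by force
      moreover have "a n \<in> {a i..<a i + 1}" if "n < i" using a_le[of n i] that n by auto
      ultimately show "n \<in> {i..<j} \<union> {n. a n \<in> {a i..<a i + 1}}" by force
    qed
    have "card {n. a n \<in> {a i..<a j}} \<le> card ({i..<j} \<union> {n. a n \<in> {a i..<a i + 1}})"
      by (rule card_mono[OF _ sub]) (use finite_window in simp)
    also have "\<dots> \<le> card {i..<j} + card {n. a n \<in> {a i..<a i + 1}}" by (rule card_Un_le)
    finally have "real (card {n. a n \<in> {a i..<a j}}) \<le> real (card {i..<j}) + real (card {n. a n \<in> {a i..<a i + 1}})"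
      by (simp only: of_nat_add[symmetric] of_nat_le_iff)
    moreover have "real (card {i..<j}) = real_of_int (j - i)" using ij by simp
    ultimately have "real (card {n. a n \<in> {a i..<a j}}) \<le> real_of_int (j - i) + real (card {n. a n \<in> {a i..<a i + 1}})"
      by linarith
    then have "pi * real (card {n. a n \<in> {a i..<a j}}) \<le> pi * real_of_int (j - i) + pi * real (card {n. a n \<in> {a i..<a i + 1}})"
      by (simp flip: distrib_left)
    then have 2: "D * (a j - a i) - C \<le> pi * real_of_int (j - i) + (D + C)"
    proof -
      have "\<bar>pi * real (card {n. a n \<in> {a i..<a i + 1}}) - D\<bar> \<le> C" using C(2)[of "a i" "a i + 1"] by simp
      then show ?thesis using C(2)[OF le] \<open>pi * real (card {n. a n \<in> {a i..<a j}}) \<le> _\<close> by linarith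
    qed
    show ?thesis using 1 2 C(1) by linarith
  qed
  then show ?thesis by (rule that)
qed

lemma symmetric_sum_bound:
  obtains C where "\<And>n. \<bar>a n + a (- n)\<bar> \<le> C"
proof -
  obtain C where C: "\<And>i j. i \<le> j \<Longrightarrow> \<bar>D * (a j - a i) - pi * real_of_int (j - i)\<bar> \<le> C"
    using index_linear by blast
  have pos: "\<bar>a n + a (- n)\<bar> \<le> 2 * C / D + 2 * \<bar>a 0\<bar>" if n: "n \<ge> 0" for n
  proof -
    have "\<bar>D * (a n + a (- n) - 2 * a 0)\<bar> \<le> 2 * C"
      using C[of 0 n] C[of "- n" 0] n by (simp add: algebra_simps)
    then have "\<bar>a n + a (- n) - 2 * a 0\<bar> \<le> 2 * C / D" using D_pos by (simp add: abs_mult le_divide_eq mult.commute)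
    then show ?thesis by linarith
  qed
  have "\<bar>a n + a (- n)\<bar> \<le> 2 * C / D + 2 * \<bar>a 0\<bar>" for n
    using pos[of n] pos[of "- n"] by (cases "n \<ge> 0") (auto simp: add.commute)
  then show ?thesis by (rule that)
qed

text \<open>Pairing \<open>a n\<close> with \<open>a (- n)\<close> is what makes the product for \<open>f\<close> converge: the sums \<open>a n + a (- n)\<close>
  are bounded by \<open>index_linear\<close>, so that the paired inverses are of the size of \<open>1 / (a n)\<^sup>2\<close>.\<close>

lemma symmetric_inverse_summable:
  "(\<lambda>n. \<bar>1 / a n + 1 / a (- n)\<bar>) summable_on UNIV"
proof -
  obtain C where C: "\<And>n. \<bar>a n + a (- n)\<bar> \<le> C" using symmetric_sum_bound by blast
  have "bij (uminus :: int \<Rightarrow> int)" by (rule bij_uminus)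
  then have "(\<lambda>n. 1 / (a (- n))\<^sup>2) summable_on UNIV"
    using summable_on_reindex_bij_betw[of uminus UNIV UNIV "\<lambda>n. 1 / (a n)\<^sup>2"] inverse_square_summable_a by simp
  then have s: "(\<lambda>n. C * (1 / (a n)\<^sup>2 + 1 / (a (- n))\<^sup>2)) summable_on UNIV"
    by (intro summable_on_cmult_right summable_on_add inverse_square_summable_a)
  show ?thesis
  proof (rule summable_on_comparison_test[OF s])
    fix n
    let ?u = "1 / \<bar>a n\<bar>" and ?v = "1 / \<bar>a (- n)\<bar>"
    have "1 / a n + 1 / a (- n) = (a n + a (- n)) * (1 / (a n * a (- n)))"
      using a_nonzero[of n] a_nonzero[of "- n"] by (simp add: field_simps)
    then have "\<bar>1 / a n + 1 / a (- n)\<bar> = \<bar>a n + a (- n)\<bar> * (?u * ?v)" by (simp add: abs_mult)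
    also have "\<dots> \<le> C * (?u\<^sup>2 + ?v\<^sup>2)"
    proof (intro mult_mono C)
      have "0 \<le> ?u * ?v" by simp
      moreover have "2 * (?u * ?v) \<le> ?u\<^sup>2 + ?v\<^sup>2" using sum_squares_bound[of ?u ?v] by (simp only: mult.assoc)
      ultimately show "?u * ?v \<le> ?u\<^sup>2 + ?v\<^sup>2" by linarith
      show "0 \<le> C" using C[of 0] by linarith
    qed simp
    finally show "\<bar>1 / a n + 1 / a (- n)\<bar> \<le> C * (1 / (a n)\<^sup>2 + 1 / (a (- n))\<^sup>2)" by (simp add: power_divide)
  qed simp
qed

end

section \<open>The product f\<close>

lemma eventually_sequentially_finite: "finite {k. \<not> Q k} \<Longrightarrow> \<forall>\<^sub>F k in sequentially. Q k"
  by (simp add: cofinite_eq_sequentially[symmetric] eventually_cofinite)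

text \<open>The enumeration \<open>int_decode\<close> visits \<open>0, -1, 1, -2, 2, \<dots>\<close>, so that its partial products of odd
  length are the symmetric partial products of \<open>f\<close>.\<close>

lemma int_decode_odd: "int_decode (2 * N + 1) = - int (Suc N)"
  and int_decode_even: "int_decode (2 * N + 2) = int (Suc N)"
proof -
  have "int_encode (- int (Suc N)) = 2 * N + 1"
    by (simp add: int_encode_def sum_encode_def nat_diff_distrib nat_add_distrib)
  then show "int_decode (2 * N + 1) = - int (Suc N)" by (metis int_encode_inverse)
  have "int_encode (int (Suc N)) = 2 * N + 2"
    by (simp add: int_encode_def sum_encode_def)
  then show "int_decode (2 * N + 2) = int (Suc N)" by (metis int_encode_inverse)
qed

lemma int_decode_Suc: "int_decode (Suc (2 * N)) = - int (Suc N)" "int_decode (Suc (Suc (2 * N))) = int (Suc N)"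
  using int_decode_odd[of N] int_decode_even[of N] by (simp_all del: of_nat_Suc)

lemma int_decode_0: "int_decode 0 = 0"
  by (simp add: int_decode_def sum_decode_def)

lemma weierstrass_factor_1_eq: "weierstrass_factor 1 w = (1 - w) * exp w"
  by (simp add: weierstrass_factor_def)

lemma has_sum_nat_reindex:
  assumes "(f has_sum s) (UNIV :: int set)"
  shows "(\<lambda>k. f (int_decode k)) sums s"
proof -
  have "((\<lambda>k. f (int_decode k)) has_sum s) UNIV"
    using assms has_sum_reindex_bij_betw[OF bij_int_decode, of f s] by simp
  then show ?thesis by (rule has_sum_imp_sums)
qed

lemma summable_half_line:
  fixes f :: "int \<Rightarrow> real"
  assumes "f summable_on UNIV"
  shows "(\<lambda>k. f (int (Suc k))) summable_on UNIV"
proof -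
  have "f summable_on range (\<lambda>k. int (Suc k))" using assms by (rule summable_on_subset_banach) auto
  then have "(f \<circ> (\<lambda>k. int (Suc k))) summable_on UNIV"
    by (subst (asm) summable_on_reindex) (auto simp: inj_on_def)
  then show ?thesis by (simp add: o_def)
qed

text \<open>A bound that does not depend on \<open>y\<close>, used as a majorant for \<open>y\<close> tending to infinity.\<close>

lemma Re_pair_bound:
  fixes p q y :: real
  assumes p: "p \<noteq> 0" and q: "q \<noteq> 0"
  shows "\<bar>p / (p\<^sup>2 + y\<^sup>2) + q / (q\<^sup>2 + y\<^sup>2)\<bar> \<le> \<bar>1 / p + 1 / q\<bar>"
proof -
  define A where "A = p\<^sup>2 + y\<^sup>2"
  define B where "B = q\<^sup>2 + y\<^sup>2"
  have A: "A > 0" and B: "B > 0" using p q by (auto simp: A_def B_def intro: add_pos_nonneg)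
  have "(p * q + y\<^sup>2)\<^sup>2 \<le> A * B"
  proof -
    have "A * B - (p * q + y\<^sup>2)\<^sup>2 = (y * (p - q))\<^sup>2"
      by (simp add: A_def B_def power2_eq_square algebra_simps)
    then show ?thesis using zero_le_power2[of "y * (p - q)"] by linarith
  qed
  moreover have "(p * q)\<^sup>2 \<le> A * B"
    unfolding power_mult_distrib A_def B_def by (intro mult_mono) auto
  ultimately have "(p * q + y\<^sup>2)\<^sup>2 * (p * q)\<^sup>2 \<le> (A * B) * (A * B)"
    by (intro mult_mono) (use A B in auto)
  moreover have "(\<bar>p * q + y\<^sup>2\<bar> * \<bar>p * q\<bar>)\<^sup>2 = (p * q + y\<^sup>2)\<^sup>2 * (p * q)\<^sup>2"
    by (simp only: power_mult_distrib[of "\<bar>p * q + y\<^sup>2\<bar>"] power2_abs)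
  ultimately have "(\<bar>p * q + y\<^sup>2\<bar> * \<bar>p * q\<bar>)\<^sup>2 \<le> (A * B)\<^sup>2"
    by (simp only: power2_eq_square[of "A * B"])
  then have le: "\<bar>p * q + y\<^sup>2\<bar> * \<bar>p * q\<bar> \<le> A * B"
    by (rule power2_le_imp_le) (use A B in simp)
  have "p / A + q / B = (p + q) * ((p * q + y\<^sup>2) / (A * B))"
    using A B by (simp add: add_frac_eq) (simp add: A_def B_def power2_eq_square algebra_simps)
  then have "\<bar>p / A + q / B\<bar> = \<bar>p + q\<bar> * (\<bar>p * q + y\<^sup>2\<bar> / (A * B))"
    using A B by (simp add: abs_mult)
  also have "\<dots> \<le> \<bar>p + q\<bar> * (1 / \<bar>p * q\<bar>)"
    using le A B p q by (intro mult_left_mono) (auto simp: divide_le_eq le_divide_eq)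
  also have "\<dots> = \<bar>1 / p + 1 / q\<bar>"
  proof -
    have "1 / p + 1 / q = (p + q) * (1 / (p * q))" using p q by (simp add: field_simps)
    then show ?thesis by (simp add: abs_mult)
  qed
  finally show ?thesis by (simp add: A_def B_def)
qed

context bounded_low_part
begin

definition \<alpha> :: "nat \<Rightarrow> complex" where "\<alpha> k = of_real (a (int_decode k))"

text \<open>The canonical product of genus one has all analytic properties by the general theory of Weierstrass
  products. It differs from \<open>f\<close> by a factor \<open>exp (\<kappa>0 z)\<close>, where \<open>\<kappa>0\<close> is the symmetric sum of the
  inverses of the zeros.\<close>

lemma weierstrass: "weierstrass_product \<alpha> (\<lambda>_. 1)"
proof
  show "\<alpha> n \<noteq> 0" for n by (simp add: \<alpha>_def a_nonzero)
  show "filterlim \<alpha> at_infinity sequentially"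
    unfolding filterlim_at_infinity_conv_norm_at_top filterlim_at_top
  proof
    fix Z :: real
    have "finite (int_decode -` {n. \<bar>a n\<bar> \<le> Z})"
      by (rule finite_vimageI[OF finite_small]) (rule inj_int_decode)
    then have "finite {k. \<not> Z \<le> norm (\<alpha> k)}" by (rule finite_subset[rotated]) (auto simp: \<alpha>_def)
    then show "\<forall>\<^sub>F k in sequentially. Z \<le> norm (\<alpha> k)" by (rule eventually_sequentially_finite)
  qed
  fix r :: real assume "r > 0"
  have "summable (\<lambda>k. 1 / (a (int_decode k))\<^sup>2)"
    using has_sum_nat_reindex[OF has_sum_infsum[OF inverse_square_summable_a]] by (rule sums_summable)
  then have "summable (\<lambda>k. r\<^sup>2 * (1 / (a (int_decode k))\<^sup>2))" by (rule summable_mult)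
  then show "summable (\<lambda>n. (r / norm (\<alpha> n)) ^ Suc 1)"
    by (simp add: \<alpha>_def power_divide numeral_2_eq_2[symmetric])
qed

definition canonical_product :: "complex \<Rightarrow> complex" where "canonical_product = weierstrass_product.f \<alpha> (\<lambda>_. 1)"
definition canonical_partial :: "nat \<Rightarrow> complex \<Rightarrow> complex" where "canonical_partial N z = (\<Prod>n<N. weierstrass_factor 1 (z / \<alpha> n))"

lemma canonical_partial_uniform_limit: "R > 0 \<Longrightarrow> uniform_limit (cball 0 R) canonical_partial canonical_product sequentially"
  using weierstrass_product.uniform_limit[OF weierstrass] by (simp add: canonical_partial_def[abs_def] canonical_product_def)

lemma canonical_partial_tendsto: "(\<lambda>N. canonical_partial N z) \<longlonglongrightarrow> canonical_product z"
  by (rule tendsto_uniform_limitI[OF canonical_partial_uniform_limit[of "norm z + 1"]]) (auto intro: add_nonneg_pos)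

lemma canonical_partial_derivative:
  assumes "Im z > 0"
  shows "(canonical_partial N has_field_derivative canonical_partial N z * (\<Sum>n<N. 1 / (z - \<alpha> n) + 1 / \<alpha> n)) (at z)"
proof (induction N)
  case 0
  then show ?case by (simp add: canonical_partial_def[abs_def])
next
  case (Suc N)
  have nz: "\<alpha> N \<noteq> 0" "z - \<alpha> N \<noteq> 0" using assms by (auto simp: \<alpha>_def a_nonzero complex_eq_iff)
  have "((\<lambda>z. (1 - z / \<alpha> N) * exp (z / \<alpha> N)) has_field_derivative
      (- (1 / \<alpha> N) * exp (z / \<alpha> N) + exp (z / \<alpha> N) * (1 / \<alpha> N) * (1 - z / \<alpha> N))) (at z)"
    by (use nz in \<open>auto intro!: derivative_eq_intros\<close>)
  moreover have "- (1 / \<alpha> N) * exp (z / \<alpha> N) + exp (z / \<alpha> N) * (1 / \<alpha> N) * (1 - z / \<alpha> N)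
      = (1 - z / \<alpha> N) * exp (z / \<alpha> N) * (1 / (z - \<alpha> N) + 1 / \<alpha> N)"
  proof -
    have "- (1 / \<alpha> N) = (1 - z / \<alpha> N) * (1 / (z - \<alpha> N))" using nz by (simp add: field_simps)
    then show ?thesis by (simp only: distrib_left mult_ac)
  qed
  ultimately have w: "((\<lambda>z. weierstrass_factor 1 (z / \<alpha> N)) has_field_derivative
      weierstrass_factor 1 (z / \<alpha> N) * (1 / (z - \<alpha> N) + 1 / \<alpha> N)) (at z)"
    by (simp only: weierstrass_factor_1_eq)
  let ?S = "\<Sum>n<N. 1 / (z - \<alpha> n) + 1 / \<alpha> n" and ?v = "1 / (z - \<alpha> N) + 1 / \<alpha> N" and ?w = "weierstrass_factor 1 (z / \<alpha> N)"
  have "((\<lambda>z. canonical_partial N z * weierstrass_factor 1 (z / \<alpha> N)) has_field_derivative (canonical_partial N z * ?S) * ?w + (?w * ?v) * canonical_partial N z) (at z)"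
    by (rule DERIV_mult[OF Suc w])
  moreover have "(canonical_partial N z * ?S) * ?w + (?w * ?v) * canonical_partial N z = (canonical_partial N z * ?w) * (?S + ?v)"
    by (simp only: distrib_left mult_ac)
  moreover have "canonical_partial (Suc N) = (\<lambda>z. canonical_partial N z * weierstrass_factor 1 (z / \<alpha> N))" by (auto simp: canonical_partial_def)
  ultimately show ?case by simp
qed

lemma H_sums: "Im z > 0 \<Longrightarrow> (\<lambda>k. 1 / (z - \<alpha> k) + 1 / \<alpha> k) sums H z"
  using has_sum_nat_reindex[OF H_has_sum] by (simp add: \<alpha>_def)

lemma canonical_product_holomorphic: "canonical_product holomorphic_on S"
  unfolding canonical_product_def by (rule weierstrass_product.holomorphic[OF weierstrass])

lemma canonical_product_deriv:
  assumes z: "Im z > 0"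
  shows "deriv canonical_product z = canonical_product z * H z"
proof -
  have sub: "cball z (Im z / 2) \<subseteq> cball 0 (2 * norm z)"
    using UHP_cball(2)[OF z] by auto
  have nz: "norm z > 0" using z by auto
  have ul: "uniform_limit (cball z (Im z / 2)) canonical_partial canonical_product sequentially"
    by (rule uniform_limit_on_subset[OF canonical_partial_uniform_limit sub]) (use nz in simp)
  have der: "\<forall>w\<in>ball z (Im z / 2). (canonical_partial N has_field_derivative canonical_partial N w * (\<Sum>n<N. 1 / (w - \<alpha> n) + 1 / \<alpha> n)) (at w)" for N
    using UHP_cball(3)[OF z] by (auto intro!: canonical_partial_derivative)
  have "continuous_on (cball z (Im z / 2)) (canonical_partial N)" for N
    unfolding canonical_partial_def weierstrass_factor_1_eq by (intro continuous_intros) (auto simp: \<alpha>_def a_nonzero)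
  then have ev: "\<forall>\<^sub>F N in sequentially. continuous_on (cball z (Im z / 2)) (canonical_partial N) \<and>
      (\<forall>w\<in>ball z (Im z / 2). (canonical_partial N has_field_derivative canonical_partial N w * (\<Sum>n<N. 1 / (w - \<alpha> n) + 1 / \<alpha> n)) (at w))"
    using der by (intro always_eventually) blast
  obtain g' where g': "\<And>w. w \<in> ball z (Im z / 2) \<Longrightarrow> (canonical_product has_field_derivative g' w) (at w) \<and>
      (\<lambda>N. canonical_partial N w * (\<Sum>n<N. 1 / (w - \<alpha> n) + 1 / \<alpha> n)) \<longlonglongrightarrow> g' w"
    using has_complex_derivative_uniform_limit[OF ev ul] z by auto
  have zz: "z \<in> ball z (Im z / 2)" using z by simp
  have "(\<lambda>N. canonical_partial N z * (\<Sum>n<N. 1 / (z - \<alpha> n) + 1 / \<alpha> n)) \<longlonglongrightarrow> canonical_product z * H z"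
    by (intro tendsto_mult canonical_partial_tendsto) (use H_sums[OF z] in \<open>simp only: sums_def\<close>)
  with g'[OF zz] have "g' z = canonical_product z * H z" using LIMSEQ_unique by blast
  then show ?thesis using g'[OF zz] by (simp add: DERIV_imp_deriv)
qed

definition pair_factor :: "complex \<Rightarrow> nat \<Rightarrow> complex" where
  "pair_factor z k = (1 - z / a (int (Suc k))) * (1 - z / a (- int (Suc k)))"

definition pair_inverse :: "nat \<Rightarrow> real" where
  "pair_inverse k = 1 / a (int (Suc k)) + 1 / a (- int (Suc k))"

definition \<kappa>0 :: real where "\<kappa>0 = 1 / a 0 + (\<Sum>k. pair_inverse k)"

lemma pair_inverse_summable_on: "(\<lambda>k. \<bar>pair_inverse k\<bar>) summable_on UNIV"
  using summable_half_line[OF symmetric_inverse_summable] by (simp add: pair_inverse_def)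

lemma pair_inverse_summable: "summable (\<lambda>k. \<bar>pair_inverse k\<bar>)"
  using has_sum_imp_sums[OF has_sum_infsum[OF pair_inverse_summable_on]] by (rule sums_summable)

lemma pair_factor_summable: "summable (\<lambda>k. norm (pair_factor z k - 1))"
proof -
  have s1: "summable (\<lambda>k. 1 / (a (int (Suc k)))\<^sup>2)"
    using has_sum_imp_sums[OF has_sum_infsum[OF summable_half_line[OF inverse_square_summable_a]]] by (rule sums_summable)
  have "(\<lambda>n. 1 / (a (- n))\<^sup>2) summable_on UNIV"
    using summable_on_reindex_bij_betw[of uminus UNIV UNIV "\<lambda>n. 1 / (a n)\<^sup>2"] inverse_square_summable_a by (simp add: bij_uminus)
  from has_sum_imp_sums[OF has_sum_infsum[OF summable_half_line[OF this]]]
  have s2: "summable (\<lambda>k. 1 / (a (- int (Suc k)))\<^sup>2)" by (rule sums_summable)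
  show ?thesis
  proof (rule summable_comparison_test')
    show "summable (\<lambda>k. norm z * \<bar>pair_inverse k\<bar> + (norm z)\<^sup>2 * (1 / (a (int (Suc k)))\<^sup>2 + 1 / (a (- int (Suc k)))\<^sup>2))"
      by (intro summable_add summable_mult pair_inverse_summable s1 s2)
    fix k
    let ?p = "a (int (Suc k))" and ?q = "a (- int (Suc k))"
    have nz: "?p \<noteq> 0" "?q \<noteq> 0" using a_nonzero by auto
    have "pair_factor z k - 1 = - (z * of_real (pair_inverse k)) + z\<^sup>2 * of_real (1 / ?p * (1 / ?q))"
      using nz by (simp add: pair_factor_def pair_inverse_def field_simps power2_eq_square)
    then have "norm (pair_factor z k - 1) \<le> norm z * \<bar>pair_inverse k\<bar> + (norm z)\<^sup>2 * \<bar>1 / ?p * (1 / ?q)\<bar>"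
      using norm_triangle_ineq[of "- (z * of_real (pair_inverse k))" "z\<^sup>2 * of_real (1 / ?p * (1 / ?q))"]
      by (simp only: norm_minus_cancel norm_mult norm_of_real norm_power)
    moreover have "(norm z)\<^sup>2 * \<bar>1 / ?p * (1 / ?q)\<bar> \<le> (norm z)\<^sup>2 * (1 / ?p\<^sup>2 + 1 / ?q\<^sup>2)"
    proof (intro mult_left_mono)
      have "2 * (\<bar>1 / ?p\<bar> * \<bar>1 / ?q\<bar>) \<le> \<bar>1 / ?p\<bar>\<^sup>2 + \<bar>1 / ?q\<bar>\<^sup>2"
        using sum_squares_bound[of "\<bar>1 / ?p\<bar>" "\<bar>1 / ?q\<bar>"] by (simp only: mult.assoc)
      moreover have "0 \<le> \<bar>1 / ?p\<bar> * \<bar>1 / ?q\<bar>" by simp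
      ultimately have "\<bar>1 / ?p\<bar> * \<bar>1 / ?q\<bar> \<le> \<bar>1 / ?p\<bar>\<^sup>2 + \<bar>1 / ?q\<bar>\<^sup>2" by linarith
      then show "\<bar>1 / ?p * (1 / ?q)\<bar> \<le> 1 / ?p\<^sup>2 + 1 / ?q\<^sup>2"
        by (simp only: abs_mult[symmetric] power2_abs power_one_over)
    qed simp
    ultimately show "norm (norm (pair_factor z k - 1)) \<le> norm z * \<bar>pair_inverse k\<bar> + (norm z)\<^sup>2 * (1 / ?p\<^sup>2 + 1 / ?q\<^sup>2)"
      by simp
  qed
qed

definition f_partial :: "nat \<Rightarrow> complex \<Rightarrow> complex" where
  "f_partial N z = (1 - z / a 0) * (\<Prod>k<N. pair_factor z k)"

lemma f_partial_tendsto: "(\<lambda>N. f_partial N z) \<longlonglongrightarrow> f_prod a z"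
proof -
  have "abs_convergent_prod (pair_factor z)" using pair_factor_summable by (simp add: abs_convergent_prod_conv_summable)
  then have "convergent_prod (pair_factor z)" by (rule abs_convergent_prod_imp_convergent_prod)
  then have "(\<lambda>N. \<Prod>k\<le>N. pair_factor z k) \<longlonglongrightarrow> prodinf (pair_factor z)" by (rule convergent_prod_LIMSEQ)
  then have "(\<lambda>N. \<Prod>k<Suc N. pair_factor z k) \<longlonglongrightarrow> prodinf (pair_factor z)" by (simp only: lessThan_Suc_atMost)
  then have "(\<lambda>N. \<Prod>k<N. pair_factor z k) \<longlonglongrightarrow> prodinf (pair_factor z)" by (rule LIMSEQ_imp_Suc)
  then have "(\<lambda>N. (1 - z / a 0) * (\<Prod>k<N. pair_factor z k)) \<longlonglongrightarrow> (1 - z / a 0) * prodinf (pair_factor z)" by (intro tendsto_intros)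
  then show ?thesis unfolding f_partial_def f_prod_def pair_factor_def[abs_def] .
qed

lemma inverse_sum: "(\<Sum>n<2 * N + 1. 1 / \<alpha> n) = of_real (1 / a 0 + (\<Sum>k<N. pair_inverse k))"
proof (induction N)
  case (Suc N)
  have "(\<Sum>n<2 * Suc N + 1. 1 / \<alpha> n) = (\<Sum>n<2 * N + 1. 1 / \<alpha> n) + 1 / \<alpha> (2 * N + 1) + 1 / \<alpha> (2 * N + 2)"
    by (simp add: numeral_2_eq_2)
  then show ?case unfolding Suc by (simp add: \<alpha>_def int_decode_Suc pair_inverse_def del: of_nat_Suc)
qed (simp add: \<alpha>_def int_decode_0)

lemma f_partial_eq_canonical_partial: "f_partial N z = canonical_partial (2 * N + 1) z * exp (- z * (\<Sum>n<2 * N + 1. 1 / \<alpha> n))"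
proof (induction N)
  case 0
  then show ?case
    by (simp add: f_partial_def canonical_partial_def weierstrass_factor_1_eq[unfolded One_nat_def] \<alpha>_def int_decode_0 mult.assoc flip: exp_add)
next
  case (Suc N)
  let ?p = "\<alpha> (2 * N + 1)" and ?q = "\<alpha> (2 * N + 2)" and ?S = "\<Sum>n<2 * N + 1. 1 / \<alpha> n"
  have S: "(\<Sum>n<2 * Suc N + 1. 1 / \<alpha> n) = ?S + 1 / ?p + 1 / ?q" by (simp add: numeral_2_eq_2)
  have P: "canonical_partial (2 * Suc N + 1) z = canonical_partial (2 * N + 1) z * ((1 - z / ?p) * exp (z / ?p)) * ((1 - z / ?q) * exp (z / ?q))"
    by (simp add: canonical_partial_def weierstrass_factor_1_eq[unfolded One_nat_def] numeral_2_eq_2)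
  have uN: "pair_factor z N = (1 - z / ?q) * (1 - z / ?p)"
    by (simp only: pair_factor_def \<alpha>_def int_decode_odd int_decode_even)
  have e: "exp (- z * (?S + 1 / ?p + 1 / ?q)) * (exp (z / ?p) * exp (z / ?q)) = exp (- z * ?S)"
    unfolding exp_add[symmetric] by (simp add: algebra_simps)
  have "f_partial (Suc N) z = f_partial N z * pair_factor z N" by (simp add: f_partial_def)
  also have "\<dots> = canonical_partial (2 * N + 1) z * exp (- z * ?S) * ((1 - z / ?q) * (1 - z / ?p))" by (simp only: Suc uN)
  also have "\<dots> = canonical_partial (2 * Suc N + 1) z * exp (- z * (?S + 1 / ?p + 1 / ?q))"
    unfolding P e[symmetric] by (simp only: mult_ac)
  finally show ?case by (simp only: S)
qed

lemma odd_subseq: "strict_mono (\<lambda>N. 2 * N + 1 :: nat)"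
  by (rule strict_monoI) simp

lemma inverse_sum_tendsto: "(\<lambda>N. \<Sum>n<2 * N + 1. 1 / \<alpha> n) \<longlonglongrightarrow> of_real \<kappa>0"
proof -
  have "(\<lambda>N. \<Sum>k<N. pair_inverse k) \<longlonglongrightarrow> (\<Sum>k. pair_inverse k)"
    using summable_rabs_cancel[OF pair_inverse_summable] by (rule summable_LIMSEQ)
  then have "(\<lambda>N. 1 / a 0 + (\<Sum>k<N. pair_inverse k)) \<longlonglongrightarrow> \<kappa>0" unfolding \<kappa>0_def by (intro tendsto_intros)
  then show ?thesis unfolding inverse_sum by (rule tendsto_of_real)
qed

lemma f_eq_canonical_product: "f_prod a z = canonical_product z * exp (- z * of_real \<kappa>0)"
proof (rule LIMSEQ_unique[OF f_partial_tendsto])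
  show "(\<lambda>N. f_partial N z) \<longlonglongrightarrow> canonical_product z * exp (- z * of_real \<kappa>0)"
    unfolding f_partial_eq_canonical_partial
    by (intro tendsto_intros inverse_sum_tendsto LIMSEQ_subseq_LIMSEQ[OF canonical_partial_tendsto odd_subseq, unfolded o_def])
qed

lemma f_holomorphic: "f_prod a holomorphic_on S"
  unfolding f_eq_canonical_product[abs_def] by (intro holomorphic_intros canonical_product_holomorphic)

lemma f_zorder: "zorder (f_prod a) z = int (card {n. complex_of_real (a n) = z})"
proof -
  have W0: "canonical_product 0 \<noteq> 0"
    unfolding canonical_product_def weierstrass_product.zero[OF weierstrass] by (auto simp: \<alpha>_def a_nonzero)
  have "zorder (\<lambda>z. canonical_product z * exp (- z * of_real \<kappa>0)) z = zorder canonical_product z + zorder (\<lambda>z. exp (- z * of_real \<kappa>0)) z"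
  proof (rule zorder_mult)
    show "canonical_product meromorphic_on {z}"
      by (intro analytic_on_imp_meromorphic_on holomorphic_on_imp_analytic_at[OF canonical_product_holomorphic open_UNIV]) simp
    show "(\<lambda>z. exp (- z * of_real \<kappa>0)) meromorphic_on {z}"
      by (intro analytic_on_imp_meromorphic_on analytic_intros)
    show "\<exists>\<^sub>F z in at z. canonical_product z \<noteq> 0" by (rule entire_nonzero_frequently[OF canonical_product_holomorphic W0])
  qed simp
  also have "zorder (\<lambda>z. exp (- z * of_real \<kappa>0)) z = 0"
    by (rule zorder_eq_0I) (auto intro!: analytic_intros)
  also have "zorder canonical_product z = int (card (\<alpha> -` {z}))"
    unfolding canonical_product_def by (rule weierstrass_product.zorder[OF weierstrass])
  also have "card (\<alpha> -` {z}) = card {n. complex_of_real (a n) = z}"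
  proof (rule bij_betw_same_card[of int_decode])
    show "bij_betw int_decode (\<alpha> -` {z}) {n. complex_of_real (a n) = z}"
      unfolding bij_betw_def
    proof
      show "inj_on int_decode (\<alpha> -` {z})" by (rule inj_int_decode)
      show "int_decode ` (\<alpha> -` {z}) = {n. complex_of_real (a n) = z}"
      proof (intro equalityI subsetI)
        fix n assume "n \<in> {n. complex_of_real (a n) = z}"
        then show "n \<in> int_decode ` (\<alpha> -` {z})"
          by (intro image_eqI[of _ _ "int_encode n"]) (auto simp: \<alpha>_def)
      qed (auto simp: \<alpha>_def)
    qed
  qed
  finally show ?thesis by (simp add: f_eq_canonical_product[abs_def])
qed

lemma f_0: "f_prod a 0 = 1"
  using LIMSEQ_unique[OF f_partial_tendsto[of 0]] by (simp add: f_partial_def pair_factor_def)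

definition \<kappa> :: complex where "\<kappa> = K - of_real \<kappa>0"

lemma f_nonzero: "Im z > 0 \<Longrightarrow> f_prod a z \<noteq> 0"
  unfolding f_eq_canonical_product canonical_product_def using weierstrass_product.zero[OF weierstrass, of z] by (auto simp: \<alpha>_def)

lemma f_deriv:
  assumes z: "Im z > 0"
  shows "deriv (f_prod a) z = f_prod a z * (\<kappa> - 2 * pi * \<i> * E z)"
proof -
  have dW: "(canonical_product has_field_derivative canonical_product z * H z) (at z)"
    using holomorphic_derivI[OF canonical_product_holomorphic open_UNIV, of z] canonical_product_deriv[OF z] by simp
  have de: "((\<lambda>z. exp (- z * of_real \<kappa>0)) has_field_derivative exp (- z * of_real \<kappa>0) * (- of_real \<kappa>0)) (at z)"
    by (auto intro!: derivative_eq_intros)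
  have "(f_prod a has_field_derivative (canonical_product z * H z) * exp (- z * of_real \<kappa>0) + (exp (- z * of_real \<kappa>0) * (- of_real \<kappa>0)) * canonical_product z) (at z)"
    unfolding f_eq_canonical_product[abs_def] by (rule DERIV_mult[OF dW de])
  then have "deriv (f_prod a) z = (canonical_product z * H z) * exp (- z * of_real \<kappa>0) + (exp (- z * of_real \<kappa>0) * (- of_real \<kappa>0)) * canonical_product z"
    by (rule DERIV_imp_deriv)
  also have "\<dots> = f_prod a z * (H z - of_real \<kappa>0)"
    unfolding f_eq_canonical_product by (simp add: algebra_simps)
  also have "H z - of_real \<kappa>0 = \<kappa> - 2 * pi * \<i> * E z" using H_eq_E[OF z] by (simp add: \<kappa>_def)
  finally show ?thesis .
qed

lemma E_tendsto_0: "(\<lambda>j. E (\<i> * of_real (real (Suc j)))) \<longlonglongrightarrow> 0"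
proof -
  let ?f = "\<lambda>j \<gamma>. b \<gamma> * exp (2 * pi * \<i> * (\<i> * of_real (real (Suc j))) * of_real \<gamma>)"
  have n: "norm (?f j \<gamma>) = norm (b \<gamma>) * exp (- 2 * pi * real (Suc j) * \<gamma>)" for j \<gamma>
    by (simp add: norm_mult norm_exp)
  have "(\<lambda>j. \<Sum>\<^sub>\<infinity>\<gamma>\<in>P. ?f j \<gamma>) \<longlonglongrightarrow> (\<Sum>\<^sub>\<infinity>\<gamma>\<in>P. 0)"
  proof (rule tendsto_infsum_dominated[OF b_exp_summable[of "2 * pi"]])
    have "norm (?f j \<gamma>) \<le> norm (b \<gamma>) * exp (- (2 * pi) * \<gamma>)" if "\<gamma> \<in> P" for j \<gamma>
      unfolding n
    proof (intro mult_left_mono)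
      have "2 * pi * 1 * \<gamma> \<le> 2 * pi * real (Suc j) * \<gamma>" using P_pos[OF that] by (intro mult_right_mono mult_left_mono) auto
      then show "exp (- 2 * pi * real (Suc j) * \<gamma>) \<le> exp (- (2 * pi) * \<gamma>)" by simp
    qed simp
    then show "\<forall>\<^sub>F j in sequentially. \<forall>\<gamma>\<in>P. norm (?f j \<gamma>) \<le> norm (b \<gamma>) * exp (- (2 * pi) * \<gamma>)" by simp
    fix \<gamma> assume g: "\<gamma> \<in> P"
    have "(\<lambda>j. exp (- 2 * pi * \<gamma>) ^ Suc j) \<longlonglongrightarrow> 0"
      by (rule LIMSEQ_Suc[OF LIMSEQ_realpow_zero]) (use P_pos[OF g] in auto)
    then have "(\<lambda>j. norm (b \<gamma>) * exp (- 2 * pi * \<gamma>) ^ Suc j) \<longlonglongrightarrow> norm (b \<gamma>) * 0" by (intro tendsto_intros)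
    moreover have "exp (- 2 * pi * \<gamma>) ^ Suc j = exp (- 2 * pi * real (Suc j) * \<gamma>)" for j
      unfolding exp_of_nat_mult[symmetric] by (simp only: mult_ac)
    ultimately have "(\<lambda>j. norm (?f j \<gamma>)) \<longlonglongrightarrow> 0" unfolding n by simp
    then show "(\<lambda>j. ?f j \<gamma>) \<longlonglongrightarrow> 0" by (rule tendsto_norm_zero_cancel)
  qed auto
  then show ?thesis by (simp add: E_def)
qed

text \<open>Along the imaginary axis \<open>f' / f\<close> tends to \<open>\<kappa>\<close>, as \<open>E\<close> tends to 0; and its real part is a sum over
  pairs of zeros that tends to 0 by dominated convergence.\<close>

lemma Re_\<kappa>: "Re \<kappa> = 0"
proof -
  define y where "y j = real (Suc j)" for j
  define v where "v j k = a (int (Suc k)) / ((a (int (Suc k)))\<^sup>2 + (y j)\<^sup>2) + a (- int (Suc k)) / ((a (- int (Suc k)))\<^sup>2 + (y j)\<^sup>2)" for j k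
  have yinf: "filterlim y at_top sequentially"
    unfolding y_def by (rule filterlim_compose[OF filterlim_real_sequentially filterlim_Suc])
  have term0: "(\<lambda>j. p / (p\<^sup>2 + (y j)\<^sup>2)) \<longlonglongrightarrow> 0" for p
  proof (rule tendsto_divide_0[OF tendsto_const], rule filterlim_at_top_imp_at_infinity,
      rule filterlim_tendsto_add_at_top[OF tendsto_const])
    show "filterlim (\<lambda>j. (y j)\<^sup>2) at_top sequentially" by (rule filterlim_pow_at_top[OF _ yinf]) simp
  qed
  have vb: "\<bar>v j k\<bar> \<le> \<bar>pair_inverse k\<bar>" for j k
    unfolding v_def pair_inverse_def by (rule Re_pair_bound) (auto simp: a_nonzero)
  have vs: "v j summable_on UNIV" for j
    by (rule norm_infsum_le_dominated(1)[OF pair_inverse_summable_on]) (use vb in auto)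
  have ReH: "Re (H (\<i> * of_real (y j))) - \<kappa>0 = - (a 0 / ((a 0)\<^sup>2 + (y j)\<^sup>2) + (\<Sum>\<^sub>\<infinity>k. v j k))" for j
  proof -
    let ?z = "\<i> * of_real (y j)"
    have y0: "y j > 0" by (simp add: y_def)
    have "(\<lambda>N. (\<Sum>n<2 * N + 1. 1 / (?z - \<alpha> n) + 1 / \<alpha> n) - (\<Sum>n<2 * N + 1. 1 / \<alpha> n)) \<longlonglongrightarrow> H ?z - of_real \<kappa>0"
      by (intro tendsto_diff inverse_sum_tendsto LIMSEQ_subseq_LIMSEQ[OF H_sums[unfolded sums_def] odd_subseq, unfolded o_def])
         (use y0 in simp)
    then have "(\<lambda>N. \<Sum>n<2 * N + 1. 1 / (?z - \<alpha> n)) \<longlonglongrightarrow> H ?z - of_real \<kappa>0" by (simp add: sum.distrib)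
    then have l1: "(\<lambda>N. Re (\<Sum>n<2 * N + 1. 1 / (?z - \<alpha> n))) \<longlonglongrightarrow> Re (H ?z - of_real \<kappa>0)" by (rule tendsto_Re)
    have Re1: "Re (1 / (?z - of_real p)) = - (p / (p\<^sup>2 + (y j)\<^sup>2))" for p by (simp add: Re_divide)
    have "Re (\<Sum>n<2 * N + 1. 1 / (?z - \<alpha> n)) = - (a 0 / ((a 0)\<^sup>2 + (y j)\<^sup>2) + (\<Sum>k<N. v j k))" for N
    proof (induction N)
      case 0
      have "Re (1 / (?z - \<alpha> 0)) = - (a 0 / ((a 0)\<^sup>2 + (y j)\<^sup>2))" unfolding \<alpha>_def int_decode_0 by (rule Re1)
      then show ?case by simp
    next
      case (Suc N)
      have "(\<Sum>n<2 * Suc N + 1. 1 / (?z - \<alpha> n)) = (\<Sum>n<2 * N + 1. 1 / (?z - \<alpha> n)) + 1 / (?z - \<alpha> (2 * N + 1)) + 1 / (?z - \<alpha> (2 * N + 2))"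
        by (simp add: numeral_2_eq_2)
      then have "Re (\<Sum>n<2 * Suc N + 1. 1 / (?z - \<alpha> n)) = Re (\<Sum>n<2 * N + 1. 1 / (?z - \<alpha> n))
         + Re (1 / (?z - \<alpha> (2 * N + 1))) + Re (1 / (?z - \<alpha> (2 * N + 2)))" by (simp only: plus_complex.sel)
      moreover have "Re (1 / (?z - \<alpha> (2 * N + 1))) + Re (1 / (?z - \<alpha> (2 * N + 2))) = - v j N"
        unfolding \<alpha>_def int_decode_odd int_decode_even Re1 v_def by simp
      ultimately show ?case unfolding Suc by (simp add: add.assoc)
    qed
    moreover have "(\<lambda>N. - (a 0 / ((a 0)\<^sup>2 + (y j)\<^sup>2) + (\<Sum>k<N. v j k))) \<longlonglongrightarrow> - (a 0 / ((a 0)\<^sup>2 + (y j)\<^sup>2) + (\<Sum>\<^sub>\<infinity>k. v j k))"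
      by (intro tendsto_intros) (use has_sum_imp_sums[OF has_sum_infsum[OF vs]] in \<open>simp only: sums_def\<close>)
    ultimately have "(\<lambda>N. Re (\<Sum>n<2 * N + 1. 1 / (?z - \<alpha> n))) \<longlonglongrightarrow> - (a 0 / ((a 0)\<^sup>2 + (y j)\<^sup>2) + (\<Sum>\<^sub>\<infinity>k. v j k))" by simp
    from LIMSEQ_unique[OF l1 this] show ?thesis by simp
  qed
  have "(\<lambda>j. \<Sum>\<^sub>\<infinity>k. v j k) \<longlonglongrightarrow> (\<Sum>\<^sub>\<infinity>k::nat. 0)"
  proof (rule tendsto_infsum_dominated[OF pair_inverse_summable_on])
    show "\<forall>\<^sub>F j in sequentially. \<forall>k\<in>UNIV. norm (v j k) \<le> \<bar>pair_inverse k\<bar>" using vb by simp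
    show "(\<lambda>j. v j k) \<longlonglongrightarrow> 0" for k
      using tendsto_add[OF term0[of "a (int (Suc k))"] term0[of "a (- int (Suc k))"]] by (simp add: v_def)
  qed
  then have "(\<lambda>j. - (a 0 / ((a 0)\<^sup>2 + (y j)\<^sup>2) + (\<Sum>\<^sub>\<infinity>k. v j k))) \<longlonglongrightarrow> - (0 + 0)"
    by (intro tendsto_intros term0) simp
  then have l1: "(\<lambda>j. Re (H (\<i> * of_real (y j))) - \<kappa>0) \<longlonglongrightarrow> 0" unfolding ReH by simp
  have "Re (H (\<i> * of_real (y j))) - \<kappa>0 = Re (\<kappa> - 2 * pi * \<i> * E (\<i> * of_real (y j)))" for j
    using H_eq_E[of "\<i> * of_real (y j)"] by (simp add: \<kappa>_def y_def)
  moreover have "(\<lambda>j. Re (\<kappa> - 2 * pi * \<i> * E (\<i> * of_real (y j)))) \<longlonglongrightarrow> Re (\<kappa> - 2 * pi * \<i> * 0)"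
    unfolding y_def by (intro tendsto_intros E_tendsto_0)
  ultimately have "(\<lambda>j. Re (H (\<i> * of_real (y j))) - \<kappa>0) \<longlonglongrightarrow> Re \<kappa>" by simp
  from LIMSEQ_unique[OF this l1] show ?thesis .
qed

lemma \<kappa>_eq: "\<kappa> = - \<i> * of_real D"
  using Re_\<kappa> by (simp add: complex_eq_iff \<kappa>_def D_def)

lemma f_representation:
  obtains C where "C \<noteq> 0" "\<And>z. Im z > 0 \<Longrightarrow> f_prod a z = C * exp (T (- \<i> * of_real D) z)"
proof -
  have "\<exists>C. C \<noteq> 0 \<and> (\<forall>z. Im z > 0 \<longrightarrow> f_prod a z = C * exp (T \<kappa> z))"
    by (rule exponential_representation[OF f_holomorphic f_nonzero f_deriv])
  then show ?thesis using that unfolding \<kappa>_eq by blast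
qed

lemma f_cnj: "f_prod a (cnj z) = cnj (f_prod a z)"
proof (rule LIMSEQ_unique[OF f_partial_tendsto])
  have "f_partial N (cnj z) = cnj (f_partial N z)" for N by (simp add: f_partial_def pair_factor_def)
  then show "(\<lambda>N. f_partial N (cnj z)) \<longlonglongrightarrow> cnj (f_prod a z)" using tendsto_cnj[OF f_partial_tendsto[of z]] by simp
qed

text \<open>The zeros are real, so each factor grows in modulus away from the real axis. Bounds on one horizontal
  line therefore hold in the whole strip below it.\<close>

lemma f_vertical_mono:
  assumes "\<bar>y\<bar> \<le> \<bar>y'\<bar>"
  shows "norm (f_prod a (Complex x y)) \<le> norm (f_prod a (Complex x y'))"
proof (rule LIMSEQ_le[OF tendsto_norm[OF f_partial_tendsto] tendsto_norm[OF f_partial_tendsto]])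
  have l: "norm (1 - Complex x y / of_real p) \<le> norm (1 - Complex x y' / of_real p)" for p
  proof (rule power2_le_imp_le)
    have "y\<^sup>2 \<le> y'\<^sup>2" using assms by (simp add: abs_le_square_iff)
    then have "y\<^sup>2 / p\<^sup>2 \<le> y'\<^sup>2 / p\<^sup>2" by (rule divide_right_mono) simp
    then show "(norm (1 - Complex x y / of_real p))\<^sup>2 \<le> (norm (1 - Complex x y' / of_real p))\<^sup>2"
      by (simp add: cmod_power2 power_divide)
  qed simp
  have "norm (f_partial N (Complex x y)) \<le> norm (f_partial N (Complex x y'))" for N
    unfolding f_partial_def pair_factor_def norm_mult prod_norm[symmetric]
    by (intro mult_mono prod_mono l conjI mult_nonneg_nonneg prod_nonneg norm_ge_zero ballI)
  then show "\<exists>M. \<forall>N\<ge>M. norm (f_partial N (Complex x y)) \<le> norm (f_partial N (Complex x y'))" by blast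
qed

end

section \<open>Almost periodicity of f\<close>

text \<open>Dirichlet's pigeonhole argument: two points whose phases lie in the same cell differ by an almost
  period. Fixing one representative \<open>rep c\<close> for every nonempty cell \<open>c\<close> makes the set of differences
  relatively dense, because the finitely many representatives are bounded by \<open>M\<close>.\<close>

lemma finite_frequencies_translates:
  assumes fin: "finite \<Theta>" and d: "\<delta> > 0"
  shows "\<exists>L>0. \<forall>x::real. \<exists>\<tau>. x < \<tau> \<and> \<tau> < x + L \<and>
           (\<forall>\<theta>\<in>\<Theta>. norm (exp (2 * pi * \<i> * of_real \<theta> * of_real \<tau>) - 1) < \<delta>)"
proof -
  obtain N :: nat where N: "real N > 2 * pi / \<delta>" using reals_Archimedean2 by blast
  have "2 * pi / \<delta> > 0" using d by simp
  then have N0: "real N > 0" using N by linarith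
  define cell where "cell s = restrict (\<lambda>\<theta>. \<lfloor>real N * frac (\<theta> * s)\<rfloor>) \<Theta>" for s :: real
  have "range cell \<subseteq> (\<Pi>\<^sub>E \<theta>\<in>\<Theta>. {0..<int N})"
  proof
    fix c assume "c \<in> range cell"
    then obtain s where c: "c = cell s" by auto
    have "0 \<le> \<lfloor>real N * frac (\<theta> * s)\<rfloor> \<and> \<lfloor>real N * frac (\<theta> * s)\<rfloor> < int N" for \<theta>
    proof
      show "0 \<le> \<lfloor>real N * frac (\<theta> * s)\<rfloor>" using N0 by simp
      have "real N * frac (\<theta> * s) < real N * 1" using N0 frac_lt_1 by (intro mult_strict_left_mono) auto
      then show "\<lfloor>real N * frac (\<theta> * s)\<rfloor> < int N" by (simp add: floor_less_iff)
    qed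
    then show "c \<in> (\<Pi>\<^sub>E \<theta>\<in>\<Theta>. {0..<int N})" unfolding c cell_def by (simp add: restrict_PiE_iff)
  qed
  then have finc: "finite (range cell)" by (rule finite_subset) (intro finite_PiE fin, simp)
  define rep where "rep c = (SOME s. cell s = c)" for c
  have rep: "cell (rep (cell s)) = cell s" for s unfolding rep_def by (rule someI[of "\<lambda>t. cell t = cell s" s]) simp
  define M where "M = Max (insert 0 ((\<lambda>c. \<bar>rep c\<bar>) ` range cell))"
  have M: "\<bar>rep (cell s)\<bar> \<le> M" for s unfolding M_def using finc by (intro Max_ge) auto
  have M0: "M \<ge> 0" unfolding M_def using finc by (intro Max_ge) auto
  have "\<exists>\<tau>. x < \<tau> \<and> \<tau> < x + (2 * M + 2) \<and> (\<forall>\<theta>\<in>\<Theta>. norm (exp (2 * pi * \<i> * of_real \<theta> * of_real \<tau>) - 1) < \<delta>)" for x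
  proof -
    define s where "s = x + M + 1"
    define r where "r = rep (cell s)"
    have rM: "\<bar>r\<bar> \<le> M" unfolding r_def by (rule M)
    have "norm (exp (2 * pi * \<i> * of_real \<theta> * of_real (s - r)) - 1) < \<delta>" if t: "\<theta> \<in> \<Theta>" for \<theta>
    proof -
      define d' where "d' = frac (\<theta> * s) - frac (\<theta> * r)"
      have "cell s \<theta> = cell r \<theta>" using rep[of s] by (simp add: r_def)
      then have "\<lfloor>real N * frac (\<theta> * s)\<rfloor> = \<lfloor>real N * frac (\<theta> * r)\<rfloor>" using t by (simp add: cell_def)
      then have "\<bar>real N * frac (\<theta> * s) - real N * frac (\<theta> * r)\<bar> < 1" by linarith
      then have "real N * \<bar>d'\<bar> < 1" using N0 by (simp add: d'_def abs_mult flip: right_diff_distrib)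
      then have d': "\<bar>d'\<bar> < 1 / real N" using N0 by (simp add: field_simps)
      have "\<theta> * (s - r) = of_int (\<lfloor>\<theta> * s\<rfloor> - \<lfloor>\<theta> * r\<rfloor>) + d'"
        by (simp add: d'_def frac_def algebra_simps)
      then have "complex_of_real \<theta> * of_real (s - r) = of_int (\<lfloor>\<theta> * s\<rfloor> - \<lfloor>\<theta> * r\<rfloor>) + of_real d'"
        by (metis of_real_add of_real_mult of_real_of_int_eq)
      then have "2 * pi * \<i> * (of_real \<theta> * of_real (s - r)) = 2 * pi * \<i> * (of_int (\<lfloor>\<theta> * s\<rfloor> - \<lfloor>\<theta> * r\<rfloor>) + of_real d')"
        by (rule arg_cong)
      also have "\<dots> = 2 * pi * \<i> * of_real d' + of_int (2 * (\<lfloor>\<theta> * s\<rfloor> - \<lfloor>\<theta> * r\<rfloor>)) * pi * \<i>"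
        by (simp add: distrib_left)
      finally have "2 * pi * \<i> * (of_real \<theta> * of_real (s - r)) = 2 * pi * \<i> * of_real d' + of_int (2 * (\<lfloor>\<theta> * s\<rfloor> - \<lfloor>\<theta> * r\<rfloor>)) * pi * \<i>" .
      then have "2 * pi * \<i> * of_real \<theta> * of_real (s - r) = 2 * pi * \<i> * of_real d' + of_int (2 * (\<lfloor>\<theta> * s\<rfloor> - \<lfloor>\<theta> * r\<rfloor>)) * pi * \<i>"
        by (simp only: mult.assoc)
      then have "exp (2 * pi * \<i> * of_real \<theta> * of_real (s - r)) = exp (2 * pi * \<i> * of_real d')"
        unfolding exp_eq by blast
      then have "norm (exp (2 * pi * \<i> * of_real \<theta> * of_real (s - r)) - 1) \<le> 2 * pi * \<bar>d'\<bar>"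
        using norm_exp_minus_one_le[of "2 * pi * \<i> * of_real d'"] by (simp add: norm_mult)
      also have "\<dots> < 2 * pi * (1 / real N)" using d' by (intro mult_strict_left_mono) auto
      also have "\<dots> < \<delta>" using N N0 d by (simp add: field_simps)
      finally show ?thesis .
    qed
    moreover have "x < s - r" "s - r < x + (2 * M + 2)" using rM by (auto simp: s_def)
    ultimately show ?thesis by blast
  qed
  then show ?thesis using M0 by (intro exI[of _ "2 * M + 2"]) auto
qed

text \<open>The additional frequency \<open>\<theta>0\<close>, without a weight, is meant for the factor \<open>exp (- i D z)\<close>.\<close>

lemma weighted_translates:
  assumes m: "m summable_on P" and m0: "\<And>\<gamma>. \<gamma> \<in> P \<Longrightarrow> m \<gamma> \<ge> (0::real)" and e: "\<eta> > 0"
  obtains L where "L > 0" "\<And>x::real. \<exists>\<tau>. x < \<tau> \<and> \<tau> < x + L \<and>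
      (\<Sum>\<^sub>\<infinity>\<gamma>\<in>P. m \<gamma> * norm (exp (2 * pi * \<i> * of_real \<gamma> * of_real \<tau>) - 1)) < \<eta> \<and>
      norm (exp (2 * pi * \<i> * of_real \<theta>0 * of_real \<tau>) - 1) < \<eta>"
proof -
  have "\<forall>\<^sub>F X in finite_subsets_at_top P. (finite X \<and> X \<subseteq> P) \<and> \<bar>infsum m (P - X)\<bar> < \<eta> / 4"
    using e by (intro eventually_conj[OF eventually_finite_subsets_at_top_weakI] small_tail[OF m]) auto
  then obtain X where X: "finite X" "X \<subseteq> P" "\<bar>infsum m (P - X)\<bar> < \<eta> / 4"
    using eventually_happens[of _ "finite_subsets_at_top P"] by auto
  define S where "S = sum m X"
  have S: "S \<ge> 0" unfolding S_def using m0 X by (intro sum_nonneg) auto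
  define \<delta> where "\<delta> = min \<eta> (\<eta> / (2 * (S + 1)))"
  have d: "\<delta> > 0" using e S by (simp add: \<delta>_def)
  obtain L where L: "L > 0" "\<And>x::real. \<exists>\<tau>. x < \<tau> \<and> \<tau> < x + L \<and>
      (\<forall>\<theta>\<in>insert \<theta>0 X. norm (exp (2 * pi * \<i> * of_real \<theta> * of_real \<tau>) - 1) < \<delta>)"
    using finite_frequencies_translates[of "insert \<theta>0 X" \<delta>] X d by auto
  have "(\<Sum>\<^sub>\<infinity>\<gamma>\<in>P. m \<gamma> * norm (exp (2 * pi * \<i> * of_real \<gamma> * of_real \<tau>) - 1)) < \<eta>"
    if t: "\<forall>\<theta>\<in>insert \<theta>0 X. norm (exp (2 * pi * \<i> * of_real \<theta> * of_real \<tau>) - 1) < \<delta>" for \<tau> :: real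
  proof -
    let ?f = "\<lambda>\<gamma>. m \<gamma> * norm (exp (2 * pi * \<i> * of_real \<gamma> * of_real \<tau>) - 1)"
    have b: "norm (?f \<gamma>) \<le> m \<gamma> * 2" if g: "\<gamma> \<in> P" for \<gamma>
    proof -
      have "norm (exp (2 * pi * \<i> * of_real \<gamma> * of_real \<tau>) - 1) \<le> 2"
        by (rule order_trans[OF norm_triangle_ineq4]) (simp add: norm_exp)
      then show ?thesis using m0[OF g] by (simp add: abs_mult mult_left_mono)
    qed
    have m2: "(\<lambda>\<gamma>. m \<gamma> * 2) summable_on P" by (rule summable_on_cmult_left[OF m])
    have s: "?f summable_on P" by (rule norm_infsum_le_dominated(1)[OF m2 b])
    have "infsum ?f (P - X) = infsum ?f P - infsum ?f X" by (rule infsum_Diff) (use s X in auto)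
    then have "infsum ?f P = sum ?f X + infsum ?f (P - X)" using X by simp
    moreover have "norm (infsum ?f (P - X)) \<le> infsum (\<lambda>\<gamma>. m \<gamma> * 2) (P - X)"
      by (rule norm_infsum_le_dominated(2)[OF summable_on_subset_banach[OF m2]]) (use b in auto)
    moreover have "infsum (\<lambda>\<gamma>. m \<gamma> * 2) (P - X) = infsum m (P - X) * 2" by (rule infsum_cmult_left')
    moreover have "sum ?f X \<le> (\<Sum>\<gamma>\<in>X. m \<gamma> * \<delta>)"
      using t m0 X by (intro sum_mono mult_left_mono) (auto intro: less_imp_le)
    moreover have "(\<Sum>\<gamma>\<in>X. m \<gamma> * \<delta>) \<le> \<eta> / 2"
    proof -
      have "(\<Sum>\<gamma>\<in>X. m \<gamma> * \<delta>) = S * \<delta>" by (simp add: S_def sum_distrib_right)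
      also have "\<dots> \<le> (S + 1) * (\<eta> / (2 * (S + 1)))" unfolding \<delta>_def using S e by (intro mult_mono) auto
      also have "\<dots> = \<eta> / 2" using S by (simp add: field_simps)
      finally show ?thesis .
    qed
    ultimately show ?thesis using X(3) by simp
  qed
  note close = this
  have "\<delta> \<le> \<eta>" by (simp add: \<delta>_def)
  show ?thesis
  proof (rule that[OF L(1)])
    fix x
    obtain \<tau> where \<tau>: "x < \<tau>" "\<tau> < x + L" "\<forall>\<theta>\<in>insert \<theta>0 X. norm (exp (2 * pi * \<i> * of_real \<theta> * of_real \<tau>) - 1) < \<delta>"
      using L(2)[of x] by (elim exE conjE)
    have "norm (exp (2 * pi * \<i> * of_real \<theta>0 * of_real \<tau>) - 1) < \<eta>"
      using \<tau>(3) \<open>\<delta> \<le> \<eta>\<close> by auto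
    then show "\<exists>\<tau>. x < \<tau> \<and> \<tau> < x + L \<and>
      (\<Sum>\<^sub>\<infinity>\<gamma>\<in>P. m \<gamma> * norm (exp (2 * pi * \<i> * of_real \<gamma> * of_real \<tau>) - 1)) < \<eta> \<and>
      norm (exp (2 * pi * \<i> * of_real \<theta>0 * of_real \<tau>) - 1) < \<eta>"
      by (intro exI[of _ \<tau>] conjI \<tau>(1,2) close[OF \<tau>(3)])
  qed
qed

lemma shift_difference_bound:
  fixes V v :: "real \<Rightarrow> real"
  assumes V: "\<And>x. (V has_real_derivative v x) (at x)" and t: "\<And>u. \<bar>v (u + \<tau>) - v u\<bar> \<le> \<eta>"
  shows "\<bar>(V (y + \<tau>) - V y) - (V (x + \<tau>) - V x)\<bar> \<le> \<eta> * \<bar>y - x\<bar>"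
proof -
  have "norm ((V (y + \<tau>) - V y) - (V (x + \<tau>) - V x)) \<le> \<eta> * norm (y - x)"
  proof (rule field_differentiable_bound[of UNIV])
    fix z :: real
    have "((\<lambda>z. V (z + \<tau>)) has_real_derivative v (z + \<tau>)) (at z)" using V[of "z + \<tau>"] by (simp add: DERIV_shift)
    then show "((\<lambda>z. V (z + \<tau>) - V z) has_real_derivative (v (z + \<tau>) - v z)) (at z within UNIV)"
      using V[of z] by (auto intro: DERIV_diff)
    show "norm (v (z + \<tau>) - v z) \<le> \<eta>" using t[of z] by simp
  qed auto
  then show ?thesis by simp
qed

text \<open>Bohr's theorem that a bounded primitive is almost periodic, in the stronger form that almost periods
  of \<open>v\<close> for a suitable \<open>\<eta>\<close> are almost periods of \<open>V\<close> for \<open>\<epsilon>\<close>. The function \<open>V\<close> comes close to its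
  infimum and supremum within bounded distance of every \<open>x\<close>. Under a translation by \<open>\<tau>\<close> all values near
  \<open>x\<close> change by nearly the same amount; it cannot be much below 0 at a point where \<open>V\<close> is near its infimum,
  nor much above 0 where \<open>V\<close> is near its supremum.\<close>

lemma bounded_primitive_almost_periodic:
  fixes V v :: "real \<Rightarrow> real"
  assumes V: "\<And>x. (V has_real_derivative v x) (at x)" and B: "\<And>x. \<bar>V x\<bar> \<le> B"
    and ap: "\<And>\<eta>. \<eta> > 0 \<Longrightarrow> \<exists>L>0. \<forall>x. \<exists>\<tau>. x < \<tau> \<and> \<tau> < x + L \<and> (\<forall>u. \<bar>v (u + \<tau>) - v u\<bar> \<le> \<eta>)"
    and e: "\<epsilon> > 0"
  shows "\<exists>\<eta>>0. \<forall>\<tau>. (\<forall>u. \<bar>v (u + \<tau>) - v u\<bar> \<le> \<eta>) \<longrightarrow> (\<forall>x. \<bar>V (x + \<tau>) - V x\<bar> \<le> \<epsilon>)"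
proof -
  have bdd: "bdd_above (range V)" "bdd_below (range V)"
    using B by (auto intro!: bdd_aboveI[of _ B] bdd_belowI[of _ "- B"] simp: abs_le_iff minus_le_iff)
  define m where "m = Inf (range V)"
  define M where "M = Sup (range V)"
  have mV: "m \<le> V x" and VM: "V x \<le> M" for x
    using bdd by (auto simp: m_def M_def intro: cInf_lower cSup_upper)
  have "\<exists>y\<in>range V. y < m + \<epsilon> / 8"
    unfolding m_def by (rule cInf_lessD[of "range V" "Inf (range V) + \<epsilon> / 8"]) (use e in auto)
  then obtain x1 where x1: "V x1 < m + \<epsilon> / 8" by auto
  have "\<exists>y\<in>range V. M - \<epsilon> / 8 < y"
    unfolding M_def by (rule less_cSupD[of "range V" "Sup (range V) - \<epsilon> / 8"]) (use e in auto)
  then obtain x2 where x2: "V x2 > M - \<epsilon> / 8" by auto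
  define d where "d = \<bar>x2 - x1\<bar>"
  define \<eta>1 where "\<eta>1 = \<epsilon> / (8 * (d + 1))"
  have d0: "d \<ge> 0" by (simp add: d_def)
  have e1: "\<eta>1 > 0" using e d0 by (simp add: \<eta>1_def)
  obtain L where L: "L > 0" "\<And>x. \<exists>\<tau>. x < \<tau> \<and> \<tau> < x + L \<and> (\<forall>u. \<bar>v (u + \<tau>) - v u\<bar> \<le> \<eta>1)"
    using ap[OF e1] by blast
  have near: "\<exists>p q. \<bar>p - x\<bar> \<le> L + d \<and> \<bar>q - x\<bar> \<le> L + d \<and> V p \<le> m + 3 * \<epsilon> / 8 \<and> V q \<ge> M - 3 * \<epsilon> / 8" for x
  proof -
    obtain s where s: "x - x1 < s" "s < x - x1 + L" "\<forall>u. \<bar>v (u + s) - v u\<bar> \<le> \<eta>1" using L(2)[of "x - x1"] by blast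
    have "\<bar>(V (x2 + s) - V x2) - (V (x1 + s) - V x1)\<bar> \<le> \<eta>1 * \<bar>x2 - x1\<bar>"
      by (rule shift_difference_bound[OF V]) (use s in auto)
    also have "\<dots> \<le> \<epsilon> / 8"
    proof -
      have "\<eta>1 * d \<le> \<eta>1 * (d + 1)" using e1 by (intro mult_left_mono) auto
      also have "\<dots> = \<epsilon> / 8" using d0 unfolding \<eta>1_def by (simp add: field_simps)
      finally show ?thesis by (simp add: d_def)
    qed
    finally have "\<bar>(V (x2 + s) - V x2) - (V (x1 + s) - V x1)\<bar> \<le> \<epsilon> / 8" .
    then have "V (x1 + s) \<le> m + 3 * \<epsilon> / 8 \<and> V (x2 + s) \<ge> M - 3 * \<epsilon> / 8"
      using x1 x2 VM[of "x2 + s"] mV[of "x1 + s"] by linarith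
    moreover have "\<bar>x1 + s - x\<bar> \<le> L + d" "\<bar>x2 + s - x\<bar> \<le> L + d" using s by (auto simp: d_def)
    ultimately show ?thesis by blast
  qed
  define \<eta> where "\<eta> = \<epsilon> / (8 * (L + d + 1))"
  have eta: "\<eta> > 0" using e d0 L(1) by (simp add: \<eta>_def)
  have small: "\<eta> * r \<le> \<epsilon> / 8" if "r \<le> L + d" for r
  proof -
    have "\<eta> * r \<le> \<eta> * (L + d + 1)" using that eta by (intro mult_left_mono) auto
    also have "\<dots> = \<epsilon> / 8" using d0 L(1) unfolding \<eta>_def by (simp add: field_simps)
    finally show ?thesis .
  qed
  have "\<bar>V (x + \<tau>) - V x\<bar> \<le> \<epsilon>" if t: "\<forall>u. \<bar>v (u + \<tau>) - v u\<bar> \<le> \<eta>" for \<tau> x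
  proof -
    obtain p q where pq: "\<bar>p - x\<bar> \<le> L + d" "\<bar>q - x\<bar> \<le> L + d" "V p \<le> m + 3 * \<epsilon> / 8" "V q \<ge> M - 3 * \<epsilon> / 8"
      using near[of x] by blast
    have "\<bar>(V (p + \<tau>) - V p) - (V (x + \<tau>) - V x)\<bar> \<le> \<epsilon> / 8"
      by (rule order_trans[OF shift_difference_bound[OF V]]) (use t small[OF pq(1)] in auto)
    moreover have "\<bar>(V (q + \<tau>) - V q) - (V (x + \<tau>) - V x)\<bar> \<le> \<epsilon> / 8"
      by (rule order_trans[OF shift_difference_bound[OF V]]) (use t small[OF pq(2)] in auto)
    ultimately show ?thesis
      using pq mV[of "p + \<tau>"] VM[of "q + \<tau>"] e by linarith
  qed
  then show ?thesis using eta by blast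
qed

lemma bounded_primitive_almost_periodic_complex:
  fixes V v :: "real \<Rightarrow> complex"
  assumes V: "\<And>x. (V has_vector_derivative v x) (at x)" and B: "\<And>x. norm (V x) \<le> B"
    and ap: "\<And>\<eta>. \<eta> > 0 \<Longrightarrow> \<exists>L>0. \<forall>x. \<exists>\<tau>. x < \<tau> \<and> \<tau> < x + L \<and> (\<forall>u. norm (v (u + \<tau>) - v u) \<le> \<eta>)"
    and e: "\<epsilon> > 0"
  shows "\<exists>\<eta>>0. \<forall>\<tau>. (\<forall>u. norm (v (u + \<tau>) - v u) \<le> \<eta>) \<longrightarrow> (\<forall>x. norm (V (x + \<tau>) - V x) \<le> \<epsilon>)"
proof -
  have part: "\<exists>\<eta>>0. \<forall>\<tau>. (\<forall>u. \<bar>l (v (u + \<tau>)) - l (v u)\<bar> \<le> \<eta>) \<longrightarrow> (\<forall>x. \<bar>l (V (x + \<tau>)) - l (V x)\<bar> \<le> \<epsilon> / 2)"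
    if l: "bounded_linear l" "\<And>z. \<bar>l z\<bar> \<le> norm z" for l :: "complex \<Rightarrow> real"
  proof (rule bounded_primitive_almost_periodic)
    show "((\<lambda>x. l (V x)) has_real_derivative l (v x)) (at x)" for x
      using bounded_linear.has_vector_derivative[OF l(1) V[of x]]
      by (simp add: has_real_derivative_iff_has_vector_derivative)
    show "\<bar>l (V x)\<bar> \<le> B" for x using l(2)[of "V x"] B[of x] by linarith
    have diff: "l (v y) - l (v x) = l (v y - v x)" for x y
      using linear_diff[OF bounded_linear.linear[OF l(1)]] by simp
    fix \<eta> :: real assume "\<eta> > 0"
    from ap[OF this] obtain L where L: "L > 0" "\<And>x. \<exists>\<tau>. x < \<tau> \<and> \<tau> < x + L \<and> (\<forall>u. norm (v (u + \<tau>) - v u) \<le> \<eta>)" by blast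
    have "\<bar>l (v y) - l (v x)\<bar> \<le> \<eta>" if "norm (v y - v x) \<le> \<eta>" for x y
      unfolding diff using l(2)[of "v y - v x"] that by linarith
    then show "\<exists>L>0. \<forall>x. \<exists>\<tau>. x < \<tau> \<and> \<tau> < x + L \<and> (\<forall>u. \<bar>l (v (u + \<tau>)) - l (v u)\<bar> \<le> \<eta>)"
      using L by blast
  qed (use e in auto)
  obtain \<eta>1 where e1: "\<eta>1 > 0" "\<And>\<tau>. \<forall>u. \<bar>Re (v (u + \<tau>)) - Re (v u)\<bar> \<le> \<eta>1 \<Longrightarrow> \<forall>x. \<bar>Re (V (x + \<tau>)) - Re (V x)\<bar> \<le> \<epsilon> / 2"
    using part[OF bounded_linear_Re abs_Re_le_cmod] by auto
  obtain \<eta>2 where e2: "\<eta>2 > 0" "\<And>\<tau>. \<forall>u. \<bar>Im (v (u + \<tau>)) - Im (v u)\<bar> \<le> \<eta>2 \<Longrightarrow> \<forall>x. \<bar>Im (V (x + \<tau>)) - Im (V x)\<bar> \<le> \<epsilon> / 2"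
    using part[OF bounded_linear_Im abs_Im_le_cmod] by auto
  have "norm (V (x + \<tau>) - V x) \<le> \<epsilon>" if t: "\<forall>u. norm (v (u + \<tau>) - v u) \<le> min \<eta>1 \<eta>2" for \<tau> x
  proof -
    have "\<bar>Re (v (u + \<tau>)) - Re (v u)\<bar> \<le> \<eta>1" for u
      using t[rule_format, of u] abs_Re_le_cmod[of "v (u + \<tau>) - v u"] by simp
    then have 1: "\<bar>Re (V (x + \<tau>)) - Re (V x)\<bar> \<le> \<epsilon> / 2" by (intro e1(2)[rule_format])
    have "\<bar>Im (v (u + \<tau>)) - Im (v u)\<bar> \<le> \<eta>2" for u
      using t[rule_format, of u] abs_Im_le_cmod[of "v (u + \<tau>) - v u"] by simp
    then have 2: "\<bar>Im (V (x + \<tau>)) - Im (V x)\<bar> \<le> \<epsilon> / 2" by (intro e2(2)[rule_format])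
    note 1 2
    with cmod_le[of "V (x + \<tau>) - V x"] show ?thesis by simp
  qed
  then show ?thesis using e1(1) e2(1) by (intro exI[of _ "min \<eta>1 \<eta>2"]) auto
qed

text \<open>The maximum principle in a strip; \<open>exp (- \<delta> z\<^sup>2)\<close> makes the short sides of a long rectangle harmless,
  and \<open>\<delta>\<close> tends to 0 in the end.\<close>

lemma strip_maximum:
  assumes hol: "\<phi> holomorphic_on UNIV" and e: "\<epsilon> > 0"
    and M: "\<And>z. \<bar>Im z\<bar> \<le> Y \<Longrightarrow> norm (\<phi> z) \<le> M"
    and edge: "\<And>z. \<bar>Im z\<bar> = Y \<Longrightarrow> norm (\<phi> z) \<le> \<epsilon>" and z0: "\<bar>Im z0\<bar> \<le> Y"
  shows "norm (\<phi> z0) \<le> \<epsilon>"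
proof -
  have M0: "M \<ge> 0" using M[OF z0] norm_ge_zero order_trans by blast
  have nexp: "norm (exp (- of_real \<delta> * z\<^sup>2)) = exp (\<delta> * (Im z)\<^sup>2) * exp (- \<delta> * (Re z)\<^sup>2)" for \<delta> z
    by (simp add: norm_exp Re_power2 algebra_simps flip: exp_add)
  have main: "norm (\<phi> z0) \<le> \<epsilon> * exp (\<delta> * (Y\<^sup>2 + (Re z0)\<^sup>2))" if d: "\<delta> > 0" for \<delta>
  proof -
    define X where "X = max (\<bar>Re z0\<bar> + 1) (M / (\<epsilon> * \<delta>))"
    have X: "X \<ge> 1" "\<bar>Re z0\<bar> \<le> X" "M / (\<epsilon> * \<delta>) \<le> X" by (auto simp: X_def)
    have MX: "M * exp (- \<delta> * X\<^sup>2) \<le> \<epsilon>"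
    proof -
      have "M \<le> \<epsilon> * (\<delta> * X)" using X(3) e d by (simp add: divide_le_eq mult_ac)
      also have "\<delta> * X \<le> exp (\<delta> * X\<^sup>2)"
      proof -
        have "\<delta> * X \<le> \<delta> * X\<^sup>2" using d X(1) by (intro mult_left_mono) (auto simp: power2_eq_square)
        also have "\<dots> \<le> exp (\<delta> * X\<^sup>2)" using exp_ge_add_one_self[of "\<delta> * X\<^sup>2"] by linarith
        finally show ?thesis .
      qed
      finally have "M \<le> \<epsilon> * exp (\<delta> * X\<^sup>2)" using e by simp
      then have "M * exp (- \<delta> * X\<^sup>2) \<le> \<epsilon> * exp (\<delta> * X\<^sup>2) * exp (- \<delta> * X\<^sup>2)" by (intro mult_right_mono) auto
      then show ?thesis by (simp add: mult.assoc flip: exp_add)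
    qed
    let ?\<psi> = "\<lambda>z. \<phi> z * exp (- of_real \<delta> * z\<^sup>2)"
    let ?S = "cbox (Complex (- X) (- Y)) (Complex X Y)"
    have "norm (?\<psi> z0) \<le> \<epsilon> * exp (\<delta> * Y\<^sup>2)"
    proof (rule maximum_modulus_frontier[of ?\<psi> ?S])
      have hol\<psi>: "?\<psi> holomorphic_on UNIV" by (intro holomorphic_intros hol)
      show "?\<psi> holomorphic_on interior ?S" using hol\<psi> by (rule holomorphic_on_subset) simp
      show "continuous_on (closure ?S) ?\<psi>"
        using holomorphic_on_imp_continuous_on[OF hol\<psi>] by (rule continuous_on_subset) simp
      show "bounded ?S" by (rule bounded_cbox)
      show "z0 \<in> ?S" using X(2) z0 by (auto simp: in_cbox_complex_iff)
      fix z assume "z \<in> frontier ?S"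
      then have z: "z \<in> ?S" "z \<notin> box (Complex (- X) (- Y)) (Complex X Y)"
        by (auto simp: frontier_def)
      then have le: "\<bar>Re z\<bar> \<le> X" "\<bar>Im z\<bar> \<le> Y" by (auto simp: in_cbox_complex_iff)
      have "\<not> (\<bar>Re z\<bar> < X \<and> \<bar>Im z\<bar> < Y)" using z(2) by (auto simp: in_box_complex_iff)
      then consider "\<bar>Re z\<bar> = X" | "\<bar>Im z\<bar> = Y" using le by linarith
      then have fe: "norm (\<phi> z) * exp (- \<delta> * (Re z)\<^sup>2) \<le> \<epsilon>"
      proof cases
        case 1
        then have "(Re z)\<^sup>2 = X\<^sup>2" by (metis power2_abs)
        then have "norm (\<phi> z) * exp (- \<delta> * (Re z)\<^sup>2) \<le> M * exp (- \<delta> * X\<^sup>2)" using M[OF le(2)] by (simp add: mult_right_mono)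
        then show ?thesis using MX by linarith
      next
        case 2
        have "norm (\<phi> z) * exp (- \<delta> * (Re z)\<^sup>2) \<le> \<epsilon> * 1"
          using edge[OF 2] d e by (intro mult_mono) auto
        then show ?thesis by simp
      qed
      have "(Im z)\<^sup>2 \<le> Y\<^sup>2" using le(2) by (metis abs_ge_zero power2_abs power_mono)
      then have "exp (\<delta> * (Im z)\<^sup>2) \<le> exp (\<delta> * Y\<^sup>2)" using d by (simp add: mult_left_mono)
      from mult_mono[OF fe this] have "norm (\<phi> z) * exp (- \<delta> * (Re z)\<^sup>2) * exp (\<delta> * (Im z)\<^sup>2) \<le> \<epsilon> * exp (\<delta> * Y\<^sup>2)"
        using e by simp
      then show "norm (?\<psi> z) \<le> \<epsilon> * exp (\<delta> * Y\<^sup>2)" unfolding norm_mult nexp by (simp only: mult_ac)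
    qed
    then have "norm (\<phi> z0) * (exp (\<delta> * (Im z0)\<^sup>2) * exp (- \<delta> * (Re z0)\<^sup>2)) \<le> \<epsilon> * exp (\<delta> * Y\<^sup>2)"
      unfolding norm_mult nexp .
    moreover have "norm (\<phi> z0) * (1 * exp (- \<delta> * (Re z0)\<^sup>2)) \<le> norm (\<phi> z0) * (exp (\<delta> * (Im z0)\<^sup>2) * exp (- \<delta> * (Re z0)\<^sup>2))"
      using d by (intro mult_left_mono mult_right_mono) auto
    ultimately have "norm (\<phi> z0) * exp (- \<delta> * (Re z0)\<^sup>2) \<le> \<epsilon> * exp (\<delta> * Y\<^sup>2)" by simp
    then have "norm (\<phi> z0) * exp (- \<delta> * (Re z0)\<^sup>2) * exp (\<delta> * (Re z0)\<^sup>2) \<le> \<epsilon> * exp (\<delta> * Y\<^sup>2) * exp (\<delta> * (Re z0)\<^sup>2)"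
      by (rule mult_right_mono) simp
    then show ?thesis by (simp add: mult.assoc distrib_left flip: exp_add)
  qed
  have "((\<lambda>\<delta>. \<epsilon> * exp (\<delta> * (Y\<^sup>2 + (Re z0)\<^sup>2))) \<longlongrightarrow> \<epsilon> * exp (0 * (Y\<^sup>2 + (Re z0)\<^sup>2))) (at_right 0)"
    by (intro tendsto_intros)
  then have "norm (\<phi> z0) \<le> \<epsilon> * exp (0 * (Y\<^sup>2 + (Re z0)\<^sup>2))"
    by (rule tendsto_lowerbound) (auto intro!: eventually_at_right_less[THEN eventually_mono] main)
  then show ?thesis by simp
qed

context bounded_low_part
begin

lemma T_split: "T \<kappa>' z = \<kappa>' * z + T 0 z"
  by (simp add: T_def)

lemma T0_bound:
  assumes Y: "Y \<ge> 1"
  shows "norm (T 0 (Complex x Y)) \<le> Bg + (\<Sum>\<^sub>\<infinity>\<gamma>\<in>low. norm (b \<gamma>) * ((1 - exp (- 2 * pi * Y * \<gamma>)) / \<gamma>))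
     + (\<Sum>\<^sub>\<infinity>\<gamma>\<in>P \<inter> {1..}. norm (b \<gamma>) * exp (- (2 * pi * 1) * \<gamma>))"
proof -
  have z: "Complex x Y = of_real x + \<i> * of_real Y" by (simp add: complex_eq_iff)
  have "norm (g (Complex x Y)) \<le> norm (g (of_real x)) + norm (g (Complex x Y) - g (of_real x))"
    by (rule norm_triangle_sub)
  also have "\<dots> \<le> Bg + (\<Sum>\<^sub>\<infinity>\<gamma>\<in>low. norm (b \<gamma>) * ((1 - exp (- 2 * pi * Y * \<gamma>)) / \<gamma>))"
    unfolding z by (intro add_mono g_bounded g_vertical) (use Y in auto)
  finally have 1: "norm (g (Complex x Y)) \<le> \<dots>" .
  have 2: "norm (high (Complex x Y)) \<le> (\<Sum>\<^sub>\<infinity>\<gamma>\<in>P \<inter> {1..}. norm (b \<gamma>) * exp (- (2 * pi * 1) * \<gamma>))"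
    by (rule high_bound) (use Y in auto)
  have "norm (T 0 (Complex x Y)) \<le> norm (g (Complex x Y)) + norm (high (Complex x Y))"
    unfolding T_def using norm_triangle_ineq4[of "- g (Complex x Y)" "high (Complex x Y)"] by simp
  with 1 2 show ?thesis by linarith
qed

lemma norm_f:
  assumes C: "\<And>z. Im z > 0 \<Longrightarrow> f_prod a z = C * exp (T (- \<i> * of_real D) z)" and Y: "Y > 0"
  shows "norm (f_prod a (Complex x Y)) = norm C * exp (D * Y + Re (T 0 (Complex x Y)))"
proof -
  have "f_prod a (Complex x Y) = C * exp (- \<i> * of_real D * Complex x Y + T 0 (Complex x Y))"
    using C[of "Complex x Y"] Y by (simp only: T_split[of "- \<i> * of_real D"] complex.sel)
  then show ?thesis by (simp add: norm_mult norm_exp)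
qed

lemma f_bounded_in_strips:
  assumes Y: "Y \<ge> 1"
  obtains M where "M > 0" "\<And>z. \<bar>Im z\<bar> \<le> Y \<Longrightarrow> norm (f_prod a z) \<le> M"
proof -
  obtain C where C: "C \<noteq> 0" "\<And>z. Im z > 0 \<Longrightarrow> f_prod a z = C * exp (T (- \<i> * of_real D) z)"
    using f_representation by blast
  define B where "B = Bg + (\<Sum>\<^sub>\<infinity>\<gamma>\<in>low. norm (b \<gamma>) * ((1 - exp (- 2 * pi * Y * \<gamma>)) / \<gamma>))
     + (\<Sum>\<^sub>\<infinity>\<gamma>\<in>P \<inter> {1..}. norm (b \<gamma>) * exp (- (2 * pi * 1) * \<gamma>))"
  have "norm (f_prod a z) \<le> norm C * exp (D * Y + B)" if z: "\<bar>Im z\<bar> \<le> Y" for z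
  proof -
    have "norm (f_prod a z) \<le> norm (f_prod a (Complex (Re z) Y))"
      using f_vertical_mono[of "Im z" Y "Re z"] z Y by simp
    also have "\<dots> = norm C * exp (D * Y + Re (T 0 (Complex (Re z) Y)))"
      by (rule norm_f[OF C(2)]) (use Y in auto)
    also have "\<dots> \<le> norm C * exp (D * Y + B)"
      using T0_bound[OF Y, of "Re z"] complex_Re_le_cmod[of "T 0 (Complex (Re z) Y)"]
      by (intro mult_left_mono) (auto simp: B_def)
    finally show ?thesis .
  qed
  moreover have "norm C * exp (D * Y + B) > 0" using C(1) by simp
  ultimately show ?thesis using that by blast
qed

lemma E_shift_bound:
  assumes Y: "Y > 0"
  shows "norm (E (Complex (u + \<tau>) Y) - E (Complex u Y)) \<le>
     (\<Sum>\<^sub>\<infinity>\<gamma>\<in>P. norm (b \<gamma>) * exp (- (2 * pi * Y) * \<gamma>) * norm (exp (2 * pi * \<i> * of_real \<gamma> * of_real \<tau>) - 1))"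
proof -
  let ?m = "\<lambda>\<gamma>. norm (b \<gamma>) * exp (- (2 * pi * Y) * \<gamma>)"
  let ?t = "\<lambda>\<gamma>. exp (2 * pi * \<i> * of_real \<gamma> * of_real \<tau>) - 1"
  have ms: "?m summable_on P" by (rule b_exp_summable) (use Y in simp)
  have t2: "norm (?t \<gamma>) \<le> 2" for \<gamma> by (rule order_trans[OF norm_triangle_ineq4]) (simp add: norm_exp)
  have s: "(\<lambda>\<gamma>. ?m \<gamma> * norm (?t \<gamma>)) summable_on P"
    by (rule norm_infsum_le_dominated(1)[OF summable_on_cmult_left[OF ms, of 2]])
       (use t2 in \<open>simp add: abs_mult mult_left_mono\<close>)
  have "((\<lambda>\<gamma>. b \<gamma> * exp (2 * pi * \<i> * Complex (u + \<tau>) Y * of_real \<gamma>) - b \<gamma> * exp (2 * pi * \<i> * Complex u Y * of_real \<gamma>))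
      has_sum (E (Complex (u + \<tau>) Y) - E (Complex u Y))) P"
    by (intro has_sum_diff E_has_sum) (use Y in auto)
  from infsumI[OF this, symmetric] show ?thesis
  proof (rule ssubst, intro norm_infsum_le_dominated(2)[OF s])
    fix \<gamma> assume "\<gamma> \<in> P"
    have "2 * pi * \<i> * Complex (u + \<tau>) Y * of_real \<gamma> = 2 * pi * \<i> * Complex u Y * of_real \<gamma> + 2 * pi * \<i> * of_real \<gamma> * of_real \<tau>"
      by (simp add: complex_eq_iff algebra_simps)
    then have "b \<gamma> * exp (2 * pi * \<i> * Complex (u + \<tau>) Y * of_real \<gamma>) - b \<gamma> * exp (2 * pi * \<i> * Complex u Y * of_real \<gamma>)
        = (b \<gamma> * exp (2 * pi * \<i> * Complex u Y * of_real \<gamma>)) * ?t \<gamma>"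
      by (simp only: exp_add right_diff_distrib mult_1_right mult.assoc)
    then have "norm (b \<gamma> * exp (2 * pi * \<i> * Complex (u + \<tau>) Y * of_real \<gamma>) - b \<gamma> * exp (2 * pi * \<i> * Complex u Y * of_real \<gamma>))
        = norm (b \<gamma> * exp (2 * pi * \<i> * Complex u Y * of_real \<gamma>)) * norm (?t \<gamma>)" by (simp only: norm_mult)
    also have "\<dots> \<le> ?m \<gamma> * norm (?t \<gamma>)"
      by (intro mult_right_mono E_term_bound) (use \<open>\<gamma> \<in> P\<close> in auto)
    finally show "norm (b \<gamma> * exp (2 * pi * \<i> * Complex (u + \<tau>) Y * of_real \<gamma>) - b \<gamma> * exp (2 * pi * \<i> * Complex u Y * of_real \<gamma>))
        \<le> ?m \<gamma> * norm (?t \<gamma>)" .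
  qed
qed

text \<open>Here \<open>f = C exp (- i D z + V)\<close> with \<open>V\<close> bounded and with an almost periodic derivative. A translation
  that is good both for the exponential sum \<open>E\<close> and for the frequency \<open>D / (2 \<pi>)\<close> is an almost
  period of both factors.\<close>

lemma f_almost_periodic_on_line:
  assumes Y: "Y \<ge> 1" and e: "\<epsilon> > 0"
  shows "\<exists>L>0. \<forall>x. \<exists>\<tau>. x < \<tau> \<and> \<tau> < x + L \<and>
      (\<forall>u. norm (f_prod a (Complex (u + \<tau>) Y) - f_prod a (Complex u Y)) \<le> \<epsilon>)"
proof -
  have Y0: "Y > 0" using Y by simp
  obtain C where C: "C \<noteq> 0" "\<And>z. Im z > 0 \<Longrightarrow> f_prod a z = C * exp (T (- \<i> * of_real D) z)"
    using f_representation by blast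
  obtain M where M: "M > 0" "\<And>z. \<bar>Im z\<bar> \<le> Y \<Longrightarrow> norm (f_prod a z) \<le> M"
    using f_bounded_in_strips[OF Y] by blast
  let ?m = "\<lambda>\<gamma>. norm (b \<gamma>) * exp (- (2 * pi * Y) * \<gamma>)"
  define \<rho> where "\<rho> \<tau> = (\<Sum>\<^sub>\<infinity>\<gamma>\<in>P. ?m \<gamma> * norm (exp (2 * pi * \<i> * of_real \<gamma> * of_real \<tau>) - 1))" for \<tau> :: real
  define \<theta> where "\<theta> = - D / (2 * pi)"
  have trans: "\<exists>L>0. \<forall>x::real. \<exists>\<tau>. x < \<tau> \<and> \<tau> < x + L \<and> \<rho> \<tau> < \<eta> \<and> norm (exp (2 * pi * \<i> * of_real \<theta> * of_real \<tau>) - 1) < \<eta>"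
    if "\<eta> > 0" for \<eta>
  proof (rule weighted_translates[OF b_exp_summable _ that])
    show "2 * pi * Y > 0" using Y0 by simp
    fix L :: real
    assume L: "L > 0" "\<And>x::real. \<exists>\<tau>. x < \<tau> \<and> \<tau> < x + L \<and>
      (\<Sum>\<^sub>\<infinity>\<gamma>\<in>P. ?m \<gamma> * norm (exp (2 * pi * \<i> * of_real \<gamma> * of_real \<tau>) - 1)) < \<eta> \<and>
      norm (exp (2 * pi * \<i> * of_real \<theta> * of_real \<tau>) - 1) < \<eta>"
    show ?thesis by (intro exI[of _ L] conjI allI L(1) L(2)[folded \<rho>_def])
  qed simp
  define V where "V x = T 0 (Complex x Y)" for x
  define v where "v x = - (2 * pi * \<i> * E (Complex x Y))" for x
  have Vd: "(V has_vector_derivative v x) (at x)" for x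
  proof -
    have "(T 0 has_field_derivative (0 - 2 * pi * \<i> * E (Complex x Y))) (at (Complex x Y))"
      by (rule T_has_derivative) (use Y0 in simp)
    then have "((\<lambda>z. T 0 (z + Complex 0 Y)) has_field_derivative v x) (at (of_real x))"
      using DERIV_shift[of "T 0" "v x" "of_real x" "Complex 0 Y"] by (simp add: v_def Complex_eq add.commute)
    then have "((\<lambda>x. T 0 (of_real x + Complex 0 Y)) has_vector_derivative v x) (at x)"
      by (rule has_vector_derivative_real_field)
    moreover have "of_real x + Complex 0 Y = Complex x Y" for x by (simp add: complex_eq_iff)
    ultimately show ?thesis by (simp add: V_def[abs_def])
  qed
  have vb: "norm (v (u + \<tau>) - v u) \<le> 2 * pi * \<rho> \<tau>" for u \<tau>
  proof -
    have "v (u + \<tau>) - v u = - (2 * pi * \<i> * (E (Complex (u + \<tau>) Y) - E (Complex u Y)))"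
      by (simp add: v_def right_diff_distrib)
    then have "norm (v (u + \<tau>) - v u) = 2 * pi * norm (E (Complex (u + \<tau>) Y) - E (Complex u Y))"
      by (simp only: norm_minus_cancel) (simp add: norm_mult)
    also have "\<dots> \<le> 2 * pi * \<rho> \<tau>" unfolding \<rho>_def by (intro mult_left_mono E_shift_bound[OF Y0]) auto
    finally show ?thesis .
  qed
  define \<epsilon>1 where "\<epsilon>1 = min 1 (\<epsilon> / (6 * M))"
  have e1: "\<epsilon>1 > 0" "\<epsilon>1 \<le> 1" "M * (6 * \<epsilon>1) \<le> \<epsilon>"
  proof -
    show "\<epsilon>1 > 0" "\<epsilon>1 \<le> 1" using e M(1) by (auto simp: \<epsilon>1_def)
    have "M * (6 * \<epsilon>1) \<le> M * (6 * (\<epsilon> / (6 * M)))" using M(1) by (intro mult_left_mono) (auto simp: \<epsilon>1_def)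
    also have "\<dots> = \<epsilon>" using M(1) by simp
    finally show "M * (6 * \<epsilon>1) \<le> \<epsilon>" .
  qed
  have "\<exists>\<eta>>0. \<forall>\<tau>. (\<forall>u. norm (v (u + \<tau>) - v u) \<le> \<eta>) \<longrightarrow> (\<forall>x. norm (V (x + \<tau>) - V x) \<le> \<epsilon>1)"
  proof (rule bounded_primitive_almost_periodic_complex[OF Vd _ _ e1(1)])
    show "norm (V x) \<le> Bg + (\<Sum>\<^sub>\<infinity>\<gamma>\<in>low. norm (b \<gamma>) * ((1 - exp (- 2 * pi * Y * \<gamma>)) / \<gamma>))
     + (\<Sum>\<^sub>\<infinity>\<gamma>\<in>P \<inter> {1..}. norm (b \<gamma>) * exp (- (2 * pi * 1) * \<gamma>))" for x
      unfolding V_def by (rule T0_bound[OF Y])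
    fix \<eta> :: real assume eta: "\<eta> > 0"
    then have "\<eta> / (2 * pi) > 0" by simp
    from trans[OF this] obtain L where L: "L > 0"
      "\<And>x::real. \<exists>\<tau>. x < \<tau> \<and> \<tau> < x + L \<and> \<rho> \<tau> < \<eta> / (2 * pi)" by blast
    have "norm (v (u + \<tau>) - v u) \<le> \<eta>" if "\<rho> \<tau> < \<eta> / (2 * pi)" for u \<tau>
    proof -
      have "2 * pi * \<rho> \<tau> \<le> 2 * pi * (\<eta> / (2 * pi))" using that by (intro mult_left_mono) auto
      then show ?thesis using vb[of u \<tau>] by simp
    qed
    then show "\<exists>L>0. \<forall>x. \<exists>\<tau>. x < \<tau> \<and> \<tau> < x + L \<and> (\<forall>u. norm (v (u + \<tau>) - v u) \<le> \<eta>)"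
      using L by blast
  qed
  then obtain \<eta> where eta: "\<eta> > 0" "\<And>\<tau> x. \<forall>u. norm (v (u + \<tau>) - v u) \<le> \<eta> \<Longrightarrow> norm (V (x + \<tau>) - V x) \<le> \<epsilon>1"
    by blast
  define \<eta>' where "\<eta>' = min (\<eta> / (2 * pi)) \<epsilon>1"
  have eta': "\<eta>' > 0" using eta(1) e1(1) by (simp add: \<eta>'_def)
  obtain L where L: "L > 0" "\<And>x::real. \<exists>\<tau>. x < \<tau> \<and> \<tau> < x + L \<and> \<rho> \<tau> < \<eta>' \<and> norm (exp (2 * pi * \<i> * of_real \<theta> * of_real \<tau>) - 1) < \<eta>'"
    using trans[OF eta'] by blast
  have "norm (f_prod a (Complex (u + \<tau>) Y) - f_prod a (Complex u Y)) \<le> \<epsilon>"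
    if t: "\<rho> \<tau> < \<eta>'" "norm (exp (2 * pi * \<i> * of_real \<theta> * of_real \<tau>) - 1) < \<eta>'" for \<tau> u
  proof -
    define p where "p = exp (- \<i> * of_real D * of_real \<tau>)"
    define q where "q = V (u + \<tau>) - V u"
    have "norm (v (u + \<tau>) - v u) \<le> \<eta>" for u
    proof -
      have "2 * pi * \<rho> \<tau> \<le> 2 * pi * (\<eta> / (2 * pi))" using t(1) by (intro mult_left_mono) (auto simp: \<eta>'_def)
      then show ?thesis using vb[of u \<tau>] by simp
    qed
    then have q: "norm q \<le> \<epsilon>1" unfolding q_def by (intro eta(2)) blast
    have "2 * pi * \<i> * of_real \<theta> * of_real \<tau> = - \<i> * of_real D * of_real \<tau>" by (simp add: \<theta>_def)
    then have p: "norm (p - 1) \<le> \<epsilon>1" using t(2) by (simp only: p_def) (simp add: \<eta>'_def)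
    have "exp \<epsilon>1 \<le> 3" using e1 exp_le exp_le_cancel_iff[of \<epsilon>1 1] by linarith
    then have eq: "exp (norm q) \<le> 3" using q exp_le_cancel_iff[of "norm q" \<epsilon>1] by linarith
    have nq: "norm (exp q) \<le> 3" using norm_exp[of q] eq by (rule order_trans)
    have "norm (exp q - 1) \<le> norm q * exp (max 0 (Re q))" by (rule norm_exp_minus_one_le)
    also have "\<dots> \<le> \<epsilon>1 * 3"
    proof (intro mult_mono q)
      have "max 0 (Re q) \<le> norm q" using complex_Re_le_cmod[of q] by simp
      then show "exp (max 0 (Re q)) \<le> 3" using eq exp_le_cancel_iff[of "max 0 (Re q)" "norm q"] by linarith
    qed (use e1 in auto)
    finally have eq1: "norm (exp q - 1) \<le> \<epsilon>1 * 3" .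
    have "f_prod a (Complex (u + \<tau>) Y) = f_prod a (Complex u Y) * (p * exp q)"
    proof -
      have "T (- \<i> * of_real D) (Complex (u + \<tau>) Y) = T (- \<i> * of_real D) (Complex u Y) + (- \<i> * of_real D * of_real \<tau>) + q"
        unfolding T_split[of "- \<i> * of_real D"] q_def V_def by (simp add: complex_eq_iff algebra_simps)
      then show ?thesis using C(2)[of "Complex (u + \<tau>) Y"] C(2)[of "Complex u Y"] Y0
        by (simp only: complex.sel p_def exp_add mult.assoc)
    qed
    then have "f_prod a (Complex (u + \<tau>) Y) - f_prod a (Complex u Y) = f_prod a (Complex u Y) * ((p - 1) * exp q + (exp q - 1))"
      by (simp add: algebra_simps)
    also have "norm \<dots> \<le> M * (\<epsilon>1 * 3 + \<epsilon>1 * 3)"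
      unfolding norm_mult[of "f_prod a (Complex u Y)"]
    proof (intro mult_mono M(2) order_trans[OF norm_triangle_ineq] add_mono eq1)
      show "norm ((p - 1) * exp q) \<le> \<epsilon>1 * 3" unfolding norm_mult using e1 by (intro mult_mono p nq) auto
    qed (use M(1) Y0 in auto)
    also have "\<dots> \<le> \<epsilon>" using e1(3) by simp
    finally show ?thesis .
  qed
  then show ?thesis using L by blast
qed

text \<open>Almost periods on one line \<open>Im z = Y\<close> work on its mirror image as \<open>f\<close> is real on the real axis, and
  in the strip between by the maximum principle.\<close>

theorem f_almost_periodic: "almost_periodic_entire (f_prod a)"
  unfolding almost_periodic_entire_def
proof (intro conjI allI impI)
  show "f_prod a holomorphic_on UNIV" by (rule f_holomorphic)
  fix \<alpha>' \<beta>' \<epsilon> :: real assume ab: "\<alpha>' < \<beta>'" and e: "\<epsilon> > 0"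
  define Y where "Y = max 1 (max \<bar>\<alpha>'\<bar> \<bar>\<beta>'\<bar>)"
  have Y: "Y \<ge> 1" "\<And>y. y \<in> {\<alpha>'..\<beta>'} \<Longrightarrow> \<bar>y\<bar> \<le> Y" by (auto simp: Y_def)
  obtain M where M: "M > 0" "\<And>z. \<bar>Im z\<bar> \<le> Y \<Longrightarrow> norm (f_prod a z) \<le> M"
    using f_bounded_in_strips[OF Y(1)] by blast
  obtain L where L: "L > 0" "\<And>x. \<exists>\<tau>. x < \<tau> \<and> \<tau> < x + L \<and>
      (\<forall>u. norm (f_prod a (Complex (u + \<tau>) Y) - f_prod a (Complex u Y)) \<le> \<epsilon> / 2)"
    using f_almost_periodic_on_line[OF Y(1), of "\<epsilon> / 2"] e by auto
  let ?E = "{\<tau>. (SUP (x, y)\<in>UNIV \<times> {\<alpha>'..\<beta>'}. ereal (norm (f_prod a (Complex (x + \<tau>) y) - f_prod a (Complex x y)))) < ereal \<epsilon>}"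
  have "\<tau> \<in> ?E" if t: "\<forall>u. norm (f_prod a (Complex (u + \<tau>) Y) - f_prod a (Complex u Y)) \<le> \<epsilon> / 2" for \<tau>
  proof -
    let ?\<phi> = "\<lambda>z. f_prod a (z + of_real \<tau>) - f_prod a z"
    have edge: "norm (?\<phi> z) \<le> \<epsilon> / 2" if z: "Im z = Y" for z
    proof -
      have "z + of_real \<tau> = Complex (Re z + \<tau>) Y" "z = Complex (Re z) Y" using z by (auto simp: complex_eq_iff)
      then show ?thesis using t[rule_format, of "Re z"] by simp
    qed
    have "norm (?\<phi> z) \<le> \<epsilon> / 2" if z: "\<bar>Im z\<bar> \<le> Y" for z
    proof (rule strip_maximum[OF _ _ _ _ z])
      have "(\<lambda>z. f_prod a (z + of_real \<tau>)) holomorphic_on UNIV"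
        by (rule holomorphic_on_compose[OF _ f_holomorphic, unfolded o_def]) (intro holomorphic_intros)
      then show "?\<phi> holomorphic_on UNIV" by (intro holomorphic_intros f_holomorphic)
      show "norm (?\<phi> z) \<le> 2 * M" if "\<bar>Im z\<bar> \<le> Y" for z
        using norm_triangle_ineq4[of "f_prod a (z + of_real \<tau>)" "f_prod a z"] M(2)[of "z + of_real \<tau>"] M(2)[of z] that by simp
      show "norm (?\<phi> z) \<le> \<epsilon> / 2" if z: "\<bar>Im z\<bar> = Y" for z
      proof (cases "Im z = Y")
        case False
        then have "Im (cnj z) = Y" using z by (simp add: abs_if split: if_splits)
        from edge[OF this] have "norm (cnj (?\<phi> z)) \<le> \<epsilon> / 2"
          using f_cnj[of "z + of_real \<tau>"] f_cnj[of z] by simp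
        then show ?thesis by (simp only: complex_mod_cnj)
      qed (rule edge)
    qed (use e in auto)
    then have b: "norm (f_prod a (Complex (x + \<tau>) y) - f_prod a (Complex x y)) \<le> \<epsilon> / 2" if "y \<in> {\<alpha>'..\<beta>'}" for x y
    proof -
      have "Complex (x + \<tau>) y = Complex x y + of_real \<tau>" by (simp add: complex_eq_iff)
      then show ?thesis using \<open>\<And>z. \<bar>Im z\<bar> \<le> Y \<Longrightarrow> norm (?\<phi> z) \<le> \<epsilon> / 2\<close>[of "Complex x y"] Y(2)[OF that] by simp
    qed
    have "(SUP (x, y)\<in>UNIV \<times> {\<alpha>'..\<beta>'}. ereal (norm (f_prod a (Complex (x + \<tau>) y) - f_prod a (Complex x y)))) \<le> ereal (\<epsilon> / 2)"
      by (rule SUP_least) (use b in auto)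
    also have "\<dots> < ereal \<epsilon>" using e by simp
    finally show ?thesis by simp
  qed
  then show "relatively_dense ?E"
    unfolding relatively_dense_def
  proof (intro exI[of _ L] conjI L(1) allI)
    fix x
    obtain \<tau> where "x < \<tau>" "\<tau> < x + L"
      "\<forall>u. norm (f_prod a (Complex (u + \<tau>) Y) - f_prod a (Complex u Y)) \<le> \<epsilon> / 2" using L(2)[of x] by (elim exE conjE)
    then show "?E \<inter> {x<..<x + L} \<noteq> {}"
      using \<open>\<And>\<tau>. \<forall>u. norm (f_prod a (Complex (u + \<tau>) Y) - f_prod a (Complex u Y)) \<le> \<epsilon> / 2 \<Longrightarrow> \<tau> \<in> ?E\<close>[of \<tau>]
      by (intro notI) (simp only: disjoint_iff greaterThanLessThan_iff, blast)
  qed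
qed

end

context bounded_low_part
begin

section \<open>The exponential type\<close>

text \<open>The bound for \<open>g (x + i y) - g x\<close> from \<open>g_vertical\<close>.\<close>

definition vertical_growth :: "real \<Rightarrow> real" where
  "vertical_growth y = (\<Sum>\<^sub>\<infinity>\<gamma>\<in>low. norm (b \<gamma>) * ((1 - exp (- 2 * pi * y * \<gamma>)) / \<gamma>))"

lemma vertical_growth_sublinear: "((\<lambda>y. vertical_growth y / y) \<longlongrightarrow> 0) at_top"
proof -
  let ?f = "\<lambda>y \<gamma>. norm (b \<gamma>) * ((1 - exp (- 2 * pi * y * \<gamma>)) / \<gamma>) * (1 / y)"
  have "((\<lambda>y. \<Sum>\<^sub>\<infinity>\<gamma>\<in>low. ?f y \<gamma>) \<longlongrightarrow> (\<Sum>\<^sub>\<infinity>\<gamma>\<in>low. 0)) at_top"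
  proof (rule tendsto_infsum_dominated[OF summable_on_cmult_left[OF b_low_summable, of "2 * pi"]])
    have "norm (?f y \<gamma>) \<le> norm (b \<gamma>) * (2 * pi)" if y: "y > 0" and g: "\<gamma> \<in> low" for y \<gamma>
    proof -
      have g0: "\<gamma> > 0" using g by simp
      have "1 - exp (- (2 * pi * y * \<gamma>)) \<le> 2 * pi * y * \<gamma>"
        using exp_ge_add_one_self[of "- (2 * pi * y * \<gamma>)"] by linarith
      then have "(1 - exp (- 2 * pi * y * \<gamma>)) / \<gamma> * (1 / y) \<le> 2 * pi"
        using y g0 by (simp add: divide_le_eq mult_ac)
      moreover have "0 \<le> (1 - exp (- 2 * pi * y * \<gamma>)) / \<gamma> * (1 / y)" using y g0 by simp
      ultimately have "norm (b \<gamma>) * ((1 - exp (- 2 * pi * y * \<gamma>)) / \<gamma> * (1 / y)) \<le> norm (b \<gamma>) * (2 * pi)"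
        by (intro mult_left_mono) auto
      then show ?thesis using y g0 by (simp add: abs_mult)
    qed
    then show "\<forall>\<^sub>F y in at_top. \<forall>\<gamma>\<in>low. norm (?f y \<gamma>) \<le> norm (b \<gamma>) * (2 * pi)"
      by (intro eventually_mono[OF eventually_gt_at_top[of 0]]) blast
    fix \<gamma> assume g: "\<gamma> \<in> low"
    show "((\<lambda>y. ?f y \<gamma>) \<longlongrightarrow> 0) at_top"
    proof (rule Lim_null_comparison)
      show "\<forall>\<^sub>F y in at_top. norm (?f y \<gamma>) \<le> norm (b \<gamma>) / \<gamma> * (1 / y)"
        using eventually_gt_at_top[of 0]
      proof eventually_elim
        case (elim y)
        have "norm (b \<gamma>) * (1 - exp (- 2 * pi * y * \<gamma>)) \<le> norm (b \<gamma>) * 1" by (intro mult_left_mono) auto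
        then show ?case using elim g by (simp add: abs_mult divide_right_mono)
      qed
      have "((\<lambda>y::real. 1 / y) \<longlongrightarrow> 0) at_top" by (rule tendsto_divide_0[OF tendsto_const filterlim_at_top_imp_at_infinity[OF filterlim_ident]])
      from tendsto_mult_left[OF this, of "norm (b \<gamma>) / \<gamma>"]
      show "((\<lambda>y. norm (b \<gamma>) / \<gamma> * (1 / y)) \<longlongrightarrow> 0) at_top" by simp
    qed
  qed
  moreover have "(\<Sum>\<^sub>\<infinity>\<gamma>\<in>low. ?f y \<gamma>) = vertical_growth y / y" for y
    unfolding vertical_growth_def infsum_cmult_left' by simp
  ultimately show ?thesis by simp
qed

lemma log_f_asymptotic:
  obtains r where "(r \<longlongrightarrow> 0) at_top"
    "\<And>x y. y \<ge> 1 \<Longrightarrow> \<bar>ln (norm (f_prod a (Complex x y))) - D * y\<bar> \<le> r y * y"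
proof -
  obtain C where C: "C \<noteq> 0" "\<And>z. Im z > 0 \<Longrightarrow> f_prod a z = C * exp (T (- \<i> * of_real D) z)"
    using f_representation by blast
  define Bh where "Bh = (\<Sum>\<^sub>\<infinity>\<gamma>\<in>P \<inter> {1..}. norm (b \<gamma>) * exp (- (2 * pi * 1) * \<gamma>))"
  define r where "r y = (\<bar>ln (norm C)\<bar> + Bg + Bh) * (1 / y) + vertical_growth y / y" for y
  show ?thesis
  proof (rule that)
    have "((\<lambda>y::real. 1 / y) \<longlongrightarrow> 0) at_top" by (rule tendsto_divide_0[OF tendsto_const filterlim_at_top_imp_at_infinity[OF filterlim_ident]])
    from tendsto_add[OF tendsto_mult_left[OF this, of "\<bar>ln (norm C)\<bar> + Bg + Bh"] vertical_growth_sublinear]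
    show "(r \<longlongrightarrow> 0) at_top" by (simp add: r_def[abs_def])
    fix x y :: real assume y: "y \<ge> 1"
    have "norm (f_prod a (Complex x y)) = norm C * exp (D * y + Re (T 0 (Complex x y)))"
      by (rule norm_f[OF C(2)]) (use y in auto)
    then have "ln (norm (f_prod a (Complex x y))) - D * y = ln (norm C) + Re (T 0 (Complex x y))"
      using C(1) by (simp add: ln_mult_pos)
    moreover have "\<bar>Re (T 0 (Complex x y))\<bar> \<le> Bg + vertical_growth y + Bh"
      by (rule order_trans[OF abs_Re_le_cmod]) (use T0_bound[OF y, of x] in \<open>simp only: vertical_growth_def Bh_def\<close>)
    moreover have "r y * y = \<bar>ln (norm C)\<bar> + Bg + Bh + vertical_growth y"
      using y unfolding r_def by (simp add: field_simps)
    ultimately show "\<bar>ln (norm (f_prod a (Complex x y))) - D * y\<bar> \<le> r y * y" by linarith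
  qed
qed

text \<open>The modulus of \<open>f\<close> is \<open>exp (D |y| + o(|y|))\<close>, uniformly in \<open>x\<close>, while \<open>|y| \<le> |z|\<close> with equality on
  the imaginary axis; near the real axis, where the asymptotics say nothing, \<open>f\<close> is bounded.\<close>

theorem f_exponential_type: "has_exponential_type (f_prod a) D"
  unfolding has_exponential_type_def
proof
  show "f_prod a holomorphic_on UNIV" by (rule f_holomorphic)
  let ?F = "\<lambda>z. if f_prod a z = 0 then - \<infinity> else ereal (ln (norm (f_prod a z)) / norm z)"
  obtain r where r: "(r \<longlongrightarrow> 0) at_top"
    "\<And>x y. y \<ge> 1 \<Longrightarrow> \<bar>ln (norm (f_prod a (Complex x y))) - D * y\<bar> \<le> r y * y" using log_f_asymptotic by blast
  show "Limsup at_infinity ?F = ereal D"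
  proof (rule antisym)
    show "Limsup at_infinity ?F \<le> ereal D"
    proof (rule ereal_le_epsilon2)
      fix \<epsilon> :: real assume e: "\<epsilon> > 0"
      have "\<forall>\<^sub>F y in at_top. r y < \<epsilon>" using r(1) e by (rule order_tendstoD)
      then obtain Y1 where Y1: "\<And>y. y \<ge> Y1 \<Longrightarrow> r y < \<epsilon>" unfolding eventually_at_top_linorder by blast
      define Y where "Y = max 1 Y1"
      have Y: "Y \<ge> 1" "\<And>y. y \<ge> Y \<Longrightarrow> r y < \<epsilon>" using Y1 by (auto simp: Y_def)
      obtain M where M: "M > 0" "\<And>z. \<bar>Im z\<bar> \<le> Y \<Longrightarrow> norm (f_prod a z) \<le> M"
        using f_bounded_in_strips[OF Y(1)] by blast
      have up: "ln (norm (f_prod a z)) \<le> (D + \<epsilon>) * Im z" if z: "Im z \<ge> Y" for z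
      proof -
        have "ln (norm (f_prod a z)) - D * Im z \<le> r (Im z) * Im z" using r(2)[of "Im z" "Re z"] z Y(1) by simp
        also have "\<dots> \<le> \<epsilon> * Im z" using Y z by (intro mult_right_mono less_imp_le) auto
        finally show ?thesis by (simp add: distrib_right)
      qed
      have "?F z \<le> ereal (D + \<epsilon>)" if z: "norm z \<ge> max 1 (\<bar>ln M\<bar> / \<epsilon>)" for z
      proof (cases "f_prod a z = 0")
        case nz: False
        have "ln (norm (f_prod a z)) \<le> (D + \<epsilon>) * norm z"
        proof (cases "\<bar>Im z\<bar> \<le> Y")
          case True
          have "ln (norm (f_prod a z)) \<le> ln M" using M(2)[OF True] M(1) nz by simp
          also have "\<dots> \<le> \<epsilon> * norm z" using z e order_trans[OF abs_ge_self[of "ln M"]] by (simp add: divide_le_eq mult_ac)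
          also have "\<dots> \<le> (D + \<epsilon>) * norm z" using D_pos by (intro mult_right_mono) auto
          finally show ?thesis .
        next
          case False
          have "ln (norm (f_prod a z)) \<le> (D + \<epsilon>) * \<bar>Im z\<bar>"
          proof (cases "Im z \<ge> 0")
            case True
            then show ?thesis using up[of z] False by simp
          next
            case neg: False
            then show ?thesis using up[of "cnj z"] False f_cnj[of z] by simp
          qed
          also have "\<dots> \<le> (D + \<epsilon>) * norm z" using D_pos e by (intro mult_left_mono abs_Im_le_cmod) auto
          finally show ?thesis .
        qed
        moreover have "norm z > 0" using z by linarith
        ultimately show ?thesis using nz by (simp add: divide_le_eq)
      qed simp
      then have "\<forall>\<^sub>F z in at_infinity. ?F z \<le> ereal (D + \<epsilon>)" unfolding eventually_at_infinity by blast
      then have "Limsup at_infinity ?F \<le> ereal (D + \<epsilon>)" by (rule Limsup_bounded)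
      then show "Limsup at_infinity ?F \<le> ereal D + ereal \<epsilon>" by simp
    qed
    show "ereal D \<le> Limsup at_infinity ?F"
    proof (rule Limsup_greatest)
      fix Q assume Q: "eventually Q (at_infinity :: complex filter)"
      have inf: "filterlim (\<lambda>y. \<i> * of_real y) at_infinity at_top"
        unfolding filterlim_at_infinity_conv_norm_at_top
        by (simp add: norm_mult) (rule filterlim_at_top_mono[OF filterlim_ident], auto intro: always_eventually)
      have "((\<lambda>y. D - r y) \<longlongrightarrow> D - 0) at_top" by (intro tendsto_intros r(1))
      then have lim: "((\<lambda>y. ereal (D - r y)) \<longlongrightarrow> ereal D) at_top" by simp
      have "\<forall>\<^sub>F y in at_top. ereal (D - r y) \<le> ?F (\<i> * of_real y)"
        using eventually_ge_at_top[of 1]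
      proof eventually_elim
        case (elim y)
        have z: "\<i> * of_real y = Complex 0 y" by (simp add: complex_eq_iff)
        have "D * y - r y * y \<le> ln (norm (f_prod a (Complex 0 y)))" using r(2)[OF elim, of 0] by linarith
        then have "D - r y \<le> ln (norm (f_prod a (Complex 0 y))) / y" using elim by (simp add: le_divide_eq left_diff_distrib)
        moreover have "norm (Complex 0 y) = y" using elim by (simp add: cmod_def)
        ultimately show ?case unfolding z using f_nonzero[of "Complex 0 y"] elim by simp
      qed
      moreover have "\<forall>\<^sub>F y in at_top. Q (\<i> * of_real y)" by (rule eventually_compose_filterlim[OF Q inf])
      ultimately have "\<forall>\<^sub>F y in at_top. ereal (D - r y) \<le> (SUP z\<in>Collect Q. ?F z)"
      proof eventually_elim
        case (elim y)
        from elim(2) have "?F (\<i> * of_real y) \<le> (SUP z\<in>Collect Q. ?F z)" by (intro SUP_upper) simp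
        with elim(1) show ?case by (rule order_trans)
      qed
      then show "ereal D \<le> (SUP z\<in>Collect Q. ?F z)" by (intro tendsto_upperbound[OF lim]) simp_all
    qed
  qed
qed

end

section \<open>Sums over the enumerated zeros\<close>

text \<open>A sum over \<open>\<Lambda>\<close> with multiplicities is a sum over the indices, grouped by the value of \<open>a\<close>.\<close>

lemma summable_on_fibres:
  fixes F :: "'x \<Rightarrow> real"
  assumes fin: "\<And>x. x \<in> S \<Longrightarrow> finite {n. a n = x}" and ran: "range a = S" and F: "\<And>x. F x \<ge> 0"
    and s: "(\<lambda>x. real (card {n. a n = x}) * F x) summable_on S"
  shows "(\<lambda>n. F (a n)) summable_on UNIV"
proof -
  have "(\<lambda>(x, n). F (a n)) summable_on Sigma S (\<lambda>x. {n. a n = x})"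
  proof (rule summable_on_SigmaI[OF _ s])
    fix x assume x: "x \<in> S"
    have "(\<Sum>n | a n = x. F (a n)) = real (card {n. a n = x}) * F x" by simp
    then show "((\<lambda>n. case (x, n) of (x, n) \<Rightarrow> F (a n)) has_sum real (card {n. a n = x}) * F x) {n. a n = x}"
      using has_sum_finite[OF fin[OF x], of "\<lambda>n. F (a n)"] by simp
  qed (use F in auto)
  moreover have "bij_betw snd (Sigma S (\<lambda>x. {n. a n = x})) UNIV"
    using ran by (auto simp: bij_betw_def inj_on_def image_iff)
  ultimately show ?thesis
    using summable_on_reindex_bij_betw[of snd "Sigma S (\<lambda>x. {n. a n = x})" UNIV "\<lambda>n. F (a n)"] by (simp add: case_prod_unfold)
qed

lemma infsum_fibres:
  fixes F :: "'x \<Rightarrow> complex"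
  assumes fin: "\<And>x. x \<in> S \<Longrightarrow> finite {n. a n = x}" and ran: "range a = S"
    and s: "(\<lambda>n. F (a n)) summable_on UNIV"
  shows "(\<Sum>\<^sub>\<infinity>x\<in>S. of_nat (card {n. a n = x}) * F x) = (\<Sum>\<^sub>\<infinity>n. F (a n))"
proof -
  have bij: "bij_betw snd (Sigma S (\<lambda>x. {n. a n = x})) UNIV"
    using ran by (auto simp: bij_betw_def inj_on_def image_iff)
  have "((\<lambda>p. F (a (snd p))) has_sum (\<Sum>\<^sub>\<infinity>n. F (a n))) (Sigma S (\<lambda>x. {n. a n = x}))"
    using has_sum_infsum[OF s] has_sum_reindex_bij_betw[OF bij, of "\<lambda>n. F (a n)"] by simp
  moreover have "((\<lambda>n. F (a (snd (x, n)))) has_sum of_nat (card {n. a n = x}) * F x) {n. a n = x}" if x: "x \<in> S" for x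
  proof -
    have "(\<Sum>n | a n = x. F (a n)) = of_nat (card {n. a n = x}) * F x" by simp
    then show ?thesis using has_sum_finite[OF fin[OF x], of "\<lambda>n. F (a n)"] by simp
  qed
  ultimately show ?thesis by (intro infsumI) (rule has_sum_Sigma')
qed

lemma inverse_cube_summable:
  assumes s: "(\<lambda>n. 1 / (1 + (a n)\<^sup>2)) summable_on UNIV" and z: "Im z > 0"
  shows "(\<lambda>n. - 2 / (2 * pi * \<i> * (z - of_real (a n))) ^ 3) summable_on UNIV"
proof -
  define y where "y = Im z"
  define C where "C = 2 + (1 + 2 * (norm z)\<^sup>2) / y\<^sup>2"
  have y: "y > 0" using z by (simp add: y_def)
  have "norm (- 2 / (2 * pi * \<i> * (z - of_real x)) ^ 3) \<le> 1 / (1 + x\<^sup>2) * (2 * C / ((2 * pi) ^ 3 * y))" for x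
  proof -
    define d where "d = norm (z - of_real x)"
    have "y \<le> d" using abs_Im_le_cmod[of "z - of_real x"] by (simp add: d_def y_def)
    have "1 + x\<^sup>2 \<le> C * d\<^sup>2"
      unfolding C_def d_def by (rule one_plus_square_le_distance) (use z in \<open>auto simp: y_def\<close>)
    moreover have "0 \<le> 1 + x\<^sup>2" by simp
    ultimately have "(1 + x\<^sup>2) * y \<le> (C * d\<^sup>2) * d" using y \<open>y \<le> d\<close> by (intro mult_mono) linarith+
    then have le: "(1 + x\<^sup>2) * y \<le> C * d ^ 3" by (simp add: power3_eq_cube power2_eq_square mult_ac)
    have pos: "(1 + x\<^sup>2) * y > 0" "d ^ 3 > 0" using y \<open>y \<le> d\<close> by (auto intro!: mult_pos_pos simp: add_pos_nonneg)
    have "norm (- 2 / (2 * pi * \<i> * (z - of_real x)) ^ 3) = 2 / ((2 * pi) ^ 3 * d ^ 3)"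
      by (simp add: norm_divide norm_power norm_mult d_def power_mult_distrib)
    also have "\<dots> = 2 / (2 * pi) ^ 3 * (1 / d ^ 3)" by simp
    also have "\<dots> \<le> 2 / (2 * pi) ^ 3 * (C / ((1 + x\<^sup>2) * y))"
    proof (intro mult_left_mono)
      show "1 / d ^ 3 \<le> C / ((1 + x\<^sup>2) * y)"
        using le pos by (simp add: divide_le_eq le_divide_eq)
    qed simp
    also have "\<dots> = 1 / (1 + x\<^sup>2) * (2 * C / ((2 * pi) ^ 3 * y))" by simp
    finally show ?thesis .
  qed
  then show ?thesis
    by (intro norm_infsum_le_dominated(1)[OF summable_on_cmult_left[OF s, of "2 * C / ((2 * pi) ^ 3 * y)"]]) auto
qed

text \<open>The multiplicities are positive, so a fibre of cardinality \<open>c x\<close> is finite and not an infinite set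
  with the default cardinality 0.\<close>

lemma spectrum_of_temperate_measure:
  fixes \<Lambda> \<Gamma> :: "real set" and c :: "real \<Rightarrow> nat" and b :: "real \<Rightarrow> complex" and a :: "int \<Rightarrow> real"
  assumes c: "\<And>x. x \<in> \<Lambda> \<Longrightarrow> c x > 0"
    and \<mu>: "temperate_distribution \<mu>" "is_point_measure \<mu> \<Lambda> (\<lambda>x. of_nat (c x))" "is_point_measure (fourier_dist \<mu>) \<Gamma> b"
    and \<nu>: "temperate_distribution \<nu>" "is_point_measure \<nu> \<Gamma> (\<lambda>\<gamma>. of_real (norm (b \<gamma>)))"
    and a: "range a = \<Lambda>" "\<And>x. x \<in> \<Lambda> \<Longrightarrow> card {n. a n = x} = c x" and 0: "0 \<notin> \<Lambda>"
  shows "one_sided_spectrum a (\<Gamma> \<inter> {0<..}) b"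
proof
  have pm: "is_point_measure \<mu> \<Lambda> (\<lambda>x. of_real (real (c x)))" using \<mu>(2) by simp
  have fin: "finite {n. a n = x}" if "x \<in> \<Lambda>" for x using c[OF that] a(2)[OF that] card_gt_0_iff by metis
  show "a n \<noteq> 0" for n using a(1) 0 by (metis rangeI)
  have "(\<lambda>x. real (c x) * (1 / (1 + x\<^sup>2))) summable_on \<Lambda>"
    by (rule inverse_square_summable[OF \<mu>(1) pm _ \<mu>(3)]) simp
  moreover have "?this \<longleftrightarrow> (\<lambda>x. real (card {n. a n = x}) * (1 / (1 + x\<^sup>2))) summable_on \<Lambda>"
    by (rule summable_on_cong) (simp add: a(2))
  ultimately show s: "(\<lambda>n. 1 / (1 + (a n)\<^sup>2)) summable_on UNIV"
    by (intro summable_on_fibres[OF fin a(1)]) auto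
  show "\<gamma> \<in> \<Gamma> \<inter> {0<..} \<Longrightarrow> \<gamma> > 0" for \<gamma> by simp
  show "(\<lambda>\<gamma>. norm (b \<gamma>) * ((1 + \<gamma>)\<^sup>2 * exp (- s * \<gamma>))) summable_on \<Gamma> \<inter> {0<..}" if "s > 0" for s
    by (rule exponentially_weighted_summable[OF \<nu> that])
  fix z :: complex assume z: "Im z > 0"
  have "(\<Sum>\<^sub>\<infinity>n. - 2 / (2 * pi * \<i> * (z - of_real (a n))) ^ 3)
      = (\<Sum>\<^sub>\<infinity>x\<in>\<Lambda>. of_nat (card {n. a n = x}) * (- 2 / (2 * pi * \<i> * (z - of_real x)) ^ 3))"
    by (rule infsum_fibres[symmetric, OF fin a(1) inverse_cube_summable[OF s z]])
  also have "\<dots> = (\<Sum>\<^sub>\<infinity>x\<in>\<Lambda>. of_real (real (c x)) * (- 2 / (2 * pi * \<i> * (z - of_real x)) ^ 3))"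
    by (rule infsum_cong) (simp only: a(2) of_real_of_nat_eq)
  also have "\<dots> = (\<Sum>\<^sub>\<infinity>\<gamma>\<in>\<Gamma> \<inter> {0<..}. b \<gamma> * (of_real (\<gamma>\<^sup>2) * exp (2 * pi * \<i> * z * of_real \<gamma>)))"
    by (rule inverse_cube_pairing[OF \<mu>(1) pm _ \<mu>(3) \<nu> z]) simp
  finally show "(\<Sum>\<^sub>\<infinity>n. - 2 / (2 * pi * \<i> * (z - of_real (a n))) ^ 3)
      = (\<Sum>\<^sub>\<infinity>\<gamma>\<in>\<Gamma> \<inter> {0<..}. b \<gamma> * (of_real (\<gamma>\<^sup>2) * exp (2 * pi * \<i> * z * of_real \<gamma>)))" .
qed

theorem theorem4:
  fixes \<Lambda> \<Gamma> :: "real set" and c :: "real \<Rightarrow> nat" and b :: "real \<Rightarrow> complex"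
    and \<mu> \<nu> :: "(real \<Rightarrow> complex) \<Rightarrow> complex" and a :: "int \<Rightarrow> real"
  assumes "\<Lambda> \<noteq> {}"
    and "discrete \<Lambda>"
    and "\<And>K. compact K \<Longrightarrow> finite (\<Lambda> \<inter> K)"
    and "\<And>x. x \<in> \<Lambda> \<Longrightarrow> c x > 0"
    and "temperate_distribution \<mu>"
    and "is_point_measure \<mu> \<Lambda> (\<lambda>x. of_nat (c x))"
    and "is_point_measure (fourier_dist \<mu>) \<Gamma> b"
    and "temperate_distribution \<nu>"
    and "is_point_measure \<nu> \<Gamma> (\<lambda>\<gamma>. of_real (norm (b \<gamma>)))"
    and "\<And>n. a n \<le> a (n + 1)"
    and "range a = \<Lambda>"
    and "\<And>x. x \<in> \<Lambda> \<Longrightarrow> card {n. a n = x} = c x"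
    and "0 \<notin> \<Lambda>"
  shows "(bounded (range (\<lambda>x::real. g_sum \<Gamma> b (of_real x))) \<longrightarrow>
           has_zero_multiset (f_prod a) a \<and>
           almost_periodic_entire (f_prod a) \<and>
           has_exponential_type (f_prod a) (pi * point_density a)) \<and>
         ((\<exists>h. almost_periodic_entire h \<and> exponential_growth h \<and> has_zero_multiset h a) \<longrightarrow>
           bounded (range (\<lambda>x::real. g_sum \<Gamma> b (of_real x))))"
proof -
  let ?P = "\<Gamma> \<inter> {0<..}"
  interpret one_sided_spectrum a ?P b
    by (rule spectrum_of_temperate_measure[OF assms(4-9) assms(11-13)])
  have "?P \<inter> {0<..<1} = \<Gamma> \<inter> {0<..<1}" by auto
  then have g: "g_sum \<Gamma> b z = g_sum ?P b z" for z by (simp add: g_sum_def)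
  show ?thesis
  proof (intro conjI impI)
    assume "bounded (range (\<lambda>x::real. g_sum \<Gamma> b (of_real x)))"
    then obtain B where B: "\<And>x::real. norm (g_sum ?P b (of_real x)) \<le> B"
      unfolding bounded_iff g by auto
    interpret bounded_low_part a ?P b B
      by unfold_locales (rule B, rule assms(10))
    have "f_prod a 0 \<noteq> 0" by (simp add: f_0)
    then show "has_zero_multiset (f_prod a) a" unfolding has_zero_multiset_def using f_zorder by (intro conjI exI[of _ 0] allI)
    show "almost_periodic_entire (f_prod a)" by (rule f_almost_periodic)
    show "has_exponential_type (f_prod a) (pi * point_density a)"
      using f_exponential_type by (simp add: density)
  next
    assume "\<exists>h. almost_periodic_entire h \<and> exponential_growth h \<and> has_zero_multiset h a"
    then obtain h w where h: "almost_periodic_entire h" "exponential_growth h" "h w \<noteq> 0"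
      "\<And>z. zorder h z = int (card {n. complex_of_real (a n) = z})"
      unfolding has_zero_multiset_def by (elim exE conjE) simp
    then have "\<exists>B. \<forall>x::real. norm (g_sum ?P b (of_real x)) \<le> B" by (rule g_bounded_if_almost_periodic)
    then show "bounded (range (\<lambda>x::real. g_sum \<Gamma> b (of_real x)))"
      unfolding bounded_iff g by auto
  qed
qed


end
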